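(* Let $M$ be an $n$-dimensional, orientable, path-connected and compact $C^\infty$-submanifold of $\mathbb{R}^{n+1}$, possibly with non-empty boundary $\partial M$ of $C^\infty$-regularity. Let $g^M:M\to(0,\infty)$ and, for each $\varphi\in\operatorname{Emb}_{\partial M}(M,\mathbb{R}^{n+1})$, $f_\varphi:\varphi(M)\to(0,\infty)$ be $C^\infty$-functions, with $f$ having shape functionality and $$\int_{\varphi(M)}f_\varphi(s)\,ds=\int_Mg^M(s)\,ds\qquad\forall\varphi\in\operatorname{Emb}_{\partial M}(M,\mathbb{R}^{n+1}).$$ Assume enough regularity for $f_\varphi$ such that its pre-shape material derivatives exist, and let $$\mathfrak{J}^\tau(\varphi):=\frac12\int_{\varphi(M)}\Big(g^M\circ\varphi^{-1}(s)\cdot\frac{1}{\det D^\tau\varphi\circ\varphi^{-1}(s)}-f_\varphi(s)\Big)^2ds .$$ Then for $\varphi\in\operatorname{Emb}_{\partial M}(M,\mathbb{R}^{n+1})$ the following statements are equivalent: (i) $\varphi$ is a fiber stationary point of $\mathfrak{J}^\tau$, i.e. $$\mathfrak{D}\mathfrak{J}^\tau(\varphi)[V]=0\quad\forall V\in C^\infty_{\partial M}(\mathbb{R}^{n+1},\mathbb{R}^{n+1})\text{ with }\langle V,n\rangle=0\text{ on }\operatorname{int}\varphi(M),$$ where $\operatorname{int}\varphi(M)$ is the interior of $\varphi(M)$ and $n$ is the outer normal field on $\operatorname{int}\varphi(M)$. (ii) $\varphi$ is a global solution of $\min_{\psi\in\operatorname{Emb}_{\partial M}(M,\mathbb{R}^{n+1})}\mathfrak{J}^\tau(\psi)$,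 and in particular it satisfies $$g^M\circ\varphi^{-1}\cdot\det D^\tau\varphi^{-1}=f_\varphi\quad\text{on }\varphi(M).$$ (iii) The complete pre-shape derivative of $\mathfrak{J}^\tau$ vanishes in $\varphi$, i.e. $$\mathfrak{D}\mathfrak{J}^\tau(\varphi)[V]=0\quad\forall V\in C^\infty_{\partial M}(\mathbb{R}^{n+1},\mathbb{R}^{n+1}),$$ and additionally its normal component $g_\varphi^{\mathcal{N}}$ in $\varphi$ vanishes. In particular, the necessary first order condition regarding only directions $V$ tangential to $\varphi(M)$ is already a sufficient condition for being a global minimizer of $\mathfrak{J}^\tau$.
   Context: $\operatorname{Emb}(M,\mathbb{R}^{n+1})$ is the space of $C^\infty$-embeddings $M\to\mathbb{R}^{n+1}$ and $\operatorname{Emb}_{\partial M}(M,\mathbb{R}^{n+1}):=\{\varphi\in\operatorname{Emb}(M,\mathbb{R}^{n+1}):\varphi(p)=p\ \forall p\in\partial M\}$ (all of $\operatorname{Emb}(M,\mathbb{R}^{n+1})$ if $\partial M=\varnothing$). Shape functionality of $f$ means $f_{\varphi\circ\rho}=f_\varphi$ for all $\rho\in\operatorname{Diff}(M)$ and $\varphi$ with $\varphi,\varphi\circ\rho\in\operatorname{Emb}_{\partial M}(M,\mathbb{R}^{n+1})$. $C^\infty_{\partial M}(\mathbb{R}^{n+1},\mathbb{R}^{n+1})$ is the space of $V\in C^\infty(\mathbb{R}^{n+1},\mathbb{R}^{n+1})$ vanishing on $\partial M$ $(=\partial\varphi(M))$. $M$ and $\varphi(M)$ carry the Riemannian metrics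 and surface measures $ds$ induced from $\mathbb{R}^{n+1}$. For smooth local orthonormal frames $\tau=(\tau_1,\dots,\tau_n)$ on an open $U\subseteq M$ and $\tau^\varphi=(\tau^\varphi_1,\dots,\tau^\varphi_n)$ on $\varphi(U)$, the covariant derivative is the $n\times n$ matrix $D^\tau\varphi(p):=(\langle D\varphi\,\tau_{j,p},\tau^\varphi_{i,\varphi(p)}\rangle)_{i,j}$. Frames are taken positively oriented with respect to a fixed orientation of $M$ and the orientation of $\varphi(M)$ transported from $M$ via $\varphi$ (so $\det D^\tau\varphi>0$). The notation $\det D^\tau\varphi^{-1}$ stands for $\frac{1}{\det D^\tau\varphi}\circ\varphi^{-1}$. For a direction $V$ put $\varphi_t:=\varphi+t\cdot V\circ\varphi$ and $x_t:=x_0+tV(x_0)$ for small $t\ge0$. The pre-shape derivative is $\mathfrak{D}\mathfrak{J}(\varphi)[V]:=\lim_{t\downarrow0}\frac{\mathfrak{J}(\varphi_t)-\mathfrak{J}(\varphi)}{t}$. The pre-shape material derivative of the family $f_\varphi$ at $x_0\in\varphi(M)$ is $\mathfrak{D}_m(f_\varphi)[V](x_0):=\frac{d}{dt}\big|_{t=0}f_{\varphi_t}(x_t)$ (well-defined since $x_t\in\varphi_t(M)$). With these hypotheses the pre-shape derivative is $$\mathfrak{D}\mathfrak{J}^\tau(\varphi)[V]=-\int_{\varphi(M)}\tfrac12\big((g^M\circ\varphi^{-1}\cdot\det D^\tau\varphi^{-1})^2-f_\varphi^2\big)\operatorname{div}_\Gamma(V)+\big(g^M\circ\varphi^{-1}\cdot\det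 D^\tau\varphi^{-1}-f_\varphi\big)\mathfrak{D}_m(f_\varphi)[V]\,ds,$$ with $\operatorname{div}_\Gamma$ the tangential divergence on $\varphi(M)$. Its normal component $g_\varphi^{\mathcal{N}}$ is the part of $\mathfrak{D}\mathfrak{J}^\tau(\varphi)$ acting on normal directions: $\langle g_\varphi^{\mathcal{N}},V\rangle$ is the value of this expression at the normal part $\langle V,n\rangle n$ of $V$ on $\varphi(M)$.
   Formalization: "Enough regularity" is made precise: along smooth curves of embeddings, f_φ∘φ has difference quotients converging uniformly on M to the material derivative, which depends only on the initial velocity; mere pointwise existence does not suffice. Also n ≥ 1. *)

theory Defs
  imports "HOL-Analysis.Analysis"
begin

text \<open>
  \<open>'n option\<close> has one element more than \<open>'n\<close>, so \<open>real^'n option\<close> is Euclidean space of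
  dimension \<open>CARD('n) + 1\<close>. Hypersurfaces are subsets of it, and the dimension of
  the hypersurface is \<open>n = CARD('n)\<close>.
\<close>
type_synonym 'n ambient = "(real, 'n option) vec"

text \<open>An ordered \<open>n\<close>-tuple of ambient vectors; \<open>b $ i\<close> is the \<open>i\<close>-th vector.\<close>
type_synonym 'n frame = "('n ambient, 'n) vec"


section \<open>Smooth maps\<close>

primrec ck_on :: "nat \<Rightarrow> 'a::euclidean_space set \<Rightarrow> ('a \<Rightarrow> 'b::euclidean_space) \<Rightarrow> bool" where
  "ck_on 0 U F \<longleftrightarrow> continuous_on U F"
| "ck_on (Suc k) U F \<longleftrightarrow>
     (\<forall>x\<in>U. F differentiable (at x)) \<and> (\<forall>v. ck_on k U (\<lambda>x. frechet_derivative F (at x) v))"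

text \<open>
  Meant for open sets only. On an arbitrary set, a map is smooth if it extends smoothly to an
  ambient neighbourhood of every point.
\<close>
definition smooth_on_open :: "'a::euclidean_space set \<Rightarrow> ('a \<Rightarrow> 'b::euclidean_space) \<Rightarrow> bool" where
  "smooth_on_open U F \<longleftrightarrow> (\<forall>k. ck_on k U F)"

definition smooth_on_set :: "'a::euclidean_space set \<Rightarrow> ('a \<Rightarrow> 'b::euclidean_space) \<Rightarrow> bool" where
  "smooth_on_set S F \<longleftrightarrow>
     (\<forall>x\<in>S. \<exists>U E. open U \<and> x \<in> U \<and> smooth_on_open U E \<and> (\<forall>y\<in>S \<inter> U. E y = F y))"


section \<open>Hypersurfaces with boundary\<close>

text \<open>
  A smooth local parametrization with smooth inverse, defined on an open subset of \<open>R^n\<close> or on a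
  relatively open subset of a coordinate half-space.
\<close>
definition parametrization ::
    "'n::finite ambient set \<Rightarrow> (real^'n) set \<Rightarrow> (real^'n \<Rightarrow> 'n ambient) \<Rightarrow> bool" where
  "parametrization S \<Omega> X \<longleftrightarrow>
     (\<exists>W. open W \<and> (\<Omega> = W \<or> (\<exists>i. \<Omega> = W \<inter> {u. 0 \<le> u $ i}))) \<and>
     openin (top_of_set S) (X ` \<Omega>) \<and> inj_on X \<Omega> \<and>
     smooth_on_set \<Omega> X \<and> smooth_on_set (X ` \<Omega>) (inv_into \<Omega> X)"

definition hypersurface :: "'n::finite ambient set \<Rightarrow> bool" where
  "hypersurface S \<longleftrightarrow> (\<forall>p\<in>S. \<exists>\<Omega> X. parametrization S \<Omega> X \<and> p \<in> X ` \<Omega>)"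

definition manifold_interior :: "'n::finite ambient set \<Rightarrow> 'n ambient set" where
  "manifold_interior S = {p\<in>S. \<exists>\<Omega> X. open \<Omega> \<and> parametrization S \<Omega> X \<and> p \<in> X ` \<Omega>}"

definition manifold_boundary :: "'n::finite ambient set \<Rightarrow> 'n ambient set" where
  "manifold_boundary S = S - manifold_interior S"

text \<open>
  At boundary points the velocities only fill a half-space; the span makes the tangent space
  \<open>n\<close>-dimensional there as well.
\<close>
definition tangent_space :: "'a::real_normed_vector set \<Rightarrow> 'a \<Rightarrow> 'a set" where
  "tangent_space S p = span {v. \<exists>\<gamma>. \<gamma> 0 = p \<and> (\<forall>t\<in>{0..1}. \<gamma> t \<in> S) \<and>
     (\<gamma> has_vector_derivative v) (at (0::real) within {0..1})}"

text \<open>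
  A derivative within a hypersurface is not unique as a linear map on the ambient space, but its
  restriction to the tangent space is. It must be applied to tangent vectors only.
\<close>
definition tangent_map ::
    "'a::real_normed_vector set \<Rightarrow> ('a \<Rightarrow> 'b::real_normed_vector) \<Rightarrow> 'a \<Rightarrow> 'a \<Rightarrow> 'b" where
  "tangent_map S F p = frechet_derivative F (at p within S)"

text \<open>
  The Riemannian measure of the induced metric: the unique Borel measure with density
  \<open>sqrt (det (\<langle>\<partial>\<^sub>i X, \<partial>\<^sub>j X\<rangle>))\<close> in every local parametrization \<open>X\<close>.
\<close>
definition surface_measure :: "'n::finite ambient set \<Rightarrow> 'n ambient measure" where
  "surface_measure S = (THE \<mu>. sets \<mu> = sets (restrict_space borel S) \<and>
     (\<forall>\<Omega> X. parametrization S \<Omega> X \<longrightarrow>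
       (\<forall>A\<in>sets borel. A \<subseteq> \<Omega> \<longrightarrow>
          emeasure \<mu> (X ` A) =
            (\<integral>\<^sup>+u\<in>A. ennreal (sqrt (det (\<chi> i j.
                frechet_derivative X (at u within \<Omega>) (axis i 1) \<bullet>
                frechet_derivative X (at u within \<Omega>) (axis j 1)))) \<partial>lborel))))"


section \<open>Orientations, frames, normal fields\<close>

definition orthonormal_frame :: "'n::finite ambient set \<Rightarrow> 'n frame \<Rightarrow> bool" where
  "orthonormal_frame T b \<longleftrightarrow>
     (\<forall>i j. b $ i \<bullet> b $ j = (if i = j then 1 else 0)) \<and> span (range (\<lambda>i. b $ i)) = T"

text \<open>
  An orientation is represented by the set of positively oriented orthonormal bases of each tangent
  space. The second clause is continuity: the choice is locally realized by smooth frames.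
\<close>
definition orientation :: "'n::finite ambient set \<Rightarrow> ('n ambient \<Rightarrow> 'n frame set) \<Rightarrow> bool" where
  "orientation S ori \<longleftrightarrow>
     (\<forall>p\<in>S. ori p \<noteq> {} \<and>
        (\<forall>b\<in>ori p. orthonormal_frame (tangent_space S p) b \<and>
           ori p = {c. orthonormal_frame (tangent_space S p) c \<and> det (\<chi> i j. b $ j \<bullet> c $ i) > 0})) \<and>
     (\<forall>p\<in>S. \<exists>U b. open U \<and> p \<in> U \<and> smooth_on_set (S \<inter> U) b \<and> (\<forall>q\<in>S \<inter> U. b q \<in> ori q))"

text \<open>The orientation of \<open>\<phi> ` M\<close> transported from \<open>M\<close>.\<close>
definition transported_orientation ::
    "'n::finite ambient set \<Rightarrow> ('n ambient \<Rightarrow> 'n frame set) \<Rightarrow> ('n ambient \<Rightarrow> 'n ambient) \<Rightarrow>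
     'n ambient \<Rightarrow> 'n frame set" where
  "transported_orientation M ori \<phi> x =
     {c. orthonormal_frame (tangent_space (\<phi> ` M) x) c \<and>
         (\<exists>b\<in>ori (inv_into M \<phi> x).
            det (\<chi> i j. tangent_map M \<phi> (inv_into M \<phi> x) (b $ j) \<bullet> c $ i) > 0)}"

definition unit_normal_field ::
    "'n::finite ambient set \<Rightarrow> ('n ambient \<Rightarrow> 'n ambient) \<Rightarrow> bool" where
  "unit_normal_field S \<nu> \<longleftrightarrow>
     continuous_on (manifold_interior S) \<nu> \<and>
     (\<forall>x\<in>manifold_interior S. norm (\<nu> x) = 1 \<and> (\<forall>v\<in>tangent_space S x. \<nu> x \<bullet> v = 0))"

text \<open>\<open>\<tau>\<close> is an orthonormal basis at \<open>p\<close> and \<open>\<sigma>\<close> an orthonormal basis at \<open>\<phi> p\<close>.\<close>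
definition covariant_derivative ::
    "'n::finite ambient set \<Rightarrow> ('n ambient \<Rightarrow> 'n ambient) \<Rightarrow> 'n frame \<Rightarrow> 'n frame \<Rightarrow>
     'n ambient \<Rightarrow> real^'n^'n" where
  "covariant_derivative M \<phi> \<tau> \<sigma> p = (\<chi> i j. tangent_map M \<phi> p (\<tau> $ j) \<bullet> \<sigma> $ i)"

text \<open>\<open>b\<close> is any orthonormal basis of the tangent space at \<open>x\<close>.\<close>
definition tangential_divergence ::
    "'n::finite ambient set \<Rightarrow> 'n frame \<Rightarrow> ('n ambient \<Rightarrow> 'n ambient) \<Rightarrow> 'n ambient \<Rightarrow> real" where
  "tangential_divergence S b V x = (\<Sum>i\<in>UNIV. tangent_map S V x (b $ i) \<bullet> b $ i)"


section \<open>Embeddings, diffeomorphisms, directions\<close>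

text \<open>
  Maps on \<open>M\<close> are represented extensionally, so that equality of embeddings is equality on \<open>M\<close>.
\<close>
definition Emb :: "'n::finite ambient set \<Rightarrow> ('n ambient \<Rightarrow> 'n ambient) set" where
  "Emb M = {\<phi>. \<phi> \<in> extensional M \<and> smooth_on_set M \<phi> \<and>
     (\<forall>p\<in>M. inj_on (tangent_map M \<phi> p) (tangent_space M p)) \<and>
     (\<exists>\<psi>. homeomorphism M (\<phi> ` M) \<phi> \<psi>)}"

definition Emb_bd :: "'n::finite ambient set \<Rightarrow> ('n ambient \<Rightarrow> 'n ambient) set" where
  "Emb_bd M = {\<phi>\<in>Emb M. \<forall>p\<in>manifold_boundary M. \<phi> p = p}"

definition Diff :: "'n::finite ambient set \<Rightarrow> ('n ambient \<Rightarrow> 'n ambient) set" where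
  "Diff M = {\<rho>. \<rho> \<in> extensional M \<and> bij_betw \<rho> M M \<and>
     smooth_on_set M \<rho> \<and> smooth_on_set M (inv_into M \<rho>)}"

definition shape_functionality ::
    "'n::finite ambient set \<Rightarrow> (('n ambient \<Rightarrow> 'n ambient) \<Rightarrow> 'n ambient \<Rightarrow> real) \<Rightarrow> bool" where
  "shape_functionality M f \<longleftrightarrow>
     (\<forall>\<phi>\<in>Emb_bd M. \<forall>\<rho>\<in>Diff M. compose M \<phi> \<rho> \<in> Emb_bd M \<longrightarrow>
        (\<forall>x\<in>\<phi> ` M. f (compose M \<phi> \<rho>) x = f \<phi> x))"

definition directions :: "'n::finite ambient set \<Rightarrow> ('n ambient \<Rightarrow> 'n ambient) set" where
  "directions M = {V. smooth_on_open UNIV V \<and> (\<forall>x\<in>manifold_boundary M. V x = 0)}"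

definition perturb ::
    "'n::finite ambient set \<Rightarrow> ('n ambient \<Rightarrow> 'n ambient) \<Rightarrow> ('n ambient \<Rightarrow> 'n ambient) \<Rightarrow>
     real \<Rightarrow> 'n ambient \<Rightarrow> 'n ambient" where
  "perturb M \<phi> V t = (\<lambda>p\<in>M. \<phi> p + t *\<^sub>R V (\<phi> p))"


section \<open>Pre-shape derivatives\<close>

definition has_pre_shape_derivative ::
    "'n::finite ambient set \<Rightarrow> (('n ambient \<Rightarrow> 'n ambient) \<Rightarrow> real) \<Rightarrow>
     ('n ambient \<Rightarrow> 'n ambient) \<Rightarrow> ('n ambient \<Rightarrow> 'n ambient) \<Rightarrow> real \<Rightarrow> bool" where
  "has_pre_shape_derivative M J \<phi> V d \<longleftrightarrow>
     ((\<lambda>t. (J (perturb M \<phi> V t) - J \<phi>) / t) \<longlongrightarrow> d) (at_right 0)"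

text \<open>The derivative is one-sided, and depends only on the values of \<open>V\<close> on \<open>\<phi> ` M\<close>.\<close>
definition material_derivative ::
    "'n::finite ambient set \<Rightarrow> (('n ambient \<Rightarrow> 'n ambient) \<Rightarrow> 'n ambient \<Rightarrow> real) \<Rightarrow>
     ('n ambient \<Rightarrow> 'n ambient) \<Rightarrow> ('n ambient \<Rightarrow> 'n ambient) \<Rightarrow> 'n ambient \<Rightarrow> real" where
  "material_derivative M f \<phi> V x =
     vector_derivative (\<lambda>t. f (perturb M \<phi> V t) (x + t *\<^sub>R V x)) (at 0 within {0..})"

text \<open>
  Regularity of the family \<open>f\<close>: the pullback \<open>\<phi> \<mapsto> f \<phi> \<circ> \<phi>\<close> is differentiable, uniformly on \<open>M\<close>,
  along smooth curves \<open>\<Phi>\<close> of embeddings, and the derivative depends on the curve only through its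
  initial velocity \<open>V \<circ> \<phi>\<close>. On the curve \<open>perturb M \<phi> V\<close> this is existence of the material
  derivative. Differentiability along those curves alone would not suffice: for tangential \<open>V\<close> they
  leave the shape \<open>\<phi> ` M\<close>, and shape functionality would say nothing about the derivative.
\<close>
definition materially_differentiable ::
    "'n::finite ambient set \<Rightarrow> (('n ambient \<Rightarrow> 'n ambient) \<Rightarrow> 'n ambient \<Rightarrow> real) \<Rightarrow> bool" where
  "materially_differentiable M f \<longleftrightarrow>
     (\<forall>\<phi>\<in>Emb_bd M. \<forall>V\<in>directions M. \<forall>\<epsilon>>0. \<forall>\<Phi>.
        (\<forall>t\<in>{0..\<epsilon>}. \<Phi> t \<in> Emb_bd M) \<and>
        smooth_on_set ({0..\<epsilon>} \<times> M) (\<lambda>(t, p). \<Phi> t p) \<and>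
        \<Phi> 0 = \<phi> \<and>
        (\<forall>p\<in>M. ((\<lambda>t. \<Phi> t p) has_vector_derivative V (\<phi> p)) (at 0 within {0..\<epsilon>})) \<longrightarrow>
        uniform_limit M (\<lambda>t p. (f (\<Phi> t) (\<Phi> t p) - f \<phi> (\<phi> p)) / t)
          (\<lambda>p. material_derivative M f \<phi> V (\<phi> p)) (at_right 0))"


section \<open>The functional\<close>

text \<open>
  \<open>\<tau> p\<close> is the value at \<open>p\<close> of a local frame on \<open>M\<close>, and \<open>\<sigma> \<phi> x\<close> the value at \<open>x\<close> of a local frame on
  \<open>\<phi> ` M\<close>. Global smooth frames need not exist; only these pointwise values enter.
\<close>
definition transported_density ::
    "'n::finite ambient set \<Rightarrow> ('n ambient \<Rightarrow> real) \<Rightarrow> ('n ambient \<Rightarrow> 'n frame) \<Rightarrow>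
     (('n ambient \<Rightarrow> 'n ambient) \<Rightarrow> 'n ambient \<Rightarrow> 'n frame) \<Rightarrow>
     ('n ambient \<Rightarrow> 'n ambient) \<Rightarrow> 'n ambient \<Rightarrow> real" where
  "transported_density M g \<tau> \<sigma> \<phi> x =
     g (inv_into M \<phi> x) *
     (1 / det (covariant_derivative M \<phi> (\<tau> (inv_into M \<phi> x)) (\<sigma> \<phi> x) (inv_into M \<phi> x)))"

definition tracking_functional ::
    "'n::finite ambient set \<Rightarrow> ('n ambient \<Rightarrow> real) \<Rightarrow>
     (('n ambient \<Rightarrow> 'n ambient) \<Rightarrow> 'n ambient \<Rightarrow> real) \<Rightarrow> ('n ambient \<Rightarrow> 'n frame) \<Rightarrow>
     (('n ambient \<Rightarrow> 'n ambient) \<Rightarrow> 'n ambient \<Rightarrow> 'n frame) \<Rightarrow> ('n ambient \<Rightarrow> 'n ambient) \<Rightarrow> real" where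
  "tracking_functional M g f \<tau> \<sigma> \<phi> =
     1/2 * (LINT s|surface_measure (\<phi> ` M). (transported_density M g \<tau> \<sigma> \<phi> s - f \<phi> s)\<^sup>2)"

text \<open>
  Closed formula for the pre-shape derivative of the functional. Unlike the limit it makes sense for
  fields given on \<open>\<phi> ` M\<close> only, such as the normal part of a direction.
\<close>
definition pre_shape_formula ::
    "'n::finite ambient set \<Rightarrow> ('n ambient \<Rightarrow> real) \<Rightarrow>
     (('n ambient \<Rightarrow> 'n ambient) \<Rightarrow> 'n ambient \<Rightarrow> real) \<Rightarrow> ('n ambient \<Rightarrow> 'n frame) \<Rightarrow>
     (('n ambient \<Rightarrow> 'n ambient) \<Rightarrow> 'n ambient \<Rightarrow> 'n frame) \<Rightarrow> ('n ambient \<Rightarrow> 'n ambient) \<Rightarrow>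
     ('n ambient \<Rightarrow> 'n ambient) \<Rightarrow> real" where
  "pre_shape_formula M g f \<tau> \<sigma> \<phi> V =
     - (LINT s|surface_measure (\<phi> ` M).
          1/2 * ((transported_density M g \<tau> \<sigma> \<phi> s)\<^sup>2 - (f \<phi> s)\<^sup>2) *
            tangential_divergence (\<phi> ` M) (\<sigma> \<phi> s) V s +
          (transported_density M g \<tau> \<sigma> \<phi> s - f \<phi> s) * material_derivative M f \<phi> V s)"

text \<open>
  A normal field is only specified on the interior of \<open>\<phi> ` M\<close>. Its values on the boundary are
  immaterial here, since directions vanish there.
\<close>
definition normal_part ::
    "('n::finite ambient \<Rightarrow> 'n ambient) \<Rightarrow> ('n ambient \<Rightarrow> 'n ambient) \<Rightarrow> 'n ambient \<Rightarrow> 'n ambient" where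
  "normal_part \<nu> V x = (V x \<bullet> \<nu> x) *\<^sub>R \<nu> x"

definition fiber_stationary ::
    "'n::finite ambient set \<Rightarrow> (('n ambient \<Rightarrow> 'n ambient) \<Rightarrow> real) \<Rightarrow>
     ('n ambient \<Rightarrow> 'n ambient) \<Rightarrow> ('n ambient \<Rightarrow> 'n ambient) \<Rightarrow> bool" where
  "fiber_stationary M J \<nu> \<phi> \<longleftrightarrow>
     (\<forall>V\<in>directions M. (\<forall>x\<in>manifold_interior (\<phi> ` M). V x \<bullet> \<nu> x = 0) \<longrightarrow>
        has_pre_shape_derivative M J \<phi> V 0)"

definition global_minimizer ::
    "'n::finite ambient set \<Rightarrow> (('n ambient \<Rightarrow> 'n ambient) \<Rightarrow> real) \<Rightarrow>
     ('n ambient \<Rightarrow> 'n ambient) \<Rightarrow> bool" where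
  "global_minimizer M J \<phi> \<longleftrightarrow> \<phi> \<in> Emb_bd M \<and> (\<forall>\<psi>\<in>Emb_bd M. J \<phi> \<le> J \<psi>)"

end

theory Submission
  imports Defs
begin

text \<open>
  Write \<open>h\<close> for the transported density \<open>g / det (D \<phi>)\<close> on \<open>\<phi> ` M\<close>. Changing variables to \<open>M\<close> gives
  \<open>\<integral> h = \<integral> g\<close>, and \<open>\<integral> g\<close> is also the total mass of \<open>f \<phi>\<close>. So the defect \<open>h - f \<phi>\<close> has mean zero over
  the shape. The functional is half its squared \<open>L\<^sup>2\<close> norm. If the defect vanishes, then the functional is
  \<open>0\<close>, hence minimal, and every term of the first variation contains a factor \<open>h - f \<phi>\<close>. These are the
  implications that start from the equation \<open>h = f \<phi>\<close>.

  For the converse, suppose that the defect is not constant. Then some partial derivative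
  \<open>\<partial>\<^sub>i (h - f \<phi>)\<close> does not vanish at a point of an interior chart \<open>Y\<close> of \<open>\<phi> ` M\<close>. Let \<open>V\<close> be
  the coordinate field \<open>\<partial>\<^sub>i Y\<close> times a cutoff and a sign. It is tangential, and it is the initial
  velocity of an isotopy of the ambient space that maps \<open>\<phi> ` M\<close> onto itself. Along this isotopy the
  embedding only changes by reparametrizations of \<open>M\<close>. Shape functionality says that \<open>f\<close> stays the same there, and the
  material derivative only depends on the initial velocity. So the material derivative along \<open>V\<close> is an ordinary derivative
  of \<open>f \<phi>\<close> on the shape. The first variation becomes an explicit integral over the chart,
  and an integration by parts turns it into the integral of the cutoff times \<open>h \<partial>\<^sub>i (h - f \<phi>)\<close>
  against the surface measure, up to the sign that was chosen. Since \<open>h > 0\<close>, a suitable sign makes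
  this negative (\<open>integral_variation_negative\<close>). A stationary point or a minimizer admits no such
  direction, so its defect is locally constant on \<open>M\<close>, therefore constant, and zero because of its mean
  (\<open>no_descent_imp_equal\<close>). Only tangential directions were used.

  Two constructions carry this argument. The surface measure is defined by its values in charts; that
  such a measure exists follows from the change of variables formula for the transitions between charts.
  The measure of \<open>\<psi> ` M\<close> is then the image of a density on \<open>M\<close> (\<open>surface_measure_image\<close>), so
  that all integrals live on the fixed set \<open>M\<close>. The straight perturbations \<open>perturb M \<phi> V t\<close> leave the shape
  even for tangential \<open>V\<close>. Their first variation is found by dominated convergence on \<open>M\<close>
  (\<open>pre_shape_derivative\<close>), and it only involves quantities that depend on the initial velocity.
\<close>

section \<open>Calculus of smooth maps\<close>

lemma frechet_derivative_cong_open: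
  assumes "open U" "x \<in> U" "\<And>y. y \<in> U \<Longrightarrow> F y = G y"
  shows "frechet_derivative F (at x) = frechet_derivative G (at x)"
proof -
  have "(F has_derivative D) (at x) \<longleftrightarrow> (G has_derivative D) (at x)" for D
    using assms by (metis has_derivative_transform_within_open)
  then show ?thesis by (simp add: frechet_derivative_def)
qed

lemma ck_on_cong:
  "open U \<Longrightarrow> (\<And>x. x \<in> U \<Longrightarrow> F x = G x) \<Longrightarrow> ck_on k U F \<Longrightarrow> ck_on k U G"
proof (induction k arbitrary: F G)
  case 0
  then show ?case by (auto cong: continuous_on_cong)
next
  case (Suc k)
  have diff: "G differentiable at x" if "x \<in> U" for x
  proof -
    obtain D where "(F has_derivative D) (at x)"
      using Suc.prems(3) \<open>x \<in> U\<close> by (auto simp: differentiable_def)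
    then have "(G has_derivative D) (at x)"
      by (rule has_derivative_transform_within_open[OF _ Suc.prems(1) that]) (use Suc.prems(2) in auto)
    then show ?thesis by (rule differentiableI)
  qed
  have "ck_on k U (\<lambda>x. frechet_derivative G (at x) v)" for v
  proof (rule Suc.IH[OF Suc.prems(1)])
    show "ck_on k U (\<lambda>x. frechet_derivative F (at x) v)" using Suc.prems(3) by simp
    show "frechet_derivative F (at x) v = frechet_derivative G (at x) v" if "x \<in> U" for x
      using frechet_derivative_cong_open[OF Suc.prems(1) that Suc.prems(2)] by simp
  qed
  with diff show ?case by simp
qed

lemma ck_on_subset: "V \<subseteq> U \<Longrightarrow> ck_on k U F \<Longrightarrow> ck_on k V F"
  by (induction k arbitrary: F) (auto intro: continuous_on_subset)

lemma ck_on_local: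
  "(\<And>x. x \<in> U \<Longrightarrow> \<exists>V. open V \<and> x \<in> V \<and> ck_on k V F) \<Longrightarrow> ck_on k U F"
proof (induction k arbitrary: F)
  case 0
  then have "\<forall>x\<in>U. isCont F x"
    by (metis ck_on.simps(1) continuous_on_eq_continuous_at)
  then show ?case by (simp add: continuous_at_imp_continuous_on)
next
  case (Suc k)
  show ?case
    unfolding ck_on.simps
  proof (intro conjI ballI allI)
    fix x assume "x \<in> U"
    then show "F differentiable at x" using Suc.prems by force
  next
    fix v
    show "ck_on k U (\<lambda>x. frechet_derivative F (at x) v)"
      by (rule Suc.IH) (use Suc.prems in fastforce)
  qed
qed

text \<open>
  The definition of \<open>ck_on\<close> speaks of the canonical Frechet derivative. With this rule any
  explicit derivative can be used instead, as the calculus rules below do.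
\<close>
lemma ck_on_SucI:
  assumes "open U" "\<And>x. x \<in> U \<Longrightarrow> (F has_derivative F' x) (at x)"
    "\<And>v. ck_on k U (\<lambda>x. F' x v)"
  shows "ck_on (Suc k) U F"
proof -
  have "frechet_derivative F (at x) = F' x" if "x \<in> U" for x
    using assms(2)[OF that] frechet_derivative_at by metis
  then have "ck_on k U (\<lambda>x. frechet_derivative F (at x) v)" for v
    by (intro ck_on_cong[OF assms(1) _ assms(3)[of v]]) simp
  then show ?thesis using differentiableI[OF assms(2)] by simp
qed

lemma ck_on_Suc_has_derivative:
  "ck_on (Suc k) U F \<Longrightarrow> x \<in> U \<Longrightarrow> (F has_derivative frechet_derivative F (at x)) (at x)"
  by (simp add: frechet_derivative_works)

lemma ck_on_SucD: "ck_on (Suc k) U F \<Longrightarrow> ck_on k U F"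
proof (induction k arbitrary: F)
  case 0
  then show ?case
    by (simp add: continuous_at_imp_continuous_on differentiable_imp_continuous_within)
next
  case (Suc k)
  from Suc.prems have *: "\<forall>x\<in>U. F differentiable (at x)"
      and **: "\<And>v. ck_on (Suc k) U (\<lambda>x. frechet_derivative F (at x) v)"
    unfolding ck_on.simps(2)[of "Suc k"] by blast+
  show ?case
    unfolding ck_on.simps(2)[of k U F] using * Suc.IH[OF **] by simp
qed

lemma ck_on_const: "ck_on k U (\<lambda>x. c)"
proof (induction k arbitrary: c)
  case (Suc k)
  have "frechet_derivative (\<lambda>x. c) (at x) = (\<lambda>v. 0)" for x
    by simp
  then show ?case using Suc by simp
qed simp

lemma ck_on_linear: "bounded_linear L \<Longrightarrow> ck_on k U L"
proof (cases k)
  case 0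
  then show "bounded_linear L \<Longrightarrow> ?thesis"
    by (simp add: linear_continuous_on)
next
  case (Suc m)
  assume L: "bounded_linear L"
  then have "ck_on (Suc m) UNIV L"
    by (intro ck_on_SucI[of _ _ "\<lambda>_. L"]) (auto simp: bounded_linear_imp_has_derivative ck_on_const)
  then show ?thesis using Suc ck_on_subset by blast
qed

lemma ck_on_add:
  "open U \<Longrightarrow> ck_on k U F \<Longrightarrow> ck_on k U G \<Longrightarrow> ck_on k U (\<lambda>x. F x + G x)"
proof (induction k arbitrary: F G)
  case 0
  then show ?case by (simp add: continuous_on_add)
next
  case (Suc k)
  show ?case
    by (rule ck_on_SucI[OF Suc.prems(1) has_derivative_add[OF ck_on_Suc_has_derivative ck_on_Suc_has_derivative]])
       (use Suc in auto)
qed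

lemma ck_on_sum:
  "open U \<Longrightarrow> (\<And>i. i \<in> I \<Longrightarrow> ck_on k U (F i)) \<Longrightarrow> ck_on k U (\<lambda>x. \<Sum>i\<in>I. F i x)"
  by (induction I rule: infinite_finite_induct) (auto simp: ck_on_const ck_on_add)

lemma ck_on_bilinear:
  assumes pr: "bounded_bilinear pr"
  shows "open U \<Longrightarrow> ck_on k U F \<Longrightarrow> ck_on k U G \<Longrightarrow> ck_on k U (\<lambda>x. pr (F x) (G x))"
proof (induction k arbitrary: F G)
  case 0
  then show ?case by (simp add: bounded_bilinear.continuous_on[OF pr])
next
  case (Suc k)
  show ?case
  proof (rule ck_on_SucI[OF Suc.prems(1)])
    show "((\<lambda>x. pr (F x) (G x)) has_derivative
        (\<lambda>v. pr (F x) (frechet_derivative G (at x) v) + pr (frechet_derivative F (at x) v) (G x))) (at x)"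
      if "x \<in> U" for x
      by (rule bounded_bilinear.FDERIV[OF pr]) (use Suc.prems ck_on_Suc_has_derivative that in blast)+
    show "ck_on k U (\<lambda>x. pr (F x) (frechet_derivative G (at x) v) + pr (frechet_derivative F (at x) v) (G x))" for v
      by (intro ck_on_add Suc.IH Suc.prems) (use Suc.prems ck_on_SucD in auto)
  qed
qed

lemma linear_basis_expansion:
  fixes L :: "'a::euclidean_space \<Rightarrow> 'b::real_vector"
  assumes "linear L"
  shows "L v = (\<Sum>b\<in>Basis. (v \<bullet> b) *\<^sub>R L b)"
proof -
  have "L v = L (\<Sum>b\<in>Basis. (v \<bullet> b) *\<^sub>R b)" by (simp add: euclidean_representation)
  also have "\<dots> = (\<Sum>b\<in>Basis. (v \<bullet> b) *\<^sub>R L b)"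
    by (simp add: linear_sum[OF assms] linear_scale[OF assms])
  finally show ?thesis .
qed

lemma ck_on_comp_linear:
  assumes "open U" "bounded_linear L"
  shows "ck_on k U G \<Longrightarrow> ck_on k U (\<lambda>x. L (G x))"
proof (induction k arbitrary: G)
  case 0
  then show ?case using assms(2) by (simp add: bounded_linear.continuous_on)
next
  case (Suc k)
  show ?case
    by (rule ck_on_SucI[OF assms(1) bounded_linear.has_derivative[OF assms(2) ck_on_Suc_has_derivative]])
      (use Suc in auto)
qed

text \<open>
  The derivative of \<open>F \<circ> G\<close> applies \<open>DF (G x)\<close> to a vector that varies with \<open>x\<close>. The induction
  hypothesis only covers fixed vectors, so this vector is expanded in the standard basis.
\<close>
lemma ck_on_comp:
  assumes "open U"
  shows "G ` U \<subseteq> V \<Longrightarrow> ck_on k V F \<Longrightarrow> ck_on k U G \<Longrightarrow> ck_on k U (\<lambda>x. F (G x))"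
proof (induction k arbitrary: F)
  case 0
  then show ?case by (auto intro: continuous_on_compose2)
next
  case (Suc k)
  let ?DF = "\<lambda>y. frechet_derivative F (at y)" and ?DG = "\<lambda>x. frechet_derivative G (at x)"
  have F: "(F has_derivative ?DF (G x)) (at (G x))" if "x \<in> U" for x
    using Suc.prems that by (meson ck_on_Suc_has_derivative image_subset_iff)
  show ?case
  proof (rule ck_on_SucI[OF assms])
    show "((\<lambda>x. F (G x)) has_derivative (\<lambda>v. \<Sum>b\<in>Basis. (?DG x v \<bullet> b) *\<^sub>R ?DF (G x) b)) (at x)"
      if "x \<in> U" for x
    proof -
      have "((\<lambda>x. F (G x)) has_derivative (\<lambda>v. ?DF (G x) (?DG x v))) (at x)"
        using F[OF that] ck_on_Suc_has_derivative[OF Suc.prems(3) that]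
        by (metis has_derivative_compose)
      moreover have "?DF (G x) (?DG x v) = (\<Sum>b\<in>Basis. (?DG x v \<bullet> b) *\<^sub>R ?DF (G x) b)" for v
        by (rule linear_basis_expansion[OF has_derivative_linear[OF F[OF that]]])
      ultimately show ?thesis by simp
    qed
    show "ck_on k U (\<lambda>x. \<Sum>b\<in>Basis. (?DG x v \<bullet> b) *\<^sub>R ?DF (G x) b)" for v
    proof (intro ck_on_sum ck_on_bilinear[OF bounded_bilinear_scaleR] assms)
      fix b :: 'b
      show "ck_on k U (\<lambda>x. ?DG x v \<bullet> b)"
        using Suc.prems ck_on_comp_linear[OF assms bounded_linear_inner_left, of k "\<lambda>x. ?DG x v"] by simp
      show "ck_on k U (\<lambda>x. ?DF (G x) b)"
        using Suc.prems by (intro Suc.IH ck_on_SucD[OF Suc.prems(3)]) simp_all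
    qed
  qed
qed

lemma ck_on_inverse:
  fixes P :: "'a::euclidean_space \<Rightarrow> real"
  assumes "open U" "\<And>x. x \<in> U \<Longrightarrow> P x \<noteq> 0"
  shows "ck_on k U P \<Longrightarrow> ck_on k U (\<lambda>x. inverse (P x))"
proof (induction k)
  case 0
  then show ?case using assms by (simp add: continuous_on_inverse)
next
  case (Suc k)
  have *: "ck_on k U (\<lambda>x. inverse (P x))" using Suc ck_on_SucD by blast
  show ?case
  proof (rule ck_on_SucI[OF assms(1)])
    show "((\<lambda>x. inverse (P x)) has_derivative
       (\<lambda>v. - (inverse (P x) * frechet_derivative P (at x) v * inverse (P x)))) (at x)" if "x \<in> U" for x
      by (rule Deriv.has_derivative_inverse[OF assms(2)[OF that] ck_on_Suc_has_derivative[OF Suc.prems that]])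
    show "ck_on k U (\<lambda>x. - (inverse (P x) * frechet_derivative P (at x) v * inverse (P x)))" for v
      using Suc.prems
      by (intro ck_on_comp_linear[OF assms(1), of uminus] ck_on_bilinear[OF bounded_bilinear_mult] * assms
            bounded_linear_minus bounded_linear_ident) simp
  qed
qed

lemma ck_on_sqrt:
  fixes P :: "'a::euclidean_space \<Rightarrow> real"
  assumes "open U" "\<And>x. x \<in> U \<Longrightarrow> P x > 0"
  shows "ck_on k U P \<Longrightarrow> ck_on k U (\<lambda>x. sqrt (P x))"
proof (induction k)
  case 0
  then show ?case by (simp add: continuous_on_real_sqrt)
next
  case (Suc k)
  have *: "ck_on k U (\<lambda>x. sqrt (P x))" using Suc ck_on_SucD by blast
  show ?case
  proof (rule ck_on_SucI[OF assms(1)])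
    show "((\<lambda>x. sqrt (P x)) has_derivative
       (\<lambda>v. (1/2) *\<^sub>R (frechet_derivative P (at x) v * inverse (sqrt (P x))))) (at x)" if "x \<in> U" for x
      by (rule has_derivative_eq_rhs, rule has_derivative_real_sqrt[OF assms(2)[OF that]
          ck_on_Suc_has_derivative[OF Suc.prems that]]) (auto simp: field_simps)
    show "ck_on k U (\<lambda>x. (1/2) *\<^sub>R (frechet_derivative P (at x) v * inverse (sqrt (P x))))" for v
      using Suc.prems assms *
      by (intro ck_on_comp_linear[OF assms(1), of "(*\<^sub>R) (1/2)"] ck_on_bilinear[OF bounded_bilinear_mult]
          assms ck_on_inverse bounded_linear_scaleR_right) (auto dest: less_imp_neq simp: less_le)
  qed
qed

lemma ck_on_prod:
  fixes F :: "'i \<Rightarrow> 'a::euclidean_space \<Rightarrow> real"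
  shows "open U \<Longrightarrow> (\<And>i. i \<in> I \<Longrightarrow> ck_on k U (F i)) \<Longrightarrow> ck_on k U (\<lambda>x. \<Prod>i\<in>I. F i x)"
  by (induction I rule: infinite_finite_induct)
    (auto simp: ck_on_const ck_on_bilinear[OF bounded_bilinear_mult])

lemma ck_on_det:
  fixes A :: "'a::euclidean_space \<Rightarrow> 'm::finite \<Rightarrow> 'm \<Rightarrow> real"
  assumes "open U" "\<And>i j. ck_on k U (\<lambda>x. A x i j)"
  shows "ck_on k U (\<lambda>x. det (\<chi> i j. A x i j))"
  unfolding det_def
  by (intro ck_on_sum ck_on_bilinear[OF bounded_bilinear_mult] ck_on_const ck_on_prod assms)
     (simp_all add: assms)

lemma ck_on_vec:
  fixes F :: "'a::euclidean_space \<Rightarrow> real^'m"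
  assumes "open U" "\<And>i. ck_on k U (\<lambda>x. F x $ i)"
  shows "ck_on k U F"
proof -
  have "ck_on k U (\<lambda>x. \<Sum>i\<in>UNIV. F x $ i *\<^sub>R (axis i 1 :: real^'m))"
    by (intro ck_on_sum ck_on_bilinear[OF bounded_bilinear_scaleR] ck_on_const assms)
  moreover have "(\<lambda>x. \<Sum>i\<in>UNIV. F x $ i *\<^sub>R (axis i 1 :: real^'m)) = F"
    by (auto simp: vec_eq_iff axis_def if_distrib cong: if_cong)
  ultimately show ?thesis by (simp only:)
qed

lemma smooth_on_open_subset: "smooth_on_open U F \<Longrightarrow> V \<subseteq> U \<Longrightarrow> smooth_on_open V F"
  by (simp add: smooth_on_open_def ck_on_subset[of V U])

lemma smooth_on_open_cong:
  "open U \<Longrightarrow> smooth_on_open U F \<Longrightarrow> (\<And>x. x \<in> U \<Longrightarrow> F x = G x) \<Longrightarrow> smooth_on_open U G"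
  by (auto simp: smooth_on_open_def intro: ck_on_cong[of U F])

lemma smooth_on_open_local:
  "(\<And>x. x \<in> U \<Longrightarrow> \<exists>V. open V \<and> x \<in> V \<and> smooth_on_open V F) \<Longrightarrow> smooth_on_open U F"
proof -
  assume *: "\<And>x. x \<in> U \<Longrightarrow> \<exists>V. open V \<and> x \<in> V \<and> smooth_on_open V F"
  show "smooth_on_open U F"
    unfolding smooth_on_open_def
  proof
    show "ck_on k U F" for k
      by (rule ck_on_local) (use * in \<open>auto simp: smooth_on_open_def\<close>)
  qed
qed

lemma smooth_on_open_comp:
  "open U \<Longrightarrow> smooth_on_open V F \<Longrightarrow> smooth_on_open U G \<Longrightarrow> G ` U \<subseteq> V \<Longrightarrow> smooth_on_open U (\<lambda>x. F (G x))"
  by (simp add: smooth_on_open_def ck_on_comp)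

lemma smooth_on_open_has_derivative:
  "smooth_on_open U F \<Longrightarrow> x \<in> U \<Longrightarrow> (F has_derivative frechet_derivative F (at x)) (at x)"
  using ck_on_Suc_has_derivative smooth_on_open_def by blast

lemma smooth_on_open_frechet:
  "smooth_on_open U F \<Longrightarrow> smooth_on_open U (\<lambda>x. frechet_derivative F (at x) v)"
  by (simp add: smooth_on_open_def) (metis ck_on.simps(2))

lemma smooth_on_open_continuous: "smooth_on_open U F \<Longrightarrow> continuous_on U F"
  by (metis ck_on.simps(1) smooth_on_open_def)

lemma smooth_const: "smooth_on_open U (\<lambda>x. c)"
  by (simp add: smooth_on_open_def ck_on_const)

lemma smooth_linear: "bounded_linear L \<Longrightarrow> smooth_on_open U L"
  by (simp add: smooth_on_open_def ck_on_linear)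

lemma smooth_ident: "smooth_on_open U (\<lambda>x. x)"
  by (rule smooth_linear) (rule bounded_linear_ident)

lemma smooth_fst: "smooth_on_open U fst"
  by (rule smooth_linear) (rule bounded_linear_fst)

lemma smooth_snd: "smooth_on_open U snd"
  by (rule smooth_linear) (rule bounded_linear_snd)

context
  fixes U :: "'a::euclidean_space set"
  assumes U: "open U"
begin

lemma smooth_add:
  "smooth_on_open U F \<Longrightarrow> smooth_on_open U G \<Longrightarrow> smooth_on_open U (\<lambda>x. F x + G x)"
  by (simp add: smooth_on_open_def ck_on_add U)

lemma smooth_comp_linear:
  "bounded_linear L \<Longrightarrow> smooth_on_open U G \<Longrightarrow> smooth_on_open U (\<lambda>x. L (G x))"
  by (simp add: smooth_on_open_def ck_on_comp_linear U)

lemma smooth_uminus: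
  "smooth_on_open U F \<Longrightarrow> smooth_on_open U (\<lambda>x. - F x)"
  by (intro smooth_comp_linear[of uminus]) (auto intro: bounded_linear_minus bounded_linear_ident)

lemma smooth_diff:
  "smooth_on_open U F \<Longrightarrow> smooth_on_open U G \<Longrightarrow> smooth_on_open U (\<lambda>x. F x - G x)"
  using smooth_add[of F "\<lambda>x. - G x", OF _ smooth_uminus[of G]] by simp

lemma smooth_scaleR:
  "smooth_on_open U F \<Longrightarrow> smooth_on_open U G \<Longrightarrow> smooth_on_open U (\<lambda>x. F x *\<^sub>R G x)"
  by (simp add: smooth_on_open_def ck_on_bilinear[OF bounded_bilinear_scaleR U])

lemma smooth_mult:
  fixes F :: "'a \<Rightarrow> real"
  shows "smooth_on_open U F \<Longrightarrow> smooth_on_open U G \<Longrightarrow> smooth_on_open U (\<lambda>x. F x * G x)"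
  by (simp add: smooth_on_open_def ck_on_bilinear[OF bounded_bilinear_mult U])

lemma smooth_inner:
  "smooth_on_open U F \<Longrightarrow> smooth_on_open U G \<Longrightarrow> smooth_on_open U (\<lambda>x. F x \<bullet> G x)"
  by (simp add: smooth_on_open_def ck_on_bilinear[OF bounded_bilinear_inner U])

lemma smooth_divide:
  fixes F :: "'a \<Rightarrow> real"
  shows "smooth_on_open U F \<Longrightarrow> smooth_on_open U G \<Longrightarrow> (\<And>x. x \<in> U \<Longrightarrow> G x \<noteq> 0) \<Longrightarrow>
    smooth_on_open U (\<lambda>x. F x / G x)"
  by (simp add: smooth_on_open_def divide_inverse ck_on_bilinear[OF bounded_bilinear_mult U] ck_on_inverse U)

lemma smooth_sqrt:
  fixes F :: "'a \<Rightarrow> real"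
  shows "smooth_on_open U F \<Longrightarrow> (\<And>x. x \<in> U \<Longrightarrow> F x > 0) \<Longrightarrow> smooth_on_open U (\<lambda>x. sqrt (F x))"
  by (simp add: smooth_on_open_def ck_on_sqrt U)

lemma smooth_det:
  fixes A :: "'a \<Rightarrow> 'm::finite \<Rightarrow> 'm \<Rightarrow> real"
  shows "(\<And>i j. smooth_on_open U (\<lambda>x. A x i j)) \<Longrightarrow> smooth_on_open U (\<lambda>x. det (\<chi> i j. A x i j))"
  by (simp add: smooth_on_open_def ck_on_det U)

lemma smooth_nth:
  fixes F :: "'a \<Rightarrow> real^'m"
  shows "smooth_on_open U F \<Longrightarrow> smooth_on_open U (\<lambda>x. F x $ i)"
  by (rule smooth_comp_linear[OF bounded_linear_vec_nth])

lemma smooth_frechet_apply: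
  fixes F :: "'b::euclidean_space \<Rightarrow> 'c::euclidean_space"
  assumes "smooth_on_open V F" "smooth_on_open U G" "smooth_on_open U H" "G ` U \<subseteq> V"
  shows "smooth_on_open U (\<lambda>x. frechet_derivative F (at (G x)) (H x))"
proof -
  have "smooth_on_open U (\<lambda>x. \<Sum>b\<in>Basis. (H x \<bullet> b) *\<^sub>R frechet_derivative F (at (G x)) b)"
  proof -
    have "smooth_on_open U (\<lambda>x. (H x \<bullet> b) *\<^sub>R frechet_derivative F (at (G x)) b)" for b
      by (intro smooth_scaleR smooth_inner assms smooth_const
           smooth_on_open_comp[OF U smooth_on_open_frechet[OF assms(1)]])
    then show ?thesis by (simp add: smooth_on_open_def ck_on_sum U)
  qed
  moreover have "frechet_derivative F (at (G x)) (H x) =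
      (\<Sum>b\<in>Basis. (H x \<bullet> b) *\<^sub>R frechet_derivative F (at (G x)) b)" if "x \<in> U" for x
    using that assms
    by (intro linear_basis_expansion has_derivative_linear[OF smooth_on_open_has_derivative[OF assms(1)]]) auto
  ultimately show ?thesis by (simp add: smooth_on_open_cong[OF U])
qed

end

section \<open>A smooth bump function\<close>

text \<open>
  The family \<open>x \<mapsto> x\<^sup>-\<^sup>m exp (-1/x)\<close>, extended by zero to \<open>x \<le> 0\<close>. Differentiation only produces members of the family
  with larger \<open>m\<close>, which makes \<open>exp (-1/x)\<close> smooth.
\<close>
definition flat :: "nat \<Rightarrow> real \<Rightarrow> real" where
  "flat m x = (if x > 0 then (1 / x) ^ m * exp (- (1 / x)) else 0)"

lemma flat_tendsto_0: "(flat m \<longlongrightarrow> 0) (at 0)"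
proof -
  have "((\<lambda>x::real. (1/x) ^ m / exp (1/x)) \<longlongrightarrow> 0) (at_right 0)"
    by (rule filterlim_compose[OF tendsto_power_div_exp_0])
       (simp add: filterlim_inverse_at_top_right inverse_eq_divide[symmetric])
  then have "(flat m \<longlongrightarrow> 0) (at_right 0)"
    by (rule Lim_transform_eventually)
       (auto simp: eventually_at_filter flat_def exp_minus divide_inverse intro!: always_eventually)
  moreover have "(flat m \<longlongrightarrow> 0) (at_left 0)"
    by (rule Lim_transform_eventually[OF tendsto_const])
       (auto simp: eventually_at_filter flat_def intro!: always_eventually)
  ultimately show ?thesis using filterlim_split_at by blast
qed

lemma flat_derivative:
  "(flat m has_field_derivative (flat (m+2) x - real m * flat (m+1) x)) (at x)"
proof -
  consider "x > 0" | "x < 0" | "x = 0" by linarith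
  then show ?thesis
  proof cases
    case 1
    have "((\<lambda>x. (1 / x) ^ m * exp (- (1 / x))) has_field_derivative (flat (m+2) x - real m * flat (m+1) x)) (at x)"
    proof -
      have "((\<lambda>x. 1 / x) has_field_derivative (- ((1 / x)\<^sup>2))) (at x)"
        using 1 by (auto intro!: derivative_eq_intros simp: power2_eq_square)
      from DERIV_mult[OF DERIV_power[OF this, of m] DERIV_fun_exp[OF DERIV_minus[OF this]]]
      have "((\<lambda>x. (1 / x) ^ m * exp (- (1 / x))) has_field_derivative
          (real m * (- ((1 / x)\<^sup>2) * (1 / x) ^ (m - Suc 0))) * exp (- (1 / x))
          + (exp (- (1 / x)) * (1 / x)\<^sup>2) * (1 / x) ^ m) (at x)"
        by simp
      then show ?thesis
        using 1 by (cases m) (simp_all add: flat_def algebra_simps power2_eq_square)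
    qed
    then show ?thesis
      by (rule has_field_derivative_transform_within_open[where S="{0<..}"]) (use 1 in \<open>auto simp: flat_def\<close>)
  next
    case 2
    have "((\<lambda>x::real. 0) has_field_derivative (flat (m+2) x - real m * flat (m+1) x)) (at x)"
      using 2 by (auto intro!: derivative_eq_intros simp: flat_def)
    then show ?thesis
      by (rule has_field_derivative_transform_within_open[where S="{..<0}"]) (use 2 in \<open>auto simp: flat_def\<close>)
  next
    case 3
    have "((\<lambda>h. (flat m (0 + h) - flat m 0) / h) \<longlongrightarrow> 0) (at 0)"
      by (rule Lim_transform_eventually[OF flat_tendsto_0[of "m+1"]])
         (auto simp: eventually_at_filter flat_def intro!: always_eventually)
    then show ?thesis using 3 by (simp add: DERIV_def flat_def)
  qed
qed

lemma ck_on_flat: "ck_on k UNIV (flat m)"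
proof (induction k arbitrary: m)
  case 0
  show ?case by (auto intro!: continuous_at_imp_continuous_on DERIV_isCont[OF flat_derivative])
next
  case (Suc k)
  show ?case
  proof (rule ck_on_SucI)
    show "(flat m has_derivative (\<lambda>v. (flat (m+2) x + (- real m) * flat (m+1) x) * v)) (at x)" for x
      using flat_derivative[of m x] by (simp add: has_field_derivative_def mult_commute_abs)
    show "ck_on k UNIV (\<lambda>x. (flat (m+2) x + (- real m) * flat (m+1) x) * v)" for v
      by (intro ck_on_bilinear[OF bounded_bilinear_mult] ck_on_add ck_on_const Suc open_UNIV)
  qed simp
qed

definition bump :: "'a::euclidean_space \<Rightarrow> real \<Rightarrow> 'a \<Rightarrow> real" where
  "bump y r x = flat 0 (r\<^sup>2 - (x - y) \<bullet> (x - y))"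

lemma smooth_bump: "smooth_on_open U (bump y r)"
proof -
  have "smooth_on_open UNIV (\<lambda>x. flat 0 (r\<^sup>2 - (x - y) \<bullet> (x - y)))"
    by (rule smooth_on_open_comp[of UNIV UNIV])
       (auto simp: smooth_on_open_def[of _ "flat 0"] ck_on_flat intro!: smooth_diff smooth_inner smooth_const smooth_ident)
  then have "smooth_on_open UNIV (bump y r)" by (simp add: bump_def[abs_def])
  then show ?thesis by (rule smooth_on_open_subset) simp
qed

lemma bump_nonneg: "bump y r x \<ge> 0"
  by (simp add: bump_def flat_def)

lemma bump_pos_iff: "r > 0 \<Longrightarrow> bump y r x > 0 \<longleftrightarrow> x \<in> ball y r"
proof -
  assume "r > 0"
  then have "(x - y) \<bullet> (x - y) < r\<^sup>2 \<longleftrightarrow> norm (x - y) < r"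
    by (metis dot_square_norm norm_ge_zero less_imp_le power2_less_imp_less power_strict_mono zero_less_numeral)
  then show ?thesis by (simp add: bump_def flat_def dist_norm norm_minus_commute)
qed

lemma bump_zero: "r > 0 \<Longrightarrow> x \<notin> ball y r \<Longrightarrow> bump y r x = 0"
  using bump_pos_iff[of r y x] bump_nonneg[of y r x] by linarith

section \<open>Smooth local inverses\<close>

text \<open>
  The derivative of the inverse is the inverse of the derivative, and by Cramer's rule its entries are
  quotients of determinants in the entries of \<open>Df (g y)\<close>. So \<open>k\<close> derivatives of \<open>g\<close> yield
  \<open>k + 1\<close>.
\<close>
lemma smooth_local_inverse:
  fixes f :: "real^'m \<Rightarrow> real^'m"
  assumes U: "open U" and V: "open V" and f: "smooth_on_open U f" and gV: "g ` V \<subseteq> U"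
    and g: "\<And>y. y \<in> V \<Longrightarrow> (g has_derivative inv (frechet_derivative f (at (g y)))) (at y)"
    and bij: "\<And>y. y \<in> V \<Longrightarrow> bij (frechet_derivative f (at (g y)))"
  shows "smooth_on_open V g"
proof -
  define A where "A y i j = frechet_derivative f (at (g y)) (axis j 1) $ i" for y i j
  have lin: "linear (frechet_derivative f (at (g y)))" if "y \<in> V" for y
    using f gV that by (meson smooth_on_open_has_derivative has_derivative_linear image_subset_iff)
  have mat: "matrix (frechet_derivative f (at (g y))) = (\<chi> i j. A y i j)" for y
    by (simp add: matrix_def A_def)
  have det0: "det (\<chi> i j. A y i j) \<noteq> 0" if "y \<in> V" for y
    using det_nz_iff_inj[OF lin[OF that]] bij[OF that] mat by (simp add: bij_is_inj)
  have cramer: "inv (frechet_derivative f (at (g y))) v =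
      (\<chi> k. det (\<chi> i j. if j = k then v $ i else A y i j) / det (\<chi> i j. A y i j))" if "y \<in> V" for y v
  proof -
    let ?x = "inv (frechet_derivative f (at (g y))) v"
    have "frechet_derivative f (at (g y)) ?x = v"
      using bij[OF that] by (simp add: bij_is_surj surj_f_inv_f)
    then have "matrix (frechet_derivative f (at (g y))) *v ?x = v"
      using lin[OF that] by (simp add: matrix_works)
    then have "(\<chi> i j. A y i j) *v ?x = v" by (simp add: mat)
    then show ?thesis using cramer[OF det0[OF that]] by (simp add: if_distrib cong: if_cong)
  qed
  have "ck_on k V g" for k
  proof (induction k)
    case 0
    show ?case by (auto intro!: continuous_at_imp_continuous_on has_derivative_continuous[OF g])
  next
    case (Suc k)
    have A: "ck_on k V (\<lambda>y. A y i j)" for i j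
    proof -
      have *: "ck_on k U (\<lambda>x. frechet_derivative f (at x) (axis j 1))"
        using f unfolding smooth_on_open_def by (metis ck_on.simps(2))
      show ?thesis unfolding A_def
        by (intro ck_on_comp_linear[OF V bounded_linear_vec_nth] ck_on_comp[OF V gV *] Suc)
    qed
    show ?case
    proof (rule ck_on_SucI[OF V g])
      fix v :: "real^'m"
      have "ck_on k V (\<lambda>y. \<chi> k. det (\<chi> i j. if j = k then v $ i else A y i j) / det (\<chi> i j. A y i j))"
      proof (rule ck_on_vec[OF V])
        fix l :: 'm
        have *: "ck_on k V (\<lambda>y. if j = l then v $ i else A y i j)" for i j
          by (cases "j = l") (simp_all add: ck_on_const A)
        show "ck_on k V (\<lambda>y. (\<chi> k. det (\<chi> i j. if j = k then v $ i else A y i j) / det (\<chi> i j. A y i j)) $ l)"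
          using det0 by (simp add: divide_inverse)
            (intro ck_on_bilinear[OF bounded_bilinear_mult V] ck_on_inverse V ck_on_det A * | simp)+
      qed
      then show "ck_on k V (\<lambda>y. inv (frechet_derivative f (at (g y))) v)"
        by (rule ck_on_cong[OF V, rotated]) (simp add: cramer)
    qed
  qed
  then show ?thesis by (simp add: smooth_on_open_def)
qed

lemma smooth_inverse_function_theorem:
  fixes f :: "real^'m \<Rightarrow> real^'m"
  assumes U: "open U" and f: "smooth_on_open U f" and x0: "x0 \<in> U"
    and inj: "inj (frechet_derivative f (at x0))"
  obtains U' V g where "open U'" "U' \<subseteq> U" "x0 \<in> U'" "open V" "homeomorphism U' V f g" "smooth_on_open V g"
proof -
  define f' where "f' x = Blinfun (frechet_derivative f (at x))" for x
  have der: "(f has_derivative frechet_derivative f (at x)) (at x)" if "x \<in> U" for x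
    by (rule smooth_on_open_has_derivative[OF f that])
  have f': "blinfun_apply (f' x) = frechet_derivative f (at x)" if "x \<in> U" for x
    using der[OF that] unfolding f'_def by (simp add: bounded_linear_Blinfun_apply has_derivative_bounded_linear)
  have cont: "continuous_on U f'"
  proof (rule continuous_on_blinfun_componentwise)
    fix i
    show "continuous_on U (\<lambda>x. blinfun_apply (f' x) i)"
      by (rule continuous_on_eq[OF smooth_on_open_continuous[OF smooth_on_open_frechet[OF f, of i]]]) (simp add: f')
  qed
  have lin: "linear (frechet_derivative f (at x0))"
    by (rule has_derivative_linear[OF der[OF x0]])
  obtain h where h: "linear h" "h \<circ> frechet_derivative f (at x0) = id"
    using linear_injective_left_inverse[OF lin inj] by auto
  have der': "(f has_derivative blinfun_apply (f' x)) (at x)" if "x \<in> U" for x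
    using der f' that by simp
  have inv: "Blinfun h o\<^sub>L f' x0 = id_blinfun"
    using h f'[OF x0] by (intro blinfun_eqI)
      (simp add: bounded_linear_Blinfun_apply linear_conv_bounded_linear pointfree_idE)
  show thesis
  proof (rule inverse_function_theorem[OF U der' cont x0 inv])
    fix U' V g g'
    assume *: "open U'" "U' \<subseteq> U" "x0 \<in> U'" "open V" "f x0 \<in> V" "homeomorphism U' V f g"
      "\<And>y. y \<in> V \<Longrightarrow> (g has_derivative (g' y)) (at y)"
      "\<And>y. y \<in> V \<Longrightarrow> g' y = inv (blinfun_apply (f' (g y)))"
      "\<And>y. y \<in> V \<Longrightarrow> bij (blinfun_apply (f' (g y)))"
    have gV: "g ` V \<subseteq> U" using *(2,6) homeomorphism_image2 by blast
    have "smooth_on_open V g"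
    proof (rule smooth_local_inverse[OF U *(4) f gV])
      fix y assume y: "y \<in> V"
      then have gy: "g y \<in> U" using gV by blast
      show "(g has_derivative inv (frechet_derivative f (at (g y)))) (at y)"
        using *(7,8)[OF y] f'[OF gy] by simp
      show "bij (frechet_derivative f (at (g y)))"
        using *(9)[OF y] f'[OF gy] by simp
    qed
    then show thesis by (rule that[OF *(1-4,6)])
  qed
qed

section \<open>Smooth maps on arbitrary sets\<close>

lemma smooth_on_setI_open:
  "open U \<Longrightarrow> smooth_on_open U F \<Longrightarrow> S \<subseteq> U \<Longrightarrow> smooth_on_set S F"
  unfolding smooth_on_set_def by blast

lemma smooth_on_setI:
  assumes "\<And>x. x \<in> S \<Longrightarrow> \<exists>U E. open U \<and> x \<in> U \<and> smooth_on_open U E \<and> (\<forall>y\<in>S \<inter> U. E y = F y)"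
  shows "smooth_on_set S F"
  using assms by (simp add: smooth_on_set_def)

lemma smooth_on_setE:
  assumes "smooth_on_set S F" "x \<in> S"
  obtains U E where "open U" "x \<in> U" "smooth_on_open U E" "\<And>y. y \<in> S \<Longrightarrow> y \<in> U \<Longrightarrow> E y = F y"
proof -
  have "\<exists>U E. open U \<and> x \<in> U \<and> smooth_on_open U E \<and> (\<forall>y\<in>S \<inter> U. E y = F y)"
    using assms by (simp add: smooth_on_set_def)
  then obtain U E where "open U" "x \<in> U" "smooth_on_open U E" "\<forall>y\<in>S \<inter> U. E y = F y"
    by (elim exE conjE)
  then show thesis by (intro that[of U E]) simp_all
qed

lemma smooth_on_set_cong:
  assumes "smooth_on_set S F" "\<And>x. x \<in> S \<Longrightarrow> F x = G x"
  shows "smooth_on_set S G"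
proof (rule smooth_on_setI)
  fix x assume "x \<in> S"
  then obtain U E where "open U" "x \<in> U" "smooth_on_open U E" "\<And>y. y \<in> S \<Longrightarrow> y \<in> U \<Longrightarrow> E y = F y"
    using smooth_on_setE[OF assms(1)] by blast
  then show "\<exists>U E. open U \<and> x \<in> U \<and> smooth_on_open U E \<and> (\<forall>y\<in>S \<inter> U. E y = G y)"
    using assms(2) by (intro exI[of _ U] exI[of _ E]) simp
qed

lemma smooth_on_set_subset:
  assumes "smooth_on_set S F" "T \<subseteq> S"
  shows "smooth_on_set T F"
proof (rule smooth_on_setI)
  fix x assume "x \<in> T"
  then obtain U E where "open U" "x \<in> U" "smooth_on_open U E" "\<And>y. y \<in> S \<Longrightarrow> y \<in> U \<Longrightarrow> E y = F y"
    using smooth_on_setE[OF assms(1), of x] assms(2) by blast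
  then show "\<exists>U E. open U \<and> x \<in> U \<and> smooth_on_open U E \<and> (\<forall>y\<in>T \<inter> U. E y = F y)"
    using assms(2) by (intro exI[of _ U] exI[of _ E]) auto
qed

lemma smooth_on_set_open_iff: "open U \<Longrightarrow> smooth_on_set U F \<longleftrightarrow> smooth_on_open U F"
proof
  assume U: "open U" and F: "smooth_on_set U F"
  show "smooth_on_open U F"
  proof (rule smooth_on_open_local)
    fix x assume "x \<in> U"
    then obtain V E where V: "open V" "x \<in> V" "smooth_on_open V E" "\<And>y. y \<in> U \<Longrightarrow> y \<in> V \<Longrightarrow> E y = F y"
      using smooth_on_setE[OF F] by blast
    have "smooth_on_open (U \<inter> V) E" by (rule smooth_on_open_subset[OF V(3)]) simp
    then have "smooth_on_open (U \<inter> V) F"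
      by (rule smooth_on_open_cong[OF open_Int[OF U V(1)]]) (use V(4) in simp)
    then show "\<exists>V. open V \<and> x \<in> V \<and> smooth_on_open V F"
      using \<open>x \<in> U\<close> U V by blast
  qed
qed (auto intro: smooth_on_setI_open)

lemma smooth_on_set_compose:
  assumes F: "smooth_on_set S F" and G: "smooth_on_set T G" and ST: "F ` S \<subseteq> T"
  shows "smooth_on_set S (\<lambda>x. G (F x))"
proof (rule smooth_on_setI)
  fix x assume x: "x \<in> S"
  obtain U E where E: "open U" "x \<in> U" "smooth_on_open U E" "\<And>y. y \<in> S \<Longrightarrow> y \<in> U \<Longrightarrow> E y = F y"
    using smooth_on_setE[OF F x] by blast
  have "F x \<in> T" using ST x by blast
  then obtain U' E' where E': "open U'" "F x \<in> U'" "smooth_on_open U' E'"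
      "\<And>y. y \<in> T \<Longrightarrow> y \<in> U' \<Longrightarrow> E' y = G y"
    using smooth_on_setE[OF G] by blast
  define W where "W = U \<inter> E -` U'"
  have W: "open W"
    unfolding W_def using E E' smooth_on_open_continuous continuous_open_preimage by blast
  have "smooth_on_open W (\<lambda>y. E' (E y))"
    by (rule smooth_on_open_comp[OF W E'(3) smooth_on_open_subset[OF E(3)]]) (auto simp: W_def)
  moreover have "E' (E y) = G (F y)" if "y \<in> S \<inter> W" for y
  proof -
    have "y \<in> S" "y \<in> U" "E y \<in> U'" using that by (auto simp: W_def)
    moreover have "F y \<in> T" using ST \<open>y \<in> S\<close> by blast
    ultimately show ?thesis using E(4)[of y] E'(4)[of "F y"] by simp
  qed
  ultimately show "\<exists>U E. open U \<and> x \<in> U \<and> smooth_on_open U E \<and> (\<forall>y\<in>S \<inter> U. E y = G (F y))"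
    using W x E E' by (intro exI[of _ W] exI[of _ "\<lambda>y. E' (E y)"]) (auto simp: W_def)
qed

lemma has_derivative_of_extension:
  assumes "open U" "x \<in> U" "smooth_on_open U E" "\<And>y. y \<in> S \<Longrightarrow> y \<in> U \<Longrightarrow> E y = F y" "x \<in> S"
  shows "(F has_derivative frechet_derivative E (at x)) (at x within S)"
proof -
  have dE: "(E has_derivative frechet_derivative E (at x)) (at x within S)"
    using smooth_on_open_has_derivative[OF assms(3,2)] by (rule has_derivative_at_withinI)
  obtain d where d: "d > 0" "ball x d \<subseteq> U" using assms(1,2) open_contains_ball by blast
  show ?thesis
  proof (rule has_derivative_transform_within[OF dE d(1) assms(5)])
    fix y assume "y \<in> S" "dist y x < d"
    moreover from this have "y \<in> U" using d(2) by (auto simp: dist_commute)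
    ultimately show "E y = F y" using assms(4) by simp
  qed
qed

lemma smooth_on_set_has_derivative:
  assumes "smooth_on_set S F" "x \<in> S"
  shows "(F has_derivative frechet_derivative F (at x within S)) (at x within S)"
proof -
  obtain U E where E: "open U" "x \<in> U" "smooth_on_open U E" "\<And>y. y \<in> S \<Longrightarrow> y \<in> U \<Longrightarrow> E y = F y"
    using smooth_on_setE[OF assms] by blast
  show ?thesis
    using has_derivative_of_extension[OF E assms(2)] frechet_derivative_works differentiableI by blast
qed

lemma smooth_on_set_continuous: "smooth_on_set S F \<Longrightarrow> continuous_on S F"
  by (auto simp: continuous_on_eq_continuous_within intro: has_derivative_continuous smooth_on_set_has_derivative)

section \<open>Symmetry of second derivatives\<close>

lemma has_real_derivative_along_line:
  fixes f :: "'a::euclidean_space \<Rightarrow> real"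
  assumes "(f has_derivative D) (at (a + s *\<^sub>R v))"
  shows "((\<lambda>s. f (a + s *\<^sub>R v)) has_real_derivative D v) (at s)"
proof -
  have "((\<lambda>s. a + s *\<^sub>R v) has_derivative (\<lambda>t. t *\<^sub>R v)) (at s)"
    by (auto intro!: derivative_eq_intros)
  then have "((\<lambda>s. f (a + s *\<^sub>R v)) has_derivative (\<lambda>t. D (t *\<^sub>R v))) (at s)"
    using has_derivative_compose[of "\<lambda>s. a + s *\<^sub>R v" "\<lambda>t. t *\<^sub>R v" s UNIV f D] assms by simp
  moreover have "D (t *\<^sub>R v) = D v * t" for t
    using linear_scale[OF has_derivative_linear[OF assms]] by simp
  ultimately show ?thesis by (simp add: has_field_derivative_def)
qed

text \<open>
  Two applications of the mean value theorem. The left-hand side is symmetric in \<open>v\<close> and \<open>w\<close>, and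
  exchanging them gives the other order of differentiation.
\<close>
lemma second_difference:
  fixes f :: "'a::euclidean_space \<Rightarrow> real"
  assumes f: "smooth_on_open (ball x r) f" and h: "h > 0" "h * (norm v + norm w) < r"
  obtains y where "y \<in> cball x (h * (norm v + norm w))"
    "f (x + h *\<^sub>R v + h *\<^sub>R w) - f (x + h *\<^sub>R v) - f (x + h *\<^sub>R w) + f x =
      h\<^sup>2 * frechet_derivative (\<lambda>y. frechet_derivative f (at y) v) (at y) w"
proof -
  let ?D = "\<lambda>y. frechet_derivative f (at y) v"
  have in_cball: "x + s *\<^sub>R v + s' *\<^sub>R w \<in> cball x (h * (norm v + norm w))"
    if "0 \<le> s" "s \<le> h" "0 \<le> s'" "s' \<le> h" for s s'
  proof -
    have "norm (s *\<^sub>R v + s' *\<^sub>R w) \<le> s * norm v + s' * norm w"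
      using norm_triangle_ineq[of "s *\<^sub>R v" "s' *\<^sub>R w"] that by simp
    also have "\<dots> \<le> h * norm v + h * norm w"
      using that by (intro add_mono mult_right_mono) auto
    finally show ?thesis
      by (simp add: dist_norm norm_minus_commute algebra_simps)
  qed
  have in_ball: "x + s *\<^sub>R v + s' *\<^sub>R w \<in> ball x r"
    if "0 \<le> s" "s \<le> h" "0 \<le> s'" "s' \<le> h" for s s'
    using in_cball[OF that] h by simp
  have der: "(f has_derivative frechet_derivative f (at y)) (at y)" if "y \<in> ball x r" for y
    by (rule smooth_on_open_has_derivative[OF f that])
  have der2: "(?D has_derivative frechet_derivative ?D (at y)) (at y)" if "y \<in> ball x r" for y
    by (rule smooth_on_open_has_derivative[OF smooth_on_open_frechet[OF f] that])
  have "((\<lambda>s. f ((x + h *\<^sub>R w) + s *\<^sub>R v) - f (x + s *\<^sub>R v)) has_real_derivative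
      ?D ((x + h *\<^sub>R w) + s *\<^sub>R v) - ?D (x + s *\<^sub>R v)) (at s)" if "0 \<le> s" "s \<le> h" for s
    using in_ball[of s h] in_ball[of s 0] that h
    by (intro DERIV_diff has_real_derivative_along_line der) (simp_all add: algebra_simps)
  from MVT2[OF h(1) this] obtain z where z: "z > 0" "z < h"
    "(f ((x + h *\<^sub>R w) + h *\<^sub>R v) - f (x + h *\<^sub>R v)) - (f ((x + h *\<^sub>R w) + 0 *\<^sub>R v) - f (x + 0 *\<^sub>R v)) =
      (h - 0) * (?D ((x + h *\<^sub>R w) + z *\<^sub>R v) - ?D (x + z *\<^sub>R v))"
    by blast
  have "((\<lambda>s. ?D ((x + z *\<^sub>R v) + s *\<^sub>R w)) has_real_derivative
      frechet_derivative ?D (at ((x + z *\<^sub>R v) + s *\<^sub>R w)) w) (at s)" if "0 \<le> s" "s \<le> h" for s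
    using in_ball[of z s] that z by (intro has_real_derivative_along_line der2) simp_all
  from MVT2[OF h(1) this] obtain z' where z': "z' > 0" "z' < h"
    "?D ((x + z *\<^sub>R v) + h *\<^sub>R w) - ?D ((x + z *\<^sub>R v) + 0 *\<^sub>R w) =
      (h - 0) * frechet_derivative ?D (at ((x + z *\<^sub>R v) + z' *\<^sub>R w)) w"
    by blast
  show thesis
  proof (rule that[of "x + z *\<^sub>R v + z' *\<^sub>R w"])
    show "x + z *\<^sub>R v + z' *\<^sub>R w \<in> cball x (h * (norm v + norm w))"
      using in_cball[of z z'] z z' by simp
    show "f (x + h *\<^sub>R v + h *\<^sub>R w) - f (x + h *\<^sub>R v) - f (x + h *\<^sub>R w) + f x =
      h\<^sup>2 * frechet_derivative ?D (at (x + z *\<^sub>R v + z' *\<^sub>R w)) w"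
      using z(3) z'(3) by (simp add: algebra_simps power2_eq_square)
  qed
qed

lemma frechet_derivative_symmetric_real:
  fixes f :: "'a::euclidean_space \<Rightarrow> real"
  assumes U: "open U" and f: "smooth_on_open U f" and x: "x \<in> U"
  shows "frechet_derivative (\<lambda>y. frechet_derivative f (at y) v) (at x) w =
    frechet_derivative (\<lambda>y. frechet_derivative f (at y) w) (at x) v"
proof -
  define A where "A v w y = frechet_derivative (\<lambda>y. frechet_derivative f (at y) v) (at y) w" for v w y
  have cont: "isCont (A v w) x" for v w
    using smooth_on_open_continuous[OF smooth_on_open_frechet[OF smooth_on_open_frechet[OF f]]]
      continuous_on_eq_continuous_at[OF U] x unfolding A_def by blast
  obtain r where r: "r > 0" "ball x r \<subseteq> U" using U x open_contains_ball by blast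
  have fr: "smooth_on_open (ball x r) f" by (rule smooth_on_open_subset[OF f r(2)])
  have "\<bar>A v w x - A w v x\<bar> \<le> e" if e: "e > 0" for e
  proof -
    obtain d1 where d1: "d1 > 0" "\<And>y. dist y x < d1 \<Longrightarrow> dist (A v w y) (A v w x) < e / 2"
      using cont[of v w] e unfolding continuous_at_eps_delta by (meson half_gt_zero)
    obtain d2 where d2: "d2 > 0" "\<And>y. dist y x < d2 \<Longrightarrow> dist (A w v y) (A w v x) < e / 2"
      using cont[of w v] e unfolding continuous_at_eps_delta by (meson half_gt_zero)
    define m where "m = min r (min d1 d2)"
    have m: "m > 0" using r d1 d2 by (simp add: m_def)
    define h where "h = m / (norm v + norm w + 1)"
    have pos: "norm v + norm w + 1 > 0" by (simp add: add_nonneg_pos)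
    have h: "h > 0" using m pos by (simp add: h_def)
    have hm: "h * (norm v + norm w) < m" "h * (norm w + norm v) < m"
      using m pos by (simp_all add: h_def field_simps)
    have hr: "h * (norm v + norm w) < r" "h * (norm w + norm v) < r" using hm by (simp_all add: m_def)
    obtain y where y: "y \<in> cball x (h * (norm v + norm w))"
      "f (x + h *\<^sub>R v + h *\<^sub>R w) - f (x + h *\<^sub>R v) - f (x + h *\<^sub>R w) + f x = h\<^sup>2 * A v w y"
      unfolding A_def by (rule second_difference[OF fr h hr(1)])
    obtain y' where y': "y' \<in> cball x (h * (norm w + norm v))"
      "f (x + h *\<^sub>R w + h *\<^sub>R v) - f (x + h *\<^sub>R w) - f (x + h *\<^sub>R v) + f x = h\<^sup>2 * A w v y'"
      unfolding A_def by (rule second_difference[OF fr h hr(2)])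
    have "h\<^sup>2 * A v w y = h\<^sup>2 * A w v y'" using y(2) y'(2) by (simp add: algebra_simps)
    then have eq: "A v w y = A w v y'" using h by simp
    have "dist y x < d1" "dist y' x < d2" using y(1) y'(1) hm by (simp_all add: m_def dist_commute)
    then show ?thesis using d1(2)[of y] d2(2)[of y'] eq unfolding dist_real_def by linarith
  qed
  then have "\<bar>A v w x - A w v x\<bar> \<le> 0" by (rule field_le_epsilon) simp
  then show ?thesis by (simp add: A_def)
qed

lemma frechet_derivative_inner:
  assumes "smooth_on_open U F" "y \<in> U"
  shows "frechet_derivative (\<lambda>y. F y \<bullet> b) (at y) v = frechet_derivative F (at y) v \<bullet> b"
  using has_derivative_inner_left[OF smooth_on_open_has_derivative[OF assms], of b]
  by (simp add: frechet_derivative_at[symmetric])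

lemma frechet_derivative_symmetric:
  fixes F :: "'a::euclidean_space \<Rightarrow> 'b::euclidean_space"
  assumes U: "open U" and F: "smooth_on_open U F" and x: "x \<in> U"
  shows "frechet_derivative (\<lambda>y. frechet_derivative F (at y) v) (at x) w =
    frechet_derivative (\<lambda>y. frechet_derivative F (at y) w) (at x) v"
proof (rule euclidean_eqI)
  fix b :: 'b
  have comp: "frechet_derivative (\<lambda>y. frechet_derivative F (at y) v) (at x) w \<bullet> b =
      frechet_derivative (\<lambda>y. frechet_derivative (\<lambda>y. F y \<bullet> b) (at y) v) (at x) w" for v w
  proof -
    have "frechet_derivative (\<lambda>y. frechet_derivative (\<lambda>y. F y \<bullet> b) (at y) v) (at x) =
        frechet_derivative (\<lambda>y. frechet_derivative F (at y) v \<bullet> b) (at x)"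
      by (rule frechet_derivative_cong_open[OF U x]) (rule frechet_derivative_inner[OF F])
    then show ?thesis by (simp add: frechet_derivative_inner[OF smooth_on_open_frechet[OF F] x])
  qed
  show "frechet_derivative (\<lambda>y. frechet_derivative F (at y) v) (at x) w \<bullet> b =
    frechet_derivative (\<lambda>y. frechet_derivative F (at y) w) (at x) v \<bullet> b"
    unfolding comp
    by (rule frechet_derivative_symmetric_real[OF U _ x])
       (intro smooth_inner[OF U] F smooth_const)
qed

section \<open>Integration by parts\<close>

text \<open>
  By translation invariance the difference quotients of \<open>\<kappa>\<close> in direction \<open>e\<close> have integral zero.
  They are bounded and vanish outside a common compact set, so dominated convergence applies.
\<close>
lemma integral_directional_derivative_eq_0:
  fixes \<kappa> :: "'a::euclidean_space \<Rightarrow> real"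
  assumes der: "\<And>x. (\<kappa> has_derivative D x) (at x)" and cont: "continuous_on UNIV (\<lambda>x. D x e)"
    and K: "compact K" and zero: "\<And>x. x \<notin> K \<Longrightarrow> \<kappa> x = 0"
  shows "(\<integral>x. D x e \<partial>lborel) = 0"
proof -
  have Dzero: "D x e = 0" if "x \<notin> K" for x
  proof -
    have "(\<kappa> has_derivative (\<lambda>_. 0)) (at x)"
      by (rule has_derivative_transform_within_open[of "\<lambda>_. 0" _ _ _ "- K"])
         (use that zero K compact_imp_closed in \<open>auto\<close>)
    then show ?thesis using has_derivative_unique[OF der] by metis
  qed
  have "compact ((\<lambda>x. D x e) ` K)" using cont K compact_continuous_image continuous_on_subset by blast
  then obtain C0 where C0: "\<And>x. x \<in> K \<Longrightarrow> norm (D x e) \<le> C0" using compact_imp_bounded bounded_iff by (metis imageI)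
  define C where "C = max C0 0"
  have C: "C \<ge> 0" "\<bar>D x e\<bar> \<le> C" for x
    using C0[of x] Dzero[of x] by (cases "x \<in> K"; force simp: C_def)+
  have contk: "continuous_on UNIV \<kappa>"
    using der by (auto intro!: continuous_at_imp_continuous_on has_derivative_continuous)
  have meas: "\<kappa> \<in> borel_measurable borel" by (rule borel_measurable_continuous_onI[OF contk])
  have int: "integrable lborel \<kappa>"
  proof -
    have "integrable lborel (\<lambda>x. indicator K x *\<^sub>R \<kappa> x)"
      by (rule borel_integrable_compact[OF K continuous_on_subset[OF contk]]) simp
    moreover have "(\<lambda>x. indicator K x *\<^sub>R \<kappa> x) = \<kappa>" using zero by (auto simp: indicator_def fun_eq_iff)
    ultimately show ?thesis by simp
  qed
  define K' where "K' = (\<lambda>(k, s). k - s *\<^sub>R e) ` (K \<times> {0..1::real})"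
  have K': "compact K'"
    unfolding K'_def case_prod_beta
    by (intro compact_continuous_image compact_Times K compact_Icc continuous_intros)
  define t where "t n = 1 / (real n + 1)" for n
  have t: "t n > 0" "t n \<le> 1" for n by (simp_all add: t_def)
  have t0: "t \<longlonglongrightarrow> 0" unfolding t_def by (rule LIMSEQ_Suc[OF lim_1_over_n, unfolded of_nat_Suc add.commute[of 1]])
  define q where "q n x = (\<kappa> (t n *\<^sub>R e + x) - \<kappa> x) / t n" for n x
  have q_int: "(\<integral>x. q n x \<partial>lborel) = 0" for n
  proof -
    have "integrable (distr lborel borel ((+) (t n *\<^sub>R e))) \<kappa>" using int by (simp add: lborel_distr_plus)
    then have i: "integrable lborel (\<lambda>x. \<kappa> (t n *\<^sub>R e + x))"
      using meas by (simp add: integrable_distr_eq)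
    have "(\<integral>x. \<kappa> (t n *\<^sub>R e + x) \<partial>lborel) = (\<integral>x. \<kappa> x \<partial>distr lborel borel ((+) (t n *\<^sub>R e)))"
      by (rule integral_distr[symmetric]) (use meas in auto)
    then have "(\<integral>x. \<kappa> (t n *\<^sub>R e + x) \<partial>lborel) = (\<integral>x. \<kappa> x \<partial>lborel)" by (simp add: lborel_distr_plus)
    then show ?thesis unfolding q_def using int i by simp
  qed
  have line: "((\<lambda>s. \<kappa> (x + s *\<^sub>R e)) has_real_derivative D (x + s *\<^sub>R e) e) (at s)" for x s
    by (rule has_real_derivative_along_line[OF der])
  have "(\<lambda>n. \<integral>x. q n x \<partial>lborel) \<longlonglongrightarrow> (\<integral>x. D x e \<partial>lborel)"
  proof (rule integral_dominated_convergence[where w="\<lambda>x. indicator K' x *\<^sub>R C"])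
    show "(\<lambda>x. D x e) \<in> borel_measurable lborel"
      using borel_measurable_continuous_onI[OF cont] by simp
    show "q n \<in> borel_measurable lborel" for n
      unfolding q_def using meas by measurable
    show "integrable lborel (\<lambda>x. indicator K' x *\<^sub>R C)"
      by (rule borel_integrable_compact[OF K' continuous_on_const])
    show "AE x in lborel. (\<lambda>n. q n x) \<longlonglongrightarrow> D x e"
    proof (rule AE_I2)
      fix x
      have "((\<lambda>h. (\<kappa> (x + (0 + h) *\<^sub>R e) - \<kappa> (x + 0 *\<^sub>R e)) / h) \<longlongrightarrow> D (x + 0 *\<^sub>R e) e) (at 0)"
        using line[of x 0] unfolding DERIV_def .
      then have "((\<lambda>h. (\<kappa> (h *\<^sub>R e + x) - \<kappa> x) / h) \<longlongrightarrow> D x e) (at 0)" by (simp add: add.commute)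
      moreover have "filterlim t (at 0) sequentially"
        using t0 t(1) by (auto simp: filterlim_at less_imp_neq[symmetric] intro!: always_eventually)
      ultimately show "(\<lambda>n. q n x) \<longlonglongrightarrow> D x e"
        unfolding q_def by (rule filterlim_compose)
    qed
    show "AE x in lborel. norm (q n x) \<le> indicator K' x *\<^sub>R C" for n
    proof (rule AE_I2)
      fix x
      show "norm (q n x) \<le> indicator K' x *\<^sub>R C"
      proof (cases "x \<in> K'")
        case True
        obtain z where "\<kappa> (x + t n *\<^sub>R e) - \<kappa> (x + 0 *\<^sub>R e) = (t n - 0) * D (x + z *\<^sub>R e) e"
          using MVT2[OF t(1) line, of n x] by blast
        then have "q n x = D (x + z *\<^sub>R e) e" using t(1)[of n] by (simp add: q_def add.commute field_simps)
        then show ?thesis using C(2) True by simp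
      next
        case False
        have "x \<in> K'" if "x \<in> K"
          unfolding K'_def by (rule image_eqI[of _ _ "(x, 0)"]) (use that in auto)
        moreover have "x \<in> K'" if "t n *\<^sub>R e + x \<in> K"
          unfolding K'_def by (rule image_eqI[of _ _ "(t n *\<^sub>R e + x, t n)"]) (use that t[of n] in auto)
        ultimately have "\<kappa> x = 0" "\<kappa> (t n *\<^sub>R e + x) = 0" using False zero by blast+
        then show ?thesis using False by (simp add: q_def)
      qed
    qed
  qed
  then show ?thesis unfolding q_int by (simp add: LIMSEQ_const_iff)
qed

section \<open>Change of variables\<close>

text \<open>
  The change of variables theorem \<open>has_absolute_integral_change_of_variables\<close> requires a well-ordered
  index type. The type \<open>'a ranked\<close> is a copy of \<open>'a\<close> with such an order, and relabelling the
  coordinates preserves Lebesgue measure and determinants.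
\<close>
typedef ('a::finite) ranked = "UNIV :: 'a set" by simp

definition rank_of :: "'a::finite \<Rightarrow> nat" where "rank_of = (SOME f. inj f)"

lemma inj_rank_of: "inj (rank_of :: 'a::finite \<Rightarrow> nat)"
proof -
  have "\<exists>f :: 'a \<Rightarrow> nat. inj f" using finite_imp_inj_to_nat_seg[of "UNIV :: 'a set"] by auto
  then show ?thesis unfolding rank_of_def by (rule someI_ex)
qed

instance ranked :: (finite) finite
proof
  have "(UNIV :: 'a ranked set) = Abs_ranked ` UNIV" by (metis Rep_ranked_inverse surj_def)
  then show "finite (UNIV :: 'a ranked set)" by (metis finite finite_imageI)
qed

instantiation ranked :: (finite) wellorder
begin
definition less_eq_ranked :: "'a ranked \<Rightarrow> 'a ranked \<Rightarrow> bool" where "less_eq_ranked a b \<longleftrightarrow> rank_of (Rep_ranked a) \<le> rank_of (Rep_ranked b)"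
definition less_ranked :: "'a ranked \<Rightarrow> 'a ranked \<Rightarrow> bool" where "less_ranked a b \<longleftrightarrow> rank_of (Rep_ranked a) < rank_of (Rep_ranked b)"
instance
proof
  fix P :: "'a ranked \<Rightarrow> bool" and a
  assume step: "\<And>x. (\<And>y. y < x \<Longrightarrow> P y) \<Longrightarrow> P x"
  show "P a"
    by (induction a rule: measure_induct_rule[of "\<lambda>a. rank_of (Rep_ranked a)"])
       (rule step, simp add: less_ranked_def)
next
  fix x y :: "'a ranked"
  assume "x \<le> y" "y \<le> x"
  then have "rank_of (Rep_ranked x) = rank_of (Rep_ranked y)" by (simp add: less_eq_ranked_def)
  then show "x = y" using inj_rank_of by (metis Rep_ranked_inject injD)
qed (auto simp: less_eq_ranked_def less_ranked_def)
end

definition relabel :: "real^'n::finite \<Rightarrow> real^'n ranked" where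
  "relabel x = (\<chi> i. x $ Rep_ranked i)"

definition unlabel :: "real^'n::finite ranked \<Rightarrow> real^'n" where
  "unlabel y = (\<chi> i. y $ Abs_ranked i)"

lemma Rep_Abs_ranked [simp]: "Rep_ranked (Abs_ranked i) = i"
  by (simp add: Abs_ranked_inverse)

lemma unlabel_relabel [simp]: "unlabel (relabel x) = x"
  by (simp add: relabel_def unlabel_def vec_eq_iff)

lemma relabel_unlabel [simp]: "relabel (unlabel x) = x"
  by (simp add: relabel_def unlabel_def vec_eq_iff Rep_ranked_inverse)

lemma linear_relabel: "linear relabel" and linear_unlabel: "linear unlabel"
  by (rule linearI; simp add: relabel_def unlabel_def vec_eq_iff)+

lemma bij_Rep_ranked: "bij (Rep_ranked :: 'n::finite ranked \<Rightarrow> 'n)"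
  by (rule bijI') (auto simp: Rep_ranked_inject intro: Abs_ranked_inverse[symmetric])

text \<open>
  Conjugation with a bijection turns a product of transpositions into one of the same length.
\<close>
lemma sign_conjugate_ranked:
  fixes p :: "'n::finite ranked \<Rightarrow> 'n ranked"
  assumes "p permutes UNIV"
  shows "sign (\<lambda>i. Rep_ranked (p (Abs_ranked i))) = sign p"
proof -
  have swaps: "swapidseq n p \<Longrightarrow> swapidseq n (\<lambda>i. Rep_ranked (p (Abs_ranked i)))" for n and p :: "'n ranked \<Rightarrow> 'n ranked"
  proof (induction rule: swapidseq.induct)
    case id
    have "(\<lambda>i. Rep_ranked (id (Abs_ranked i :: 'n ranked))) = id" by auto
    then show ?case by (metis swapidseq.id)
  next
    case (comp_Suc n p a b)
    have "(\<lambda>i. Rep_ranked ((Transposition.transpose a b \<circ> p) (Abs_ranked i))) =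
       Transposition.transpose (Rep_ranked a) (Rep_ranked b) \<circ> (\<lambda>i. Rep_ranked (p (Abs_ranked i)))"
      by (auto simp: fun_eq_iff Transposition.transpose_def Rep_ranked_inject)
    then show ?case
      using swapidseq.comp_Suc[OF comp_Suc.IH, of "Rep_ranked a" "Rep_ranked b"] comp_Suc.hyps
      by (simp add: Rep_ranked_inject)
  qed
  have "permutation p" using assms by (simp add: permutation_permutes) (use finite in blast)
  then obtain n where n: "swapidseq n p" by (auto simp: permutation_def)
  have "evenperm p = even n" "evenperm (\<lambda>i. Rep_ranked (p (Abs_ranked i))) = even n"
    by (rule evenperm_unique[OF n refl], rule evenperm_unique[OF swaps[OF n] refl])
  then show ?thesis by (simp add: sign_def)
qed

lemma det_relabel:
  fixes A :: "real^'n^'n::finite"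
  shows "det (\<chi> i j. A $ Rep_ranked i $ Rep_ranked j :: real^'n ranked^'n ranked) = det A"
  unfolding det_def
proof (rule sum.reindex_bij_witness[where i="\<lambda>q i. Abs_ranked (q (Rep_ranked i))"
      and j="\<lambda>p i. Rep_ranked (p (Abs_ranked i))"]; (simp add: Rep_ranked_inverse)?)
  fix p :: "'n ranked \<Rightarrow> 'n ranked"
  assume p: "p permutes UNIV"
  show "(\<lambda>i. Rep_ranked (p (Abs_ranked i))) permutes UNIV"
  proof (rule bij_imp_permutes)
    have "bij (Rep_ranked \<circ> p \<circ> Abs_ranked)"
      using p bij_Rep_ranked
      by (metis bij_comp bij_imp_bij_inv inv_equality permutes_bij Rep_Abs_ranked Rep_ranked_inverse)
    then show "bij (\<lambda>i. Rep_ranked (p (Abs_ranked i)))" by (simp add: comp_def)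
  qed simp
  have "(\<Prod>i\<in>UNIV. A $ Rep_ranked i $ Rep_ranked (p i)) = (\<Prod>i\<in>UNIV. A $ i $ Rep_ranked (p (Abs_ranked i)))"
    using prod.reindex_bij_betw[OF bij_Rep_ranked, of "\<lambda>i. A $ i $ Rep_ranked (p (Abs_ranked i))"]
    by (simp add: Rep_ranked_inverse)
  then show "of_int (sign (\<lambda>i. Rep_ranked (p (Abs_ranked i)))) * (\<Prod>i\<in>UNIV. A $ i $ Rep_ranked (p (Abs_ranked i))) =
      of_int (sign p) * (\<Prod>i\<in>UNIV. A $ Rep_ranked i $ Rep_ranked (p i))"
    by (simp add: sign_conjugate_ranked[OF p])
next
  fix q :: "'n \<Rightarrow> 'n"
  assume q: "q permutes UNIV"
  show "(\<lambda>i. Abs_ranked (q (Rep_ranked i))) permutes UNIV"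
  proof (rule bij_imp_permutes)
    have "bij (Abs_ranked \<circ> q \<circ> Rep_ranked)"
      using q bij_Rep_ranked
      by (metis bij_comp bij_imp_bij_inv inv_equality permutes_bij Rep_Abs_ranked Rep_ranked_inverse)
    then show "bij (\<lambda>i. Abs_ranked (q (Rep_ranked i)))" by (simp add: comp_def)
  qed simp
qed

lemma lborel_relabel: "distr lborel borel relabel = (lborel :: (real^'n::finite ranked) measure)"
proof (rule lborel_eqI[symmetric])
  have meas: "relabel \<in> borel_measurable (borel :: (real^'n) measure)"
    using linear_relabel by (intro borel_measurable_continuous_onI linear_continuous_on)
      (simp add: linear_conv_bounded_linear)
  fix l u :: "real^'n ranked"
  assume lu: "\<And>b. b \<in> Basis \<Longrightarrow> l \<bullet> b \<le> u \<bullet> b"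
  have lu': "l $ i \<le> u $ i" for i using lu[of "axis i 1"] by (auto simp: inner_axis Basis_vec_def)
  have "relabel -` box l u = box (unlabel l) (unlabel u)"
    by (auto simp: mem_box_cart relabel_def unlabel_def)
       (metis Rep_Abs_ranked Rep_ranked_inverse)+
  then have "emeasure (distr lborel borel relabel) (box l u) = emeasure lborel (box (unlabel l) (unlabel u))"
    using meas by (simp add: emeasure_distr)
  also have "\<dots> = (\<Prod>b\<in>Basis. (unlabel u - unlabel l) \<bullet> b)"
    by (rule emeasure_lborel_box) (auto simp: Basis_vec_def inner_axis unlabel_def lu')
  also have "(\<Prod>b\<in>Basis. (unlabel u - unlabel l) \<bullet> b) = (\<Prod>i\<in>UNIV. (u - l) $ Abs_ranked i)"
    unfolding Basis_vec_def by (simp add: UNION_singleton_eq_range, subst prod.reindex)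
      (auto simp: inj_on_def axis_eq_axis inner_axis unlabel_def)
  also have "\<dots> = (\<Prod>i\<in>UNIV. (u - l) $ i)"
    using prod.reindex_bij_betw[OF bij_Rep_ranked, of "\<lambda>i. (u - l) $ Abs_ranked i"]
    by (simp add: Rep_ranked_inverse)
  also have "\<dots> = (\<Prod>b\<in>Basis. (u - l) \<bullet> b)"
    unfolding Basis_vec_def by (simp add: UNION_singleton_eq_range, subst prod.reindex)
      (auto simp: inj_on_def axis_eq_axis inner_axis)
  finally show "emeasure (distr lborel borel relabel) (box l u) = (\<Prod>b\<in>Basis. (u - l) \<bullet> b)" .
qed simp

lemma absolutely_integrable_on_iff_nn:
  fixes F :: "'a::euclidean_space \<Rightarrow> real"
  assumes "(\<lambda>x. indicator S x * F x) \<in> borel_measurable borel" "\<And>x. x \<in> S \<Longrightarrow> 0 \<le> F x"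
  shows "F absolutely_integrable_on S \<longleftrightarrow> (\<integral>\<^sup>+x\<in>S. ennreal (F x) \<partial>lborel) < \<infinity>"
proof -
  have "F absolutely_integrable_on S \<longleftrightarrow> integrable lborel (\<lambda>x. indicator S x * F x)"
    using assms(1) by (simp add: set_integrable_def integrable_completion)
  also have "\<dots> \<longleftrightarrow> (\<integral>\<^sup>+x. ennreal (norm (indicator S x * F x)) \<partial>lborel) < \<infinity>"
    using assms(1) by (simp add: integrable_iff_bounded)
  also have "(\<integral>\<^sup>+x. ennreal (norm (indicator S x * F x)) \<partial>lborel) = (\<integral>\<^sup>+x\<in>S. ennreal (F x) \<partial>lborel)"
    using assms(2) by (intro nn_integral_cong) (auto simp: indicator_def)
  finally show ?thesis .
qed

text \<open>
  The version for absolutely integrable functions also says that one side is integrable if and only if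
  the other is. Hence both sides are infinite together.
\<close>
lemma nn_integral_change_of_variables_wellorder:
  fixes g :: "real^'m::{finite,wellorder} \<Rightarrow> real^'m::_" and f :: "real^'m::_ \<Rightarrow> real"
  assumes S: "S \<in> sets borel"
    and der: "\<And>x. x \<in> S \<Longrightarrow> (g has_derivative g' x) (at x within S)" and inj: "inj_on g S"
    and f: "(\<lambda>x. indicator (g ` S) x * f x) \<in> borel_measurable borel" "\<And>x. x \<in> g ` S \<Longrightarrow> 0 \<le> f x"
    and fg: "(\<lambda>x. indicator S x * (\<bar>det (matrix (g' x))\<bar> * f (g x))) \<in> borel_measurable borel"
  shows "(\<integral>\<^sup>+x\<in>g ` S. ennreal (f x) \<partial>lborel) = (\<integral>\<^sup>+x\<in>S. ennreal (\<bar>det (matrix (g' x))\<bar> * f (g x)) \<partial>lborel)"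
proof -
  let ?D = "\<lambda>x. \<bar>det (matrix (g' x))\<bar> * f (g x)"
  have D0: "0 \<le> ?D x" if "x \<in> S" for x using f(2) that by simp
  have key: "?D absolutely_integrable_on S \<and> integral S ?D = b
      \<longleftrightarrow> f absolutely_integrable_on (g ` S) \<and> integral (g ` S) f = b" for b
    using has_absolute_integral_change_of_variables[of S g g' "\<lambda>x. vec (f x) :: real^1" "vec b", OF _ der inj] S
    by (simp add: absolutely_integrable_on_1_iff integral_on_1_eq)
  have i1: "f absolutely_integrable_on (g ` S) \<longleftrightarrow> (\<integral>\<^sup>+x\<in>g ` S. ennreal (f x) \<partial>lborel) < \<infinity>"
    by (rule absolutely_integrable_on_iff_nn[OF f])
  have i2: "?D absolutely_integrable_on S \<longleftrightarrow> (\<integral>\<^sup>+x\<in>S. ennreal (?D x) \<partial>lborel) < \<infinity>"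
    by (rule absolutely_integrable_on_iff_nn[OF fg D0])
  show ?thesis
  proof (cases "(\<integral>\<^sup>+x\<in>g ` S. ennreal (f x) \<partial>lborel) < \<infinity>")
    case True
    then have fin: "(\<integral>\<^sup>+x\<in>S. ennreal (?D x) \<partial>lborel) < \<infinity>" and eq: "integral S ?D = integral (g ` S) f"
      using key i1 i2 by blast+
    have "(\<integral>\<^sup>+x\<in>g ` S. ennreal (f x) \<partial>lborel) = integral (g ` S) f"
      by (rule set_nn_integral_lborel_eq_integral) (use f True in \<open>auto simp: set_borel_measurable_def\<close>)
    also have "\<dots> = integral S ?D" by (simp add: eq)
    also have "\<dots> = (\<integral>\<^sup>+x\<in>S. ennreal (?D x) \<partial>lborel)"
      by (rule set_nn_integral_lborel_eq_integral[symmetric])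
         (use fg D0 fin in \<open>auto simp: set_borel_measurable_def\<close>)
    finally show ?thesis .
  next
    case False
    then have "\<not> (\<integral>\<^sup>+x\<in>S. ennreal (?D x) \<partial>lborel) < \<infinity>" using key i1 i2 by blast
    with False show ?thesis by (simp add: less_top[symmetric])
  qed
qed

lemma nn_integral_relabel:
  fixes h :: "real^'n::finite \<Rightarrow> ennreal"
  assumes "(\<lambda>y. h (unlabel y)) \<in> borel_measurable borel"
  shows "(\<integral>\<^sup>+y. h (unlabel y) \<partial>lborel) = (\<integral>\<^sup>+x. h x \<partial>lborel)"
proof -
  have "relabel \<in> borel_measurable (borel :: (real^'n) measure)"
    using linear_relabel by (intro borel_measurable_continuous_onI linear_continuous_on)
      (simp add: linear_conv_bounded_linear)
  then have "(\<integral>\<^sup>+y. h (unlabel y) \<partial>distr lborel borel relabel) = (\<integral>\<^sup>+x. h (unlabel (relabel x)) \<partial>lborel)"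
    using assms by (intro nn_integral_distr) auto
  then show ?thesis by (simp add: lborel_relabel)
qed

lemma nn_integral_change_of_variables:
  fixes g :: "real^'n::finite \<Rightarrow> real^'n" and f :: "real^'n \<Rightarrow> real"
  assumes S: "S \<in> sets borel"
    and der: "\<And>x. x \<in> S \<Longrightarrow> (g has_derivative g' x) (at x within S)" and inj: "inj_on g S"
    and f: "(\<lambda>x. indicator (g ` S) x * f x) \<in> borel_measurable borel" "\<And>x. x \<in> g ` S \<Longrightarrow> 0 \<le> f x"
    and fg: "(\<lambda>x. indicator S x * (\<bar>det (matrix (g' x))\<bar> * f (g x))) \<in> borel_measurable borel"
  shows "(\<integral>\<^sup>+x\<in>g ` S. ennreal (f x) \<partial>lborel) = (\<integral>\<^sup>+x\<in>S. ennreal (\<bar>det (matrix (g' x))\<bar> * f (g x)) \<partial>lborel)"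
proof -
  have bl: "bounded_linear relabel" "bounded_linear unlabel"
    using linear_relabel linear_unlabel by (simp_all add: linear_conv_bounded_linear)
  have mu: "unlabel \<in> borel_measurable (borel :: (real^'n ranked) measure)"
    using bl by (intro borel_measurable_continuous_onI linear_continuous_on)
  define T where "T = relabel ` S"
  define G where "G y = relabel (g (unlabel y))" for y
  define G' where "G' y v = relabel (g' (unlabel y) (unlabel v))" for y v
  define F where "F y = f (unlabel y)" for y
  have T_iff: "y \<in> T \<longleftrightarrow> unlabel y \<in> S" for y
    unfolding T_def by (metis image_iff relabel_unlabel unlabel_relabel)
  have GT_iff: "y \<in> G ` T \<longleftrightarrow> unlabel y \<in> g ` S" for y
  proof
    show "unlabel y \<in> g ` S" if "y \<in> G ` T" using that by (auto simp: T_def G_def)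
    assume "unlabel y \<in> g ` S"
    then obtain x where x: "x \<in> S" "unlabel y = g x" by blast
    then have "y = G (relabel x)" by (metis G_def relabel_unlabel unlabel_relabel)
    then show "y \<in> G ` T" using x(1) by (simp add: T_def)
  qed
  have ind: "indicator T y = indicator S (unlabel y)" "indicator (G ` T) y = indicator (g ` S) (unlabel y)" for y
    by (simp_all add: indicator_def T_iff GT_iff)
  have det_eq: "det (matrix (G' y)) = det (matrix (g' (unlabel y)))" for y
  proof -
    have "unlabel (axis j 1) = axis (Rep_ranked j) 1" for j :: "'n ranked"
      by (auto simp: unlabel_def axis_def vec_eq_iff Rep_ranked_inverse)
    then have "matrix (G' y) = (\<chi> i j. matrix (g' (unlabel y)) $ Rep_ranked i $ Rep_ranked j)"
      by (simp add: matrix_def G'_def relabel_def)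
    then show ?thesis by (simp add: det_relabel)
  qed
  have GS: "(\<integral>\<^sup>+y\<in>G ` T. ennreal (F y) \<partial>lborel) = (\<integral>\<^sup>+y\<in>T. ennreal (\<bar>det (matrix (G' y))\<bar> * F (G y)) \<partial>lborel)"
  proof (rule nn_integral_change_of_variables_wellorder)
    have "T = unlabel -` S \<inter> space borel" using T_iff by auto
    then show "T \<in> sets borel" using measurable_sets[OF mu S] by simp
    show "(G has_derivative G' y) (at y within T)" if "y \<in> T" for y
    proof -
      have u: "(unlabel has_derivative unlabel) (at y within T)"
        by (rule bounded_linear_imp_has_derivative[OF bl(2)])
      have "(g has_derivative g' (unlabel y)) (at (unlabel y) within unlabel ` T)"
        using der[of "unlabel y"] that T_iff by (simp add: T_def image_image)
      from has_derivative_in_compose[OF u this]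
      show ?thesis unfolding G_def G'_def by (rule bounded_linear.has_derivative[OF bl(1)])
    qed
    show "inj_on G T"
    proof (rule inj_onI)
      fix a b assume ab: "a \<in> T" "b \<in> T" "G a = G b"
      then have "g (unlabel a) = g (unlabel b)" by (metis G_def unlabel_relabel)
      then have "unlabel a = unlabel b" using inj ab T_iff by (meson inj_onD)
      then show "a = b" by (metis relabel_unlabel)
    qed
    show "(\<lambda>y. indicator (G ` T) y * F y) \<in> borel_measurable borel"
      using measurable_compose[OF mu f(1)] by (simp add: ind F_def)
    show "0 \<le> F y" if "y \<in> G ` T" for y using f(2) that GT_iff F_def by simp
    show "(\<lambda>y. indicator T y * (\<bar>det (matrix (G' y))\<bar> * F (G y))) \<in> borel_measurable borel"
      using measurable_compose[OF mu fg] by (simp add: ind F_def G_def det_eq)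
  qed
  have "(\<integral>\<^sup>+y\<in>G ` T. ennreal (F y) \<partial>lborel) = (\<integral>\<^sup>+x\<in>g ` S. ennreal (f x) \<partial>lborel)"
  proof -
    have "(\<lambda>y. ennreal (f (unlabel y)) * indicator (g ` S) (unlabel y)) =
        (\<lambda>y. ennreal (indicator (g ` S) (unlabel y) * f (unlabel y)))"
      by (auto simp: indicator_def)
    also have "\<dots> \<in> borel_measurable borel"
      using measurable_compose[OF mu f(1)] by simp
    finally show ?thesis
      unfolding ind F_def by (rule nn_integral_relabel[where h="\<lambda>x. ennreal (f x) * indicator (g ` S) x"])
  qed
  moreover have "(\<integral>\<^sup>+y\<in>T. ennreal (\<bar>det (matrix (G' y))\<bar> * F (G y)) \<partial>lborel) =
      (\<integral>\<^sup>+x\<in>S. ennreal (\<bar>det (matrix (g' x))\<bar> * f (g x)) \<partial>lborel)"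
  proof -
    let ?D = "\<lambda>x. \<bar>det (matrix (g' x))\<bar> * f (g x)"
    have "(\<lambda>y. ennreal (?D (unlabel y)) * indicator S (unlabel y)) = (\<lambda>y. ennreal (indicator S (unlabel y) * ?D (unlabel y)))"
      by (auto simp: indicator_def)
    also have "\<dots> \<in> borel_measurable borel"
      using measurable_compose[OF mu fg] by simp
    finally show ?thesis
      unfolding ind F_def G_def det_eq unlabel_relabel
      by (rule nn_integral_relabel[where h="\<lambda>x. ennreal (?D x) * indicator S x"])
  qed
  ultimately show ?thesis using GS by simp
qed

section \<open>Gram determinants\<close>

definition gram :: "('n::finite \<Rightarrow> 'a::real_inner) \<Rightarrow> real" where
  "gram c = det (\<chi> i j. c i \<bullet> c j)"

lemma gram_linear_combination:
  fixes A :: "real^'n^'n::finite"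
  assumes "\<And>j. c j = (\<Sum>i\<in>UNIV. A $ i $ j *\<^sub>R b i)"
  shows "gram c = (det A)\<^sup>2 * gram b"
proof -
  have "c i \<bullet> c j = (\<Sum>k\<in>UNIV. (\<Sum>l\<in>UNIV. A $ l $ i * (b l \<bullet> b k)) * A $ k $ j)" for i j
    unfolding assms inner_sum_right inner_sum_left
    by (rule sum.cong[OF refl]) (simp add: sum_distrib_right mult_ac sum_distrib_left)
  then have "(\<chi> i j. c i \<bullet> c j) = Finite_Cartesian_Product.transpose A ** (\<chi> i j. b i \<bullet> b j) ** A"
    by (simp add: vec_eq_iff matrix_matrix_mult_def Finite_Cartesian_Product.transpose_def)
  then show ?thesis
    by (simp add: gram_def det_mul power2_eq_square)
qed

lemma sqrt_gram_linear_combination: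
  fixes A :: "real^'n^'n::finite"
  assumes "\<And>j. c j = (\<Sum>i\<in>UNIV. A $ i $ j *\<^sub>R b i)"
  shows "sqrt (gram c) = \<bar>det A\<bar> * sqrt (gram b)"
  using gram_linear_combination[of c A b, OF assms] by (simp add: real_sqrt_mult)

lemma gram_orthonormal:
  assumes "\<And>i j. b i \<bullet> b j = (if i = j then 1 else 0)"
  shows "gram b = 1"
proof -
  have "(\<chi> i j. b i \<bullet> b j) = mat 1" by (simp add: assms mat_def)
  then show ?thesis by (simp add: gram_def)
qed

lemma linear_axis_expansion:
  fixes L :: "real^'n::finite \<Rightarrow> 'b::real_vector"
  assumes "linear L"
  shows "L v = (\<Sum>i\<in>UNIV. v $ i *\<^sub>R L (axis i 1))"
proof -
  have "v = (\<Sum>i\<in>UNIV. v $ i *\<^sub>R axis i 1)"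
    by (auto simp: vec_eq_iff axis_def if_distrib cong: if_cong)
  then have "L v = L (\<Sum>i\<in>UNIV. v $ i *\<^sub>R axis i 1)" by simp
  then show ?thesis by (simp add: linear_sum[OF assms] linear_scale[OF assms])
qed

section \<open>Domains of parametrizations\<close>

text \<open>
  The sets that \<open>parametrization\<close> admits as domains.
\<close>
definition chart_domain :: "(real^'n::finite) set \<Rightarrow> bool" where
  "chart_domain \<Omega> \<longleftrightarrow> (\<exists>W. open W \<and> (\<Omega> = W \<or> (\<exists>i. \<Omega> = W \<inter> {u. 0 \<le> u $ i})))"

lemma chart_domain_Int_open:
  assumes "chart_domain \<Omega>" "open G"
  shows "chart_domain (\<Omega> \<inter> G)"
proof -
  obtain W where W: "open W" "\<Omega> = W \<or> (\<exists>i. \<Omega> = W \<inter> {u. 0 \<le> u $ i})"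
    using assms(1) by (auto simp: chart_domain_def)
  then have "open (W \<inter> G)" "\<Omega> \<inter> G = W \<inter> G \<or> (\<exists>i. \<Omega> \<inter> G = (W \<inter> G) \<inter> {u. 0 \<le> u $ i})"
    using assms(2) by auto
  then show ?thesis unfolding chart_domain_def by blast
qed

lemma closed_half_space: "closed {u :: real^'n::finite. 0 \<le> u $ i}"
  by (intro closed_Collect_le continuous_intros)

lemma chart_domain_borel: "chart_domain \<Omega> \<Longrightarrow> \<Omega> \<in> sets borel"
proof -
  assume "chart_domain \<Omega>"
  then consider W where "open W" "\<Omega> = W" | W i where "open W" "\<Omega> = W \<inter> {u. 0 \<le> u $ i}"
    by (auto simp: chart_domain_def)
  then show ?thesis
    by cases (auto intro!: sets.Int borel_closed closed_half_space simp: borel_open)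
qed

lemma chart_domain_ray:
  assumes "chart_domain \<Omega>" "u \<in> \<Omega>"
  obtains \<delta> where "\<delta> > 0" "\<And>t. 0 \<le> t \<Longrightarrow> t \<le> \<delta> \<Longrightarrow> u + t *\<^sub>R axis j 1 \<in> \<Omega>"
proof -
  obtain W where W: "open W" "\<Omega> = W \<or> (\<exists>i. \<Omega> = W \<inter> {u. 0 \<le> u $ i})"
    using assms(1) by (auto simp: chart_domain_def)
  obtain e where e: "e > 0" "ball u e \<subseteq> W" using W assms(2) open_contains_ball by blast
  have in_W: "u + t *\<^sub>R axis j 1 \<in> W" if "0 \<le> t" "t \<le> e / 2" for t
  proof -
    have "dist u (u + t *\<^sub>R axis j 1) = t" using that by (simp add: dist_norm norm_axis_1)
    then show ?thesis using e that by (auto simp: subset_iff)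
  qed
  have "u + t *\<^sub>R axis j 1 \<in> \<Omega>" if "0 \<le> t" "t \<le> e / 2" for t
    using W(2) in_W[OF that] assms(2) that by (auto simp: axis_def)
  then show thesis using that[of "e / 2"] e(1) by simp
qed

text \<open>
  Derivatives within a half-space are unique because every coordinate direction can be followed for a
  short while without leaving it.
\<close>
lemma chart_domain_derivative_unique:
  assumes \<Omega>: "chart_domain \<Omega>" "u \<in> \<Omega>"
    and "(F has_derivative D) (at u within \<Omega>)" "(F has_derivative D') (at u within \<Omega>)"
  shows "D = D'"
proof (rule frechet_derivative_unique_within[OF assms(3,4)])
  fix b :: "real^'a" and e :: real
  assume "b \<in> Basis" "e > 0"
  then obtain j where b: "b = axis j 1" by (auto simp: Basis_vec_def)
  obtain \<delta> where \<delta>: "\<delta> > 0" "\<And>t. 0 \<le> t \<Longrightarrow> t \<le> \<delta> \<Longrightarrow> u + t *\<^sub>R axis j 1 \<in> \<Omega>"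
    by (rule chart_domain_ray[OF \<Omega>, of j]) blast
  show "\<exists>d. 0 < \<bar>d\<bar> \<and> \<bar>d\<bar> < e \<and> u + d *\<^sub>R b \<in> \<Omega>"
    using \<delta> \<open>e > 0\<close> b by (intro exI[of _ "min \<delta> (e / 2)"]) auto
qed

lemma chart_domain_frechet:
  assumes "chart_domain \<Omega>" "u \<in> \<Omega>" "(F has_derivative D) (at u within \<Omega>)"
  shows "frechet_derivative F (at u within \<Omega>) = D"
  using chart_domain_derivative_unique[OF assms(1,2) _ assms(3)] assms(3)
    frechet_derivative_works differentiableI by blast

lemma smooth_gram:
  assumes "open U" "\<And>i. smooth_on_open U (\<lambda>x. c x i)"
  shows "smooth_on_open U (\<lambda>x. gram (c x))"
  unfolding gram_def by (intro smooth_det[OF assms(1)] smooth_inner[OF assms(1)] assms(2))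

section \<open>Parametrizations\<close>

definition chart_density :: "(real^'n::finite) set \<Rightarrow> (real^'n \<Rightarrow> 'n ambient) \<Rightarrow> real^'n \<Rightarrow> real" where
  "chart_density \<Omega> X u = sqrt (gram (\<lambda>i. frechet_derivative X (at u within \<Omega>) (axis i 1)))"

lemma parametrizationD:
  assumes "parametrization S \<Omega> X"
  shows "chart_domain \<Omega>" "openin (top_of_set S) (X ` \<Omega>)" "inj_on X \<Omega>" "smooth_on_set \<Omega> X"
    "smooth_on_set (X ` \<Omega>) (inv_into \<Omega> X)" "X ` \<Omega> \<subseteq> S" "continuous_on \<Omega> X"
    "continuous_on (X ` \<Omega>) (inv_into \<Omega> X)"
proof -
  show P: "chart_domain \<Omega>" "openin (top_of_set S) (X ` \<Omega>)" "inj_on X \<Omega>" "smooth_on_set \<Omega> X"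
    "smooth_on_set (X ` \<Omega>) (inv_into \<Omega> X)"
    using assms by (simp_all add: parametrization_def chart_domain_def)
  show "X ` \<Omega> \<subseteq> S" using openin_imp_subset[OF P(2)] .
  show "continuous_on \<Omega> X" "continuous_on (X ` \<Omega>) (inv_into \<Omega> X)"
    using smooth_on_set_continuous P(4,5) by blast+
qed

lemma continuous_on_chart_density:
  assumes \<Omega>: "chart_domain \<Omega>" and X: "smooth_on_set \<Omega> X"
  shows "continuous_on \<Omega> (chart_density \<Omega> X)"
  unfolding continuous_on_eq_continuous_within
proof
  fix u assume u: "u \<in> \<Omega>"
  obtain U E where E: "open U" "u \<in> U" "smooth_on_open U E" "\<And>y. y \<in> \<Omega> \<Longrightarrow> y \<in> U \<Longrightarrow> E y = X y"
    using smooth_on_setE[OF X u] by blast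
  let ?w = "\<lambda>v. sqrt (gram (\<lambda>i. frechet_derivative E (at v) (axis i 1)))"
  have eq: "chart_density \<Omega> X v = ?w v" if "v \<in> \<Omega>" "v \<in> U" for v
    using chart_domain_frechet[OF \<Omega> that(1) has_derivative_of_extension[OF E(1) that(2) E(3,4) that(1)]]
    by (simp add: chart_density_def)
  have "continuous_on U (\<lambda>v. gram (\<lambda>i. frechet_derivative E (at v) (axis i 1)))"
    by (intro smooth_on_open_continuous smooth_gram E(1) smooth_on_open_frechet E(3))
  then have "continuous_on U ?w" by (rule continuous_on_real_sqrt)
  then have "isCont ?w u" using E(1,2) continuous_on_eq_continuous_at by blast
  then have cw: "continuous (at u within \<Omega>) ?w" by (rule continuous_at_imp_continuous_at_within)
  obtain d where d: "d > 0" "ball u d \<subseteq> U" using E(1,2) open_contains_ball by blast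
  show "continuous (at u within \<Omega>) (chart_density \<Omega> X)"
  proof (rule continuous_transform_within[OF cw d(1) u])
    fix v assume "v \<in> \<Omega>" "dist v u < d"
    moreover from this have "v \<in> U" using d(2) by (auto simp: dist_commute)
    ultimately show "?w v = chart_density \<Omega> X v" using eq by simp
  qed
qed

lemma orthonormal_frame_expansion:
  assumes b: "orthonormal_frame T b" and v: "v \<in> T"
  shows "v = (\<Sum>i\<in>UNIV. (b $ i \<bullet> v) *\<^sub>R b $ i)"
proof -
  have on: "b $ i \<bullet> b $ j = (if i = j then 1 else 0)" for i j
    using b by (auto simp: orthonormal_frame_def)
  have sp: "span (range (\<lambda>i. b $ i)) = T" using b by (auto simp: orthonormal_frame_def)
  define w where "w = v - (\<Sum>i\<in>UNIV. (b $ i \<bullet> v) *\<^sub>R b $ i)"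
  have "w \<in> span (range (\<lambda>i. b $ i))"
    unfolding w_def using v sp by (intro span_diff span_sum span_scale) (auto intro: span_base)
  moreover have "orthogonal w x" if x: "x \<in> range (\<lambda>i. b $ i)" for x
  proof -
    obtain j where x: "x = b $ j" using x by blast
    have "(\<Sum>i\<in>UNIV. (b $ i \<bullet> v) *\<^sub>R b $ i) \<bullet> b $ j = b $ j \<bullet> v"
      by (simp add: inner_sum_left on if_distrib cong: if_cong)
    then show ?thesis by (simp add: orthogonal_def w_def x inner_diff_left inner_diff_right inner_commute)
  qed
  ultimately have "orthogonal w w" using orthogonal_to_span by blast
  then have "w = 0" by (simp add: orthogonal_self)
  then show ?thesis by (simp add: w_def)
qed

lemma chart_velocity_tangent:
  assumes X: "parametrization S \<Omega> X" and u: "u \<in> \<Omega>"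
  shows "frechet_derivative X (at u within \<Omega>) (axis j 1) \<in> tangent_space S (X u)"
proof -
  note XD = parametrizationD[OF X]
  let ?D = "frechet_derivative X (at u within \<Omega>)"
  have D: "(X has_derivative ?D) (at u within \<Omega>)" by (rule smooth_on_set_has_derivative[OF XD(4) u])
  obtain \<delta> where \<delta>: "\<delta> > 0" "\<And>t. 0 \<le> t \<Longrightarrow> t \<le> \<delta> \<Longrightarrow> u + t *\<^sub>R axis j 1 \<in> \<Omega>"
    by (rule chart_domain_ray[OF XD(1) u, of j]) blast
  define c where "c t = u + (t * \<delta>) *\<^sub>R axis j 1" for t :: real
  have c: "c ` {0..1} \<subseteq> \<Omega>" using \<delta> by (auto simp: c_def intro!: \<delta>(2) mult_left_le_one_le)
  have "(c has_derivative (\<lambda>t. (t * \<delta>) *\<^sub>R axis j 1)) (at 0 within {0..1})"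
    unfolding c_def by (auto intro!: derivative_eq_intros)
  moreover have "(X has_derivative ?D) (at (c 0) within c ` {0..1})"
    by (rule has_derivative_subset[OF _ c]) (use D in \<open>simp add: c_def\<close>)
  ultimately have "((\<lambda>t. X (c t)) has_derivative (\<lambda>t. ?D ((t * \<delta>) *\<^sub>R axis j 1))) (at 0 within {0..1})"
    by (rule has_derivative_in_compose)
  then have "((\<lambda>t. X (c t)) has_vector_derivative (\<delta> *\<^sub>R ?D (axis j 1))) (at 0 within {0..1})"
    by (simp add: has_vector_derivative_def linear_scale[OF has_derivative_linear[OF D]])
  moreover have "\<forall>t\<in>{0..1}. X (c t) \<in> S" using c XD(6) by blast
  ultimately have "\<delta> *\<^sub>R ?D (axis j 1) \<in> tangent_space S (X u)"
    unfolding tangent_space_def by (intro span_base CollectI exI[of _ "\<lambda>t. X (c t)"]) (simp add: c_def)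
  then have "(1 / \<delta>) *\<^sub>R (\<delta> *\<^sub>R ?D (axis j 1)) \<in> tangent_space S (X u)"
    unfolding tangent_space_def by (rule span_scale)
  then show ?thesis using \<delta>(1) by simp
qed

text \<open>
  This makes Gram determinants of tangent vectors squares of determinants. In particular the density of
  a parametrization cannot be negative.
\<close>
definition has_frames :: "'n::finite ambient set \<Rightarrow> bool" where
  "has_frames S \<longleftrightarrow> (\<forall>p\<in>S. \<exists>b :: 'n frame. orthonormal_frame (tangent_space S p) b)"

lemma chart_density_frame:
  assumes X: "parametrization S \<Omega> X" and u: "u \<in> \<Omega>"
    and b: "orthonormal_frame (tangent_space S (X u)) b"
  shows "chart_density \<Omega> X u = \<bar>det (\<chi> i j. b $ i \<bullet> frechet_derivative X (at u within \<Omega>) (axis j 1))\<bar>"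
proof -
  have "frechet_derivative X (at u within \<Omega>) (axis j 1) =
     (\<Sum>i\<in>UNIV. (\<chi> i j. b $ i \<bullet> frechet_derivative X (at u within \<Omega>) (axis j 1)) $ i $ j *\<^sub>R b $ i)" for j
    using orthonormal_frame_expansion[OF b chart_velocity_tangent[OF X u, of j]] by simp
  then have "chart_density \<Omega> X u = \<bar>det (\<chi> i j. b $ i \<bullet> frechet_derivative X (at u within \<Omega>) (axis j 1))\<bar> * sqrt (gram (\<lambda>i. b $ i))"
    unfolding chart_density_def by (rule sqrt_gram_linear_combination)
  moreover have "gram (\<lambda>i. b $ i) = 1"
    by (rule gram_orthonormal) (use b in \<open>auto simp: orthonormal_frame_def\<close>)
  ultimately show ?thesis by simp
qed

lemma chart_density_nonneg:
  assumes "has_frames S" "parametrization S \<Omega> X" "u \<in> \<Omega>"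
  shows "chart_density \<Omega> X u \<ge> 0"
proof -
  have "X u \<in> S" using parametrizationD(6)[OF assms(2)] assms(3) by blast
  then obtain b :: "'a frame" where "orthonormal_frame (tangent_space S (X u)) b"
    using assms(1) unfolding has_frames_def by blast
  then show ?thesis by (simp add: chart_density_frame[OF assms(2,3)])
qed

text \<open>
  Differentiating \<open>X = X' \<circ> T\<close> expresses the tangent vectors of \<open>X\<close> through those of \<open>X'\<close>,
  with the Jacobian matrix of \<open>T\<close> as coefficients.
\<close>
lemma parametrization_transition:
  assumes X: "parametrization S \<Omega> X" and X': "parametrization S \<Omega>' X'"
  defines "A \<equiv> {u\<in>\<Omega>. X u \<in> X' ` \<Omega>'}" and "T \<equiv> \<lambda>u. inv_into \<Omega>' X' (X u)"
  obtains T' where "\<And>u. u \<in> A \<Longrightarrow> (T has_derivative T' u) (at u within A)"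
    "\<And>u. u \<in> A \<Longrightarrow> chart_density \<Omega> X u = \<bar>det (matrix (T' u))\<bar> * chart_density \<Omega>' X' (T u)"
proof -
  note XD = parametrizationD[OF X] and X'D = parametrizationD[OF X']
  obtain O1 where O1: "open O1" "X' ` \<Omega>' = S \<inter> O1" using X'D(2) openin_open by metis
  have "openin (top_of_set \<Omega>) (\<Omega> \<inter> X -` O1)" by (rule continuous_openin_preimage_gen[OF XD(7) O1(1)])
  then obtain G where G: "open G" "\<Omega> \<inter> X -` O1 = \<Omega> \<inter> G" using openin_open by metis
  have A: "A = \<Omega> \<inter> G" using G(2) O1(2) XD(6) by (auto simp: A_def)
  have Adom: "chart_domain A" unfolding A by (rule chart_domain_Int_open[OF XD(1) G(1)])
  have "A \<subseteq> \<Omega>" by (auto simp: A_def)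
  have T: "smooth_on_set A T" unfolding T_def
    by (rule smooth_on_set_compose[OF smooth_on_set_subset[OF XD(4) \<open>A \<subseteq> \<Omega>\<close>] X'D(5)]) (auto simp: A_def)
  have TA: "T u \<in> \<Omega>'" "X' (T u) = X u" if "u \<in> A" for u
    using that inv_into_into[of "X u" X' \<Omega>'] f_inv_into_f[of "X u" X' \<Omega>'] by (auto simp: T_def A_def)
  let ?T' = "\<lambda>u. frechet_derivative T (at u within A)"
  have der: "(T has_derivative ?T' u) (at u within A)" if "u \<in> A" for u
    by (rule smooth_on_set_has_derivative[OF T that])
  moreover have "chart_density \<Omega> X u = \<bar>det (matrix (?T' u))\<bar> * chart_density \<Omega>' X' (T u)" if u: "u \<in> A" for u
  proof -
    let ?D = "frechet_derivative X (at u within \<Omega>)" and ?D' = "frechet_derivative X' (at (T u) within \<Omega>')"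
    have D': "(X' has_derivative ?D') (at (T u) within \<Omega>')"
      by (rule smooth_on_set_has_derivative[OF X'D(4) TA(1)[OF u]])
    have "(X' has_derivative ?D') (at (T u) within T ` A)"
      by (rule has_derivative_subset[OF D']) (use TA in auto)
    from has_derivative_in_compose[OF der[OF u] this]
    have "((\<lambda>u. X' (T u)) has_derivative (\<lambda>v. ?D' (?T' u v))) (at u within A)" .
    then have "(X has_derivative (\<lambda>v. ?D' (?T' u v))) (at u within A)"
      by (rule has_derivative_transform[rotated 2]) (use u TA in auto)
    moreover have "(X has_derivative ?D) (at u within A)"
      by (rule has_derivative_subset[OF smooth_on_set_has_derivative[OF XD(4)]]) (use u \<open>A \<subseteq> \<Omega>\<close> in auto)
    ultimately have D: "?D = (\<lambda>v. ?D' (?T' u v))" using chart_domain_derivative_unique[OF Adom u] by metis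
    have "?D (axis j 1) = (\<Sum>i\<in>UNIV. matrix (?T' u) $ i $ j *\<^sub>R ?D' (axis i 1))" for j
      using linear_axis_expansion[OF has_derivative_linear[OF D'], of "?T' u (axis j 1)"]
      by (simp add: D matrix_def)
    then show ?thesis
      unfolding chart_density_def by (rule sqrt_gram_linear_combination)
  qed
  ultimately show thesis by (rule that)
qed

lemma borel_preimage_on:
  assumes "A \<in> sets borel" "continuous_on A F" "B \<in> sets borel"
  shows "{x\<in>A. F x \<in> B} \<in> sets borel"
proof -
  have "F \<in> borel_measurable (restrict_space borel A)"
    by (rule borel_measurable_continuous_on_restrict[OF assms(2)])
  then have "F -` B \<inter> space (restrict_space borel A) \<in> sets (restrict_space borel A)"
    using assms(3) by (rule measurable_sets)
  moreover have "F -` B \<inter> space (restrict_space borel A) = {x\<in>A. F x \<in> B}"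
    by (auto simp: space_restrict_space)
  ultimately show ?thesis using assms(1) by (auto simp: sets_restrict_space_iff)
qed

lemma parametrization_image_borel:
  assumes X: "parametrization S \<Omega> X" and S: "S \<in> sets borel" and A: "A \<in> sets borel" "A \<subseteq> \<Omega>"
  shows "X ` A \<in> sets borel"
proof -
  note XD = parametrizationD[OF X]
  obtain O1 where O1: "open O1" "X ` \<Omega> = S \<inter> O1" using XD(2) openin_open by metis
  then have im: "X ` \<Omega> \<in> sets borel" using S by auto
  have "X ` A = {p \<in> X ` \<Omega>. inv_into \<Omega> X p \<in> A}"
    using A(2) XD(3) by (auto simp: inv_into_f_f subset_iff)
  then show ?thesis using borel_preimage_on[OF im XD(8) A(1)] by simp
qed

definition chart_integral :: "(real^'n::finite) set \<Rightarrow> (real^'n \<Rightarrow> 'n ambient) \<Rightarrow> 'n ambient set \<Rightarrow> ennreal" where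
  "chart_integral \<Omega> X B = (\<integral>\<^sup>+u\<in>{u\<in>\<Omega>. X u \<in> B}. ennreal (chart_density \<Omega> X u) \<partial>lborel)"

lemma chart_integral_transition:
  assumes fr: "has_frames S" and X: "parametrization S \<Omega> X" and X': "parametrization S \<Omega>' X'"
    and B: "B \<in> sets borel" "B \<subseteq> X ` \<Omega>" "B \<subseteq> X' ` \<Omega>'"
  shows "chart_integral \<Omega> X B = chart_integral \<Omega>' X' B"
proof -
  note XD = parametrizationD[OF X] and X'D = parametrizationD[OF X']
  define T where "T u = inv_into \<Omega>' X' (X u)" for u
  define A where "A = {u\<in>\<Omega>. X u \<in> X' ` \<Omega>'}"
  obtain T' where T': "\<And>u. u \<in> A \<Longrightarrow> (T has_derivative T' u) (at u within A)"
    "\<And>u. u \<in> A \<Longrightarrow> chart_density \<Omega> X u = \<bar>det (matrix (T' u))\<bar> * chart_density \<Omega>' X' (T u)"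
    unfolding A_def T_def by (rule parametrization_transition[OF X X']) blast
  define S1 where "S1 = {u\<in>\<Omega>. X u \<in> B}"
  define S2 where "S2 = {u\<in>\<Omega>'. X' u \<in> B}"
  have S1: "S1 \<in> sets borel" unfolding S1_def
    by (rule borel_preimage_on[OF chart_domain_borel[OF XD(1)] XD(7) B(1)])
  have S2: "S2 \<in> sets borel" unfolding S2_def
    by (rule borel_preimage_on[OF chart_domain_borel[OF X'D(1)] X'D(7) B(1)])
  have S1A: "S1 \<subseteq> A" using B(3) by (auto simp: S1_def A_def)
  have T: "T u \<in> \<Omega>'" "X' (T u) = X u" if "u \<in> A" for u
    using that inv_into_into[of "X u" X' \<Omega>'] f_inv_into_f[of "X u" X' \<Omega>'] by (auto simp: T_def A_def)
  have inj: "inj_on T S1"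
  proof (rule inj_onI)
    fix u v assume uv: "u \<in> S1" "v \<in> S1" "T u = T v"
    then have "X u = X v" using T S1A by (metis subsetD)
    then show "u = v" using XD(3) uv(1,2) by (auto simp: S1_def inj_on_def)
  qed
  have TS: "T ` S1 = S2"
  proof
    show "T ` S1 \<subseteq> S2" using T S1A by (auto simp: S1_def S2_def subset_iff)
    show "S2 \<subseteq> T ` S1"
    proof
      fix v assume v: "v \<in> S2"
      then obtain u where u: "u \<in> \<Omega>" "X u = X' v" using B(2) by (auto simp: S2_def)
      then have "u \<in> S1" "T u = v" using v X'D(3) by (auto simp: S1_def S2_def T_def)
      then show "v \<in> T ` S1" by blast
    qed
  qed
  have c1: "continuous_on S1 (chart_density \<Omega> X)"
    by (rule continuous_on_subset[OF continuous_on_chart_density[OF XD(1,4)]]) (auto simp: S1_def)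
  have c2: "continuous_on S2 (chart_density \<Omega>' X')"
    by (rule continuous_on_subset[OF continuous_on_chart_density[OF X'D(1,4)]]) (auto simp: S2_def)
  have "(\<integral>\<^sup>+v\<in>T ` S1. ennreal (chart_density \<Omega>' X' v) \<partial>lborel) =
     (\<integral>\<^sup>+u\<in>S1. ennreal (\<bar>det (matrix (T' u))\<bar> * chart_density \<Omega>' X' (T u)) \<partial>lborel)"
  proof (rule nn_integral_change_of_variables[OF S1 _ inj])
    show "(T has_derivative T' u) (at u within S1)" if "u \<in> S1" for u
      using T'(1) that S1A by (meson has_derivative_subset subsetD)
    show "(\<lambda>x. indicator (T ` S1) x * chart_density \<Omega>' X' x) \<in> borel_measurable borel"
      unfolding TS using borel_measurable_continuous_on_indicator[OF S2 c2] by simp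
    show "0 \<le> chart_density \<Omega>' X' x" if "x \<in> T ` S1" for x
      by (rule chart_density_nonneg[OF fr X']) (use that TS in \<open>auto simp: S2_def\<close>)
    have "(\<lambda>x. indicator S1 x * (\<bar>det (matrix (T' x))\<bar> * chart_density \<Omega>' X' (T x))) =
        (\<lambda>x. indicator S1 x *\<^sub>R chart_density \<Omega> X x)"
      using T'(2) S1A by (auto simp: fun_eq_iff indicator_def)
    then show "(\<lambda>x. indicator S1 x * (\<bar>det (matrix (T' x))\<bar> * chart_density \<Omega>' X' (T x))) \<in> borel_measurable borel"
      using borel_measurable_continuous_on_indicator[OF S1 c1] by simp
  qed
  also have "\<dots> = (\<integral>\<^sup>+u\<in>S1. ennreal (chart_density \<Omega> X u) \<partial>lborel)"
    by (intro nn_integral_cong) (use T'(2) S1A in \<open>auto simp: indicator_def\<close>)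
  finally show ?thesis unfolding TS chart_integral_def S1_def[symmetric] S2_def[symmetric] by simp
qed

section \<open>The surface measure\<close>

definition is_surface_measure :: "'n::finite ambient set \<Rightarrow> 'n ambient measure \<Rightarrow> bool" where
  "is_surface_measure S \<mu> \<longleftrightarrow> sets \<mu> = sets (restrict_space borel S) \<and>
     (\<forall>\<Omega> X. parametrization S \<Omega> X \<longrightarrow>
       (\<forall>A\<in>sets borel. A \<subseteq> \<Omega> \<longrightarrow>
          emeasure \<mu> (X ` A) = (\<integral>\<^sup>+u\<in>A. ennreal (chart_density \<Omega> X u) \<partial>lborel)))"

lemma surface_measure_eq_The: "surface_measure S = (THE \<mu>. is_surface_measure S \<mu>)"
  by (simp add: surface_measure_def is_surface_measure_def chart_density_def gram_def)

definition chart_measure :: "'n::finite ambient set \<Rightarrow> (real^'n) set \<Rightarrow> (real^'n \<Rightarrow> 'n ambient) \<Rightarrow> 'n ambient measure" where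
  "chart_measure S \<Omega> X = distr (density (restrict_space lborel \<Omega>) (\<lambda>u. ennreal (chart_density \<Omega> X u))) (restrict_space borel S) X"

lemma chart_measurable:
  assumes X: "parametrization S \<Omega> X"
  shows "X \<in> measurable (restrict_space lborel \<Omega>) (restrict_space borel S)"
    "chart_density \<Omega> X \<in> borel_measurable (restrict_space lborel \<Omega>)"
proof -
  note XD = parametrizationD[OF X]
  have sets: "sets (restrict_space lborel \<Omega>) = sets (restrict_space borel \<Omega>)"
    by (rule sets_restrict_space_cong) simp
  have "X \<in> borel_measurable (restrict_space lborel \<Omega>)"
    unfolding measurable_cong_sets[OF sets refl] by (rule borel_measurable_continuous_on_restrict[OF XD(7)])
  then show "X \<in> measurable (restrict_space lborel \<Omega>) (restrict_space borel S)"
    by (rule measurable_restrict_space2[rotated]) (use XD(6) in \<open>auto simp: space_restrict_space\<close>)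
  show "chart_density \<Omega> X \<in> borel_measurable (restrict_space lborel \<Omega>)"
    unfolding measurable_cong_sets[OF sets refl]
    by (rule borel_measurable_continuous_on_restrict[OF continuous_on_chart_density[OF XD(1,4)]])
qed

lemma nn_integral_chart_measure:
  assumes X: "parametrization S \<Omega> X" and F: "F \<in> borel_measurable (restrict_space borel S)"
  shows "(\<integral>\<^sup>+x. F x \<partial>chart_measure S \<Omega> X) = (\<integral>\<^sup>+u\<in>\<Omega>. ennreal (chart_density \<Omega> X u) * F (X u) \<partial>lborel)"
proof -
  note m = chart_measurable[OF X]
  have "(\<integral>\<^sup>+x. F x \<partial>chart_measure S \<Omega> X) =
      (\<integral>\<^sup>+u. F (X u) \<partial>density (restrict_space lborel \<Omega>) (\<lambda>u. ennreal (chart_density \<Omega> X u)))"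
    unfolding chart_measure_def by (rule nn_integral_distr) (simp_all add: m F)
  also have "\<dots> = (\<integral>\<^sup>+u. ennreal (chart_density \<Omega> X u) * F (X u) \<partial>restrict_space lborel \<Omega>)"
    using m measurable_compose[OF m(1) F] by (intro nn_integral_density) auto
  also have "\<dots> = (\<integral>\<^sup>+u\<in>\<Omega>. ennreal (chart_density \<Omega> X u) * F (X u) \<partial>lborel)"
    using chart_domain_borel[OF parametrizationD(1)[OF X]] by (intro nn_integral_restrict_space) auto
  finally show ?thesis .
qed

lemma integral_chart_measure:
  fixes F :: "'n::finite ambient \<Rightarrow> real"
  assumes fr: "has_frames S" and X: "parametrization S \<Omega> X" and F: "F \<in> borel_measurable (restrict_space borel S)"
  shows "(\<integral>x. F x \<partial>chart_measure S \<Omega> X) = (\<integral>u\<in>\<Omega>. chart_density \<Omega> X u * F (X u) \<partial>lborel)"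
proof -
  note m = chart_measurable[OF X]
  have "(\<integral>x. F x \<partial>chart_measure S \<Omega> X) =
      (\<integral>u. F (X u) \<partial>density (restrict_space lborel \<Omega>) (\<lambda>u. ennreal (chart_density \<Omega> X u)))"
    unfolding chart_measure_def by (rule integral_distr) (simp_all add: m F)
  also have "\<dots> = (\<integral>u. chart_density \<Omega> X u * F (X u) \<partial>restrict_space lborel \<Omega>)"
    using m measurable_compose[OF m(1) F]
    by (subst integral_density) (auto simp: space_restrict_space intro!: AE_I2 chart_density_nonneg[OF fr X])
  also have "\<dots> = (\<integral>u\<in>\<Omega>. chart_density \<Omega> X u * F (X u) \<partial>lborel)"
    using chart_domain_borel[OF parametrizationD(1)[OF X]]
    unfolding set_lebesgue_integral_def by (subst integral_restrict_space) auto
  finally show ?thesis .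
qed

lemma emeasure_chart_measure:
  assumes X: "parametrization S \<Omega> X" and B: "B \<in> sets (restrict_space borel S)"
  shows "emeasure (chart_measure S \<Omega> X) B = chart_integral \<Omega> X B"
proof -
  have "emeasure (chart_measure S \<Omega> X) B = (\<integral>\<^sup>+x. indicator B x \<partial>chart_measure S \<Omega> X)"
    using B by (simp add: chart_measure_def)
  also have "\<dots> = (\<integral>\<^sup>+u\<in>\<Omega>. ennreal (chart_density \<Omega> X u) * indicator B (X u) \<partial>lborel)"
    using B by (intro nn_integral_chart_measure[OF X]) auto
  also have "\<dots> = chart_integral \<Omega> X B"
    unfolding chart_integral_def by (intro nn_integral_cong) (auto simp: indicator_def)
  finally show ?thesis .
qed

text \<open>
  Finitely many charts cover \<open>S\<close>. The piece \<open>D k\<close> is the part of the \<open>k\<close>-th chart that no earlier chart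
  covers, so that a measure on \<open>S\<close> is determined by its values in charts.
\<close>
lemma chart_decomposition:
  fixes S :: "'n::finite ambient set"
  assumes S: "hypersurface S" "compact S"
  obtains m :: nat and Om :: "nat \<Rightarrow> (real^'n) set" and X :: "nat \<Rightarrow> real^'n \<Rightarrow> 'n ambient" and D where
    "\<And>k. k < m \<Longrightarrow> parametrization S (Om k) (X k)" "\<And>k. k < m \<Longrightarrow> D k \<in> sets borel"
    "\<And>k. k < m \<Longrightarrow> D k \<subseteq> X k ` Om k" "disjoint_family_on D {..<m}" "(\<Union>k<m. D k) = S"
proof -
  define \<C> where "\<C> = {C. \<exists>\<Omega> (X :: real^'n \<Rightarrow> 'n ambient). parametrization S \<Omega> X \<and> C = X ` \<Omega>}"
  have "\<forall>C\<in>\<C>. openin (top_of_set S) C" unfolding \<C>_def using parametrizationD(2) by blast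
  moreover have "S \<subseteq> \<Union>\<C>" unfolding \<C>_def using S(1) by (fastforce simp: hypersurface_def)
  ultimately obtain \<D> where \<D>: "\<D> \<subseteq> \<C>" "finite \<D>" "S \<subseteq> \<Union>\<D>"
    using S(2) unfolding compact_eq_openin_cover by meson
  obtain m :: nat and f where f: "\<D> = f ` {i. i < m}"
    using finite_imp_nat_seg_image_inj_on[OF \<D>(2)] by metis
  have "\<forall>k. \<exists>\<Omega> X. k < m \<longrightarrow> parametrization S \<Omega> X \<and> f k = X ` \<Omega>"
    using f \<D>(1) unfolding \<C>_def by blast
  then obtain Om X where OX: "\<And>k. k < m \<Longrightarrow> parametrization S (Om k) (X k)" "\<And>k. k < m \<Longrightarrow> f k = X k ` Om k"
    by metis
  define D where "D k = f k - (\<Union>j<k. f j)" for k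
  have Sb: "S \<in> sets borel" using S(2) by (simp add: borel_compact)
  have fb: "f k \<in> sets borel" if "k < m" for k
    using parametrization_image_borel[OF OX(1)[OF that] Sb chart_domain_borel[OF parametrizationD(1)[OF OX(1)[OF that]]]]
      OX(2)[OF that] by simp
  show thesis
  proof (rule that[of m Om X D])
    show "D k \<in> sets borel" if "k < m" for k
      unfolding D_def using fb that by (intro sets.Diff sets.finite_UN) auto
    show "D k \<subseteq> X k ` Om k" if "k < m" for k
      using OX(2)[OF that] by (auto simp: D_def)
    show "disjoint_family_on D {..<m}"
      unfolding disjoint_family_on_def
    proof (intro ballI impI)
      fix a b :: nat assume "a \<noteq> b"
      then consider "a < b" | "b < a" by linarith
      then show "D a \<inter> D b = {}" by cases (auto simp: D_def)
    qed
    show "(\<Union>k<m. D k) = S"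
    proof
      show "(\<Union>k<m. D k) \<subseteq> S" using parametrizationD(6)[OF OX(1)] OX(2) by (fastforce simp: D_def)
      show "S \<subseteq> (\<Union>k<m. D k)"
      proof
        fix x assume "x \<in> S"
        then have ex: "\<exists>k. k < m \<and> x \<in> f k" using \<D>(3) f by auto
        define k where "k = (LEAST k. k < m \<and> x \<in> f k)"
        have k: "k < m" "x \<in> f k" using LeastI_ex[OF ex] by (auto simp: k_def)
        have "x \<notin> f j" if "j < k" for j
          using not_less_Least[of j "\<lambda>k. k < m \<and> x \<in> f k"] that k(1) by (auto simp: k_def[symmetric])
        then show "x \<in> (\<Union>k<m. D k)" using k by (auto simp: D_def)
      qed
    qed
  qed (use OX in auto)
qed

lemma surface_measure_unique:
  fixes S :: "'n::finite ambient set"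
  assumes S: "hypersurface S" "compact S" and \<mu>: "is_surface_measure S \<mu>" and \<nu>: "is_surface_measure S \<nu>"
  shows "\<mu> = \<nu>"
proof (rule measure_eqI)
  show sets: "sets \<mu> = sets \<nu>" using \<mu> \<nu> by (simp add: is_surface_measure_def)
  fix B assume "B \<in> sets \<mu>"
  have Sb: "S \<in> sets borel" using S(2) by (simp add: borel_compact)
  then have B: "B \<in> sets borel" "B \<subseteq> S"
    using \<open>B \<in> sets \<mu>\<close> \<mu> by (auto simp: is_surface_measure_def sets_restrict_space_iff)
  obtain m :: nat and Om X D where ch: "\<And>k. k < m \<Longrightarrow> parametrization S (Om k) (X k)"
    "\<And>k. k < m \<Longrightarrow> D k \<in> sets borel" "\<And>k. k < m \<Longrightarrow> D k \<subseteq> X k ` Om k"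
    "disjoint_family_on D {..<m}" "(\<Union>k<m. D k) = S"
    by (rule chart_decomposition[OF S]) blast
  have pieces: "B \<inter> D k \<in> sets \<mu>" if "k < m" for k
    using B ch(2)[OF that] Sb \<mu> by (auto simp: is_surface_measure_def sets_restrict_space_iff)
  have eq: "emeasure \<mu> (B \<inter> D k) = emeasure \<nu> (B \<inter> D k)" if k: "k < m" for k
  proof -
    let ?A = "{u\<in>Om k. X k u \<in> B \<inter> D k}"
    have A: "?A \<in> sets borel"
      by (rule borel_preimage_on[OF chart_domain_borel[OF parametrizationD(1)[OF ch(1)[OF k]]]
            parametrizationD(7)[OF ch(1)[OF k]] sets.Int[OF B(1) ch(2)[OF k]]])
    have "X k ` ?A = B \<inter> D k" using ch(3)[OF k] by auto
    moreover have "emeasure \<mu> (X k ` ?A) = emeasure \<nu> (X k ` ?A)"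
      using \<mu> \<nu> ch(1)[OF k] A by (simp add: is_surface_measure_def)
    ultimately show ?thesis by simp
  qed
  have dis: "disjoint_family_on (\<lambda>k. B \<inter> D k) {..<m}"
    using ch(4) by (auto simp: disjoint_family_on_def)
  have "(\<Union>k\<in>{..<m}. B \<inter> D k) = B" using ch(5) B(2) by auto
  moreover have "(\<lambda>k. B \<inter> D k) ` {..<m} \<subseteq> sets \<mu>" using pieces by auto
  ultimately have "emeasure M B = (\<Sum>k<m. emeasure M (B \<inter> D k))" if "sets M = sets \<mu>" for M
    using sum_emeasure[of "\<lambda>k. B \<inter> D k" "{..<m}" M] dis that by simp
  then show "emeasure \<mu> B = emeasure \<nu> B" using eq sets by simp
qed

text \<open>
  The chart measures are added up over the pieces of a decomposition. In another chart each piece has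
  the same measure, by \<open>chart_integral_transition\<close>.
\<close>
lemma surface_measure_exists:
  fixes S :: "'n::finite ambient set"
  assumes S: "hypersurface S" "compact S" and fr: "has_frames S"
  shows "\<exists>\<mu>. is_surface_measure S \<mu>"
proof -
  define R where "R = (restrict_space borel S :: 'n ambient measure)"
  have Sb: "S \<in> sets borel" using S(2) by (simp add: borel_compact)
  have spR: "space R = S" by (simp add: R_def space_restrict_space)
  have setsR: "B \<in> sets R \<longleftrightarrow> B \<in> sets borel \<and> B \<subseteq> S" for B
    using Sb by (auto simp: R_def sets_restrict_space_iff)
  obtain m :: nat and Om X D where ch: "\<And>k. k < m \<Longrightarrow> parametrization S (Om k) (X k)"
    "\<And>k. k < m \<Longrightarrow> D k \<in> sets borel" "\<And>k. k < m \<Longrightarrow> D k \<subseteq> X k ` Om k"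
    "disjoint_family_on D {..<m}" "(\<Union>k<m. D k) = S"
    by (rule chart_decomposition[OF S]) blast
  have DR: "D k \<in> sets R" if "k < m" for k using ch(2,3)[OF that] parametrizationD(6)[OF ch(1)[OF that]] setsR by blast
  define N where "N k = chart_measure S (Om k) (X k)" for k
  have setsN: "sets (N k) = sets R" for k by (simp add: N_def chart_measure_def R_def)
  have emN: "emeasure (N k) B = chart_integral (Om k) (X k) B" if "k < m" "B \<in> sets R" for k B
    unfolding N_def by (rule emeasure_chart_measure[OF ch(1)[OF that(1)] that(2)[unfolded R_def]])
  define e where "e B = (\<Sum>k<m. emeasure (N k) (B \<inter> D k))" for B
  define \<mu> where "\<mu> = measure_of S (sets R) e"
  have sets\<mu>: "sets \<mu> = sets R"
    unfolding \<mu>_def using sets.sets_measure_of_eq[of R e] by (simp add: spR)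
  have em\<mu>: "emeasure \<mu> B = e B" if "B \<in> sets R" for B
    unfolding \<mu>_def
  proof (rule emeasure_measure_of_sigma)
    show "sigma_algebra S (sets R)" using sets.sigma_algebra_axioms[of R] by (simp add: spR)
    show "positive (sets R) e" by (simp add: positive_def e_def)
    show "countably_additive (sets R) e"
      unfolding countably_additive_def
    proof (intro allI impI)
      fix A :: "nat \<Rightarrow> 'n ambient set"
      assume A: "range A \<subseteq> sets R" "disjoint_family A" "\<Union> (range A) \<in> sets R"
      have "(\<Sum>i. emeasure (N k) (A i \<inter> D k)) = emeasure (N k) (\<Union> (range A) \<inter> D k)" if "k < m" for k
      proof -
        have "(\<Sum>i. emeasure (N k) (A i \<inter> D k)) = emeasure (N k) (\<Union>i. A i \<inter> D k)"
          using A DR[OF that] setsN[of k]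
          by (intro suminf_emeasure) (auto simp: disjoint_family_on_def)
        also have "(\<Union>i. A i \<inter> D k) = \<Union> (range A) \<inter> D k" by blast
        finally show ?thesis .
      qed
      then have "(\<Sum>k<m. \<Sum>i. emeasure (N k) (A i \<inter> D k)) = e (\<Union> (range A))"
        unfolding e_def by (intro sum.cong) auto
      then show "(\<Sum>i. e (A i)) = e (\<Union> (range A))"
        unfolding e_def by (subst suminf_sum) auto
    qed
  qed (rule that)
  have "emeasure \<mu> (Y ` A) = (\<integral>\<^sup>+u\<in>A. ennreal (chart_density \<Omega> Y u) \<partial>lborel)"
    if Y: "parametrization S \<Omega> Y" and A: "A \<in> sets borel" "A \<subseteq> \<Omega>" for \<Omega> Y A
  proof -
    note YD = parametrizationD[OF Y]
    have YA: "Y ` A \<in> sets R"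
      using parametrization_image_borel[OF Y Sb A] YD(6) A(2) by (auto simp: setsR)
    have YAD: "Y ` A \<inter> D k \<in> sets R" if "k < m" for k using YA DR[OF that] by blast
    have "e (Y ` A) = (\<Sum>k<m. emeasure (chart_measure S \<Omega> Y) (Y ` A \<inter> D k))"
      unfolding e_def
    proof (rule sum.cong[OF refl])
      fix k assume "k \<in> {..<m}"
      then have k: "k < m" by simp
      have "emeasure (N k) (Y ` A \<inter> D k) = chart_integral (Om k) (X k) (Y ` A \<inter> D k)"
        by (rule emN[OF k YAD[OF k]])
      also have "\<dots> = chart_integral \<Omega> Y (Y ` A \<inter> D k)"
        by (rule chart_integral_transition[OF fr ch(1)[OF k] Y])
          (use YAD[OF k] ch(3)[OF k] A(2) in \<open>auto simp: setsR\<close>)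
      also have "\<dots> = emeasure (chart_measure S \<Omega> Y) (Y ` A \<inter> D k)"
        by (rule emeasure_chart_measure[OF Y, symmetric]) (use YAD[OF k] in \<open>simp add: R_def\<close>)
      finally show "emeasure (N k) (Y ` A \<inter> D k) = emeasure (chart_measure S \<Omega> Y) (Y ` A \<inter> D k)" .
    qed
    also have "\<dots> = emeasure (chart_measure S \<Omega> Y) (\<Union>k\<in>{..<m}. Y ` A \<inter> D k)"
    proof (rule sum_emeasure)
      show "(\<lambda>k. Y ` A \<inter> D k) ` {..<m} \<subseteq> sets (chart_measure S \<Omega> Y)"
        using YAD by (auto simp: chart_measure_def R_def)
      show "disjoint_family_on (\<lambda>k. Y ` A \<inter> D k) {..<m}"
        using ch(4) by (auto simp: disjoint_family_on_def)
    qed simp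
    also have "(\<Union>k\<in>{..<m}. Y ` A \<inter> D k) = Y ` A" using ch(5) A(2) YD(6) by auto
    also have "emeasure (chart_measure S \<Omega> Y) (Y ` A) = chart_integral \<Omega> Y (Y ` A)"
      by (rule emeasure_chart_measure[OF Y]) (use YA in \<open>simp add: R_def\<close>)
    also have "{u\<in>\<Omega>. Y u \<in> Y ` A} = A" using YD(3) A(2) by (auto simp: inj_on_def)
    then have "chart_integral \<Omega> Y (Y ` A) = (\<integral>\<^sup>+u\<in>A. ennreal (chart_density \<Omega> Y u) \<partial>lborel)"
      by (simp add: chart_integral_def)
    finally show ?thesis using em\<mu>[OF YA] by simp
  qed
  then have "is_surface_measure S \<mu>" unfolding is_surface_measure_def using sets\<mu> R_def by simp
  then show ?thesis by blast
qed

lemma surface_measure_eqI: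
  assumes "hypersurface S" "compact S" "is_surface_measure S \<mu>"
  shows "surface_measure S = \<mu>"
  unfolding surface_measure_eq_The using assms surface_measure_unique[OF assms(1,2)]
  by (intro the_equality) auto

lemma is_surface_measure_surface_measure:
  assumes "hypersurface S" "compact S" "has_frames S"
  shows "is_surface_measure S (surface_measure S)"
  using surface_measure_exists[OF assms] surface_measure_eqI[OF assms(1,2)] by metis

lemma restrict_to_chart:
  assumes S: "S \<in> sets borel" and \<mu>: "is_surface_measure S \<mu>" and X: "parametrization S \<Omega> X"
  shows "density \<mu> (indicator (X ` \<Omega>)) = chart_measure S \<Omega> X"
proof (rule measure_eqI)
  show "sets (density \<mu> (indicator (X ` \<Omega>))) = sets (chart_measure S \<Omega> X)"
    using \<mu> by (simp add: is_surface_measure_def chart_measure_def)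
  note XD = parametrizationD[OF X]
  fix B assume "B \<in> sets (density \<mu> (indicator (X ` \<Omega>)))"
  then have B\<mu>: "B \<in> sets \<mu>" and BR: "B \<in> sets (restrict_space borel S)"
    using \<mu> by (simp_all add: is_surface_measure_def)
  then have B: "B \<in> sets borel" "B \<subseteq> S" using S by (auto simp: sets_restrict_space_iff)
  have "X ` \<Omega> \<in> sets borel" using parametrization_image_borel[OF X S chart_domain_borel[OF XD(1)]] by simp
  then have X\<mu>: "X ` \<Omega> \<in> sets \<mu>" using \<mu> S XD(6) by (auto simp: is_surface_measure_def sets_restrict_space_iff)
  have "emeasure (density \<mu> (indicator (X ` \<Omega>))) B = (\<integral>\<^sup>+x. indicator (X ` \<Omega> \<inter> B) x \<partial>\<mu>)"
    using B\<mu> X\<mu> by (simp add: emeasure_density indicator_inter_arith)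
  also have "\<dots> = emeasure \<mu> (X ` \<Omega> \<inter> B)" using B\<mu> X\<mu> by (intro nn_integral_indicator sets.Int)
  also have "X ` \<Omega> \<inter> B = X ` {u\<in>\<Omega>. X u \<in> B}" by auto
  also have "emeasure \<mu> \<dots> = (\<integral>\<^sup>+u\<in>{u\<in>\<Omega>. X u \<in> B}. ennreal (chart_density \<Omega> X u) \<partial>lborel)"
  proof -
    have "{u\<in>\<Omega>. X u \<in> B} \<in> sets borel" by (rule borel_preimage_on[OF chart_domain_borel[OF XD(1)] XD(7) B(1)])
    then show ?thesis using \<mu> X by (simp add: is_surface_measure_def)
  qed
  also have "\<dots> = emeasure (chart_measure S \<Omega> X) B"
    by (simp add: emeasure_chart_measure[OF X BR] chart_integral_def)
  finally show "emeasure (density \<mu> (indicator (X ` \<Omega>))) B = emeasure (chart_measure S \<Omega> X) B" .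
qed

lemma nn_integral_surface_chart:
  assumes S: "S \<in> sets borel" and \<mu>: "is_surface_measure S \<mu>" and X: "parametrization S \<Omega> X"
    and F: "F \<in> borel_measurable \<mu>"
  shows "(\<integral>\<^sup>+x\<in>X ` \<Omega>. F x \<partial>\<mu>) = (\<integral>\<^sup>+u\<in>\<Omega>. ennreal (chart_density \<Omega> X u) * F (X u) \<partial>lborel)"
proof -
  note XD = parametrizationD[OF X]
  have sets: "sets \<mu> = sets (restrict_space borel S)" using \<mu> by (simp add: is_surface_measure_def)
  have "X ` \<Omega> \<in> sets borel" using parametrization_image_borel[OF X S chart_domain_borel[OF XD(1)]] by simp
  then have X\<mu>: "X ` \<Omega> \<in> sets \<mu>" using sets S XD(6) by (auto simp: sets_restrict_space_iff)
  have "(\<integral>\<^sup>+x\<in>X ` \<Omega>. F x \<partial>\<mu>) = (\<integral>\<^sup>+x. F x \<partial>density \<mu> (indicator (X ` \<Omega>)))"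
    using X\<mu> F by (subst nn_integral_density) (auto simp: mult.commute)
  also have "\<dots> = (\<integral>\<^sup>+x. F x \<partial>chart_measure S \<Omega> X)" by (simp add: restrict_to_chart[OF S \<mu> X])
  also have "\<dots> = (\<integral>\<^sup>+u\<in>\<Omega>. ennreal (chart_density \<Omega> X u) * F (X u) \<partial>lborel)"
    by (rule nn_integral_chart_measure[OF X]) (use F measurable_cong_sets[OF sets refl] in blast)
  finally show ?thesis .
qed

lemma integral_surface_chart:
  fixes F :: "'n::finite ambient \<Rightarrow> real"
  assumes S: "S \<in> sets borel" and fr: "has_frames S" and \<mu>: "is_surface_measure S \<mu>" and X: "parametrization S \<Omega> X"
    and F: "F \<in> borel_measurable \<mu>"
  shows "(\<integral>x\<in>X ` \<Omega>. F x \<partial>\<mu>) = (\<integral>u\<in>\<Omega>. chart_density \<Omega> X u * F (X u) \<partial>lborel)"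
proof -
  note XD = parametrizationD[OF X]
  have sets: "sets \<mu> = sets (restrict_space borel S)" using \<mu> by (simp add: is_surface_measure_def)
  have "X ` \<Omega> \<in> sets borel" using parametrization_image_borel[OF X S chart_domain_borel[OF XD(1)]] by simp
  then have X\<mu>: "X ` \<Omega> \<in> sets \<mu>" using sets S XD(6) by (auto simp: sets_restrict_space_iff)
  have ind: "(indicator (X ` \<Omega>) :: 'n ambient \<Rightarrow> ennreal) = (\<lambda>x. ennreal (indicator (X ` \<Omega>) x))"
    by (auto simp: indicator_def)
  have "(\<integral>x\<in>X ` \<Omega>. F x \<partial>\<mu>) = (\<integral>x. F x \<partial>density \<mu> (\<lambda>x. ennreal (indicator (X ` \<Omega>) x)))"
    unfolding set_lebesgue_integral_def using X\<mu> F by (subst integral_density) auto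
  also have "\<dots> = (\<integral>x. F x \<partial>chart_measure S \<Omega> X)" by (simp add: restrict_to_chart[OF S \<mu> X] ind[symmetric])
  also have "\<dots> = (\<integral>u\<in>\<Omega>. chart_density \<Omega> X u * F (X u) \<partial>lborel)"
    by (rule integral_chart_measure[OF fr X]) (use F measurable_cong_sets[OF sets refl] in blast)
  finally show ?thesis .
qed

lemma chart_image_openin:
  assumes X: "parametrization S \<Omega> X" and G: "open G"
  shows "openin (top_of_set S) (X ` (\<Omega> \<inter> G))"
proof -
  note XD = parametrizationD[OF X]
  have "openin (top_of_set (X ` \<Omega>)) (X ` \<Omega> \<inter> inv_into \<Omega> X -` G)"
    by (rule continuous_openin_preimage_gen[OF XD(8) G])
  moreover have "X ` \<Omega> \<inter> inv_into \<Omega> X -` G = X ` (\<Omega> \<inter> G)" using XD(3) by auto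
  ultimately show ?thesis using openin_trans[OF _ XD(2)] by metis
qed

lemma finite_surface_measure:
  fixes S :: "'n::finite ambient set"
  assumes S: "hypersurface S" "compact S" and fr: "has_frames S" and \<mu>: "is_surface_measure S \<mu>"
  shows "finite_measure \<mu>"
proof
  have Sb: "S \<in> sets borel" using S(2) by (simp add: borel_compact)
  have sets: "sets \<mu> = sets (restrict_space borel S)" using \<mu> by (simp add: is_surface_measure_def)
  then have sp: "space \<mu> = S" using sets_eq_imp_space_eq[OF sets] by (simp add: space_restrict_space)
  define \<C> where "\<C> = {C. openin (top_of_set S) C \<and> emeasure \<mu> C < \<infinity>}"
  have "\<exists>C\<in>\<C>. p \<in> C" if p: "p \<in> S" for p
  proof -
    obtain \<Omega> and X :: "real^'n \<Rightarrow> 'n ambient" where X: "parametrization S \<Omega> X" "p \<in> X ` \<Omega>"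
      using S(1) p unfolding hypersurface_def by blast
    note XD = parametrizationD[OF X(1)]
    obtain u where u: "u \<in> \<Omega>" "p = X u" using X(2) by blast
    let ?w = "chart_density \<Omega> X"
    have "continuous (at u within \<Omega>) ?w"
      using continuous_on_chart_density[OF XD(1,4)] u(1) by (simp add: continuous_on_eq_continuous_within)
    then obtain d where d: "d > 0" "\<And>v. v \<in> \<Omega> \<Longrightarrow> dist v u < d \<Longrightarrow> dist (?w v) (?w u) < 1"
      unfolding continuous_within_eps_delta by (meson zero_less_one)
    define c where "c = \<bar>?w u\<bar> + 1"
    have bound: "?w v \<le> c" if "v \<in> \<Omega>" "v \<in> ball u d" for v
      using d(2)[of v] that by (simp add: dist_commute dist_real_def c_def)
    have bl: "\<Omega> \<inter> ball u d \<in> sets borel" using chart_domain_borel[OF XD(1)] by auto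
    have "emeasure \<mu> (X ` (\<Omega> \<inter> ball u d)) = (\<integral>\<^sup>+v\<in>\<Omega> \<inter> ball u d. ennreal (?w v) \<partial>lborel)"
      using \<mu> X(1) bl by (simp add: is_surface_measure_def)
    also have "\<dots> \<le> (\<integral>\<^sup>+v. ennreal c * indicator (ball u d) v \<partial>lborel)"
      by (intro nn_integral_mono) (use bound in \<open>auto simp: indicator_def intro!: ennreal_leI\<close>)
    also have "\<dots> = ennreal c * emeasure lborel (ball u d)"
      by (rule nn_integral_cmult_indicator) simp
    also have "\<dots> < \<infinity>"
      using emeasure_lborel_ball_finite[of u d] by (simp add: ennreal_mult_less_top)
    finally have "X ` (\<Omega> \<inter> ball u d) \<in> \<C>"
      using chart_image_openin[OF X(1), of "ball u d"] by (simp add: \<C>_def)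
    then show ?thesis using u d(1) by (intro bexI[of _ "X ` (\<Omega> \<inter> ball u d)"]) auto
  qed
  then have "S \<subseteq> \<Union>\<C>" by blast
  moreover have "\<forall>C\<in>\<C>. openin (top_of_set S) C" by (simp add: \<C>_def)
  ultimately obtain \<D> where \<D>: "\<D> \<subseteq> \<C>" "finite \<D>" "S \<subseteq> \<Union>\<D>"
    using S(2) unfolding compact_eq_openin_cover by meson
  have in_sets: "C \<in> sets \<mu>" if "C \<in> \<D>" for C
  proof -
    have "openin (top_of_set S) C" using that \<D>(1) by (auto simp: \<C>_def)
    then obtain G where "open G" "C = S \<inter> G" using openin_open by metis
    then show ?thesis using Sb by (auto simp: sets sets_restrict_space_iff)
  qed
  have "emeasure \<mu> S \<le> emeasure \<mu> (\<Union>C\<in>\<D>. C)"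
    using \<D>(3) in_sets \<D>(2) by (intro emeasure_mono sets.finite_UN) auto
  also have "\<dots> \<le> (\<Sum>C\<in>\<D>. emeasure \<mu> C)"
    by (rule emeasure_subadditive_finite) (use \<D>(2) in_sets in auto)
  also have "\<dots> < \<infinity>" using \<D>(1,2) by (auto simp: \<C>_def)
  finally show "emeasure \<mu> (space \<mu>) \<noteq> \<infinity>" by (simp add: sp)
qed

lemma borel_measurable_surface:
  fixes F :: "'n::finite ambient \<Rightarrow> real"
  assumes "is_surface_measure S \<mu>" "continuous_on S F"
  shows "F \<in> borel_measurable \<mu>"
proof -
  have sets: "sets \<mu> = sets (restrict_space borel S)" using assms by (simp add: is_surface_measure_def)
  show ?thesis unfolding measurable_cong_sets[OF sets refl]
    by (rule borel_measurable_continuous_on_restrict[OF assms(2)])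
qed

section \<open>Tangent maps\<close>

lemma velocity_compose:
  assumes D: "(F has_derivative D) (at p within S)"
    and \<gamma>: "\<gamma> 0 = p" "\<forall>t\<in>{0..1}. \<gamma> t \<in> S" "(\<gamma> has_vector_derivative v) (at (0::real) within {0..1})"
  shows "((\<lambda>t. F (\<gamma> t)) has_vector_derivative D v) (at 0 within {0..1})"
proof -
  have "(F has_derivative D) (at (\<gamma> 0) within \<gamma> ` {0..1})"
    by (rule has_derivative_subset[of _ _ _ S]) (use D \<gamma> in auto)
  from has_derivative_in_compose[OF \<gamma>(3)[unfolded has_vector_derivative_def] this]
  have "((\<lambda>t. F (\<gamma> t)) has_derivative (\<lambda>t. D (t *\<^sub>R v))) (at 0 within {0..1})" .
  then show ?thesis
    by (simp add: has_vector_derivative_def linear_scale[OF has_derivative_linear[OF D]])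
qed

text \<open>
  A derivative within \<open>S\<close> determines the velocity of the image of every curve in \<open>S\<close>, and these
  velocities span the tangent space.
\<close>
lemma tangent_derivative_unique:
  assumes D: "(F has_derivative D) (at p within S)" and D': "(F has_derivative D') (at p within S)"
    and v: "v \<in> tangent_space S p"
  shows "D v = D' v"
proof -
  note l = has_derivative_linear[OF D] and l' = has_derivative_linear[OF D']
  have "tangent_space S p \<subseteq> {v. D v = D' v}"
    unfolding tangent_space_def
  proof (rule span_minimal)
    show "subspace {v. D v = D' v}"
      by (simp add: subspace_def linear_0[OF l] linear_0[OF l'] linear_add[OF l] linear_add[OF l']
          linear_scale[OF l] linear_scale[OF l'])
    show "{v. \<exists>\<gamma>. \<gamma> 0 = p \<and> (\<forall>t\<in>{0..1}. \<gamma> t \<in> S) \<and> (\<gamma> has_vector_derivative v) (at (0::real) within {0..1})}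
        \<subseteq> {v. D v = D' v}"
    proof clarify
      fix v \<gamma>
      assume \<gamma>: "p = \<gamma> 0" "\<forall>t\<in>{0..1}. \<gamma> t \<in> S" "(\<gamma> has_vector_derivative v) (at (0::real) within {0..1})"
      have "((\<lambda>t. F (\<gamma> t)) has_vector_derivative D v) (at 0 within {0..1})"
        "((\<lambda>t. F (\<gamma> t)) has_vector_derivative D' v) (at 0 within {0..1})"
        by (rule velocity_compose[OF D \<gamma>(1)[symmetric] \<gamma>(2,3)], rule velocity_compose[OF D' \<gamma>(1)[symmetric] \<gamma>(2,3)])
      then show "D v = D' v"
        using vector_derivative_unique_within_closed_interval[of 0 1 0 "\<lambda>t. F (\<gamma> t)"] by auto
    qed
  qed
  then show ?thesis using v by blast
qed

lemma tangent_derivative_image: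
  assumes D: "(F has_derivative D) (at p within S)" and FS: "F ` S \<subseteq> S'" and v: "v \<in> tangent_space S p"
  shows "D v \<in> tangent_space S' (F p)"
proof -
  note l = has_derivative_linear[OF D]
  have sub: "subspace (tangent_space S' (F p))" by (simp add: tangent_space_def)
  have "tangent_space S p \<subseteq> {v. D v \<in> tangent_space S' (F p)}"
    unfolding tangent_space_def[of S]
  proof (rule span_minimal)
    show "subspace {v. D v \<in> tangent_space S' (F p)}"
      using sub by (simp add: subspace_def linear_0[OF l] linear_add[OF l] linear_scale[OF l])
    show "{v. \<exists>\<gamma>. \<gamma> 0 = p \<and> (\<forall>t\<in>{0..1}. \<gamma> t \<in> S) \<and> (\<gamma> has_vector_derivative v) (at (0::real) within {0..1})}
        \<subseteq> {v. D v \<in> tangent_space S' (F p)}"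
    proof clarify
      fix v \<gamma>
      assume \<gamma>: "p = \<gamma> 0" "\<forall>t\<in>{0..1}. \<gamma> t \<in> S" "(\<gamma> has_vector_derivative v) (at (0::real) within {0..1})"
      have "((\<lambda>t. F (\<gamma> t)) has_vector_derivative D v) (at 0 within {0..1})"
        by (rule velocity_compose[OF D \<gamma>(1)[symmetric] \<gamma>(2,3)])
      moreover have "\<forall>t\<in>{0..1}. F (\<gamma> t) \<in> S'" using \<gamma>(2) FS by blast
      ultimately show "D v \<in> tangent_space S' (F (\<gamma> 0))"
        unfolding tangent_space_def by (intro span_base CollectI exI[of _ "\<lambda>t. F (\<gamma> t)"]) simp
    qed
  qed
  then show ?thesis using v by blast
qed

lemma tangent_map_eq:
  assumes "(F has_derivative D) (at p within S)" "v \<in> tangent_space S p"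
  shows "tangent_map S F p v = D v"
proof -
  have "(F has_derivative frechet_derivative F (at p within S)) (at p within S)"
    using assms(1) frechet_derivative_works differentiableI by blast
  then show ?thesis unfolding tangent_map_def using tangent_derivative_unique assms by metis
qed

lemma tangent_map_derivative:
  "smooth_on_set S F \<Longrightarrow> p \<in> S \<Longrightarrow> (F has_derivative tangent_map S F p) (at p within S)"
  unfolding tangent_map_def by (rule smooth_on_set_has_derivative)

lemma chart_derivative_tangent:
  assumes X: "parametrization S \<Omega> X" and u: "u \<in> \<Omega>"
  shows "frechet_derivative X (at u within \<Omega>) v \<in> tangent_space S (X u)"
proof -
  have "linear (frechet_derivative X (at u within \<Omega>))"
    by (rule has_derivative_linear[OF smooth_on_set_has_derivative[OF parametrizationD(4)[OF X] u]])
  then have "frechet_derivative X (at u within \<Omega>) v =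
      (\<Sum>i\<in>UNIV. v $ i *\<^sub>R frechet_derivative X (at u within \<Omega>) (axis i 1))"
    by (rule linear_axis_expansion)
  also have "\<dots> \<in> tangent_space S (X u)"
    unfolding tangent_space_def
    by (intro span_sum span_scale) (use chart_velocity_tangent[OF X u] in \<open>simp add: tangent_space_def\<close>)
  finally show ?thesis .
qed

text \<open>
  The inverse of a parametrization is differentiable, and its derivative inverts that of the
  parametrization.
\<close>
lemma chart_derivative_inj:
  assumes X: "parametrization S \<Omega> X" and u: "u \<in> \<Omega>"
  shows "inj (frechet_derivative X (at u within \<Omega>))"
proof -
  note XD = parametrizationD[OF X]
  let ?D = "frechet_derivative X (at u within \<Omega>)"
  let ?G = "inv_into \<Omega> X"
  let ?DG = "frechet_derivative ?G (at (X u) within X ` \<Omega>)"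
  have D: "(X has_derivative ?D) (at u within \<Omega>)" by (rule smooth_on_set_has_derivative[OF XD(4) u])
  have "(?G has_derivative ?DG) (at (X u) within X ` \<Omega>)"
    by (rule smooth_on_set_has_derivative[OF XD(5)]) (use u in blast)
  from has_derivative_in_compose[OF D this]
  have "((\<lambda>v. ?G (X v)) has_derivative (\<lambda>v. ?DG (?D v))) (at u within \<Omega>)" .
  then have "((\<lambda>v. v) has_derivative (\<lambda>v. ?DG (?D v))) (at u within \<Omega>)"
    by (rule has_derivative_transform[OF u, rotated]) (use XD(3) in simp)
  from chart_domain_derivative_unique[OF XD(1) u this has_derivative_ident]
  have "?DG (?D v) = v" for v by metis
  then show ?thesis by (rule inj_on_inverseI)
qed

section \<open>Embeddings\<close>

lemma EmbD:
  assumes "\<phi> \<in> Emb M"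
  shows "smooth_on_set M \<phi>" "inj_on \<phi> M" "homeomorphism M (\<phi> ` M) \<phi> (inv_into M \<phi>)"
    "\<And>p. p \<in> M \<Longrightarrow> inj_on (tangent_map M \<phi> p) (tangent_space M p)" "\<phi> \<in> extensional M"
proof -
  obtain \<psi> where \<psi>: "homeomorphism M (\<phi> ` M) \<phi> \<psi>" using assms by (auto simp: Emb_def)
  show inj: "inj_on \<phi> M" using \<psi> by (metis homeomorphism_apply1 inj_on_inverseI)
  show "homeomorphism M (\<phi> ` M) \<phi> (inv_into M \<phi>)"
  proof (rule homeomorphism_cong[OF \<psi>])
    fix y assume "y \<in> \<phi> ` M"
    then obtain p where "p \<in> M" "y = \<phi> p" by blast
    then show "inv_into M \<phi> y = \<psi> y" using \<psi> inj by (simp add: homeomorphism_def)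
  qed auto
qed (use assms in \<open>auto simp: Emb_def\<close>)

lemma EmbI:
  assumes "compact M" "\<phi> \<in> extensional M" "smooth_on_set M \<phi>" "inj_on \<phi> M"
    "\<And>p. p \<in> M \<Longrightarrow> inj_on (tangent_map M \<phi> p) (tangent_space M p)"
  shows "\<phi> \<in> Emb M"
  using assms homeomorphism_compact[OF assms(1) smooth_on_set_continuous[OF assms(3)] refl assms(4)]
  by (auto simp: Emb_def)

text \<open>
  Here \<open>R^(n+1)\<close> is viewed as \<open>R^n \<times> R\<close>, with the \<open>None\<close> coordinate as the extra factor.
\<close>
definition option_proj :: "real^'n::finite option \<Rightarrow> real^'n" where
  "option_proj x = (\<chi> i. x $ Some i)"

definition option_lift :: "real^'n::finite \<Rightarrow> real^'n option" where
  "option_lift u = (\<chi> i. case i of None \<Rightarrow> 0 | Some j \<Rightarrow> u $ j)"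

lemma option_proj_lift [simp]: "option_proj (option_lift u) = u" "option_lift u $ None = 0"
  by (simp_all add: option_proj_def option_lift_def vec_eq_iff)

lemma linear_option_proj: "linear option_proj"
  by (rule linearI) (simp_all add: option_proj_def vec_eq_iff)

lemma ex_vector_not_in_range:
  fixes L :: "real^'n::finite \<Rightarrow> 'n ambient"
  assumes "linear L"
  obtains w where "w \<notin> range L"
proof -
  have "CARD('n option) = Suc (CARD('n))"
    by (simp add: UNIV_option_conv card_image)
  moreover have "dim (range L) \<le> CARD('n)"
    using dim_image_le[OF assms, of UNIV] by (simp add: dim_UNIV)
  ultimately have "range L \<noteq> UNIV" by (auto simp: dim_UNIV)
  then show thesis using that by blast
qed

text \<open>
  Near \<open>p0\<close> the map \<open>\<phi> \<circ> X\<close> extends smoothly to an open set, with injective derivative. Adding a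
  multiple of a vector \<open>w\<close> outside the range of this derivative gives a map \<open>f\<close> between spaces of equal dimension,
  to which the inverse function theorem applies. Its local inverse, followed by the projection that
  forgets the multiple of \<open>w\<close> and by the extension of \<open>X\<close>, extends the inverse of \<open>\<phi>\<close>.
  This argument also covers boundary points.
\<close>
lemma smooth_inverse_embedding:
  fixes M :: "'n::finite ambient set"
  assumes M: "hypersurface M" and \<phi>: "\<phi> \<in> Emb M"
  shows "smooth_on_set (\<phi> ` M) (inv_into M \<phi>)"
proof (rule smooth_on_setI)
  fix y0 assume "y0 \<in> \<phi> ` M"
  then obtain p0 where p0: "p0 \<in> M" "y0 = \<phi> p0" by blast
  note E = EmbD[OF \<phi>]
  obtain \<Omega> and X :: "real^'n \<Rightarrow> 'n ambient" where X: "parametrization M \<Omega> X" "p0 \<in> X ` \<Omega>"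
    using M p0 unfolding hypersurface_def by blast
  obtain u0 where u0: "u0 \<in> \<Omega>" "p0 = X u0" using X(2) by blast
  note XD = parametrizationD[OF X(1)]
  obtain U Xh where Xh: "open U" "u0 \<in> U" "smooth_on_open U Xh" "\<And>u. u \<in> \<Omega> \<Longrightarrow> u \<in> U \<Longrightarrow> Xh u = X u"
    by (rule smooth_on_setE[OF XD(4) u0(1)]) blast
  obtain P \<Phi> where \<Phi>: "open P" "p0 \<in> P" "smooth_on_open P \<Phi>" "\<And>p. p \<in> M \<Longrightarrow> p \<in> P \<Longrightarrow> \<Phi> p = \<phi> p"
    by (rule smooth_on_setE[OF E(1) p0(1)]) blast
  have Xh0: "Xh u0 = p0" using Xh(2,4) u0 by simp
  let ?DX = "frechet_derivative Xh (at u0)" and ?D\<Phi> = "frechet_derivative \<Phi> (at p0)"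
  have DX: "?DX = frechet_derivative X (at u0 within \<Omega>)"
    using chart_domain_frechet[OF XD(1) u0(1) has_derivative_of_extension[OF Xh u0(1)]] by simp
  have lX: "linear ?DX" by (rule has_derivative_linear[OF smooth_on_open_has_derivative[OF Xh(3,2)]])
  have l\<Phi>: "linear ?D\<Phi>" by (rule has_derivative_linear[OF smooth_on_open_has_derivative[OF \<Phi>(3,2)]])
  define L where "L v = ?D\<Phi> (?DX v)" for v
  have lL: "linear L" unfolding L_def using linear_compose[OF lX l\<Phi>] by (simp add: o_def)
  have L0: "v = 0" if "L v = 0" for v
  proof -
    have t: "?DX v \<in> tangent_space M p0" unfolding DX u0(2) by (rule chart_derivative_tangent[OF X(1) u0(1)])
    have "tangent_map M \<phi> p0 (?DX v) = ?D\<Phi> (?DX v)"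
      by (rule tangent_map_eq[OF has_derivative_of_extension[OF \<Phi> p0(1)] t])
    then have "tangent_map M \<phi> p0 (?DX v) = 0" using that by (simp add: L_def)
    moreover have "tangent_map M \<phi> p0 0 = 0"
      by (rule linear_0[OF has_derivative_linear[OF tangent_map_derivative[OF E(1) p0(1)]]])
    moreover have "0 \<in> tangent_space M p0" by (simp add: tangent_space_def span_zero)
    ultimately have "?DX v = 0" using E(4)[OF p0(1)] t by (metis inj_onD)
    then have "frechet_derivative X (at u0 within \<Omega>) v = frechet_derivative X (at u0 within \<Omega>) 0"
      using linear_0[OF lX] by (simp add: DX)
    then show "v = 0" using chart_derivative_inj[OF X(1) u0(1)] by (metis injD)
  qed
  obtain w where w: "w \<notin> range L" by (rule ex_vector_not_in_range[OF lL])
  have bl: "bounded_linear option_proj" using linear_option_proj by (simp add: linear_conv_bounded_linear)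
  define f where "f x = \<Phi> (Xh (option_proj x)) + x $ None *\<^sub>R w" for x
  \<comment> \<open>the second summand moves off the hypersurface and makes the derivative injective\<close>
  define U1 where "U1 = U \<inter> Xh -` P"
  have U1: "open U1" unfolding U1_def
    using continuous_open_preimage[OF smooth_on_open_continuous[OF Xh(3)] Xh(1) \<Phi>(1)] .
  define Q where "Q = option_proj -` U1"
  have Q: "open Q" unfolding Q_def
    using continuous_open_vimage[OF U1] linear_continuous_at[OF bl] by blast
  define x0 where "x0 = option_lift u0"
  have x0: "x0 \<in> Q" using Xh(2) Xh0 \<Phi>(2) by (simp add: Q_def U1_def x0_def)
  have sp: "smooth_on_open Q option_proj" by (rule smooth_linear[OF bl])
  have sX: "smooth_on_open Q (\<lambda>x. Xh (option_proj x))"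
    by (rule smooth_on_open_comp[OF Q Xh(3) sp]) (auto simp: Q_def U1_def)
  have sf: "smooth_on_open Q f"
    unfolding f_def
    by (intro smooth_add smooth_scaleR smooth_nth smooth_const smooth_ident Q smooth_on_open_comp[OF Q \<Phi>(3) sX])
       (auto simp: Q_def U1_def)
  have "(f has_derivative (\<lambda>v. L (option_proj v) + v $ None *\<^sub>R w)) (at x0)"
  proof -
    have 1: "(option_proj has_derivative option_proj) (at x0)" by (rule bounded_linear_imp_has_derivative[OF bl])
    have 2: "(Xh has_derivative ?DX) (at (option_proj x0))"
      using smooth_on_open_has_derivative[OF Xh(3,2)] by (simp add: x0_def)
    have 3: "(\<Phi> has_derivative ?D\<Phi>) (at (Xh (option_proj x0)))"
      using smooth_on_open_has_derivative[OF \<Phi>(3,2)] by (simp add: x0_def Xh0)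
    have 4: "((\<lambda>x. x $ None *\<^sub>R w) has_derivative (\<lambda>v. v $ None *\<^sub>R w)) (at x0)"
      by (intro bounded_linear_imp_has_derivative bounded_linear_compose[OF bounded_linear_scaleR_left bounded_linear_vec_nth])
    show ?thesis unfolding f_def L_def
      by (rule has_derivative_add[OF has_derivative_compose[OF has_derivative_compose[OF 1 2] 3] 4])
  qed
  then have Df: "frechet_derivative f (at x0) = (\<lambda>v. L (option_proj v) + v $ None *\<^sub>R w)"
    by (simp add: frechet_derivative_at[symmetric])
  have inj: "inj (frechet_derivative f (at x0))"
    unfolding Df
  proof (rule linear_injective_0[THEN iffD2, rule_format])
    show "linear (\<lambda>v. L (option_proj v) + v $ None *\<^sub>R w)"
      using has_derivative_linear[OF smooth_on_open_has_derivative[OF sf x0]] by (simp add: Df)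
    fix v :: "real^'n option"
    assume z: "L (option_proj v) + v $ None *\<^sub>R w = 0"
    have "v $ None = 0"
    proof (rule ccontr)
      assume nz: "v $ None \<noteq> 0"
      have "v $ None *\<^sub>R w = - L (option_proj v)" using z by (simp add: eq_neg_iff_add_eq_0 add.commute)
      then have "w = (1 / v $ None) *\<^sub>R (- L (option_proj v))" using nz by (metis scaleR_scaleR divide_self_if scaleR_one times_divide_eq_left mult_1)
      also have "\<dots> = L ((- 1 / v $ None) *\<^sub>R option_proj v)" by (simp add: linear_scale[OF lL] linear_neg[OF lL])
      finally show False using w by blast
    qed
    moreover from this have "option_proj v = 0" using z L0 by simp
    ultimately show "v = 0"
      unfolding vec_eq_iff option_proj_def by (metis option.exhaust vec_lambda_beta zero_index)
  qed
  obtain Q' V h where h: "open Q'" "Q' \<subseteq> Q" "x0 \<in> Q'" "open V" "homeomorphism Q' V f h" "smooth_on_open V h"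
    by (rule smooth_inverse_function_theorem[OF Q sf x0 inj]) blast
  define G where "G = {u. option_lift u \<in> Q'}"
  have bl': "bounded_linear (option_lift :: real^'n \<Rightarrow> 'n ambient)"
    unfolding linear_conv_bounded_linear[symmetric]
    by (rule linearI) (auto simp: option_lift_def vec_eq_iff split: option.split)
  have G: "open G"
    using continuous_open_vimage[OF h(1), of option_lift] linear_continuous_at[OF bl'] by (simp add: G_def vimage_def)
  have "openin (top_of_set (\<phi> ` M)) (\<phi> ` (X ` (\<Omega> \<inter> G)))"
    by (rule homeomorphism_imp_open_map[OF E(3) chart_image_openin[OF X(1) G]])
  then obtain O1 where O1: "open O1" "\<phi> ` (X ` (\<Omega> \<inter> G)) = \<phi> ` M \<inter> O1" using openin_open by metis
  have key: "y \<in> V \<and> Xh (option_proj (h y)) = inv_into M \<phi> y" if y: "y \<in> \<phi> ` M \<inter> O1" for y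
  proof -
    obtain u where u: "u \<in> \<Omega>" "option_lift u \<in> Q'" "y = \<phi> (X u)" using y O1(2) by (auto simp: G_def)
    then have "u \<in> U1" using h(2) by (auto simp: Q_def)
    then have uU: "u \<in> U" "X u \<in> P" using Xh(4)[OF u(1)] by (auto simp: U1_def)
    have XM: "X u \<in> M" using XD(6) u(1) by blast
    have "f (option_lift u) = y"
      using Xh(4)[OF u(1) uU(1)] \<Phi>(4)[OF XM uU(2)] u(3) by (simp add: f_def)
    moreover from this have "h y = option_lift u" "y \<in> V" using h(5) u(2) by (auto simp: homeomorphism_def)
    ultimately show ?thesis using Xh(4)[OF u(1) uU(1)] u(3) E(2) XM by simp
  qed
  have "y0 \<in> O1" 
  proof -
    have "u0 \<in> G" using h(3) by (simp add: G_def x0_def)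
    then have "y0 \<in> \<phi> ` (X ` (\<Omega> \<inter> G))" using u0 p0 by blast
    then show ?thesis using O1(2) by blast
  qed
  have hV: "h ` V \<subseteq> Q" using h(2,5) by (auto simp: homeomorphism_def)
  have "smooth_on_open V (\<lambda>y. Xh (option_proj (h y)))"
    by (rule smooth_on_open_comp[OF h(4) sX h(6) hV])
  then have "smooth_on_open (V \<inter> O1) (\<lambda>y. Xh (option_proj (h y)))" by (rule smooth_on_open_subset) simp
  moreover have "y0 \<in> V \<inter> O1" using key[of y0] \<open>y0 \<in> O1\<close> p0 by blast
  moreover have "open (V \<inter> O1)" using h(4) O1(1) by blast
  moreover have "\<forall>y\<in>\<phi> ` M \<inter> (V \<inter> O1). Xh (option_proj (h y)) = inv_into M \<phi> y" using key by blast
  ultimately show "\<exists>U E. open U \<and> y0 \<in> U \<and> smooth_on_open U E \<and> (\<forall>y\<in>\<phi> ` M \<inter> U. E y = inv_into M \<phi> y)"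
    by (intro exI conjI)
qed

lemma parametrization_diffeo_image:
  assumes X: "parametrization S \<Omega> X" and F: "smooth_on_set S F" and G: "smooth_on_set (F ` S) G"
    and GF: "\<And>x. x \<in> S \<Longrightarrow> G (F x) = x"
  shows "parametrization (F ` S) \<Omega> (\<lambda>u. F (X u))"
proof -
  note XD = parametrizationD[OF X]
  have hom: "homeomorphism S (F ` S) F G"
    using GF smooth_on_set_continuous[OF F] smooth_on_set_continuous[OF G]
    by (intro homeomorphismI) auto
  have XS: "X u \<in> S" if "u \<in> \<Omega>" for u using XD(6) that by blast
  have im: "(\<lambda>u. F (X u)) ` \<Omega> = F ` (X ` \<Omega>)" by (simp add: image_image)
  have inj: "inj_on (\<lambda>u. F (X u)) \<Omega>"
  proof (rule inj_onI)
    fix u v assume uv: "u \<in> \<Omega>" "v \<in> \<Omega>" "F (X u) = F (X v)"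
    then have "X u = X v" using GF XS by metis
    then show "u = v" using XD(3) uv by (simp add: inj_on_def)
  qed
  have inv: "inv_into \<Omega> (\<lambda>u. F (X u)) y = inv_into \<Omega> X (G y)" if y: "y \<in> F ` (X ` \<Omega>)" for y
  proof -
    obtain u where "u \<in> \<Omega>" "y = F (X u)" using y by auto
    then show ?thesis using inv_into_f_f[OF inj] inv_into_f_f[OF XD(3)] GF XS by simp
  qed
  have "smooth_on_set (F ` (X ` \<Omega>)) (\<lambda>y. inv_into \<Omega> X (G y))"
  proof (rule smooth_on_set_compose[OF smooth_on_set_subset[OF G] XD(5)])
    show "F ` X ` \<Omega> \<subseteq> F ` S" using XD(6) by blast
    show "G ` F ` X ` \<Omega> \<subseteq> X ` \<Omega>" using GF XS by auto
  qed
  then have "smooth_on_set (F ` (X ` \<Omega>)) (inv_into \<Omega> (\<lambda>u. F (X u)))"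
    by (rule smooth_on_set_cong) (simp add: inv)
  moreover have "smooth_on_set \<Omega> (\<lambda>u. F (X u))"
    by (rule smooth_on_set_compose[OF XD(4) F XD(6)])
  moreover have "openin (top_of_set (F ` S)) (F ` (X ` \<Omega>))"
    by (rule homeomorphism_imp_open_map[OF hom XD(2)])
  ultimately show ?thesis
    using inj X by (simp add: parametrization_def im)
qed

lemma hypersurface_embedding_image:
  fixes M :: "'n::finite ambient set"
  assumes M: "hypersurface M" and \<phi>: "\<phi> \<in> Emb M"
  shows "hypersurface (\<phi> ` M)"
  unfolding hypersurface_def
proof
  fix y assume "y \<in> \<phi> ` M"
  then obtain p where p: "p \<in> M" "y = \<phi> p" by blast
  obtain \<Omega> and X :: "real^'n \<Rightarrow> 'n ambient" where X: "parametrization M \<Omega> X" "p \<in> X ` \<Omega>"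
    using M p unfolding hypersurface_def by blast
  have "parametrization (\<phi> ` M) \<Omega> (\<lambda>u. \<phi> (X u))"
    by (rule parametrization_diffeo_image[OF X(1) EmbD(1)[OF \<phi>] smooth_inverse_embedding[OF M \<phi>]])
      (simp add: EmbD(2)[OF \<phi>])
  then show "\<exists>\<Omega> X. parametrization (\<phi> ` M) \<Omega> X \<and> y \<in> X ` \<Omega>" using X(2) p by blast
qed

section \<open>The volume element of an embedding\<close>

lemma chart_density_cong:
  assumes X: "smooth_on_set \<Omega> X" and \<Omega>: "chart_domain \<Omega>" and u: "u \<in> \<Omega>" and eq: "\<And>v. v \<in> \<Omega> \<Longrightarrow> Y v = X v"
  shows "chart_density \<Omega> Y u = chart_density \<Omega> X u"
proof -
  have "(Y has_derivative frechet_derivative X (at u within \<Omega>)) (at u within \<Omega>)"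
    by (rule has_derivative_transform[OF u _ smooth_on_set_has_derivative[OF X u]]) (rule eq)
  then show ?thesis by (simp add: chart_density_def chart_domain_frechet[OF \<Omega> u])
qed

lemma orthonormal_frame_in: "orthonormal_frame T b \<Longrightarrow> b $ i \<in> T"
  using span_base[of "b $ i" "range (\<lambda>i. b $ i)"] by (auto simp: orthonormal_frame_def)

locale framed_hypersurface =
  fixes M :: "'n::finite ambient set" and ori :: "'n ambient \<Rightarrow> 'n frame set" and \<tau> :: "'n ambient \<Rightarrow> 'n frame"
  assumes hypersurface: "hypersurface M" and compact: "compact M" and orientation: "orientation M ori"
    and \<tau>_ori: "\<And>p. p \<in> M \<Longrightarrow> \<tau> p \<in> ori p"
begin

abbreviation \<mu> :: "'n ambient measure" where "\<mu> \<equiv> surface_measure M"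

lemma ori_frame: "p \<in> M \<Longrightarrow> b \<in> ori p \<Longrightarrow> orthonormal_frame (tangent_space M p) b"
  using orientation unfolding orientation_def by blast

lemma has_frames: "has_frames M"
  unfolding has_frames_def using ori_frame \<tau>_ori by blast

lemma surface: "is_surface_measure M \<mu>"
  by (rule is_surface_measure_surface_measure[OF hypersurface compact has_frames])

lemma borel_M: "M \<in> sets borel"
  using compact by (simp add: borel_compact)

lemma sets_\<mu>: "sets \<mu> = sets (restrict_space borel M)"
  using surface by (simp add: is_surface_measure_def)

lemma space_\<mu>: "space \<mu> = M"
  using sets_eq_imp_space_eq[OF sets_\<mu>] by (simp add: space_restrict_space)

lemma finite_\<mu>: "finite_measure \<mu>"
  by (rule finite_surface_measure[OF hypersurface compact has_frames surface])

lemma measurable_\<mu>: "continuous_on M F \<Longrightarrow> F \<in> borel_measurable \<mu>" for F :: "'n ambient \<Rightarrow> real"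
  by (rule borel_measurable_surface[OF surface])

text \<open>
  The factor by which \<open>\<psi>\<close> scales \<open>n\<close>-dimensional volume. It is defined without a frame on
  \<open>\<psi> ` M\<close>, and equals the determinant of the covariant derivative for positively oriented frames, see
  \<open>det_covariant_derivative\<close>.
\<close>
definition jac :: "('n ambient \<Rightarrow> 'n ambient) \<Rightarrow> 'n ambient \<Rightarrow> real" where
  "jac \<psi> p = sqrt (gram (\<lambda>i. tangent_map M \<psi> p (\<tau> p $ i)))"

text \<open>
  Two orthonormal bases of the same space differ by a matrix of determinant \<open>\<plusminus>1\<close>.
\<close>
lemma jac_frame:
  assumes \<psi>: "smooth_on_set M \<psi>" and p: "p \<in> M" and b: "orthonormal_frame (tangent_space M p) b"
  shows "jac \<psi> p = sqrt (gram (\<lambda>i. tangent_map M \<psi> p (b $ i)))"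
proof -
  note l = has_derivative_linear[OF tangent_map_derivative[OF \<psi> p]]
  note t = ori_frame[OF p \<tau>_ori[OF p]]
  define B where "B = (\<chi> i j. b $ i \<bullet> \<tau> p $ j)"
  have \<tau>: "\<tau> p $ j = (\<Sum>i\<in>UNIV. B $ i $ j *\<^sub>R b $ i)" for j
  proof -
    have "\<tau> p $ j \<in> tangent_space M p" by (rule orthonormal_frame_in[OF t])
    from orthonormal_frame_expansion[OF b this] show ?thesis by (simp add: B_def)
  qed
  have "gram (\<lambda>j. \<tau> p $ j) = (det B)\<^sup>2 * gram (\<lambda>i. b $ i)"
    by (rule gram_linear_combination) (rule \<tau>)
  moreover have "gram (\<lambda>j. \<tau> p $ j) = 1" "gram (\<lambda>i. b $ i) = 1"
    using t b by (auto simp: orthonormal_frame_def intro!: gram_orthonormal)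
  ultimately have "\<bar>det B\<bar> = 1" by (simp add: power2_eq_1_iff abs_eq_iff')
  moreover have "tangent_map M \<psi> p (\<tau> p $ j) = (\<Sum>i\<in>UNIV. B $ i $ j *\<^sub>R tangent_map M \<psi> p (b $ i))" for j
    unfolding \<tau>[of j] by (simp add: linear_sum[OF l] linear_scale[OF l])
  ultimately show ?thesis
    unfolding jac_def using sqrt_gram_linear_combination[of "\<lambda>j. tangent_map M \<psi> p (\<tau> p $ j)" B] by simp
qed

lemma chart_density_compose:
  assumes \<psi>: "smooth_on_set M \<psi>" and X: "parametrization M \<Omega> X" and u: "u \<in> \<Omega>"
  shows "chart_density \<Omega> (\<lambda>u. \<psi> (X u)) u = jac \<psi> (X u) * chart_density \<Omega> X u"
proof -
  note XD = parametrizationD[OF X]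
  have p: "X u \<in> M" using XD(6) u by blast
  note t = ori_frame[OF p \<tau>_ori[OF p]]
  let ?D = "frechet_derivative X (at u within \<Omega>)"
  let ?A = "\<chi> i j. \<tau> (X u) $ i \<bullet> ?D (axis j 1)"
  have D: "(X has_derivative ?D) (at u within \<Omega>)" by (rule smooth_on_set_has_derivative[OF XD(4) u])
  note T = tangent_map_derivative[OF \<psi> p]
  note l = has_derivative_linear[OF T]
  have "((\<lambda>u. \<psi> (X u)) has_derivative (\<lambda>v. tangent_map M \<psi> (X u) (?D v))) (at u within \<Omega>)"
    by (rule has_derivative_in_compose[OF D has_derivative_subset[OF T XD(6)]])
  then have DY: "frechet_derivative (\<lambda>u. \<psi> (X u)) (at u within \<Omega>) = (\<lambda>v. tangent_map M \<psi> (X u) (?D v))"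
    by (rule chart_domain_frechet[OF XD(1) u])
  have "tangent_map M \<psi> (X u) (?D (axis j 1)) = (\<Sum>i\<in>UNIV. ?A $ i $ j *\<^sub>R tangent_map M \<psi> (X u) (\<tau> (X u) $ i))" for j
    using arg_cong[OF orthonormal_frame_expansion[OF t chart_velocity_tangent[OF X u, of j]], of "tangent_map M \<psi> (X u)"]
    by (simp add: linear_sum[OF l] linear_scale[OF l])
  then have "chart_density \<Omega> (\<lambda>u. \<psi> (X u)) u = \<bar>det ?A\<bar> * jac \<psi> (X u)"
    unfolding chart_density_def DY jac_def by (rule sqrt_gram_linear_combination)
  then show ?thesis by (simp add: chart_density_frame[OF X u t])
qed

text \<open>
  The frame \<open>\<tau>\<close> need not be continuous. By \<open>jac_frame\<close> it can be replaced locally by the smooth frames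
  that realize the orientation.
\<close>
lemma continuous_on_jac:
  assumes \<psi>: "smooth_on_set M \<psi>"
  shows "continuous_on M (jac \<psi>)"
  unfolding continuous_on_eq_continuous_within
proof
  fix p assume p: "p \<in> M"
  have "\<forall>p\<in>M. \<exists>U b. open U \<and> p \<in> U \<and> smooth_on_set (M \<inter> U) b \<and> (\<forall>q\<in>M \<inter> U. b q \<in> ori q)"
    using orientation by (simp add: orientation_def)
  from bspec[OF this p] obtain U b where b: "open U" "p \<in> U" "smooth_on_set (M \<inter> U) b" "\<forall>q\<in>M \<inter> U. b q \<in> ori q"
    by (elim exE conjE)
  obtain P \<Psi> where \<Psi>: "open P" "p \<in> P" "smooth_on_open P \<Psi>" "\<And>p. p \<in> M \<Longrightarrow> p \<in> P \<Longrightarrow> \<Psi> p = \<psi> p"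
    by (rule smooth_on_setE[OF \<psi> p]) blast
  define N where "N = M \<inter> (U \<inter> P)"
  have cb: "continuous_on N b"
    by (rule continuous_on_subset[OF smooth_on_set_continuous[OF b(3)]]) (auto simp: N_def)
  have eq: "jac \<psi> q = sqrt (gram (\<lambda>i. \<Sum>e\<in>Basis. (b q $ i \<bullet> e) *\<^sub>R frechet_derivative \<Psi> (at q) e))" if q: "q \<in> N" for q
  proof -
    have qM: "q \<in> M" "q \<in> U" "q \<in> P" using q by (auto simp: N_def)
    have fb: "orthonormal_frame (tangent_space M q) (b q)" using ori_frame b(4) qM by blast
    have "tangent_map M \<psi> q (b q $ i) = frechet_derivative \<Psi> (at q) (b q $ i)" for i
    proof (rule tangent_map_eq[OF has_derivative_of_extension[OF \<Psi>(1) qM(3) \<Psi>(3,4) qM(1)]])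
      show "b q $ i \<in> tangent_space M q" by (rule orthonormal_frame_in[OF fb])
    qed
    also have "\<And>i. frechet_derivative \<Psi> (at q) (b q $ i) = (\<Sum>e\<in>Basis. (b q $ i \<bullet> e) *\<^sub>R frechet_derivative \<Psi> (at q) e)"
      by (rule linear_basis_expansion[OF has_derivative_linear[OF smooth_on_open_has_derivative[OF \<Psi>(3) qM(3)]]])
    finally show ?thesis by (simp add: jac_frame[OF \<psi> qM(1) fb])
  qed
  have "continuous_on N (\<lambda>q. sqrt (gram (\<lambda>i. \<Sum>e\<in>Basis. (b q $ i \<bullet> e) *\<^sub>R frechet_derivative \<Psi> (at q) e)))"
  proof -
    have c: "continuous_on N (\<lambda>q. \<Sum>e\<in>Basis. (b q $ i \<bullet> e) *\<^sub>R frechet_derivative \<Psi> (at q) e)" for i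
    proof (intro continuous_on_sum continuous_on_scaleR continuous_on_inner continuous_on_const)
      show "continuous_on N (\<lambda>q. b q $ i)" by (rule bounded_linear.continuous_on[OF bounded_linear_vec_nth cb])
      show "continuous_on N (\<lambda>q. frechet_derivative \<Psi> (at q) e)" for e
        by (rule continuous_on_subset[OF smooth_on_open_continuous[OF smooth_on_open_frechet[OF \<Psi>(3)]]]) (auto simp: N_def)
    qed
    show ?thesis
      unfolding gram_def det_def
      by (intro continuous_on_real_sqrt continuous_on_sum continuous_on_mult continuous_on_const continuous_on_prod)
         (simp, intro continuous_on_inner c)
  qed
  then have "continuous_on N (jac \<psi>)" by (rule continuous_on_eq) (simp add: eq)
  moreover have pN: "p \<in> N" using p b(2) \<Psi>(2) by (simp add: N_def)
  ultimately have "continuous (at p within N) (jac \<psi>)" by (simp add: continuous_on_eq_continuous_within)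
  moreover have "at p within N = at p within M"
    by (rule at_within_nhd[of p "U \<inter> P"]) (use b(1,2) \<Psi>(1,2) in \<open>auto simp: N_def\<close>)
  ultimately show "continuous (at p within M) (jac \<psi>)" by (simp add: continuous_within)
qed

text \<open>
  The determinant is \<open>\<plusminus>jac \<psi> p\<close>. The orientation of the image is transported through some frame
  \<open>b\<close> in \<open>ori p\<close>, which differs from \<open>\<tau> p\<close> by a matrix of positive determinant, and this fixes the sign.
\<close>
lemma det_covariant_derivative:
  assumes \<psi>: "\<psi> \<in> Emb M" and p: "p \<in> M" and c: "c \<in> transported_orientation M ori \<psi> (\<psi> p)"
  shows "det (covariant_derivative M \<psi> (\<tau> p) c p) = jac \<psi> p" "jac \<psi> p > 0"
proof -
  note E = EmbD[OF \<psi>]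
  note T = tangent_map_derivative[OF E(1) p]
  note l = has_derivative_linear[OF T]
  note t = ori_frame[OF p \<tau>_ori[OF p]]
  define D where "D v = tangent_map M \<psi> p v" for v
  have inv: "inv_into M \<psi> (\<psi> p) = p" using E(2) p by simp
  have cf: "orthonormal_frame (tangent_space (\<psi> ` M) (\<psi> p)) c"
    using c by (simp add: transported_orientation_def)
  obtain b where b: "b \<in> ori p" "det (\<chi> i j. D (b $ j) \<bullet> c $ i) > 0"
    using c by (auto simp: transported_orientation_def inv D_def)
  define C where "C = covariant_derivative M \<psi> (\<tau> p) c p"
  have Cij: "C $ i $ j = D (\<tau> p $ j) \<bullet> c $ i" for i j by (simp add: C_def covariant_derivative_def D_def)
  have Dt: "D v \<in> tangent_space (\<psi> ` M) (\<psi> p)" if "v \<in> tangent_space M p" for v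
    unfolding D_def by (rule tangent_derivative_image[OF T _ that]) simp
  have frame_in: "e $ j \<in> tangent_space M p" if "orthonormal_frame (tangent_space M p) e" for e :: "'n frame" and j
    by (rule orthonormal_frame_in[OF that])
  have "D (\<tau> p $ j) = (\<Sum>i\<in>UNIV. C $ i $ j *\<^sub>R c $ i)" for j
    using orthonormal_frame_expansion[OF cf Dt[OF frame_in[OF t]], of j] by (simp add: Cij inner_commute)
  then have "jac \<psi> p = \<bar>det C\<bar> * sqrt (gram (\<lambda>i. c $ i))"
    unfolding jac_def D_def[symmetric] by (rule sqrt_gram_linear_combination)
  moreover have "gram (\<lambda>i. c $ i) = 1"
    by (rule gram_orthonormal) (use cf in \<open>auto simp: orthonormal_frame_def\<close>)
  ultimately have jac: "jac \<psi> p = \<bar>det C\<bar>" by simp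
  define B where "B = (\<chi> i j. b $ j \<bullet> \<tau> p $ i)"
  have "\<tau> p \<in> {c. orthonormal_frame (tangent_space M p) c \<and> det (\<chi> i j. b $ j \<bullet> c $ i) > 0}"
    using orientation \<tau>_ori[OF p] b(1) p unfolding orientation_def by blast
  then have Bpos: "det B > 0" by (simp add: B_def)
  have "(\<chi> i j. D (b $ j) \<bullet> c $ i) = C ** B"
  proof -
    have Db: "D (b $ j) = (\<Sum>k\<in>UNIV. B $ k $ j *\<^sub>R D (\<tau> p $ k))" for j
      using arg_cong[OF orthonormal_frame_expansion[OF t frame_in[OF ori_frame[OF p b(1)]], of j], of D] l
      by (simp add: D_def B_def linear_sum linear_scale inner_commute)
    have "D (b $ j) \<bullet> c $ i = (\<Sum>k\<in>UNIV. C $ i $ k * B $ k $ j)" for i j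
      unfolding Db[of j] by (simp add: inner_sum_left Cij mult.commute)
    then show ?thesis by (simp add: vec_eq_iff[where 'b='n] matrix_matrix_mult_def)
  qed
  then have "det C * det B > 0" using b(2) by (simp add: det_mul)
  then have Cpos: "det C > 0" using Bpos by (simp add: zero_less_mult_iff)
  show "det (covariant_derivative M \<psi> (\<tau> p) c p) = jac \<psi> p" "jac \<psi> p > 0"
    using jac Cpos by (simp_all add: C_def)
qed

text \<open>
  The right-hand side has the values in charts that characterize the surface measure: a chart of
  \<open>\<psi> ` M\<close> is \<open>\<psi>\<close> after a chart of \<open>M\<close>, and \<open>jac \<psi>\<close> is the ratio of their densities.
\<close>
lemma surface_measure_image:
  assumes \<psi>: "\<psi> \<in> Emb M" and jac: "\<And>p. p \<in> M \<Longrightarrow> jac \<psi> p > 0"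
  shows "surface_measure (\<psi> ` M) = distr (density \<mu> (\<lambda>p. ennreal (jac \<psi> p))) (restrict_space borel (\<psi> ` M)) \<psi>"
    "\<psi> \<in> measurable \<mu> (restrict_space borel (\<psi> ` M))"
proof -
  note E = EmbD[OF \<psi>]
  let ?R = "restrict_space borel (\<psi> ` M) :: 'n ambient measure"
  define \<nu> where "\<nu> = distr (density \<mu> (\<lambda>p. ennreal (jac \<psi> p))) ?R \<psi>"
  have cM: "compact (\<psi> ` M)" by (rule compact_continuous_image[OF smooth_on_set_continuous[OF E(1)] compact])
  have "\<psi> \<in> borel_measurable \<mu>"
    unfolding measurable_cong_sets[OF sets_\<mu> refl]
    by (rule borel_measurable_continuous_on_restrict[OF smooth_on_set_continuous[OF E(1)]])
  then show meas: "\<psi> \<in> measurable \<mu> ?R"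
    by (rule measurable_restrict_space2[rotated]) (auto simp: space_\<mu>)
  have jm: "jac \<psi> \<in> borel_measurable \<mu>" by (rule measurable_\<mu>[OF continuous_on_jac[OF E(1)]])
  have "is_surface_measure (\<psi> ` M) \<nu>"
    unfolding is_surface_measure_def
  proof (intro conjI allI impI ballI)
    show "sets \<nu> = sets ?R" by (simp add: \<nu>_def)
    fix \<Omega> and Y :: "real^'n \<Rightarrow> 'n ambient" and A
    assume Y: "parametrization (\<psi> ` M) \<Omega> Y" and A: "A \<in> sets borel" "A \<subseteq> \<Omega>"
    note YD = parametrizationD[OF Y]
    define X where "X u = inv_into M \<psi> (Y u)" for u
    have inv: "inv_into M \<psi> ` (\<psi> ` M) = M" using E(2) by (simp add: inv_into_image_cancel)
    have X: "parametrization M \<Omega> X"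
      using parametrization_diffeo_image[OF Y smooth_inverse_embedding[OF hypersurface \<psi>], of \<psi>] E(1)
      by (simp add: inv X_def[abs_def] f_inv_into_f)
    note XD = parametrizationD[OF X]
    have YX: "\<psi> (X u) = Y u" if "u \<in> \<Omega>" for u
      unfolding X_def by (rule f_inv_into_f) (use YD(6) that in blast)
    have XM: "X u \<in> M" if "u \<in> \<Omega>" for u using XD(6) that by blast
    have YA: "Y ` A \<in> sets ?R"
      using parametrization_image_borel[OF Y _ A] cM YD(6) A(2)
      by (auto simp: sets_restrict_space_iff borel_compact)
    have XA: "X ` A \<in> sets \<mu>"
      using parametrization_image_borel[OF X borel_M A] XD(6) A(2) borel_M
      by (auto simp: sets_\<mu> sets_restrict_space_iff)
    have YXA: "\<psi> p \<in> Y ` A \<longleftrightarrow> p \<in> X ` A" if "p \<in> M" for p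
    proof -
      have "\<psi> p = Y u \<longleftrightarrow> p = X u" if "u \<in> A" for u
        using YX[of u] XM[of u] A(2) that \<open>p \<in> M\<close> E(2) by (metis inj_on_eq_iff subsetD)
      then show ?thesis by (auto simp: image_iff)
    qed
    have "emeasure \<nu> (Y ` A) = (\<integral>\<^sup>+y. indicator (Y ` A) y \<partial>\<nu>)"
      using YA by (simp add: \<nu>_def)
    also have "\<dots> = (\<integral>\<^sup>+p. indicator (Y ` A) (\<psi> p) \<partial>density \<mu> (\<lambda>p. ennreal (jac \<psi> p)))"
      unfolding \<nu>_def by (rule nn_integral_distr) (use meas YA in simp_all)
    also have "\<dots> = (\<integral>\<^sup>+p. ennreal (jac \<psi> p) * indicator (Y ` A) (\<psi> p) \<partial>\<mu>)"
      by (rule nn_integral_density)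
         (use jm measurable_compose[OF meas borel_measurable_indicator[OF YA]] in simp_all)
    also have "\<dots> = (\<integral>\<^sup>+p\<in>X ` \<Omega>. ennreal (jac \<psi> p) * indicator (X ` A) p \<partial>\<mu>)"
      by (rule nn_integral_cong) (use YXA A(2) in \<open>auto simp: space_\<mu> indicator_def\<close>)
    also have "\<dots> = (\<integral>\<^sup>+u\<in>\<Omega>. ennreal (chart_density \<Omega> X u) * (ennreal (jac \<psi> (X u)) * indicator (X ` A) (X u)) \<partial>lborel)"
      by (rule nn_integral_surface_chart[OF borel_M surface X]) (use jm XA in simp)
    also have "\<dots> = (\<integral>\<^sup>+u\<in>A. ennreal (chart_density \<Omega> Y u) \<partial>lborel)"
    proof (rule nn_integral_cong)
      fix u
      have XuA: "X u \<in> X ` A \<longleftrightarrow> u \<in> A" if "u \<in> \<Omega>" using XD(3) A(2) that by (auto simp: inj_on_def)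
      have "chart_density \<Omega> Y u = jac \<psi> (X u) * chart_density \<Omega> X u" if u: "u \<in> \<Omega>"
        using chart_density_compose[OF E(1) X u] chart_density_cong[OF YD(4,1) u, of "\<lambda>u. \<psi> (X u)"] YX by simp
      then show "ennreal (chart_density \<Omega> X u) * (ennreal (jac \<psi> (X u)) * indicator (X ` A) (X u)) * indicator \<Omega> u =
         ennreal (chart_density \<Omega> Y u) * indicator A u"
        using XuA A(2) jac[OF XM, of u] chart_density_nonneg[OF has_frames X, of u]
        by (cases "u \<in> \<Omega>") (auto simp: indicator_def ennreal_mult' mult.commute)
    qed
    finally show "emeasure \<nu> (Y ` A) = (\<integral>\<^sup>+u\<in>A. ennreal (chart_density \<Omega> Y u) \<partial>lborel)" .
  qed
  then show "surface_measure (\<psi> ` M) = \<nu>"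
    by (rule surface_measure_eqI[OF hypersurface_embedding_image[OF hypersurface \<psi>] cM])
qed

lemma integral_surface_image:
  fixes H :: "'n ambient \<Rightarrow> real"
  assumes \<psi>: "\<psi> \<in> Emb M" and jac: "\<And>p. p \<in> M \<Longrightarrow> jac \<psi> p > 0" and H: "continuous_on (\<psi> ` M) H"
  shows "(\<integral>x. H x \<partial>surface_measure (\<psi> ` M)) = (\<integral>p. jac \<psi> p * H (\<psi> p) \<partial>\<mu>)"
proof -
  note E = EmbD[OF \<psi>]
  have s: "surface_measure (\<psi> ` M) = distr (density \<mu> (\<lambda>p. ennreal (jac \<psi> p))) (restrict_space borel (\<psi> ` M)) \<psi>"
    "\<psi> \<in> measurable \<mu> (restrict_space borel (\<psi> ` M))"
    by (rule surface_measure_image[OF \<psi>], rule jac, assumption)+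
  have jm: "jac \<psi> \<in> borel_measurable \<mu>" by (rule measurable_\<mu>[OF continuous_on_jac[OF E(1)]])
  have Hm: "H \<in> borel_measurable (restrict_space borel (\<psi> ` M))"
    by (rule borel_measurable_continuous_on_restrict[OF H])
  have "(\<integral>x. H x \<partial>surface_measure (\<psi> ` M)) = (\<integral>p. H (\<psi> p) \<partial>density \<mu> (\<lambda>p. ennreal (jac \<psi> p)))"
    unfolding s(1) by (rule integral_distr) (use s(2) Hm in simp_all)
  also have "\<dots> = (\<integral>p. jac \<psi> p *\<^sub>R H (\<psi> p) \<partial>\<mu>)"
    by (rule integral_density) (use jm measurable_compose[OF s(2) Hm] jac in \<open>auto simp: space_\<mu> less_imp_le intro!: AE_I2\<close>)
  finally show ?thesis by simp
qed

end

section \<open>Isotopies of the ambient space\<close>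

lemma smooth_Pair:
  assumes U: "open U" and F: "smooth_on_open U F" and G: "smooth_on_open U G"
  shows "smooth_on_open U (\<lambda>x. (F x, G x))"
proof -
  have "smooth_on_open U (\<lambda>x. (F x, 0) + (0, G x))"
    by (intro smooth_add[OF U] smooth_comp_linear[OF U, of "\<lambda>y. (y, 0)"] smooth_comp_linear[OF U, of "\<lambda>y. (0, y)"] F G
        bounded_linear_Pair bounded_linear_ident bounded_linear_zero)
  then show ?thesis by simp
qed

lemma norm_linear_bound:
  fixes L :: "'a::euclidean_space \<Rightarrow> 'b::real_normed_vector"
  assumes "linear L"
  shows "norm (L v) \<le> (\<Sum>b\<in>Basis. norm (L b)) * norm v"
proof -
  have "norm (L v) \<le> (\<Sum>b\<in>Basis. norm ((v \<bullet> b) *\<^sub>R L b))"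
    unfolding linear_basis_expansion[OF assms, of v] by (rule norm_sum)
  also have "\<dots> \<le> (\<Sum>b\<in>Basis. norm (L b) * norm v)"
    by (rule sum_mono) (metis Basis_le_norm mult.commute mult_right_mono norm_ge_zero norm_scaleR)
  finally show ?thesis by (simp add: sum_distrib_right)
qed

text \<open>
  The derivative of \<open>x \<mapsto> \<Theta> (t, x) - x\<close> is zero at \<open>t = 0\<close>. By uniform continuity on a compact set it
  stays small on a ball for small \<open>t\<close>.
\<close>
lemma isotopy_near_identity:
  fixes \<Theta> :: "real \<times> 'a::euclidean_space \<Rightarrow> 'a"
  assumes \<delta>: "\<delta> > 0" and \<Theta>: "smooth_on_open ({-\<delta><..<\<delta>} \<times> UNIV) \<Theta>" and id: "\<And>x. \<Theta> (0, x) = x"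
  obtains \<epsilon> where "\<epsilon> > 0" "\<epsilon> < \<delta>"
    "\<And>t x y. t \<in> {0..\<epsilon>} \<Longrightarrow> x \<in> ball 0 R \<Longrightarrow> y \<in> ball 0 R \<Longrightarrow>
      norm ((\<Theta> (t, x) - x) - (\<Theta> (t, y) - y)) \<le> 1/2 * norm (x - y)"
proof -
  define W where "W = {-\<delta><..<\<delta>} \<times> (UNIV :: 'a set)"
  have W: "open W" by (simp add: W_def open_Times)
  have der: "(\<Theta> has_derivative frechet_derivative \<Theta> (at z)) (at z)" if "z \<in> W" for z
    by (rule smooth_on_open_has_derivative[OF \<Theta>[folded W_def] that])
  define A where "A b z = frechet_derivative \<Theta> (at z) (0, b) - b" for b z
  define S where "S z = (\<Sum>b\<in>Basis. norm (A b z))" for z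
  have cont: "continuous_on W S"
    unfolding S_def A_def
    by (intro continuous_on_sum continuous_on_norm continuous_on_diff continuous_on_const
        smooth_on_open_continuous[OF smooth_on_open_frechet[OF \<Theta>[folded W_def]]])
  have dx: "((\<lambda>x. \<Theta> (t, x) - x) has_derivative (\<lambda>v. frechet_derivative \<Theta> (at (t, x)) (0, v) - v)) (at x)"
    if "(t, x) \<in> W" for t x
  proof -
    have "((\<lambda>x. (t, x)) has_derivative (\<lambda>v. (0, v))) (at x)" by (auto intro!: derivative_eq_intros)
    from has_derivative_compose[OF this der[OF that]]
    have "((\<lambda>x. \<Theta> (t, x)) has_derivative (\<lambda>v. frechet_derivative \<Theta> (at (t, x)) (0, v))) (at x)" .
    then show ?thesis by (rule has_derivative_diff) (rule has_derivative_ident)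
  qed
  have S0: "S (0, x) = 0" for x
  proof -
    have in_W: "(0, x) \<in> W" using \<delta> by (simp add: W_def)
    have "((\<lambda>x. 0) has_derivative (\<lambda>v. frechet_derivative \<Theta> (at (0, x)) (0, v) - v)) (at x)"
      using dx[OF in_W] by (simp add: id)
    then have "(\<lambda>v. frechet_derivative \<Theta> (at (0, x)) (0, v) - v) = (\<lambda>v. 0)"
      using has_derivative_unique[OF _ has_derivative_const] by blast
    then have "frechet_derivative \<Theta> (at (0, x)) (0, v) - v = 0" for v by metis
    then show ?thesis by (simp add: S_def A_def)
  qed
  define K where "K = {0..\<delta>/2} \<times> cball (0::'a) R"
  have "K \<subseteq> W" using \<delta> by (auto simp: K_def W_def)
  have "compact K" unfolding K_def by (intro compact_Times compact_Icc compact_cball)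
  then have "uniformly_continuous_on K S"
    using compact_uniformly_continuous continuous_on_subset[OF cont \<open>K \<subseteq> W\<close>] by blast
  then obtain \<eta> where \<eta>: "\<eta> > 0" "\<And>z z'. z \<in> K \<Longrightarrow> z' \<in> K \<Longrightarrow> dist z' z < \<eta> \<Longrightarrow> dist (S z') (S z) < 1/2"
    unfolding uniformly_continuous_on_def by (metis half_gt_zero zero_less_one)
  define \<epsilon> where "\<epsilon> = min (\<delta>/2) (\<eta>/2)"
  have small: "S (t, x) \<le> 1/2" if "t \<in> {0..\<epsilon>}" "x \<in> ball 0 R" for t x
  proof -
    have "dist (t, x) (0, x) < \<eta>" using that \<eta>(1) by (simp add: dist_Pair_Pair \<epsilon>_def)
    moreover have "(t, x) \<in> K" "(0, x) \<in> K" using that \<delta> by (auto simp: K_def \<epsilon>_def)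
    ultimately have "dist (S (t, x)) (S (0, x)) < 1/2" using \<eta>(2) by blast
    then show ?thesis by (simp add: S0 dist_real_def)
  qed
  show thesis
  proof (rule that[of \<epsilon>])
    show "\<epsilon> > 0" "\<epsilon> < \<delta>" using \<delta> \<eta>(1) by (auto simp: \<epsilon>_def)
    fix t and x y :: 'a
    assume t: "t \<in> {0..\<epsilon>}" and xy: "x \<in> ball 0 R" "y \<in> ball 0 R"
    show "norm ((\<Theta> (t, x) - x) - (\<Theta> (t, y) - y)) \<le> 1/2 * norm (x - y)"
    proof (rule differentiable_bound[OF convex_ball _ _ xy])
      fix z :: 'a assume z: "z \<in> ball 0 R"
      have zW: "(t, z) \<in> W" using t \<delta> by (auto simp: W_def \<epsilon>_def)
      show d: "((\<lambda>x. \<Theta> (t, x) - x) has_derivative (\<lambda>v. frechet_derivative \<Theta> (at (t, z)) (0, v) - v)) (at z within ball 0 R)"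
        by (rule has_derivative_at_withinI[OF dx[OF zW]])
      show "onorm (\<lambda>v. frechet_derivative \<Theta> (at (t, z)) (0, v) - v) \<le> 1/2"
      proof (rule onorm_le)
        fix v
        have "norm (frechet_derivative \<Theta> (at (t, z)) (0, v) - v) \<le> S (t, z) * norm v"
          using norm_linear_bound[OF has_derivative_linear[OF d], of v] by (simp add: S_def A_def)
        also have "\<dots> \<le> 1/2 * norm v" using small[OF t z] by (intro mult_right_mono) auto
        finally show "norm (frechet_derivative \<Theta> (at (t, z)) (0, v) - v) \<le> 1/2 * norm v" .
      qed
    qed
  qed
qed

text \<open>
  If \<open>\<Theta>\<close> differs from the identity by a map with Lipschitz constant \<open>1/2\<close>, then neither \<open>\<Theta>\<close> nor
  its derivatives can identify two points. By compactness of \<open>M\<close> an injective immersion is an embedding.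
\<close>
lemma near_identity_embedding:
  fixes M :: "'n::finite ambient set"
  assumes M: "compact M" and \<phi>: "\<phi> \<in> Emb_bd M" and U: "open U" "\<phi> ` M \<subseteq> U" and \<Theta>: "smooth_on_open U \<Theta>"
    and lip: "\<And>x y. x \<in> U \<Longrightarrow> y \<in> U \<Longrightarrow> norm ((\<Theta> x - x) - (\<Theta> y - y)) \<le> 1/2 * norm (x - y)"
    and bd: "\<And>p. p \<in> manifold_boundary M \<Longrightarrow> \<Theta> p = p"
  shows "(\<lambda>p\<in>M. \<Theta> (\<phi> p)) \<in> Emb_bd M"
    "\<And>p v. p \<in> M \<Longrightarrow> v \<in> tangent_space M p \<Longrightarrow>
      tangent_map M (\<lambda>p\<in>M. \<Theta> (\<phi> p)) p v = frechet_derivative \<Theta> (at (\<phi> p)) (tangent_map M \<phi> p v)"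
proof -
  have \<phi>E: "\<phi> \<in> Emb M" and \<phi>bd: "\<And>p. p \<in> manifold_boundary M \<Longrightarrow> \<phi> p = p"
    using \<phi> by (auto simp: Emb_bd_def)
  note E = EmbD[OF \<phi>E]
  let ?\<psi> = "\<lambda>p\<in>M. \<Theta> (\<phi> p)"
  have inj: "x = y" if xy: "x \<in> U" "y \<in> U" "\<Theta> x = \<Theta> y" for x y
  proof -
    have "norm (y - x) \<le> 1/2 * norm (x - y)" using lip[OF xy(1,2)] xy(3) by simp
    then show ?thesis by (simp add: norm_minus_commute)
  qed
  have D0: "v = 0" if x: "x \<in> U" and v: "frechet_derivative \<Theta> (at x) v = 0" for x v
  proof -
    have der: "(\<Theta> has_derivative frechet_derivative \<Theta> (at x)) (at x)"
      by (rule smooth_on_open_has_derivative[OF \<Theta> x])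
    have "((\<lambda>y. (\<Theta> y - y) \<bullet> v) has_derivative (\<lambda>w. (frechet_derivative \<Theta> (at x) w - w) \<bullet> v)) (at (x + 0 *\<^sub>R v))"
      using has_derivative_inner_left[OF has_derivative_diff[OF der has_derivative_ident]] by simp
    from has_real_derivative_along_line[OF this]
    have lim: "((\<lambda>s. ((\<Theta> (x + s *\<^sub>R v) - (x + s *\<^sub>R v)) \<bullet> v - (\<Theta> x - x) \<bullet> v) / s) \<longlongrightarrow> - (v \<bullet> v)) (at 0)"
      by (simp add: DERIV_def v)
    have "eventually (\<lambda>s. x + s *\<^sub>R v \<in> U) (at (0::real))"
    proof -
      have "((\<lambda>s. x + s *\<^sub>R v) \<longlongrightarrow> x + 0 *\<^sub>R v) (at (0::real))" by (intro tendsto_intros)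
      then show ?thesis using U(1) x by (intro topological_tendstoD) auto
    qed
    then have "eventually (\<lambda>s. norm (((\<Theta> (x + s *\<^sub>R v) - (x + s *\<^sub>R v)) \<bullet> v - (\<Theta> x - x) \<bullet> v) / s) \<le> 1/2 * (v \<bullet> v)) (at (0::real))"
      unfolding eventually_at_filter
    proof (eventually_elim, safe)
      fix s :: real assume s: "s \<noteq> 0" "x + s *\<^sub>R v \<in> U"
      define z where "z = (\<Theta> (x + s *\<^sub>R v) - (x + s *\<^sub>R v)) - (\<Theta> x - x)"
      have "norm z * norm v \<le> (1/2 * norm (s *\<^sub>R v)) * norm v"
        using lip[OF s(2) x] by (intro mult_right_mono) (simp_all add: z_def)
      then have "\<bar>z \<bullet> v\<bar> \<le> \<bar>s\<bar> * (1/2 * (v \<bullet> v))"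
        using Cauchy_Schwarz_ineq2[of z v] by (simp add: dot_square_norm power2_eq_square)
      then have "\<bar>z \<bullet> v\<bar> / \<bar>s\<bar> \<le> 1/2 * (v \<bullet> v)" using s(1) by (simp add: pos_divide_le_eq mult.commute)
      then show "norm (((\<Theta> (x + s *\<^sub>R v) - (x + s *\<^sub>R v)) \<bullet> v - (\<Theta> x - x) \<bullet> v) / s) \<le> 1/2 * (v \<bullet> v)"
        unfolding inner_diff_left[symmetric] z_def[symmetric] by (simp add: abs_divide)
    qed
    from Lim_norm_ubound[OF _ lim this] have "v \<bullet> v \<le> 1/2 * (v \<bullet> v)" by simp
    moreover have "v \<bullet> v \<ge> 0" by simp
    ultimately have "v \<bullet> v = 0" by linarith
    then show "v = 0" by simp
  qed
  have smooth: "smooth_on_set M (\<lambda>p. \<Theta> (\<phi> p))"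
    by (rule smooth_on_set_compose[OF E(1) smooth_on_setI_open[OF U(1) \<Theta> order_refl] U(2)])
  have s\<psi>: "smooth_on_set M ?\<psi>" by (rule smooth_on_set_cong[OF smooth]) simp
  show tm: "tangent_map M ?\<psi> p v = frechet_derivative \<Theta> (at (\<phi> p)) (tangent_map M \<phi> p v)"
    if p: "p \<in> M" and v: "v \<in> tangent_space M p" for p v
  proof (rule tangent_map_eq[OF _ v])
    have "\<phi> p \<in> U" using U(2) p by blast
    then have "(\<Theta> has_derivative frechet_derivative \<Theta> (at (\<phi> p))) (at (\<phi> p) within \<phi> ` M)"
      by (rule has_derivative_at_withinI[OF smooth_on_open_has_derivative[OF \<Theta>]])
    from has_derivative_in_compose[OF tangent_map_derivative[OF E(1) p] this]
    show "(?\<psi> has_derivative (\<lambda>v. frechet_derivative \<Theta> (at (\<phi> p)) (tangent_map M \<phi> p v))) (at p within M)"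
      by (rule has_derivative_transform[OF p, rotated]) simp
  qed
  have "?\<psi> \<in> Emb M"
  proof (rule EmbI[OF M _ s\<psi>])
    show "?\<psi> \<in> extensional M" by simp
    show "inj_on ?\<psi> M"
    proof (rule inj_onI)
      fix p q assume pq: "p \<in> M" "q \<in> M" "?\<psi> p = ?\<psi> q"
      then have "\<phi> p = \<phi> q" using inj[of "\<phi> p" "\<phi> q"] U(2) by auto
      then show "p = q" using E(2) pq(1,2) by (simp add: inj_on_def)
    qed
    fix p assume p: "p \<in> M"
    have pU: "\<phi> p \<in> U" using U(2) p by blast
    have l\<Theta>: "linear (frechet_derivative \<Theta> (at (\<phi> p)))"
      by (rule has_derivative_linear[OF smooth_on_open_has_derivative[OF \<Theta> pU]])
    show "inj_on (tangent_map M ?\<psi> p) (tangent_space M p)"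
    proof (rule inj_onI)
      fix v w assume vw: "v \<in> tangent_space M p" "w \<in> tangent_space M p" "tangent_map M ?\<psi> p v = tangent_map M ?\<psi> p w"
      then have "frechet_derivative \<Theta> (at (\<phi> p)) (tangent_map M \<phi> p v - tangent_map M \<phi> p w) = 0"
        using tm[OF p] by (simp add: linear_diff[OF l\<Theta>])
      then have "tangent_map M \<phi> p v = tangent_map M \<phi> p w" using D0[OF pU] by fastforce
      then show "v = w" using E(4)[OF p] vw(1,2) by (meson inj_onD)
    qed
  qed
  moreover have "\<forall>p\<in>manifold_boundary M. ?\<psi> p = p"
    using \<phi>bd bd by (auto simp: manifold_boundary_def)
  ultimately show "?\<psi> \<in> Emb_bd M" by (simp add: Emb_bd_def)
qed

text \<open>
  Composition with an isotopy produces curves of the kind that \<open>materially_differentiable\<close>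
  quantifies over.
\<close>
lemma isotopy_curve:
  fixes M :: "'n::finite ambient set" and \<Theta> :: "real \<times> 'n ambient \<Rightarrow> 'n ambient"
  assumes M: "compact M" and \<phi>: "\<phi> \<in> Emb_bd M"
    and \<delta>: "\<delta> > 0" and \<Theta>: "smooth_on_open ({-\<delta><..<\<delta>} \<times> UNIV) \<Theta>" and id: "\<And>x. \<Theta> (0, x) = x"
    and bd: "\<And>t p. t \<in> {0..<\<delta>} \<Longrightarrow> p \<in> manifold_boundary M \<Longrightarrow> \<Theta> (t, p) = p"
  obtains \<epsilon> where "\<epsilon> > 0" "\<epsilon> < \<delta>" "\<And>t. t \<in> {0..\<epsilon>} \<Longrightarrow> (\<lambda>p\<in>M. \<Theta> (t, \<phi> p)) \<in> Emb_bd M"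
    "smooth_on_set ({0..\<epsilon>} \<times> M) (\<lambda>(t, p). (\<lambda>p\<in>M. \<Theta> (t, \<phi> p)) p)"
    "\<And>t p v. t \<in> {0..\<epsilon>} \<Longrightarrow> p \<in> M \<Longrightarrow> v \<in> tangent_space M p \<Longrightarrow>
      tangent_map M (\<lambda>p\<in>M. \<Theta> (t, \<phi> p)) p v = frechet_derivative (\<lambda>x. \<Theta> (t, x)) (at (\<phi> p)) (tangent_map M \<phi> p v)"
proof -
  have \<phi>E: "\<phi> \<in> Emb M" using \<phi> by (simp add: Emb_bd_def)
  note E = EmbD[OF \<phi>E]
  have "compact (\<phi> ` M)" by (rule compact_continuous_image[OF smooth_on_set_continuous[OF E(1)] M])
  then obtain R where R: "\<phi> ` M \<subseteq> ball 0 R"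
    using compact_imp_bounded bounded_subset_ballD by blast
  obtain \<epsilon> where \<epsilon>: "\<epsilon> > 0" "\<epsilon> < \<delta>"
    and lip: "\<And>t x y. t \<in> {0..\<epsilon>} \<Longrightarrow> x \<in> ball 0 R \<Longrightarrow> y \<in> ball 0 R \<Longrightarrow>
      norm ((\<Theta> (t, x) - x) - (\<Theta> (t, y) - y)) \<le> 1/2 * norm (x - y)"
    by (rule isotopy_near_identity[OF \<delta> \<Theta> id, of R]) blast
  have st: "smooth_on_open (ball 0 R) (\<lambda>x. \<Theta> (t, x))" if "t \<in> {0..\<epsilon>}" for t
    by (rule smooth_on_open_comp[OF open_ball \<Theta> smooth_Pair[OF open_ball smooth_const smooth_ident]])
       (use that \<epsilon> \<delta> in auto)
  have bdt: "\<Theta> (t, p) = p" if "t \<in> {0..\<epsilon>}" "p \<in> manifold_boundary M" for t p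
    by (rule bd) (use that \<epsilon> in auto)
  note ne = near_identity_embedding[OF M \<phi> open_ball R]
  show thesis
  proof (rule that[OF \<epsilon>])
    fix t assume t: "t \<in> {0..\<epsilon>}"
    show "(\<lambda>p\<in>M. \<Theta> (t, \<phi> p)) \<in> Emb_bd M"
      by (rule ne(1)[OF st[OF t]]) (use lip[OF t] bdt[OF t] in auto)
    fix p v assume pv: "p \<in> M" "v \<in> tangent_space M p"
    show "tangent_map M (\<lambda>p\<in>M. \<Theta> (t, \<phi> p)) p v = frechet_derivative (\<lambda>x. \<Theta> (t, x)) (at (\<phi> p)) (tangent_map M \<phi> p v)"
      by (rule ne(2)[OF st[OF t] _ _ pv]) (use lip[OF t] bdt[OF t] in auto)
  next
    have pair: "smooth_on_set ({0..\<epsilon>} \<times> M) (\<lambda>z. (fst z, \<phi> (snd z)))"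
    proof (rule smooth_on_setI)
      fix z :: "real \<times> 'n ambient" assume z: "z \<in> {0..\<epsilon>} \<times> M"
      then have "snd z \<in> M" by auto
      then obtain U E where U: "open U" "snd z \<in> U" "smooth_on_open U E" "\<And>y. y \<in> M \<Longrightarrow> y \<in> U \<Longrightarrow> E y = \<phi> y"
        using smooth_on_setE[OF E(1)] by blast
      have o: "open ((UNIV :: real set) \<times> U)" using U(1) by (simp add: open_Times)
      have "smooth_on_open ((UNIV :: real set) \<times> U) (\<lambda>z. (fst z, E (snd z)))"
        by (intro smooth_Pair[OF o] smooth_fst smooth_on_open_comp[OF o U(3) smooth_snd]) auto
      then show "\<exists>V F. open V \<and> z \<in> V \<and> smooth_on_open V F \<and> (\<forall>y\<in>{0..\<epsilon>} \<times> M \<inter> V. F y = (fst y, \<phi> (snd y)))"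
        using o U(2,4) by (intro exI[of _ "UNIV \<times> U"] exI[of _ "\<lambda>z. (fst z, E (snd z))"]) (auto simp: mem_Times_iff)
    qed
    have o: "open ({-\<delta><..<\<delta>} \<times> (UNIV :: 'n ambient set))" by (simp add: open_Times)
    have "smooth_on_set ({0..\<epsilon>} \<times> M) (\<lambda>z. \<Theta> (fst z, \<phi> (snd z)))"
      by (rule smooth_on_set_compose[OF pair smooth_on_setI_open[OF o \<Theta> order_refl]]) (use \<epsilon> \<delta> in auto)
    then show "smooth_on_set ({0..\<epsilon>} \<times> M) (\<lambda>(t, p). (\<lambda>p\<in>M. \<Theta> (t, \<phi> p)) p)"
      by (rule smooth_on_set_cong) auto
  qed
qed

section \<open>Uniform Lipschitz continuity at time 0\<close>

text \<open>
  The bound is uniform in \<open>p\<close>, so difference quotients at time \<open>0\<close> have a constant majorant. Including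
  boundedness of \<open>F 0\<close> makes the class closed under products.
\<close>
definition lip_at_0 :: "'a set \<Rightarrow> (real \<Rightarrow> 'a \<Rightarrow> real) \<Rightarrow> bool" where
  "lip_at_0 A F \<longleftrightarrow> (\<exists>C \<epsilon>. C \<ge> 0 \<and> \<epsilon> > 0 \<and> (\<forall>p\<in>A. \<bar>F 0 p\<bar> \<le> C \<and> (\<forall>t\<in>{0..\<epsilon>}. \<bar>F t p - F 0 p\<bar> \<le> C * t)))"

lemma lip_at_0I:
  assumes "\<epsilon> > 0" "\<And>p. p \<in> A \<Longrightarrow> \<bar>F 0 p\<bar> \<le> C" "\<And>p t. p \<in> A \<Longrightarrow> t \<in> {0..\<epsilon>} \<Longrightarrow> \<bar>F t p - F 0 p\<bar> \<le> C' * t"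
  shows "lip_at_0 A F"
  unfolding lip_at_0_def
proof (rule exI[of _ "max 0 (max C C')"], rule exI[of _ \<epsilon>], intro conjI ballI)
  fix p t assume pt: "p \<in> A" "t \<in> {0..\<epsilon>}"
  have "C' * t \<le> max 0 (max C C') * t" using pt by (intro mult_right_mono) auto
  then show "\<bar>F t p - F 0 p\<bar> \<le> max 0 (max C C') * t" using assms(3)[OF pt] by linarith
qed (use assms(1,2) in force)+

lemma lip_at_0E:
  assumes "lip_at_0 A F"
  obtains C \<epsilon> where "C \<ge> 0" "\<epsilon> > 0" "\<And>p. p \<in> A \<Longrightarrow> \<bar>F 0 p\<bar> \<le> C"
    "\<And>p t. p \<in> A \<Longrightarrow> 0 \<le> t \<Longrightarrow> t \<le> \<epsilon> \<Longrightarrow> \<bar>F t p - F 0 p\<bar> \<le> C * t"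
  using assms unfolding lip_at_0_def by fastforce

lemma lip_at_0_cong:
  assumes F: "lip_at_0 A F" and \<epsilon>: "\<epsilon> > 0" and eq: "\<And>t p. t \<in> {0..\<epsilon>} \<Longrightarrow> p \<in> A \<Longrightarrow> G t p = F t p"
  shows "lip_at_0 A G"
proof -
  obtain C e where C: "C \<ge> 0" "e > 0" "\<And>p. p \<in> A \<Longrightarrow> \<bar>F 0 p\<bar> \<le> C"
    "\<And>p t. p \<in> A \<Longrightarrow> 0 \<le> t \<Longrightarrow> t \<le> e \<Longrightarrow> \<bar>F t p - F 0 p\<bar> \<le> C * t"
    by (rule lip_at_0E[OF F]) blast
  show ?thesis
    by (rule lip_at_0I[of "min e \<epsilon>" A G C C]) (use C \<epsilon> eq in auto)
qed

lemma lip_at_0_const: "(\<And>p. p \<in> A \<Longrightarrow> \<bar>F p\<bar> \<le> C) \<Longrightarrow> lip_at_0 A (\<lambda>t. F)"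
  by (rule lip_at_0I[of 1 A _ C 0]) auto

lemma lip_at_0_id: "lip_at_0 A (\<lambda>t p. t)"
  by (rule lip_at_0I[of 1 A _ 0 1]) auto

lemma lip_at_0_add:
  assumes "lip_at_0 A F" "lip_at_0 A G"
  shows "lip_at_0 A (\<lambda>t p. F t p + G t p)"
proof -
  obtain C e where C: "C \<ge> 0" "e > 0" "\<And>p. p \<in> A \<Longrightarrow> \<bar>F 0 p\<bar> \<le> C"
    "\<And>p t. p \<in> A \<Longrightarrow> 0 \<le> t \<Longrightarrow> t \<le> e \<Longrightarrow> \<bar>F t p - F 0 p\<bar> \<le> C * t"
    by (rule lip_at_0E[OF assms(1)]) blast
  obtain C' e' where C': "C' \<ge> 0" "e' > 0" "\<And>p. p \<in> A \<Longrightarrow> \<bar>G 0 p\<bar> \<le> C'"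
    "\<And>p t. p \<in> A \<Longrightarrow> 0 \<le> t \<Longrightarrow> t \<le> e' \<Longrightarrow> \<bar>G t p - G 0 p\<bar> \<le> C' * t"
    by (rule lip_at_0E[OF assms(2)]) blast
  show ?thesis
  proof (rule lip_at_0I[of "min e e'" A _ "C + C'" "C + C'"])
    fix p assume p: "p \<in> A"
    show "\<bar>F 0 p + G 0 p\<bar> \<le> C + C'" using C(3)[OF p] C'(3)[OF p] by linarith
    fix t assume t: "t \<in> {0..min e e'}"
    show "\<bar>F t p + G t p - (F 0 p + G 0 p)\<bar> \<le> (C + C') * t"
      using C(4)[OF p, of t] C'(4)[OF p, of t] t by (simp add: distrib_right)
  qed (use C C' in auto)
qed

lemma lip_at_0_mult:
  assumes "lip_at_0 A F" "lip_at_0 A G"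
  shows "lip_at_0 A (\<lambda>t p. F t p * G t p)"
proof -
  obtain C e where C: "C \<ge> 0" "e > 0" "\<And>p. p \<in> A \<Longrightarrow> \<bar>F 0 p\<bar> \<le> C"
    "\<And>p t. p \<in> A \<Longrightarrow> 0 \<le> t \<Longrightarrow> t \<le> e \<Longrightarrow> \<bar>F t p - F 0 p\<bar> \<le> C * t"
    by (rule lip_at_0E[OF assms(1)]) blast
  obtain C' e' where C': "C' \<ge> 0" "e' > 0" "\<And>p. p \<in> A \<Longrightarrow> \<bar>G 0 p\<bar> \<le> C'"
    "\<And>p t. p \<in> A \<Longrightarrow> 0 \<le> t \<Longrightarrow> t \<le> e' \<Longrightarrow> \<bar>G t p - G 0 p\<bar> \<le> C' * t"
    by (rule lip_at_0E[OF assms(2)]) blast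
  show ?thesis
  proof (rule lip_at_0I[of "min 1 (min e e')" A _ "C * C'" "3 * (C * C')"])
    fix p assume p: "p \<in> A"
    show "\<bar>F 0 p * G 0 p\<bar> \<le> C * C'" using C(1) C'(1) C(3)[OF p] C'(3)[OF p] by (simp add: abs_mult mult_mono)
    fix t assume t: "t \<in> {0..min 1 (min e e')}"
    have a: "\<bar>F t p - F 0 p\<bar> \<le> C * t" and b: "\<bar>G t p - G 0 p\<bar> \<le> C' * t"
      using C(4)[OF p, of t] C'(4)[OF p, of t] t by auto
    have "\<bar>(F t p - F 0 p) * (G t p - G 0 p)\<bar> \<le> (C * t) * C'"
    proof -
      have "C' * t \<le> C'" using C'(1) t by (simp add: mult_left_le)
      then show ?thesis unfolding abs_mult using a b C(1) C'(1) t by (intro mult_mono) auto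
    qed
    moreover have "\<bar>(F t p - F 0 p) * G 0 p\<bar> \<le> (C * t) * C'"
      unfolding abs_mult using a C'(3)[OF p] C(1) t by (intro mult_mono) auto
    moreover have "\<bar>F 0 p * (G t p - G 0 p)\<bar> \<le> C * (C' * t)"
      unfolding abs_mult using b C(3)[OF p] C(1) by (intro mult_mono) auto
    moreover have "F t p * G t p - F 0 p * G 0 p =
       (F t p - F 0 p) * (G t p - G 0 p) + (F t p - F 0 p) * G 0 p + F 0 p * (G t p - G 0 p)"
      by (simp add: algebra_simps)
    ultimately show "\<bar>F t p * G t p - F 0 p * G 0 p\<bar> \<le> 3 * (C * C') * t"
      by (simp add: algebra_simps)
  qed (use C C' in auto)
qed

lemma lip_at_0_sum: "(\<And>i. i \<in> I \<Longrightarrow> lip_at_0 A (F i)) \<Longrightarrow> lip_at_0 A (\<lambda>t p. \<Sum>i\<in>I. F i t p)"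
  by (induction I rule: infinite_finite_induct) (simp_all add: lip_at_0_const[of A "\<lambda>p. 0" 0] lip_at_0_add)

lemma lip_at_0_prod: "(\<And>i. i \<in> I \<Longrightarrow> lip_at_0 A (F i)) \<Longrightarrow> lip_at_0 A (\<lambda>t p. \<Prod>i\<in>I. F i t p)"
  by (induction I rule: infinite_finite_induct) (simp_all add: lip_at_0_const[of A "\<lambda>p. 1" 1] lip_at_0_mult)

lemma lip_at_0_det:
  fixes F :: "real \<Rightarrow> 'a \<Rightarrow> 'm::finite \<Rightarrow> 'm \<Rightarrow> real"
  assumes "\<And>i j. lip_at_0 A (\<lambda>t p. F t p i j)"
  shows "lip_at_0 A (\<lambda>t p. det (\<chi> i j. F t p i j))"
  unfolding det_def
proof (intro lip_at_0_sum lip_at_0_mult lip_at_0_prod)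
  show "lip_at_0 A (\<lambda>t p. of_int (sign x))" for x :: "'m \<Rightarrow> 'm"
    by (rule lip_at_0_const[of _ _ "\<bar>of_int (sign x)\<bar>"]) simp
  show "lip_at_0 A (\<lambda>t p. (\<chi> i j. F t p i j) $ i $ q i)" for i and q :: "'m \<Rightarrow> 'm"
    using assms by simp
qed

lemma lip_at_0_lower:
  assumes F: "lip_at_0 A F" and m: "m > 0" "\<And>p. p \<in> A \<Longrightarrow> F 0 p \<ge> 2 * m"
  obtains C \<epsilon> where "C \<ge> 0" "\<epsilon> > 0" "\<And>p. p \<in> A \<Longrightarrow> \<bar>F 0 p\<bar> \<le> C"
    "\<And>p t. p \<in> A \<Longrightarrow> 0 \<le> t \<Longrightarrow> t \<le> \<epsilon> \<Longrightarrow> \<bar>F t p - F 0 p\<bar> \<le> C * t"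
    "\<And>p t. p \<in> A \<Longrightarrow> 0 \<le> t \<Longrightarrow> t \<le> \<epsilon> \<Longrightarrow> F t p \<ge> m"
proof -
  obtain C e where C: "C \<ge> 0" "e > 0" "\<And>p. p \<in> A \<Longrightarrow> \<bar>F 0 p\<bar> \<le> C"
    "\<And>p t. p \<in> A \<Longrightarrow> 0 \<le> t \<Longrightarrow> t \<le> e \<Longrightarrow> \<bar>F t p - F 0 p\<bar> \<le> C * t"
    by (rule lip_at_0E[OF F]) blast
  show thesis
  proof (rule that[OF C(1) _ C(3)])
    show "min e (m / (C + 1)) > 0" using C m by simp
    fix p t assume pt: "p \<in> A" "0 \<le> t" "t \<le> min e (m / (C + 1))"
    have "C * t \<le> (C + 1) * (m / (C + 1))" using pt C(1) by (intro mult_mono) auto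
    then have "C * t \<le> m" using C(1) by simp
    moreover show "\<bar>F t p - F 0 p\<bar> \<le> C * t" using C(4)[OF pt(1,2)] pt by simp
    ultimately show "F t p \<ge> m" using m(2)[OF pt(1)] by linarith
  qed
qed

lemma lip_at_0_inverse:
  assumes F: "lip_at_0 A F" and m: "m > 0" "\<And>p. p \<in> A \<Longrightarrow> F 0 p \<ge> 2 * m"
  shows "lip_at_0 A (\<lambda>t p. inverse (F t p))"
proof -
  obtain C e where C: "C \<ge> 0" "e > 0" "\<And>p. p \<in> A \<Longrightarrow> \<bar>F 0 p\<bar> \<le> C"
    "\<And>p t. p \<in> A \<Longrightarrow> 0 \<le> t \<Longrightarrow> t \<le> e \<Longrightarrow> \<bar>F t p - F 0 p\<bar> \<le> C * t"
    "\<And>p t. p \<in> A \<Longrightarrow> 0 \<le> t \<Longrightarrow> t \<le> e \<Longrightarrow> F t p \<ge> m"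
    using lip_at_0_lower[OF F m] by metis
  show ?thesis
  proof (rule lip_at_0I[of e A _ "inverse m" "C * inverse (m * m)"])
    fix p assume p: "p \<in> A"
    have F0: "F 0 p \<ge> m" using m(1) m(2)[OF p] by linarith
    then show "\<bar>inverse (F 0 p)\<bar> \<le> inverse m" using m(1) by (simp add: le_imp_inverse_le)
    fix t assume t: "t \<in> {0..e}"
    have Ft: "F t p \<ge> m" "\<bar>F t p - F 0 p\<bar> \<le> C * t" using C(4,5)[OF p, of t] t by auto
    have "\<bar>inverse (F t p) - inverse (F 0 p)\<bar> = \<bar>F t p - F 0 p\<bar> * inverse (F t p * F 0 p)"
      using Ft F0 m(1) by (simp add: field_simps abs_minus_commute abs_div_pos[symmetric])
    also have "\<dots> \<le> (C * t) * inverse (m * m)"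
      using Ft F0 m(1) C(1) t by (intro mult_mono le_imp_inverse_le) auto
    finally show "\<bar>inverse (F t p) - inverse (F 0 p)\<bar> \<le> C * inverse (m * m) * t" by (simp add: mult_ac)
  qed (use C in auto)
qed

lemma lip_at_0_sqrt:
  assumes F: "lip_at_0 A F" and m: "m > 0" "\<And>p. p \<in> A \<Longrightarrow> F 0 p \<ge> 2 * m"
  shows "lip_at_0 A (\<lambda>t p. sqrt (F t p))"
proof -
  obtain C e where C: "C \<ge> 0" "e > 0" "\<And>p. p \<in> A \<Longrightarrow> \<bar>F 0 p\<bar> \<le> C"
    "\<And>p t. p \<in> A \<Longrightarrow> 0 \<le> t \<Longrightarrow> t \<le> e \<Longrightarrow> \<bar>F t p - F 0 p\<bar> \<le> C * t"
    "\<And>p t. p \<in> A \<Longrightarrow> 0 \<le> t \<Longrightarrow> t \<le> e \<Longrightarrow> F t p \<ge> m"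
    using lip_at_0_lower[OF F m] by metis
  show ?thesis
  proof (rule lip_at_0I[of e A _ "sqrt C" "C / sqrt m"])
    fix p assume p: "p \<in> A"
    have F0: "F 0 p \<ge> m" using m(1) m(2)[OF p] by linarith
    then show "\<bar>sqrt (F 0 p)\<bar> \<le> sqrt C" using m(1) C(3)[OF p] by simp
    fix t assume t: "t \<in> {0..e}"
    have Ft: "F t p \<ge> m" "\<bar>F t p - F 0 p\<bar> \<le> C * t" using C(4,5)[OF p, of t] t by auto
    have pos: "sqrt (F t p) \<ge> 0" "sqrt (F 0 p) \<ge> sqrt m" "sqrt m > 0" using Ft F0 m(1) by auto
    have "sqrt m \<le> sqrt (F t p) + sqrt (F 0 p)" using pos by linarith
    then have "\<bar>sqrt (F t p) - sqrt (F 0 p)\<bar> * sqrt m \<le> \<bar>sqrt (F t p) - sqrt (F 0 p)\<bar> * (sqrt (F t p) + sqrt (F 0 p))"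
      by (rule mult_left_mono) simp
    also have "\<dots> = \<bar>F t p - F 0 p\<bar>"
    proof -
      have "(sqrt (F t p) - sqrt (F 0 p)) * (sqrt (F t p) + sqrt (F 0 p)) = F t p - F 0 p"
        using Ft F0 m(1) by (simp add: algebra_simps)
      moreover have "\<bar>sqrt (F t p) + sqrt (F 0 p)\<bar> = sqrt (F t p) + sqrt (F 0 p)" using pos by simp
      ultimately show ?thesis by (metis abs_mult)
    qed
    finally show "\<bar>sqrt (F t p) - sqrt (F 0 p)\<bar> \<le> C / sqrt m * t"
      using Ft(2) pos(3) by (simp add: field_simps)
  qed (use C in auto)
qed

section \<open>The first variation of the tracking functional\<close>

locale tracking_problem = framed_hypersurface M ori \<tau>
  for M :: "'n::finite ambient set" and ori \<tau> +
  fixes \<sigma> :: "('n ambient \<Rightarrow> 'n ambient) \<Rightarrow> 'n ambient \<Rightarrow> 'n frame"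
    and g :: "'n ambient \<Rightarrow> real" and f :: "('n ambient \<Rightarrow> 'n ambient) \<Rightarrow> 'n ambient \<Rightarrow> real"
  assumes \<sigma>: "\<And>\<psi> x. \<psi> \<in> Emb_bd M \<Longrightarrow> x \<in> \<psi> ` M \<Longrightarrow> \<sigma> \<psi> x \<in> transported_orientation M ori \<psi> x"
    and g_smooth: "smooth_on_set M g" and g_pos: "\<And>p. p \<in> M \<Longrightarrow> g p > 0"
    and f_smooth: "\<And>\<psi>. \<psi> \<in> Emb_bd M \<Longrightarrow> smooth_on_set (\<psi> ` M) (f \<psi>)"
    and shape: "shape_functionality M f"
    and mass: "\<And>\<psi>. \<psi> \<in> Emb_bd M \<Longrightarrow>
      (LINT s|surface_measure (\<psi> ` M). f \<psi> s) = (LINT s|surface_measure M. g s)"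
    and material: "materially_differentiable M f"
begin

abbreviation J :: "('n ambient \<Rightarrow> 'n ambient) \<Rightarrow> real" where "J \<equiv> tracking_functional M g f \<tau> \<sigma>"

abbreviation td :: "('n ambient \<Rightarrow> 'n ambient) \<Rightarrow> 'n ambient \<Rightarrow> real" where
  "td \<equiv> transported_density M g \<tau> \<sigma>"

lemma Emb_bd_Emb: "\<psi> \<in> Emb_bd M \<Longrightarrow> \<psi> \<in> Emb M"
  by (simp add: Emb_bd_def)

lemmas Emb_bdD = EmbD[OF Emb_bd_Emb]

lemma jac_pos: "\<psi> \<in> Emb_bd M \<Longrightarrow> p \<in> M \<Longrightarrow> jac \<psi> p > 0"
  by (rule det_covariant_derivative(2)[OF Emb_bd_Emb _ \<sigma>]) auto

text \<open>
  The frames cancel, so the transported density only depends on the embedding.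
\<close>
lemma td_eq:
  assumes \<psi>: "\<psi> \<in> Emb_bd M" and p: "p \<in> M"
  shows "td \<psi> (\<psi> p) = g p / jac \<psi> p"
  using det_covariant_derivative(1)[OF Emb_bd_Emb[OF \<psi>] p \<sigma>[OF \<psi>]] p Emb_bdD(2)[OF \<psi>]
  by (simp add: transported_density_def)

lemma continuous_g: "continuous_on M g"
  by (rule smooth_on_set_continuous[OF g_smooth])

lemma continuous_jac: "\<psi> \<in> Emb_bd M \<Longrightarrow> continuous_on M (jac \<psi>)"
  by (rule continuous_on_jac[OF Emb_bdD(1)])

lemma smooth_f_pullback: "\<psi> \<in> Emb_bd M \<Longrightarrow> smooth_on_set M (\<lambda>p. f \<psi> (\<psi> p))"
  by (rule smooth_on_set_compose[OF Emb_bdD(1) f_smooth]) auto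

lemma continuous_f_pullback: "\<psi> \<in> Emb_bd M \<Longrightarrow> continuous_on M (\<lambda>p. f \<psi> (\<psi> p))"
  by (rule smooth_on_set_continuous[OF smooth_f_pullback])

lemma continuous_td:
  assumes \<psi>: "\<psi> \<in> Emb_bd M"
  shows "continuous_on (\<psi> ` M) (td \<psi>)"
proof -
  have c: "continuous_on M (\<lambda>p. g p / jac \<psi> p)"
    by (intro continuous_on_divide continuous_g continuous_jac \<psi>) (use jac_pos[OF \<psi>] in fastforce)
  have "continuous_on (\<psi> ` M) (inv_into M \<psi>)" using Emb_bdD(3)[OF \<psi>] by (simp add: homeomorphism_def)
  then have "continuous_on (\<psi> ` M) (\<lambda>x. g (inv_into M \<psi> x) / jac \<psi> (inv_into M \<psi> x))"
    by (rule continuous_on_compose2[OF c]) (auto simp: inv_into_into)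
  then show ?thesis
    by (rule continuous_on_eq) (use td_eq[OF \<psi>] Emb_bdD(2)[OF \<psi>] in auto)
qed

lemma integrable_continuous: 
  fixes F :: "'n ambient \<Rightarrow> real"
  assumes F: "continuous_on M F"
  shows "integrable \<mu> F"
proof -
  obtain B where "\<And>p. p \<in> M \<Longrightarrow> norm (F p) \<le> B"
    using compact_imp_bounded[OF compact_continuous_image[OF F compact]] by (auto simp: bounded_iff)
  then show ?thesis
    by (intro finite_measure.integrable_const_bound[OF finite_\<mu>, of _ B] measurable_\<mu> F AE_I2) (simp add: space_\<mu>)
qed

text \<open>
  Twice the integrand of the functional, pulled back to \<open>M\<close> and expanded: the volume element times
  \<open>(g / jac \<psi> - f \<psi> \<circ> \<psi>)\<^sup>2\<close>.
\<close>
definition integrand :: "('n ambient \<Rightarrow> 'n ambient) \<Rightarrow> 'n ambient \<Rightarrow> real" where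
  "integrand \<psi> p = (g p)\<^sup>2 / jac \<psi> p - 2 * g p * f \<psi> (\<psi> p) + (f \<psi> (\<psi> p))\<^sup>2 * jac \<psi> p"

lemma continuous_integrand:
  assumes \<psi>: "\<psi> \<in> Emb_bd M"
  shows "continuous_on M (integrand \<psi>)"
  unfolding integrand_def
  by (intro continuous_intros continuous_g continuous_jac continuous_f_pullback \<psi>) (use jac_pos[OF \<psi>] in fastforce)

lemma J_eq:
  assumes \<psi>: "\<psi> \<in> Emb_bd M"
  shows "J \<psi> = 1/2 * (\<integral>p. integrand \<psi> p \<partial>\<mu>)"
proof -
  have "continuous_on (\<psi> ` M) (\<lambda>x. (td \<psi> x - f \<psi> x)\<^sup>2)"
    by (intro continuous_intros continuous_td \<psi> smooth_on_set_continuous[OF f_smooth[OF \<psi>]])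
  then have "(\<integral>x. (td \<psi> x - f \<psi> x)\<^sup>2 \<partial>surface_measure (\<psi> ` M)) =
      (\<integral>p. jac \<psi> p * (td \<psi> (\<psi> p) - f \<psi> (\<psi> p))\<^sup>2 \<partial>\<mu>)"
    by (rule integral_surface_image[OF Emb_bd_Emb[OF \<psi>] jac_pos[OF \<psi>], rotated])
  also have "\<dots> = (\<integral>p. integrand \<psi> p \<partial>\<mu>)"
  proof (rule Bochner_Integration.integral_cong[OF refl])
    fix p assume "p \<in> space \<mu>"
    then have p: "p \<in> M" by (simp add: space_\<mu>)
    show "jac \<psi> p * (td \<psi> (\<psi> p) - f \<psi> (\<psi> p))\<^sup>2 = integrand \<psi> p"
      using jac_pos[OF \<psi> p] by (simp add: td_eq[OF \<psi> p] integrand_def power2_eq_square field_simps)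
  qed
  finally show ?thesis by (simp add: tracking_functional_def)
qed

lemma mass_pullback:
  assumes \<psi>: "\<psi> \<in> Emb_bd M"
  shows "(\<integral>p. jac \<psi> p * f \<psi> (\<psi> p) \<partial>\<mu>) = (\<integral>p. g p \<partial>\<mu>)"
  using integral_surface_image[OF Emb_bd_Emb[OF \<psi>] jac_pos[OF \<psi>] smooth_on_set_continuous[OF f_smooth[OF \<psi>]]]
    mass[OF \<psi>] by simp

lemma material_limit:
  assumes "\<phi> \<in> Emb_bd M" "V \<in> directions M" "\<epsilon> > 0"
    and "\<And>t. t \<in> {0..\<epsilon>} \<Longrightarrow> \<Phi> t \<in> Emb_bd M" "smooth_on_set ({0..\<epsilon>} \<times> M) (\<lambda>(t, p). \<Phi> t p)" "\<Phi> 0 = \<phi>"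
    "\<And>p. p \<in> M \<Longrightarrow> ((\<lambda>t. \<Phi> t p) has_vector_derivative V (\<phi> p)) (at 0 within {0..\<epsilon>})"
  shows "uniform_limit M (\<lambda>t p. (f (\<Phi> t) (\<Phi> t p) - f \<phi> (\<phi> p)) / t)
          (\<lambda>p. material_derivative M f \<phi> V (\<phi> p)) (at_right 0)"
  using material assms unfolding materially_differentiable_def by simp

lemma perturb_0: "\<phi> \<in> Emb_bd M \<Longrightarrow> perturb M \<phi> V 0 = \<phi>"
  using Emb_bdD(5)[of \<phi>] by (auto simp: perturb_def fun_eq_iff extensional_def)

lemma perturb_curve:
  assumes \<phi>: "\<phi> \<in> Emb_bd M" and V: "V \<in> directions M"
  obtains \<epsilon> where "\<epsilon> > 0" "\<And>t. t \<in> {0..\<epsilon>} \<Longrightarrow> perturb M \<phi> V t \<in> Emb_bd M"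
    "smooth_on_set ({0..\<epsilon>} \<times> M) (\<lambda>(t, p). perturb M \<phi> V t p)"
    "\<And>t p v. t \<in> {0..\<epsilon>} \<Longrightarrow> p \<in> M \<Longrightarrow> v \<in> tangent_space M p \<Longrightarrow>
      tangent_map M (perturb M \<phi> V t) p v =
        tangent_map M \<phi> p v + t *\<^sub>R frechet_derivative V (at (\<phi> p)) (tangent_map M \<phi> p v)"
proof -
  define \<Theta> where "\<Theta> z = snd z + fst z *\<^sub>R V (snd z)" for z :: "real \<times> 'n ambient"
  have Vs: "smooth_on_open UNIV V" and V0: "\<And>p. p \<in> manifold_boundary M \<Longrightarrow> V p = 0"
    using V by (auto simp: directions_def)
  have o: "open ({-1<..<(1::real)} \<times> (UNIV :: 'n ambient set))" by (simp add: open_Times)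
  have s\<Theta>: "smooth_on_open ({-1<..<1} \<times> UNIV) \<Theta>"
    unfolding \<Theta>_def[abs_def]
    by (intro smooth_add[OF o] smooth_scaleR[OF o] smooth_fst smooth_snd smooth_on_open_comp[OF o Vs smooth_snd]) auto
  have eq: "perturb M \<phi> V t = (\<lambda>p\<in>M. \<Theta> (t, \<phi> p))" for t by (simp add: perturb_def \<Theta>_def)
  have d: "frechet_derivative (\<lambda>x. \<Theta> (t, x)) (at x) v = v + t *\<^sub>R frechet_derivative V (at x) v" for t x v
  proof -
    have "(V has_derivative frechet_derivative V (at x)) (at x)"
      by (rule smooth_on_open_has_derivative[OF Vs]) simp
    then have "((\<lambda>x. \<Theta> (t, x)) has_derivative (\<lambda>v. v + t *\<^sub>R frechet_derivative V (at x) v)) (at x)"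
      unfolding \<Theta>_def by (auto intro!: derivative_eq_intros)
    then show ?thesis by (simp add: frechet_derivative_at[symmetric])
  qed
  obtain \<epsilon> where \<epsilon>: "\<epsilon> > 0" "\<epsilon> < 1" "\<And>t. t \<in> {0..\<epsilon>} \<Longrightarrow> (\<lambda>p\<in>M. \<Theta> (t, \<phi> p)) \<in> Emb_bd M"
    "smooth_on_set ({0..\<epsilon>} \<times> M) (\<lambda>(t, p). (\<lambda>p\<in>M. \<Theta> (t, \<phi> p)) p)"
    "\<And>t p v. t \<in> {0..\<epsilon>} \<Longrightarrow> p \<in> M \<Longrightarrow> v \<in> tangent_space M p \<Longrightarrow>
      tangent_map M (\<lambda>p\<in>M. \<Theta> (t, \<phi> p)) p v = frechet_derivative (\<lambda>x. \<Theta> (t, x)) (at (\<phi> p)) (tangent_map M \<phi> p v)"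
    by (rule isotopy_curve[OF compact \<phi> zero_less_one s\<Theta>]) (auto simp: \<Theta>_def V0)
  show thesis
    by (rule that[of \<epsilon>]) (use \<epsilon> in \<open>simp_all only: eq d\<close>)
qed

lemma tangent_map_bounded:
  assumes \<phi>: "\<phi> \<in> Emb_bd M"
  obtains C where "\<And>p v. p \<in> M \<Longrightarrow> v \<in> tangent_space M p \<Longrightarrow> norm (tangent_map M \<phi> p v) \<le> C * norm v"
proof -
  define good where "good U C \<longleftrightarrow> open U \<and> (\<forall>p\<in>M \<inter> U. \<forall>v\<in>tangent_space M p. norm (tangent_map M \<phi> p v) \<le> C * norm v)" for U C
  have "\<exists>U C. p \<in> U \<and> good U C" if p: "p \<in> M" for p
  proof -
    obtain P \<Phi> where \<Phi>: "open P" "p \<in> P" "smooth_on_open P \<Phi>" "\<And>p. p \<in> M \<Longrightarrow> p \<in> P \<Longrightarrow> \<Phi> p = \<phi> p"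
      by (rule smooth_on_setE[OF Emb_bdD(1)[OF \<phi>] p]) blast
    let ?S = "\<lambda>q. \<Sum>b\<in>Basis. norm (frechet_derivative \<Phi> (at q) b)"
    have "continuous_on P ?S"
      by (intro continuous_on_sum continuous_on_norm smooth_on_open_continuous smooth_on_open_frechet \<Phi>(3))
    then have "open (P \<inter> ?S -` {..<?S p + 1})"
      by (rule continuous_open_preimage[OF _ \<Phi>(1)]) simp
    moreover have "norm (tangent_map M \<phi> q v) \<le> (?S p + 1) * norm v"
      if q: "q \<in> M" "q \<in> P" "?S q < ?S p + 1" and v: "v \<in> tangent_space M q" for q v
    proof -
      have "norm (tangent_map M \<phi> q v) = norm (frechet_derivative \<Phi> (at q) v)"
        using tangent_map_eq[OF has_derivative_of_extension[OF \<Phi>(1) q(2) \<Phi>(3,4) q(1)] v] by simp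
      also have "\<dots> \<le> ?S q * norm v"
        by (rule norm_linear_bound[OF has_derivative_linear[OF smooth_on_open_has_derivative[OF \<Phi>(3) q(2)]]])
      also have "\<dots> \<le> (?S p + 1) * norm v" using q(3) by (intro mult_right_mono) auto
      finally show ?thesis .
    qed
    ultimately have "good (P \<inter> ?S -` {..<?S p + 1}) (?S p + 1)" unfolding good_def by auto
    then show ?thesis using \<Phi>(2) by (intro exI[of _ "P \<inter> ?S -` {..<?S p + 1}"] exI[of _ "?S p + 1"]) simp
  qed
  then have "M \<subseteq> \<Union>{U. \<exists>C. good U C}" by blast
  moreover have "\<And>U. U \<in> {U. \<exists>C. good U C} \<Longrightarrow> open U" by (auto simp: good_def)
  ultimately obtain \<D> where \<D>: "\<D> \<subseteq> {U. \<exists>C. good U C}" "finite \<D>" "M \<subseteq> \<Union>\<D>"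
    using compactE[OF compact] by metis
  define c where "c U = (SOME C. good U C)" for U
  have c: "good U (c U)" if "U \<in> \<D>" for U
  proof -
    have "\<exists>C. good U C" using \<D>(1) that by blast
    then show ?thesis unfolding c_def by (rule someI_ex)
  qed
  show thesis
  proof (rule that[of "\<Sum>U\<in>\<D>. \<bar>c U\<bar>"])
    fix p v assume pv: "p \<in> M" "v \<in> tangent_space M p"
    then obtain U where U: "U \<in> \<D>" "p \<in> U" using \<D>(3) by blast
    have "norm (tangent_map M \<phi> p v) \<le> c U * norm v" using c[OF U(1)] pv U(2) by (auto simp: good_def)
    also have "\<dots> \<le> (\<Sum>U\<in>\<D>. \<bar>c U\<bar>) * norm v"
      using member_le_sum[OF U(1), of "\<lambda>U. \<bar>c U\<bar>"] \<D>(2) by (intro mult_right_mono) auto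
    finally show "norm (tangent_map M \<phi> p v) \<le> (\<Sum>U\<in>\<D>. \<bar>c U\<bar>) * norm v" .
  qed
qed

context
  fixes \<phi> V :: "'n ambient \<Rightarrow> 'n ambient"
  assumes \<phi>: "\<phi> \<in> Emb_bd M" and V: "V \<in> directions M"
begin

definition push :: "'n \<Rightarrow> 'n ambient \<Rightarrow> 'n ambient" where
  "push i p = tangent_map M \<phi> p (\<tau> p $ i)"

definition push_V :: "'n \<Rightarrow> 'n ambient \<Rightarrow> 'n ambient" where
  "push_V i p = frechet_derivative V (at (\<phi> p)) (push i p)"

text \<open>
  The derivative at time \<open>0\<close> of the volume element of the perturbed embedding, see \<open>perturb_jac\<close>.
\<close>
definition jac_deriv :: "'n ambient \<Rightarrow> real" where
  "jac_deriv p = frechet_derivative (\<lambda>t. sqrt (gram (\<lambda>i. push i p + t *\<^sub>R push_V i p))) (at 0) 1"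

definition f_deriv :: "'n ambient \<Rightarrow> real" where
  "f_deriv p = material_derivative M f \<phi> V (\<phi> p)"

text \<open>
  The derivative at time \<open>0\<close> of \<open>integrand\<close> along the perturbation. In contrast to
  \<open>pre_shape_formula\<close> it is a density on \<open>M\<close>, and \<open>jac_deriv\<close> stands for the tangential
  divergence times the volume element.
\<close>
definition variation :: "'n ambient \<Rightarrow> real" where
  "variation p = ((f \<phi> (\<phi> p))\<^sup>2 - (td \<phi> (\<phi> p))\<^sup>2) * jac_deriv p +
     2 * (f \<phi> (\<phi> p) * jac \<phi> p - g p) * f_deriv p"

lemma \<tau>_tangent: "p \<in> M \<Longrightarrow> \<tau> p $ i \<in> tangent_space M p"
  by (rule orthonormal_frame_in[OF ori_frame[OF _ \<tau>_ori]])

lemma perturb_jac: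
  obtains \<epsilon> where "\<epsilon> > 0" "\<And>t. t \<in> {0..\<epsilon>} \<Longrightarrow> perturb M \<phi> V t \<in> Emb_bd M"
    "\<And>t p. t \<in> {0..\<epsilon>} \<Longrightarrow> p \<in> M \<Longrightarrow> jac (perturb M \<phi> V t) p = sqrt (gram (\<lambda>i. push i p + t *\<^sub>R push_V i p))"
    "uniform_limit M (\<lambda>t p. (f (perturb M \<phi> V t) (perturb M \<phi> V t p) - f \<phi> (\<phi> p)) / t) f_deriv (at_right 0)"
proof -
  obtain \<epsilon> where \<epsilon>: "\<epsilon> > 0" "\<And>t. t \<in> {0..\<epsilon>} \<Longrightarrow> perturb M \<phi> V t \<in> Emb_bd M"
    "smooth_on_set ({0..\<epsilon>} \<times> M) (\<lambda>(t, p). perturb M \<phi> V t p)"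
    "\<And>t p v. t \<in> {0..\<epsilon>} \<Longrightarrow> p \<in> M \<Longrightarrow> v \<in> tangent_space M p \<Longrightarrow>
      tangent_map M (perturb M \<phi> V t) p v =
        tangent_map M \<phi> p v + t *\<^sub>R frechet_derivative V (at (\<phi> p)) (tangent_map M \<phi> p v)"
    by (rule perturb_curve[OF \<phi> V]) blast
  show thesis
  proof (rule that[OF \<epsilon>(1,2)])
    show "jac (perturb M \<phi> V t) p = sqrt (gram (\<lambda>i. push i p + t *\<^sub>R push_V i p))" if "t \<in> {0..\<epsilon>}" "p \<in> M" for t p
      by (simp add: jac_def \<epsilon>(4)[OF that \<tau>_tangent[OF that(2)]] push_def push_V_def)
    show "uniform_limit M (\<lambda>t p. (f (perturb M \<phi> V t) (perturb M \<phi> V t p) - f \<phi> (\<phi> p)) / t) f_deriv (at_right 0)"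
      unfolding f_deriv_def[abs_def]
    proof (rule material_limit[OF \<phi> V \<epsilon>(1) \<epsilon>(2) \<epsilon>(3) perturb_0[OF \<phi>]])
      fix p assume p: "p \<in> M"
      have "((\<lambda>t. \<phi> p + t *\<^sub>R V (\<phi> p)) has_vector_derivative V (\<phi> p)) (at 0 within {0..\<epsilon>})"
        by (auto intro!: derivative_eq_intros)
      then show "((\<lambda>t. perturb M \<phi> V t p) has_vector_derivative V (\<phi> p)) (at 0 within {0..\<epsilon>})"
        using p by (simp add: perturb_def)
    qed
  qed
qed

lemma push_bounded:
  obtains C where "\<And>i p. p \<in> M \<Longrightarrow> norm (push i p) \<le> C" "\<And>i p. p \<in> M \<Longrightarrow> norm (push_V i p) \<le> C"
proof -
  obtain C where C: "\<And>p v. p \<in> M \<Longrightarrow> v \<in> tangent_space M p \<Longrightarrow> norm (tangent_map M \<phi> p v) \<le> C * norm v"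
    by (rule tangent_map_bounded[OF \<phi>]) blast
  have c1: "norm (push i p) \<le> C" if "p \<in> M" for i p
  proof -
    have "\<tau> p $ i \<bullet> \<tau> p $ i = 1" using ori_frame[OF that \<tau>_ori[OF that]] by (simp add: orthonormal_frame_def)
    then have "norm (\<tau> p $ i) = 1" by (simp add: norm_eq_1)
    then show ?thesis using C[OF that \<tau>_tangent[OF that, of i]] by (simp add: push_def)
  qed
  have Vs: "smooth_on_open UNIV V" using V by (simp add: directions_def)
  let ?S = "\<lambda>x. \<Sum>b\<in>Basis. norm (frechet_derivative V (at x) b)"
  have "continuous_on (\<phi> ` M) ?S"
    by (intro continuous_on_sum continuous_on_norm continuous_on_subset[OF smooth_on_open_continuous[OF smooth_on_open_frechet[OF Vs]]]) auto
  then have "bounded (?S ` \<phi> ` M)"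
    using compact_imp_bounded[OF compact_continuous_image] compact_continuous_image[OF smooth_on_set_continuous[OF Emb_bdD(1)[OF \<phi>]] compact]
    by blast
  then obtain B where B: "\<And>p. p \<in> M \<Longrightarrow> ?S (\<phi> p) \<le> B" unfolding bounded_iff by (fastforce simp: abs_le_iff)
  have "norm (push_V i p) \<le> \<bar>B\<bar> * \<bar>C\<bar>" if "p \<in> M" for i p
  proof -
    have "norm (push_V i p) \<le> ?S (\<phi> p) * norm (push i p)"
      unfolding push_V_def
      by (rule norm_linear_bound[OF has_derivative_linear[OF smooth_on_open_has_derivative[OF Vs]]]) simp
    also have "\<dots> \<le> \<bar>B\<bar> * \<bar>C\<bar>"
      using B[OF that] c1[OF that, of i] by (intro mult_mono) (auto intro: order_trans)
    finally show ?thesis .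
  qed
  then show thesis
    by (intro that[of "max C (\<bar>B\<bar> * \<bar>C\<bar>)"]) (use c1 in \<open>auto simp: max.coboundedI1 max.coboundedI2\<close>)
qed

lemma lip_gram: "lip_at_0 M (\<lambda>t p. gram (\<lambda>i. push i p + t *\<^sub>R push_V i p))"
  unfolding gram_def
proof (rule lip_at_0_det)
  fix i j
  obtain C where C: "\<And>i p. p \<in> M \<Longrightarrow> norm (push i p) \<le> C" "\<And>i p. p \<in> M \<Longrightarrow> norm (push_V i p) \<le> C"
    by (rule push_bounded) blast
  have inner: "lip_at_0 M (\<lambda>t p. a p \<bullet> b p)"
    if "\<And>p. p \<in> M \<Longrightarrow> norm (a p) \<le> C" "\<And>p. p \<in> M \<Longrightarrow> norm (b p) \<le> C" for a b :: "'n ambient \<Rightarrow> 'n ambient"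
  proof (rule lip_at_0_const)
    fix p assume p: "p \<in> M"
    have "\<bar>a p \<bullet> b p\<bar> \<le> norm (a p) * norm (b p)" by (rule Cauchy_Schwarz_ineq2)
    also have "\<dots> \<le> C * C" using that[OF p] by (intro mult_mono) (auto intro: order_trans[OF norm_ge_zero])
    finally show "\<bar>a p \<bullet> b p\<bar> \<le> C * C" .
  qed
  have "lip_at_0 M (\<lambda>t p. push i p \<bullet> push j p + t * (push i p \<bullet> push_V j p + push_V i p \<bullet> push j p + t * (push_V i p \<bullet> push_V j p)))"
    by (intro lip_at_0_add lip_at_0_mult lip_at_0_id inner C)
  then show "lip_at_0 M (\<lambda>t p. (push i p + t *\<^sub>R push_V i p) \<bullet> (push j p + t *\<^sub>R push_V j p))"
    by (simp add: inner_add_left inner_add_right algebra_simps)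
qed

lemma gram_push: "p \<in> M \<Longrightarrow> sqrt (gram (\<lambda>i. push i p)) = jac \<phi> p"
  by (simp add: jac_def push_def)

lemma gram_push_lower:
  obtains m where "m > 0" "\<And>p. p \<in> M \<Longrightarrow> gram (\<lambda>i. push i p) \<ge> 2 * m" "\<And>p. p \<in> M \<Longrightarrow> jac \<phi> p \<ge> 2 * m"
proof (cases "M = {}")
  case True
  then show thesis using that[of 1] by simp
next
  case False
  obtain p0 where p0: "p0 \<in> M" "\<And>p. p \<in> M \<Longrightarrow> jac \<phi> p0 \<le> jac \<phi> p"
    using continuous_attains_inf[OF compact False continuous_jac[OF \<phi>]] by blast
  define j where "j = jac \<phi> p0"
  have j: "j > 0" using jac_pos[OF \<phi> p0(1)] by (simp add: j_def)
  have low: "gram (\<lambda>i. push i p) \<ge> j * j" if "p \<in> M" for p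
  proof -
    have "gram (\<lambda>i. push i p) \<ge> 0" using gram_push[OF that] jac_pos[OF \<phi> that] by (metis less_imp_le real_sqrt_ge_0_iff)
    then have "gram (\<lambda>i. push i p) = jac \<phi> p * jac \<phi> p" using gram_push[OF that] by (metis real_sqrt_mult_self abs_of_nonneg)
    then show ?thesis using p0(2)[OF that] j by (simp add: j_def mult_mono)
  qed
  show thesis
  proof (rule that[of "min (j * j) j / 2"])
    show "min (j * j) j / 2 > 0" using j by simp
    show "gram (\<lambda>i. push i p) \<ge> 2 * (min (j * j) j / 2)" if "p \<in> M" for p using low[OF that] by simp
    show "jac \<phi> p \<ge> 2 * (min (j * j) j / 2)" if "p \<in> M" for p using p0(2)[OF that] by (simp add: j_def)
  qed
qed

lemma lip_jac: "lip_at_0 M (\<lambda>t p. jac (perturb M \<phi> V t) p)"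
proof -
  obtain \<epsilon> where \<epsilon>: "\<epsilon> > 0" "\<And>t p. t \<in> {0..\<epsilon>} \<Longrightarrow> p \<in> M \<Longrightarrow> jac (perturb M \<phi> V t) p = sqrt (gram (\<lambda>i. push i p + t *\<^sub>R push_V i p))"
    by (rule perturb_jac) blast
  obtain m where m: "m > 0" "\<And>p. p \<in> M \<Longrightarrow> gram (\<lambda>i. push i p) \<ge> 2 * m" by (rule gram_push_lower) blast
  have "lip_at_0 M (\<lambda>t p. sqrt (gram (\<lambda>i. push i p + t *\<^sub>R push_V i p)))"
    by (rule lip_at_0_sqrt[OF lip_gram m(1)]) (use m(2) in simp)
  then show ?thesis by (rule lip_at_0_cong[OF _ \<epsilon>(1)]) (rule \<epsilon>(2))
qed

text \<open>
  The difference quotients of the pullback converge uniformly on \<open>M\<close>, so they are all within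
  distance \<open>2\<close> of one of them. That one is continuous, hence bounded.
\<close>
lemma lip_f: "lip_at_0 M (\<lambda>t p. f (perturb M \<phi> V t) (perturb M \<phi> V t p))"
proof -
  obtain \<epsilon> where \<epsilon>: "\<epsilon> > 0" "\<And>t. t \<in> {0..\<epsilon>} \<Longrightarrow> perturb M \<phi> V t \<in> Emb_bd M"
    and u: "uniform_limit M (\<lambda>t p. (f (perturb M \<phi> V t) (perturb M \<phi> V t p) - f \<phi> (\<phi> p)) / t) f_deriv (at_right 0)"
    by (rule perturb_jac) blast
  define q where "q t p = (f (perturb M \<phi> V t) (perturb M \<phi> V t p) - f \<phi> (\<phi> p)) / t" for t p
  have "eventually (\<lambda>t. \<forall>p\<in>M. dist (q t p) (f_deriv p) < 1) (at_right 0)"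
    using uniform_limitD[OF u zero_less_one] by (simp add: q_def)
  then obtain b where b: "b > 0" "\<And>t p. 0 < t \<Longrightarrow> t < b \<Longrightarrow> p \<in> M \<Longrightarrow> \<bar>q t p - f_deriv p\<bar> < 1"
    unfolding eventually_at_right_field dist_real_def by blast
  have bounded: "\<exists>B. \<forall>p\<in>M. \<bar>F p\<bar> \<le> B" if "continuous_on M F" for F :: "'n ambient \<Rightarrow> real"
    using compact_imp_bounded[OF compact_continuous_image[OF that compact]] by (auto simp: bounded_iff)
  define s where "s = min \<epsilon> b / 2"
  have s: "0 < s" "s < b" "s \<in> {0..\<epsilon>}" using \<epsilon>(1) b(1) by (auto simp: s_def)
  have "continuous_on M (q s)"
    unfolding q_def
    using s by (intro continuous_intros continuous_f_pullback \<phi> \<epsilon>(2)) auto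
  then obtain B where B: "\<And>p. p \<in> M \<Longrightarrow> \<bar>q s p\<bar> \<le> B" using bounded by blast
  obtain B' where B': "\<And>p. p \<in> M \<Longrightarrow> \<bar>f \<phi> (\<phi> p)\<bar> \<le> B'" using bounded[OF continuous_f_pullback[OF \<phi>]] by blast
  show ?thesis
  proof (rule lip_at_0I[of s])
    show "s > 0" by (rule s(1))
    fix p assume p: "p \<in> M"
    show "\<bar>f (perturb M \<phi> V 0) (perturb M \<phi> V 0 p)\<bar> \<le> B'" using B'[OF p] by (simp add: perturb_0[OF \<phi>])
    fix t assume t: "t \<in> {0..s}"
    show "\<bar>f (perturb M \<phi> V t) (perturb M \<phi> V t p) - f (perturb M \<phi> V 0) (perturb M \<phi> V 0 p)\<bar> \<le> (B + 2) * t"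
    proof (cases "t = 0")
      case False
      then have t0: "0 < t" "t < b" using t s by auto
      have "\<bar>q t p\<bar> \<le> B + 2" using b(2)[OF t0 p] b(2)[OF s(1,2) p] B[OF p] by linarith
      then have "\<bar>q t p\<bar> * t \<le> (B + 2) * t" using t0 by (intro mult_right_mono) auto
      then show ?thesis using t0 by (simp add: q_def perturb_0[OF \<phi>] abs_divide)
    qed simp
  qed
qed

lemma lip_integrand: "lip_at_0 M (\<lambda>t. integrand (perturb M \<phi> V t))"
proof -
  obtain m where m: "m > 0" "\<And>p. p \<in> M \<Longrightarrow> jac \<phi> p \<ge> 2 * m" by (rule gram_push_lower) blast
  have inv: "lip_at_0 M (\<lambda>t p. inverse (jac (perturb M \<phi> V t) p))"
    by (rule lip_at_0_inverse[OF lip_jac m(1)]) (use m(2) in \<open>simp add: perturb_0[OF \<phi>]\<close>)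
  obtain B where "\<And>p. p \<in> M \<Longrightarrow> \<bar>g p\<bar> \<le> B"
    using compact_imp_bounded[OF compact_continuous_image[OF continuous_g compact]] by (auto simp: bounded_iff)
  then have g: "lip_at_0 M (\<lambda>t p. g p)" by (rule lip_at_0_const)
  have c: "lip_at_0 M (\<lambda>t p. -2)" by (rule lip_at_0_const[of _ _ 2]) simp
  have "lip_at_0 M (\<lambda>t p. g p * g p * inverse (jac (perturb M \<phi> V t) p)
      + (-2) * (g p * f (perturb M \<phi> V t) (perturb M \<phi> V t p))
      + f (perturb M \<phi> V t) (perturb M \<phi> V t p) * f (perturb M \<phi> V t) (perturb M \<phi> V t p) * jac (perturb M \<phi> V t) p)"
    by (intro lip_at_0_add lip_at_0_mult inv g c lip_f lip_jac)
  moreover have "(\<lambda>t p. g p * g p * inverse (jac (perturb M \<phi> V t) p)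
      + (-2) * (g p * f (perturb M \<phi> V t) (perturb M \<phi> V t p))
      + f (perturb M \<phi> V t) (perturb M \<phi> V t p) * f (perturb M \<phi> V t) (perturb M \<phi> V t p) * jac (perturb M \<phi> V t) p)
    = (\<lambda>t. integrand (perturb M \<phi> V t))"
    by (simp add: integrand_def fun_eq_iff power2_eq_square divide_inverse)
  ultimately show ?thesis by simp
qed

lemma jac_has_derivative:
  assumes p: "p \<in> M"
  shows "((\<lambda>t. sqrt (gram (\<lambda>i. push i p + t *\<^sub>R push_V i p))) has_real_derivative jac_deriv p) (at 0)"
proof -
  let ?P = "\<lambda>t. gram (\<lambda>i. push i p + t *\<^sub>R push_V i p)"
  have "smooth_on_open UNIV ?P"
    by (intro smooth_gram open_UNIV smooth_add smooth_const smooth_scaleR smooth_ident)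
  then have dP: "(?P has_derivative frechet_derivative ?P (at 0)) (at 0)" by (rule smooth_on_open_has_derivative) simp
  have "0 < sqrt (gram (\<lambda>i. push i p))" unfolding gram_push[OF p] by (rule jac_pos[OF \<phi> p])
  then have "?P 0 > 0" by simp
  from differentiableI[OF has_derivative_real_sqrt[OF this dP]]
  have d: "((\<lambda>t. sqrt (?P t)) has_derivative frechet_derivative (\<lambda>t. sqrt (?P t)) (at 0)) (at 0)"
    by (simp add: frechet_derivative_works)
  have "frechet_derivative (\<lambda>t. sqrt (?P t)) (at 0) s = jac_deriv p * s" for s
    using linear_scale[OF has_derivative_linear[OF d], of s 1] by (simp add: jac_deriv_def)
  then have "frechet_derivative (\<lambda>t. sqrt (?P t)) (at 0) = (*) (jac_deriv p)" by (rule ext)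
  with d show ?thesis by (simp only: has_field_derivative_def)
qed

lemma integrand_quotient:
  assumes p: "p \<in> M"
  shows "((\<lambda>t. (integrand (perturb M \<phi> V t) p - integrand \<phi> p) / t) \<longlongrightarrow> variation p) (at_right 0)"
proof -
  obtain \<epsilon> where \<epsilon>: "\<epsilon> > 0" "\<And>t p. t \<in> {0..\<epsilon>} \<Longrightarrow> p \<in> M \<Longrightarrow> jac (perturb M \<phi> V t) p = sqrt (gram (\<lambda>i. push i p + t *\<^sub>R push_V i p))"
    "uniform_limit M (\<lambda>t p. (f (perturb M \<phi> V t) (perturb M \<phi> V t p) - f \<phi> (\<phi> p)) / t) f_deriv (at_right 0)"
    by (rule perturb_jac) blast
  define j where "j t = jac (perturb M \<phi> V t) p" for t
  define F where "F t = f (perturb M \<phi> V t) (perturb M \<phi> V t p)" for t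
  have j0: "j 0 = jac \<phi> p" and F0: "F 0 = f \<phi> (\<phi> p)" by (simp_all add: j_def F_def perturb_0[OF \<phi>])
  have jpos: "j 0 > 0" using jac_pos[OF \<phi> p] by (simp add: j0)
  have "((\<lambda>t. (F t - F 0) / t) \<longlongrightarrow> f_deriv p) (at_right 0)"
    using tendsto_uniform_limitI[OF \<epsilon>(3) p] by (simp add: F_def perturb_0[OF \<phi>])
  then have dF: "(F has_real_derivative f_deriv p) (at 0 within {0<..})"
    by (simp add: has_field_derivative_iff)
  have ev: "eventually (\<lambda>t. t \<in> {0..\<epsilon>}) (at_right (0::real))"
    unfolding eventually_at_right_field using \<epsilon>(1) by (intro exI[of _ \<epsilon>]) auto
  have "((\<lambda>t. (sqrt (gram (\<lambda>i. push i p + t *\<^sub>R push_V i p)) - sqrt (gram (\<lambda>i. push i p + 0 *\<^sub>R push_V i p))) / t) \<longlongrightarrow> jac_deriv p) (at_right 0)"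
    using DERIV_subset[OF jac_has_derivative[OF p], of "{0<..}"] by (simp add: has_field_derivative_iff)
  then have "((\<lambda>t. (j t - j 0) / t) \<longlongrightarrow> jac_deriv p) (at_right 0)"
    by (rule Lim_transform_eventually) (use ev in eventually_elim, use \<epsilon> p in \<open>simp add: j_def\<close>)
  then have dj: "(j has_real_derivative jac_deriv p) (at 0 within {0<..})"
    by (simp add: has_field_derivative_iff)
  have "((\<lambda>t. (g p)\<^sup>2 / j t - 2 * g p * F t + (F t)\<^sup>2 * j t) has_real_derivative variation p) (at 0 within {0<..})"
    using jpos
    by (auto intro!: derivative_eq_intros dF dj)
      (simp add: variation_def td_eq[OF \<phi> p] j0 F0 field_simps power2_eq_square)
  then have "((\<lambda>t. integrand (perturb M \<phi> V t) p) has_real_derivative variation p) (at 0 within {0<..})"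
    by (simp add: integrand_def j_def F_def)
  then show ?thesis by (simp add: has_field_derivative_iff perturb_0[OF \<phi>])
qed

lemma variation_measurable: "variation \<in> borel_measurable \<mu>"
proof -
  obtain \<epsilon> where \<epsilon>: "\<epsilon> > 0" "\<And>t. t \<in> {0..\<epsilon>} \<Longrightarrow> perturb M \<phi> V t \<in> Emb_bd M"
    by (rule perturb_jac) blast
  define S where "S n = \<epsilon> / (real n + 1)" for n
  have S: "S n > 0" "S n \<noteq> 0" "S n \<in> {0..\<epsilon>}" for n
    using \<epsilon>(1) by (auto simp: S_def field_simps)
  have "S \<longlonglongrightarrow> 0"
    unfolding S_def by (rule LIMSEQ_Suc[OF lim_const_over_n, unfolded of_nat_Suc add.commute[of 1]])
  then have S_right: "filterlim S (at_right 0) sequentially"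
    using S by (simp add: filterlim_at less_imp_le)
  show ?thesis
  proof (rule borel_measurable_LIMSEQ_real[where u="\<lambda>n p. (integrand (perturb M \<phi> V (S n)) p - integrand \<phi> p) / S n"])
    show "(\<lambda>n. (integrand (perturb M \<phi> V (S n)) p - integrand \<phi> p) / S n) \<longlonglongrightarrow> variation p" if "p \<in> space \<mu>" for p
      by (rule filterlim_compose[OF integrand_quotient S_right]) (use that in \<open>simp add: space_\<mu>\<close>)
    show "(\<lambda>p. (integrand (perturb M \<phi> V (S n)) p - integrand \<phi> p) / S n) \<in> borel_measurable \<mu>" for n
      using S[of n] by (intro measurable_\<mu> continuous_intros continuous_integrand \<phi> \<epsilon>(2)) auto
  qed
qed

text \<open>
  Dominated convergence, with the constant majorant from \<open>lip_integrand\<close>.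
\<close>
theorem pre_shape_derivative:
  "has_pre_shape_derivative M J \<phi> V (1/2 * (\<integral>p. variation p \<partial>\<mu>))"
proof -
  obtain \<epsilon> where \<epsilon>: "\<epsilon> > 0" "\<And>t. t \<in> {0..\<epsilon>} \<Longrightarrow> perturb M \<phi> V t \<in> Emb_bd M"
    by (rule perturb_jac) blast
  obtain C e where C: "C \<ge> 0" "e > 0"
    "\<And>p t. p \<in> M \<Longrightarrow> 0 \<le> t \<Longrightarrow> t \<le> e \<Longrightarrow> \<bar>integrand (perturb M \<phi> V t) p - integrand (perturb M \<phi> V 0) p\<bar> \<le> C * t"
    by (rule lip_at_0E[OF lip_integrand]) blast
  have "((\<lambda>t. (J (perturb M \<phi> V t) - J \<phi>) / t) \<longlongrightarrow> 1/2 * (\<integral>p. variation p \<partial>\<mu>)) (at_right 0)"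
  proof (rule tendsto_at_right_sequentially[of 0 "min \<epsilon> e"])
    show "0 < min \<epsilon> e" using \<epsilon>(1) C(2) by simp
    fix S :: "nat \<Rightarrow> real"
    assume S: "\<And>n. 0 < S n" "\<And>n. S n < min \<epsilon> e" "decseq S" "S \<longlonglongrightarrow> 0"
    have S_emb: "perturb M \<phi> V (S n) \<in> Emb_bd M" for n using \<epsilon>(2)[of "S n"] S(1,2)[of n] by simp
    have S_right: "filterlim S (at_right 0) sequentially"
    proof -
      have "S n \<noteq> 0" for n using S(1)[of n] by simp
      then show ?thesis using S(1,4) by (simp add: filterlim_at less_imp_le)
    qed
    define q where "q n p = (integrand (perturb M \<phi> V (S n)) p - integrand \<phi> p) / S n" for n p
    have q_cont: "continuous_on M (q n)" for n
      unfolding q_def using S(1)[of n] by (intro continuous_intros continuous_integrand S_emb \<phi>) auto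
    have q_lim: "(\<lambda>n. q n p) \<longlonglongrightarrow> variation p" if "p \<in> M" for p
      unfolding q_def by (rule filterlim_compose[OF integrand_quotient[OF that] S_right])
    have q_bound: "norm (q n p) \<le> C" if p: "p \<in> M" for n p
    proof -
      have "\<bar>integrand (perturb M \<phi> V (S n)) p - integrand \<phi> p\<bar> \<le> C * S n"
        using C(3)[OF p, of "S n"] S(1,2)[of n] by (simp add: perturb_0[OF \<phi>])
      then show ?thesis using S(1)[of n] by (simp add: q_def pos_divide_le_eq)
    qed
    have "(\<lambda>n. \<integral>p. q n p \<partial>\<mu>) \<longlonglongrightarrow> (\<integral>p. variation p \<partial>\<mu>)"
    proof (rule integral_dominated_convergence[where w="\<lambda>p. C"])
      show "q n \<in> borel_measurable \<mu>" for n by (rule measurable_\<mu>[OF q_cont])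
      show "variation \<in> borel_measurable \<mu>" by (rule variation_measurable)
      show "integrable \<mu> (\<lambda>p. C)" by (rule integrable_continuous[OF continuous_on_const])
      show "AE p in \<mu>. (\<lambda>n. q n p) \<longlonglongrightarrow> variation p" by (rule AE_I2) (simp add: space_\<mu> q_lim)
      show "AE p in \<mu>. norm (q n p) \<le> C" for n by (rule AE_I2) (use q_bound in \<open>simp add: space_\<mu>\<close>)
    qed
    moreover define D where "D n = (J (perturb M \<phi> V (S n)) - J \<phi>) / S n" for n
    moreover have "(\<integral>p. q n p \<partial>\<mu>) = 2 * D n" for n
    proof -
      have "(\<integral>p. q n p \<partial>\<mu>) = ((\<integral>p. integrand (perturb M \<phi> V (S n)) p \<partial>\<mu>) - (\<integral>p. integrand \<phi> p \<partial>\<mu>)) / S n"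
        unfolding q_def using integrable_continuous[OF continuous_integrand[OF S_emb]]
          integrable_continuous[OF continuous_integrand[OF \<phi>]] by simp
      moreover have "J (perturb M \<phi> V (S n)) - J \<phi> =
          ((\<integral>p. integrand (perturb M \<phi> V (S n)) p \<partial>\<mu>) - (\<integral>p. integrand \<phi> p \<partial>\<mu>)) / 2"
        by (simp add: J_eq[OF S_emb] J_eq[OF \<phi>] diff_divide_distrib)
      ultimately show ?thesis by (simp add: D_def)
    qed
    ultimately have "(\<lambda>n. 2 * D n) \<longlonglongrightarrow> (\<integral>p. variation p \<partial>\<mu>)" by simp
    from tendsto_mult_left[OF this, of "1/2"]
    show "(\<lambda>n. (J (perturb M \<phi> V (S n)) - J \<phi>) / S n) \<longlonglongrightarrow> 1/2 * (\<integral>p. variation p \<partial>\<mu>)"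
      unfolding D_def[symmetric] by simp
  qed
  then show ?thesis by (simp add: has_pre_shape_derivative_def)
qed

end

end

section \<open>Tangential directions supported in a chart\<close>

lemma smooth_extend_zero:
  assumes Q: "open Q" and K: "closed K" "K \<subseteq> Q" and F: "smooth_on_open Q F"
    and zero: "\<And>x. x \<in> Q \<Longrightarrow> x \<notin> K \<Longrightarrow> F x = 0"
  shows "smooth_on_open UNIV (\<lambda>x. if x \<in> Q then F x else 0)"
proof (rule smooth_on_open_local)
  fix x
  show "\<exists>V. open V \<and> x \<in> V \<and> smooth_on_open V (\<lambda>x. if x \<in> Q then F x else 0)"
  proof (cases "x \<in> Q")
    case True
    have "smooth_on_open Q (\<lambda>x. if x \<in> Q then F x else 0)"
      by (rule smooth_on_open_cong[OF Q F]) simp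
    then show ?thesis using Q True by blast
  next
    case False
    have "smooth_on_open (- K) (\<lambda>x. if x \<in> Q then F x else 0)"
      by (rule smooth_on_open_cong[OF open_Compl[OF K(1)] smooth_const[of _ 0]]) (use zero in auto)
    then show ?thesis using K False by blast
  qed
qed

lemma bump_le_1: "bump y r x \<le> 1"
  by (simp add: bump_def flat_def)

lemma chart_density_pos:
  assumes fr: "has_frames S" and X: "parametrization S \<Omega> X" and u: "u \<in> \<Omega>"
  shows "chart_density \<Omega> X u > 0"
proof -
  have "X u \<in> S" using parametrizationD(6)[OF X] u by blast
  then obtain b :: "'a frame" where b: "orthonormal_frame (tangent_space S (X u)) b"
    using fr unfolding has_frames_def by blast
  let ?D = "frechet_derivative X (at u within \<Omega>)"
  define A where "A = (\<chi> i j. b $ i \<bullet> ?D (axis j 1))"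
  have l: "linear ?D" by (rule has_derivative_linear[OF smooth_on_set_has_derivative[OF parametrizationD(4)[OF X] u]])
  have "v = 0" if "A *v v = 0" for v
  proof -
    have "b $ i \<bullet> ?D v = (A *v v) $ i" for i
      by (subst linear_axis_expansion[OF l]) (simp add: A_def matrix_vector_mult_def inner_sum_right mult.commute)
    then have "b $ i \<bullet> ?D v = 0" for i using that by simp
    then have "?D v = 0" using orthonormal_frame_expansion[OF b chart_derivative_tangent[OF X u, of v]] by simp
    then have "?D v = ?D 0" by (simp add: linear_0[OF l])
    then show "v = 0" using chart_derivative_inj[OF X u] by (meson injD)
  qed
  then have "invertible A" unfolding invertible_left_inverse matrix_left_invertible_ker by blast
  then have "det A \<noteq> 0" by (simp add: invertible_det_nz)
  then show ?thesis using chart_density_frame[OF X u b] by (simp add: A_def)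
qed

text \<open>
  The data of a direction that pushes the shape along a coordinate line of an interior chart \<open>\<phi> \<circ> X\<close>.
  The map \<open>\<pi>\<close> extends the inverse chart to an ambient open set \<open>Q\<close>, the cutoff is supported in a closed ball
  inside \<open>Q\<close>, and \<open>\<pi>\<close> takes values in the ball of radius \<open>\<rho> / 2\<close>. So there is room for steps of length
  \<open>\<rho> / 2\<close> along the coordinate line. The sign of the direction is \<open>\<omega>\<close>.
\<close>
locale chart_push = tracking_problem M ori \<tau> \<sigma> g f
  for M :: "'n::finite ambient set" and ori \<tau> \<sigma> g f +
  fixes \<phi> :: "'n ambient \<Rightarrow> 'n ambient" and X :: "real^'n \<Rightarrow> 'n ambient" and W :: "(real^'n) set"
    and Q :: "'n ambient set" and \<pi> :: "'n ambient \<Rightarrow> real^'n" and u0 :: "real^'n" and \<rho> r :: real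
    and y0 :: "'n ambient" and i :: 'n and \<omega> :: real
  assumes \<phi>: "\<phi> \<in> Emb_bd M" and W: "open W" and X: "parametrization M W X"
    and \<rho>: "\<rho> > 0" "ball u0 \<rho> \<subseteq> W" and Q: "open Q" and \<pi>: "smooth_on_open Q \<pi>" "\<pi> ` Q \<subseteq> ball u0 (\<rho> / 2)"
    and Y\<pi>: "\<And>x. x \<in> \<phi> ` M \<Longrightarrow> x \<in> Q \<Longrightarrow> \<phi> (X (\<pi> x)) = x"
    and r: "r > 0" "cball y0 r \<subseteq> Q" and \<omega>: "\<bar>\<omega>\<bar> = 1"
begin

abbreviation S where "S \<equiv> \<phi> ` M"
abbreviation e :: "real^'n" where "e \<equiv> axis i 1"

definition Y :: "real^'n \<Rightarrow> 'n ambient" where "Y v = \<phi> (X v)"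

abbreviation \<beta> :: "'n ambient \<Rightarrow> real" where "\<beta> \<equiv> bump y0 r"

lemma Y_param: "parametrization S W Y"
  unfolding Y_def[abs_def]
  by (rule parametrization_diffeo_image[OF X Emb_bdD(1)[OF \<phi>] smooth_inverse_embedding[OF hypersurface Emb_bd_Emb[OF \<phi>]]])
    (simp add: Emb_bdD(2)[OF \<phi>])

lemmas YD = parametrizationD[OF Y_param]
lemmas XD = parametrizationD[OF X]

lemma Y_smooth: "smooth_on_open W Y"
  using YD(4) by (simp add: smooth_on_set_open_iff[OF W])

lemma Y_derivative: "v \<in> W \<Longrightarrow> (Y has_derivative frechet_derivative Y (at v)) (at v)"
  by (rule smooth_on_open_has_derivative[OF Y_smooth])

lemma half_ball: "ball u0 (\<rho> / 2) \<subseteq> W"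
  using \<rho> subset_ball[of "\<rho> / 2" \<rho> u0] by auto

lemma \<pi>W: "x \<in> Q \<Longrightarrow> \<pi> x \<in> W"
  using \<pi>(2) half_ball by blast

lemma \<pi>Y: "v \<in> W \<Longrightarrow> Y v \<in> Q \<Longrightarrow> \<pi> (Y v) = v"
proof -
  assume v: "v \<in> W" "Y v \<in> Q"
  have "Y v \<in> S" using YD(6) v(1) by blast
  then have "Y (\<pi> (Y v)) = Y v" using Y\<pi>[of "Y v"] v(2) by (simp add: Y_def)
  then show ?thesis using YD(3) v \<pi>W by (meson inj_onD)
qed

definition W_Q :: "(real^'n) set" where "W_Q = W \<inter> Y -` Q"

lemma open_W_Q: "open W_Q"
  unfolding W_Q_def by (rule continuous_open_preimage[OF smooth_on_open_continuous[OF Y_smooth] W Q])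

lemma W_Q: "v \<in> W_Q \<Longrightarrow> v \<in> W" "v \<in> W_Q \<Longrightarrow> Y v \<in> Q" "v \<in> W_Q \<Longrightarrow> \<pi> (Y v) = v" "v \<in> W_Q \<Longrightarrow> v \<in> ball u0 (\<rho> / 2)"
proof -
  show a: "v \<in> W_Q \<Longrightarrow> v \<in> W" "v \<in> W_Q \<Longrightarrow> Y v \<in> Q" by (auto simp: W_Q_def)
  then show b: "v \<in> W_Q \<Longrightarrow> \<pi> (Y v) = v" using \<pi>Y by blast
  show "v \<in> ball u0 (\<rho> / 2)" if "v \<in> W_Q"
  proof -
    have "\<pi> (Y v) \<in> ball u0 (\<rho> / 2)" using \<pi>(2) a(2)[OF that] by blast
    then show ?thesis by (simp only: b[OF that])
  qed
qed

lemma S_Q: "x \<in> S \<Longrightarrow> x \<in> Q \<Longrightarrow> \<pi> x \<in> W_Q \<and> Y (\<pi> x) = x"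
  using Y\<pi> \<pi>W by (auto simp: W_Q_def Y_def)

lemma \<beta>_zero: "x \<notin> Q \<Longrightarrow> \<beta> x = 0"
  using r by (intro bump_zero) (auto simp: subset_iff)

definition V :: "'n ambient \<Rightarrow> 'n ambient" where
  "V x = (if x \<in> Q then (\<omega> * \<beta> x) *\<^sub>R frechet_derivative Y (at (\<pi> x)) e else 0)"

text \<open>
  In the chart this is the step \<open>v \<mapsto> v + \<omega> t \<beta> e\<close>, see \<open>\<Theta>_Y\<close>. Off the shape it displaces \<open>x\<close>
  as it displaces the point of the shape with the coordinates \<open>\<pi> x\<close>, with the cutoff taken at \<open>x\<close> itself.
\<close>
definition \<Theta> :: "real \<times> 'n ambient \<Rightarrow> 'n ambient" where
  "\<Theta> z = snd z + (if snd z \<in> Q then Y (\<pi> (snd z) + (\<omega> * fst z * \<beta> (snd z)) *\<^sub>R e) - Y (\<pi> (snd z)) else 0)"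

lemma V_smooth: "smooth_on_open UNIV V"
  unfolding V_def[abs_def]
proof (rule smooth_extend_zero[OF Q closed_cball r(2)])
  show "smooth_on_open Q (\<lambda>x. (\<omega> * \<beta> x) *\<^sub>R frechet_derivative Y (at (\<pi> x)) e)"
    by (intro smooth_scaleR[OF Q] smooth_mult[OF Q] smooth_frechet_apply[OF Q Y_smooth \<pi>(1) smooth_const] smooth_const smooth_bump) (use \<pi>W in blast)
  show "(\<omega> * \<beta> x) *\<^sub>R frechet_derivative Y (at (\<pi> x)) e = 0" if "x \<notin> cball y0 r" for x
    using bump_zero[OF r(1), of x y0] that by simp
qed

lemma step_in_W:
  assumes "v \<in> ball u0 (\<rho> / 2)" "\<bar>s\<bar> < \<rho> / 2"
  shows "v + s *\<^sub>R e \<in> ball u0 \<rho>" "v + s *\<^sub>R e \<in> W"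
proof -
  have "dist u0 (v + s *\<^sub>R e) \<le> dist u0 v + dist v (v + s *\<^sub>R e)" by (rule dist_triangle)
  also have "dist v (v + s *\<^sub>R e) = \<bar>s\<bar>" by (simp add: dist_norm norm_axis_1)
  finally show "v + s *\<^sub>R e \<in> ball u0 \<rho>" using assms by simp
  then show "v + s *\<^sub>R e \<in> W" using \<rho>(2) by blast
qed

lemma \<beta>_step: "\<bar>\<omega> * t * \<beta> x\<bar> \<le> \<bar>t\<bar>"
proof -
  have "\<bar>t\<bar> * \<bar>\<beta> x\<bar> \<le> \<bar>t\<bar> * 1" using bump_nonneg[of y0 r x] bump_le_1[of y0 r x] by (intro mult_left_mono) auto
  then show ?thesis by (simp add: abs_mult \<omega>)
qed

lemma \<Theta>_smooth: "smooth_on_open ({- (\<rho> / 2)<..<\<rho> / 2} \<times> UNIV) \<Theta>"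
proof (rule smooth_on_open_local)
  fix z :: "real \<times> 'n ambient"
  assume z: "z \<in> {- (\<rho> / 2)<..<\<rho> / 2} \<times> UNIV"
  let ?I = "{- (\<rho> / 2)<..<\<rho> / 2}"
  show "\<exists>V. open V \<and> z \<in> V \<and> smooth_on_open V \<Theta>"
  proof (cases "snd z \<in> Q")
    case True
    have o: "open (?I \<times> Q)" using Q by (simp add: open_Times)
    have sq: "smooth_on_open (?I \<times> Q) (\<lambda>z. \<pi> (snd z))"
      by (rule smooth_on_open_comp[OF o \<pi>(1) smooth_snd]) auto
    have s\<beta>: "smooth_on_open (?I \<times> Q) (\<lambda>z. \<beta> (snd z))"
      by (rule smooth_on_open_comp[OF o smooth_bump[of UNIV] smooth_snd]) auto
    have arg: "smooth_on_open (?I \<times> Q) (\<lambda>z. \<pi> (snd z) + (\<omega> * fst z * \<beta> (snd z)) *\<^sub>R e)"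
      by (intro smooth_add[OF o] sq smooth_scaleR[OF o] smooth_mult[OF o] s\<beta> smooth_const smooth_fst)
    have in_W: "\<pi> (snd z) + (\<omega> * fst z * \<beta> (snd z)) *\<^sub>R e \<in> W" if "z \<in> ?I \<times> Q" for z
    proof (rule step_in_W)
      show "\<pi> (snd z) \<in> ball u0 (\<rho> / 2)" using that \<pi>(2) by auto
      show "\<bar>\<omega> * fst z * \<beta> (snd z)\<bar> < \<rho> / 2" using \<beta>_step[of "fst z" "snd z"] that by auto
    qed
    have "smooth_on_open (?I \<times> Q) (\<lambda>z. snd z + (Y (\<pi> (snd z) + (\<omega> * fst z * \<beta> (snd z)) *\<^sub>R e) - Y (\<pi> (snd z))))"
      by (intro smooth_add[OF o] smooth_diff[OF o] smooth_snd smooth_on_open_comp[OF o Y_smooth arg]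
           smooth_on_open_comp[OF o Y_smooth sq]) (use in_W \<pi>W in auto)
    then have "smooth_on_open (?I \<times> Q) \<Theta>"
      by (rule smooth_on_open_cong[OF o]) (auto simp: \<Theta>_def)
    then show ?thesis using o z True by (intro exI[of _ "?I \<times> Q"]) (auto simp: mem_Times_iff)
  next
    case False
    have o: "open ((UNIV :: real set) \<times> - cball y0 r)" by (intro open_Times open_UNIV open_Compl closed_cball)
    have "smooth_on_open (UNIV \<times> - cball y0 r) \<Theta>"
    proof (rule smooth_on_open_cong[OF o smooth_snd])
      fix z :: "real \<times> 'n ambient" assume "z \<in> UNIV \<times> - cball y0 r"
      then have "\<beta> (snd z) = 0" using bump_zero[OF r(1), of "snd z" y0] by auto
      then show "snd z = \<Theta> z" by (simp add: \<Theta>_def)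
    qed
    then show ?thesis using o z False r(2) by (intro exI[of _ "UNIV \<times> - cball y0 r"]) (auto simp: mem_Times_iff)
  qed
qed

lemma \<Theta>_0: "\<Theta> (0, x) = x"
  by (simp add: \<Theta>_def)

text \<open>
  Boundary points of \<open>M\<close> are fixed by \<open>\<phi>\<close>. If one of them were in \<open>Q\<close>, then it would be in the
  interior chart \<open>X\<close>.
\<close>
lemma boundary_not_Q: "p \<in> manifold_boundary M \<Longrightarrow> p \<notin> Q"
proof
  assume p: "p \<in> manifold_boundary M" "p \<in> Q"
  then have "\<phi> p = p" "p \<in> M" using \<phi> by (auto simp: Emb_bd_def manifold_boundary_def)
  then have "p \<in> S" by force
  then have "\<phi> (X (\<pi> p)) = \<phi> p" using Y\<pi>[OF _ p(2)] \<open>\<phi> p = p\<close> by simp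
  moreover have "X (\<pi> p) \<in> M" using XD(6) \<pi>W[OF p(2)] by blast
  ultimately have "p \<in> X ` W" using Emb_bdD(2)[OF \<phi>] \<open>p \<in> M\<close> \<pi>W[OF p(2)] by (metis inj_onD imageI)
  then have "p \<in> manifold_interior M" unfolding manifold_interior_def using W X \<open>p \<in> M\<close> by blast
  then show False using p(1) by (simp add: manifold_boundary_def)
qed

lemma V_direction: "V \<in> directions M"
  using V_smooth boundary_not_Q by (auto simp: directions_def V_def)

lemma V_Y: "v \<in> W_Q \<Longrightarrow> V (Y v) = (\<omega> * \<beta> (Y v)) *\<^sub>R frechet_derivative Y (at v) e"
  using W_Q by (simp add: V_def)

lemma V_tangent: "x \<in> S \<Longrightarrow> V x \<in> tangent_space S x"
proof (cases "x \<in> Q")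
  case True
  assume x: "x \<in> S"
  have v: "\<pi> x \<in> W" "Y (\<pi> x) = x" using S_Q[OF x True] W_Q(1) by auto
  have "frechet_derivative Y (at (\<pi> x)) e \<in> tangent_space S x"
    using chart_derivative_tangent[OF Y_param v(1), of e] by (simp add: at_within_open[OF v(1) W] v(2))
  then show ?thesis using True by (simp add: V_def tangent_space_def span_scale)
qed (simp add: V_def tangent_space_def span_zero)

lemma \<Theta>_Y:
  assumes v: "v \<in> W_Q"
  shows "\<Theta> (t, Y v) = Y (v + (\<omega> * t * \<beta> (Y v)) *\<^sub>R e)"
  using W_Q[OF v] by (simp add: \<Theta>_def)

lemma \<Theta>_velocity: "((\<lambda>t. \<Theta> (t, x)) has_vector_derivative V x) (at 0 within A)"
proof (cases "x \<in> Q")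
  case True
  let ?D = "frechet_derivative Y (at (\<pi> x))"
  have D: "(Y has_derivative ?D) (at (\<pi> x + (\<omega> * 0 * \<beta> x) *\<^sub>R e))" using Y_derivative[OF \<pi>W[OF True]] by simp
  have "((\<lambda>t. \<pi> x + (\<omega> * t * \<beta> x) *\<^sub>R e) has_derivative (\<lambda>t. (\<omega> * t * \<beta> x) *\<^sub>R e)) (at 0)"
    by (auto intro!: derivative_eq_intros)
  from has_derivative_compose[OF this D]
  have "((\<lambda>t. Y (\<pi> x + (\<omega> * t * \<beta> x) *\<^sub>R e)) has_derivative (\<lambda>t. ?D ((\<omega> * t * \<beta> x) *\<^sub>R e))) (at 0)" .
  then have "((\<lambda>t. x + (Y (\<pi> x + (\<omega> * t * \<beta> x) *\<^sub>R e) - Y (\<pi> x))) has_derivative (\<lambda>t. 0 + (?D ((\<omega> * t * \<beta> x) *\<^sub>R e) - 0))) (at 0)"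
    by (intro has_derivative_add has_derivative_diff has_derivative_const)
  moreover have "?D ((\<omega> * t * \<beta> x) *\<^sub>R e) = t *\<^sub>R V x" for t
    using True linear_scale[OF has_derivative_linear[OF D], of "\<omega> * t * \<beta> x" e] by (simp add: V_def mult_ac)
  ultimately have "((\<lambda>t. \<Theta> (t, x)) has_vector_derivative V x) (at 0)"
    using True by (simp add: has_vector_derivative_def \<Theta>_def)
  then show ?thesis by (rule has_vector_derivative_at_within)
qed (simp add: \<Theta>_def V_def)

text \<open>
  On each coordinate line the step is a continuous perturbation of the identity by at most \<open>t\<close>, and the
  intermediate value theorem finds preimages.
\<close>
lemma \<Theta>_image:
  assumes t: "0 \<le> t" "t < \<rho> / 2"
  shows "(\<lambda>x. \<Theta> (t, x)) ` S = S"
proof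
  show "(\<lambda>x. \<Theta> (t, x)) ` S \<subseteq> S"
  proof clarify
    fix p assume "p \<in> M"
    then have pS: "\<phi> p \<in> S" by blast
    show "\<Theta> (t, \<phi> p) \<in> S"
    proof (cases "\<phi> p \<in> Q")
      case True
      have v: "\<pi> (\<phi> p) \<in> W_Q" "Y (\<pi> (\<phi> p)) = \<phi> p" using S_Q[OF pS True] by auto
      have "\<pi> (\<phi> p) + (\<omega> * t * \<beta> (\<phi> p)) *\<^sub>R e \<in> W"
        by (rule step_in_W(2)[OF W_Q(4)[OF v(1)]]) (use \<beta>_step[of t "\<phi> p"] t in linarith)
      then show ?thesis using \<Theta>_Y[OF v(1), of t] v(2) YD(6) by auto
    next
      case False
      then show ?thesis using pS by (simp add: \<Theta>_def)
    qed
  qed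
  show "S \<subseteq> (\<lambda>x. \<Theta> (t, x)) ` S"
  proof
    fix y assume y: "y \<in> S"
    show "y \<in> (\<lambda>x. \<Theta> (t, x)) ` S"
    proof (cases "\<beta> y = 0")
      case True
      then have "\<Theta> (t, y) = y" by (simp add: \<Theta>_def)
      then show ?thesis using y by (metis image_eqI)
    next
      case False
      then have "y \<in> Q" using \<beta>_zero by blast
      then have v: "\<pi> y \<in> W_Q" "Y (\<pi> y) = y" using S_Q[OF y] by auto
      define v where "v = \<pi> y"
      \<comment> \<open>a zero \<open>s\<close> of \<open>F\<close> makes \<open>v + s e\<close> a preimage of \<open>v\<close>\<close>
      define F where "F s = s + \<omega> * t * \<beta> (Y (v + s *\<^sub>R e))" for s
      have in_W: "v + s *\<^sub>R e \<in> W" if "s \<in> {-t..t}" for s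
        by (rule step_in_W(2)) (use W_Q(4)[OF v(1)] that t in \<open>auto simp: v_def\<close>)
      have "continuous_on {-t..t} F"
      proof -
        have "continuous_on {-t..t} (\<lambda>s. Y (v + s *\<^sub>R e))"
          by (rule continuous_on_compose2[OF smooth_on_open_continuous[OF Y_smooth]])
             (use in_W in \<open>auto intro!: continuous_intros\<close>)
        then have "continuous_on {-t..t} (\<lambda>s. \<beta> (Y (v + s *\<^sub>R e)))"
          by (rule continuous_on_compose2[OF smooth_on_open_continuous[OF smooth_bump[of UNIV]]]) auto
        then show ?thesis unfolding F_def by (intro continuous_intros)
      qed
      moreover have "F (- t) \<le> 0" "0 \<le> F t"
        using \<beta>_step[of t "Y (v + (- t) *\<^sub>R e)"] \<beta>_step[of t "Y (v + t *\<^sub>R e)"] t unfolding F_def by linarith+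
      ultimately obtain s where s: "s \<in> {-t..t}" "F s = 0"
        using IVT'[of F "- t" 0 t] t by auto
      define z where "z = v + s *\<^sub>R e"
      have zW: "z \<in> W" using in_W[OF s(1)] by (simp add: z_def)
      have sz: "s + \<omega> * t * \<beta> (Y z) = 0" using s(2) by (simp add: F_def z_def)
      have "\<Theta> (t, Y z) = y"
      proof (cases "\<beta> (Y z) = 0")
        case True
        then have "z = v" using sz by (simp add: z_def)
        then show ?thesis using True v(2) False by (simp add: v_def)
      next
        case False
        then have "Y z \<in> Q" using \<beta>_zero by blast
        then have "z \<in> W_Q" using zW by (simp add: W_Q_def)
        then have "\<Theta> (t, Y z) = Y (z + (\<omega> * t * \<beta> (Y z)) *\<^sub>R e)" by (rule \<Theta>_Y)
        also have "z + (\<omega> * t * \<beta> (Y z)) *\<^sub>R e = v + (s + \<omega> * t * \<beta> (Y z)) *\<^sub>R e"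
          by (simp add: z_def scaleR_add_left add.assoc)
        finally show ?thesis using v(2) by (simp add: sz v_def)
      qed
      moreover have "Y z \<in> S" using YD(6) zW by blast
      ultimately show ?thesis by blast
    qed
  qed
qed

text \<open>
  The isotopy maps the shape onto itself, so the embeddings along it differ from \<open>\<phi>\<close> by
  diffeomorphisms \<open>shift\<close> of \<open>M\<close>, and shape functionality applies. This replaces the material derivative along \<open>V\<close> by
  a derivative of the fixed function \<open>f \<phi>\<close>.
\<close>
lemma flow_curve:
  obtains \<epsilon> where "\<epsilon> > 0" "\<And>t. t \<in> {0..\<epsilon>} \<Longrightarrow> (\<lambda>p\<in>M. \<Theta> (t, \<phi> p)) \<in> Emb_bd M"
    "\<And>t x. t \<in> {0..\<epsilon>} \<Longrightarrow> x \<in> S \<Longrightarrow> f (\<lambda>p\<in>M. \<Theta> (t, \<phi> p)) x = f \<phi> x"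
    "\<And>p. p \<in> M \<Longrightarrow> ((\<lambda>t. (f \<phi> (\<Theta> (t, \<phi> p)) - f \<phi> (\<phi> p)) / t) \<longlongrightarrow> f_deriv \<phi> V p) (at_right 0)"
proof -
  define \<Phi> where "\<Phi> t = (\<lambda>p\<in>M. \<Theta> (t, \<phi> p))" for t
  obtain \<epsilon> where \<epsilon>: "\<epsilon> > 0" "\<epsilon> < \<rho> / 2" "\<And>t. t \<in> {0..\<epsilon>} \<Longrightarrow> \<Phi> t \<in> Emb_bd M"
    "smooth_on_set ({0..\<epsilon>} \<times> M) (\<lambda>(t, p). \<Phi> t p)"
    unfolding \<Phi>_def
    by (rule isotopy_curve[OF compact \<phi> half_gt_zero[OF \<rho>(1)] \<Theta>_smooth \<Theta>_0])
      (auto simp: \<Theta>_def boundary_not_Q)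
  have fS: "f (\<Phi> t) x = f \<phi> x" if t: "t \<in> {0..\<epsilon>}" and x: "x \<in> S" for t x
  proof -
    note \<Phi>t = \<epsilon>(3)[OF t]
    have im: "\<Phi> t ` M = S"
    proof -
      have "\<Phi> t ` M = (\<lambda>x. \<Theta> (t, x)) ` S" by (simp add: \<Phi>_def image_image)
      then show ?thesis using \<Theta>_image[of t] t \<epsilon>(2) by simp
    qed
    define shift where "shift = (\<lambda>p\<in>M. inv_into M \<phi> (\<Phi> t p))"
    have shift_in: "\<phi> (shift p) = \<Phi> t p" "shift p \<in> M" if "p \<in> M" for p
    proof -
      have "\<Phi> t p \<in> S" using im that by blast
      then show "\<phi> (shift p) = \<Phi> t p" "shift p \<in> M" using that by (auto simp: shift_def f_inv_into_f inv_into_into)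
    qed
    have inj: "inj_on shift M"
      by (rule inj_onI) (metis shift_in(1) Emb_bdD(2)[OF \<Phi>t] inj_onD)
    have inv: "inv_into M shift q = inv_into M (\<Phi> t) (\<phi> q)" "q \<in> shift ` M" if q: "q \<in> M" for q
    proof -
      have "\<phi> q \<in> \<Phi> t ` M" using im q by blast
      then obtain p where p: "p \<in> M" "\<Phi> t p = \<phi> q" by force
      have "shift p = q" using shift_in[OF p(1)] p(2) Emb_bdD(2)[OF \<phi>] q by (metis inj_onD)
      then show "q \<in> shift ` M" using p(1) by blast
      show "inv_into M shift q = inv_into M (\<Phi> t) (\<phi> q)"
        using \<open>shift p = q\<close> p inv_into_f_f[OF inj p(1)] inv_into_f_f[OF Emb_bdD(2)[OF \<Phi>t] p(1)] by simp
    qed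
    have "bij_betw shift M M" unfolding bij_betw_def using inj inv(2) shift_in(2) by blast
    moreover have "smooth_on_set M shift"
    proof (rule smooth_on_set_cong)
      show "smooth_on_set M (\<lambda>p. inv_into M \<phi> (\<Phi> t p))"
        by (rule smooth_on_set_compose[OF Emb_bdD(1)[OF \<Phi>t] smooth_inverse_embedding[OF hypersurface Emb_bd_Emb[OF \<phi>]]])
          (simp add: im)
    qed (simp add: shift_def)
    moreover have "smooth_on_set M (inv_into M shift)"
    proof (rule smooth_on_set_cong)
      show "smooth_on_set M (\<lambda>q. inv_into M (\<Phi> t) (\<phi> q))"
        by (rule smooth_on_set_compose[OF Emb_bdD(1)[OF \<phi>] smooth_inverse_embedding[OF hypersurface Emb_bd_Emb[OF \<Phi>t]]])
          (simp add: im)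
    qed (simp add: inv)
    ultimately have "shift \<in> Diff M" by (simp add: Diff_def shift_def)
    moreover have eq: "compose M \<phi> shift = \<Phi> t"
      by (rule extensionalityI[of _ M]) (use shift_in in \<open>auto simp: compose_def \<Phi>_def\<close>)
    ultimately show ?thesis
      using shape \<phi> \<Phi>t x unfolding shape_functionality_def by metis
  qed
  have \<Phi>0: "\<Phi> 0 = \<phi>" unfolding \<Phi>_def \<Theta>_0 using Emb_bdD(5)[OF \<phi>] by (simp add: extensional_restrict)
  have u: "uniform_limit M (\<lambda>t p. (f (\<Phi> t) (\<Phi> t p) - f \<phi> (\<phi> p)) / t)
          (\<lambda>p. material_derivative M f \<phi> V (\<phi> p)) (at_right 0)"
  proof (rule material_limit[OF \<phi> V_direction \<epsilon>(1,3,4) \<Phi>0])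
    fix p assume "p \<in> M"
    then show "((\<lambda>t. \<Phi> t p) has_vector_derivative V (\<phi> p)) (at 0 within {0..\<epsilon>})"
      using \<Theta>_velocity[of "\<phi> p"] by (simp add: \<Phi>_def)
  qed
  show thesis
  proof (rule that[OF \<epsilon>(1) \<epsilon>(3)[unfolded \<Phi>_def] fS[unfolded \<Phi>_def]])
    fix p assume p: "p \<in> M"
    have lim: "((\<lambda>t. (f (\<Phi> t) (\<Phi> t p) - f \<phi> (\<phi> p)) / t) \<longlongrightarrow> f_deriv \<phi> V p) (at_right 0)"
      using tendsto_uniform_limitI[OF u p] by (simp add: f_deriv_def[OF \<phi> V_direction])
    have ev: "eventually (\<lambda>t. t \<in> {0..\<epsilon>}) (at_right (0::real))"
      unfolding eventually_at_right_field using \<epsilon>(1) by (intro exI[of _ \<epsilon>]) auto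
    show "((\<lambda>t. (f \<phi> (\<Theta> (t, \<phi> p)) - f \<phi> (\<phi> p)) / t) \<longlongrightarrow> f_deriv \<phi> V p) (at_right 0)"
    proof (rule Lim_transform_eventually[OF lim])
      show "\<forall>\<^sub>F t in at_right 0. (f (\<Phi> t) (\<Phi> t p) - f \<phi> (\<phi> p)) / t = (f \<phi> (\<Theta> (t, \<phi> p)) - f \<phi> (\<phi> p)) / t"
        using ev
      proof eventually_elim
        case (elim t)
        have "\<Theta> (t, \<phi> p) \<in> S" using \<Theta>_image[of t] elim \<epsilon>(2) p by auto
        then show ?case using fS[OF elim] p by (simp add: \<Phi>_def)
      qed
    qed
  qed (simp_all)
qed

end

section \<open>The first variation in a chart\<close>

text \<open>
  The Jacobian determinant of a step along one coordinate whose length depends on the point.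
\<close>
lemma det_identity_plus_row:
  fixes \<beta> :: "'n::finite \<Rightarrow> real"
  shows "det (\<chi> k j. (if k = j then 1 else 0) + (if k = i then \<beta> j else 0)) = 1 + \<beta> i"
proof -
  define A :: "real^'n^'n" where "A = (\<chi> k. if k = i then (1 + \<beta> i) *s axis k 1 else axis k 1)"
  define x :: "real^'n" where "x = (\<Sum>j\<in>UNIV - {i}. \<beta> j *s axis j 1)"
  have rows: "row k A = (if k = i then (1 + \<beta> i) *s axis k 1 else axis k 1)" for k
    by (simp add: A_def row_def vec_eq_iff)
  have "x \<in> vec.span {row j A |j. j \<noteq> i}"
    unfolding x_def
  proof (intro vec.span_sum vec.span_scale vec.span_base CollectI)
    show "\<exists>k. axis j 1 = row k A \<and> k \<noteq> i" if "j \<in> UNIV - {i}" for j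
      using that by (intro exI[of _ j]) (simp add: rows)
  qed
  then have "det (\<chi> k. if k = i then row i A + x else row k A) = det A" by (rule det_row_span)
  also have "det A = (1 + \<beta> i) * det (\<chi> k. if k = i then axis k 1 else axis k (1::real))"
    unfolding A_def by (rule det_row_mul)
  also have "(\<chi> k. if k = i then axis k 1 else axis k (1::real)) = (mat 1 :: real^'n^'n)"
    by (auto simp: mat_def axis_def vec_eq_iff)
  also have "(\<chi> k. if k = i then row i A + x else row k A) =
      (\<chi> k j. (if k = j then 1 else 0) + (if k = i then \<beta> j else 0))"
  proof -
    have "x $ j = (if j = i then 0 else \<beta> j)" for j
    proof -
      have "x $ j = (\<Sum>k\<in>UNIV - {i}. if k = j then \<beta> k else 0)"
        unfolding x_def sum_component by (rule sum.cong) (auto simp: axis_def)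
      then show ?thesis by (simp add: sum.delta)
    qed
    then show ?thesis by (auto simp: vec_eq_iff rows axis_def)
  qed
  finally show ?thesis by simp
qed

lemma has_derivative_vec_components:
  fixes F :: "'a::real_normed_vector \<Rightarrow> ('b::euclidean_space)^'n::finite"
  assumes "\<And>j. ((\<lambda>x. F x $ j) has_derivative (\<lambda>h. F' h $ j)) (at a within S)"
  shows "(F has_derivative F') (at a within S)"
  unfolding has_derivative_componentwise_within[of F]
proof
  fix b :: "'b^'n" assume "b \<in> Basis"
  then obtain j c where b: "b = axis j c" by (auto simp: Basis_vec_def)
  show "((\<lambda>x. F x \<bullet> b) has_derivative (\<lambda>x. F' x \<bullet> b)) (at a within S)"
    unfolding b inner_axis by (rule has_derivative_inner_left[OF assms])
qed

text \<open>
  The derivative only depends on the point and the velocity of the curve of frames.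
\<close>
lemma gram_curve_derivative:
  fixes z1 z2 :: "real \<Rightarrow> 'n::finite \<Rightarrow> 'n ambient"
  assumes z1: "\<And>j. ((\<lambda>t. z1 t j) has_vector_derivative b j) (at 0)"
    and z2: "\<And>j. ((\<lambda>t. z2 t j) has_vector_derivative b j) (at 0)"
    and eq: "z1 0 = z2 0" and pos: "gram (z2 0) > 0"
    and d1: "((\<lambda>t. sqrt (gram (z1 t))) has_real_derivative d1) (at 0)"
    and d2: "((\<lambda>t. sqrt (gram (z2 t))) has_real_derivative d2) (at 0)"
  shows "d1 = d2"
proof -
  define gr where "gr z = gram (\<lambda>j. z $ j)" for z :: "'n frame"
  have "smooth_on_open UNIV gr"
    unfolding gr_def
    by (intro smooth_gram open_UNIV smooth_comp_linear[OF open_UNIV bounded_linear_vec_nth] smooth_ident)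
  then have D: "(gr has_derivative frechet_derivative gr (at z)) (at z)" for z
    by (rule smooth_on_open_has_derivative) simp
  let ?L = "\<lambda>t. frechet_derivative gr (at (\<chi> j. z2 0 j)) (\<chi> j. t *\<^sub>R b j)"
  have der: "((\<lambda>t. gram (z t)) has_derivative ?L) (at 0)"
    if z: "\<And>j. ((\<lambda>t. z t j) has_vector_derivative b j) (at 0)" "z 0 = z2 0" for z :: "real \<Rightarrow> 'n \<Rightarrow> 'n ambient"
  proof -
    have "((\<lambda>t. \<chi> j. z t j) has_derivative (\<lambda>t. \<chi> j. t *\<^sub>R b j)) (at 0)"
      by (rule has_derivative_vec_components) (use z(1) in \<open>simp add: has_vector_derivative_def\<close>)
    moreover have "(gr has_derivative frechet_derivative gr (at (\<chi> j. z2 0 j))) (at (\<chi> j. z 0 j))"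
      unfolding z(2) by (rule D)
    ultimately have "((\<lambda>t. gr (\<chi> j. z t j)) has_derivative ?L) (at 0)" by (rule has_derivative_compose)
    then show ?thesis by (simp add: gr_def)
  qed
  have s1: "((\<lambda>t. sqrt (gram (z1 t))) has_derivative (\<lambda>t. ?L t * (inverse (sqrt (gram (z2 0))) / 2))) (at 0)"
    using has_derivative_real_sqrt[OF _ der[OF z1 eq]] pos by (simp add: eq)
  have s2: "((\<lambda>t. sqrt (gram (z2 t))) has_derivative (\<lambda>t. ?L t * (inverse (sqrt (gram (z2 0))) / 2))) (at 0)"
    using has_derivative_real_sqrt[OF _ der[OF z2 refl]] pos by simp
  have "(*) d1 = (\<lambda>t. ?L t * (inverse (sqrt (gram (z2 0))) / 2))"
    by (rule has_derivative_unique[OF d1[unfolded has_field_derivative_def] s1])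
  also have "\<dots> = (*) d2"
    by (rule has_derivative_unique[OF s2 d2[unfolded has_field_derivative_def]])
  finally have "d1 * 1 = d2 * 1" by (rule fun_cong)
  then show ?thesis by simp
qed

context chart_push
begin

abbreviation w where "w \<equiv> chart_density W Y"
abbreviation wX where "wX \<equiv> chart_density W X"

definition cut :: "real^'n \<Rightarrow> real" where "cut v = \<beta> (Y v)"

definition chart_f :: "real^'n \<Rightarrow> real" where "chart_f v = f \<phi> (Y v)"

definition chart_td :: "real^'n \<Rightarrow> real" where "chart_td v = g (X v) * wX v / w v"

lemma XM: "v \<in> W \<Longrightarrow> X v \<in> M"
  using XD(6) by blast

lemma frames_S: "has_frames S"
  unfolding has_frames_def
proof
  fix x assume "x \<in> S"
  then have "orthonormal_frame (tangent_space S x) (\<sigma> \<phi> x)"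
    using \<sigma>[OF \<phi>] by (auto simp: transported_orientation_def)
  then show "\<exists>b :: 'n frame. orthonormal_frame (tangent_space S x) b" by blast
qed

lemma w_pos: "v \<in> W \<Longrightarrow> w v > 0" and wX_pos: "v \<in> W \<Longrightarrow> wX v > 0"
  by (rule chart_density_pos[OF frames_S Y_param], assumption) (rule chart_density_pos[OF has_frames X])

lemma w_eq_jac: "v \<in> W \<Longrightarrow> w v = jac \<phi> (X v) * wX v"
  using chart_density_compose[OF Emb_bdD(1)[OF \<phi>] X] by (simp add: Y_def[abs_def])

lemma td_Y:
  assumes v: "v \<in> W"
  shows "td \<phi> (Y v) = chart_td v"
  using td_eq[OF \<phi> XM[OF v]] w_eq_jac[OF v] wX_pos[OF v] by (simp add: Y_def chart_td_def)

lemma smooth_chart_density: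
  assumes "smooth_on_open W Z" "\<And>v. v \<in> W \<Longrightarrow> chart_density W Z v > 0"
  shows "smooth_on_open W (chart_density W Z)"
proof -
  have eq: "chart_density W Z v = sqrt (gram (\<lambda>j. frechet_derivative Z (at v) (axis j 1)))" if "v \<in> W" for v
    by (simp add: chart_density_def at_within_open[OF that W])
  have "smooth_on_open W (\<lambda>v. sqrt (gram (\<lambda>j. frechet_derivative Z (at v) (axis j 1))))"
    by (intro smooth_sqrt[OF W] smooth_gram[OF W] smooth_on_open_frechet assms(1)) (use assms(2) eq in fastforce)
  then show ?thesis by (rule smooth_on_open_cong[OF W]) (simp add: eq)
qed

lemma w_smooth: "smooth_on_open W w"
  by (rule smooth_chart_density[OF Y_smooth w_pos])

lemma X_smooth: "smooth_on_open W X"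
  using XD(4) by (simp add: smooth_on_set_open_iff[OF W])

lemma wX_smooth: "smooth_on_open W wX"
  by (rule smooth_chart_density[OF X_smooth wX_pos])

lemma chart_td_smooth: "smooth_on_open W chart_td"
proof -
  have "smooth_on_set W (\<lambda>v. g (X v))" by (rule smooth_on_set_compose[OF XD(4) g_smooth XD(6)])
  then have "smooth_on_open W (\<lambda>v. g (X v))" by (simp add: smooth_on_set_open_iff[OF W])
  moreover have "w v \<noteq> 0" if "v \<in> W" for v using w_pos[OF that] by simp
  ultimately show ?thesis
    unfolding chart_td_def[abs_def]
    by (intro smooth_divide[OF W] smooth_mult[OF W] wX_smooth w_smooth)
qed

lemma chart_f_smooth: "smooth_on_open W chart_f"
proof -
  have "smooth_on_set W chart_f" unfolding chart_f_def[abs_def]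
    by (rule smooth_on_set_compose[OF YD(4) f_smooth[OF \<phi>] YD(6)])
  then show ?thesis by (simp add: smooth_on_set_open_iff[OF W])
qed

lemma cut_smooth: "smooth_on_open W cut"
  unfolding cut_def[abs_def] by (rule smooth_on_open_comp[OF W smooth_bump[of UNIV] Y_smooth]) simp

lemma push_X:
  assumes v: "v \<in> W"
  shows "frechet_derivative Y (at v) (axis j 1) =
    (\<Sum>k\<in>UNIV. (\<chi> i j. \<tau> (X v) $ i \<bullet> frechet_derivative X (at v within W) (axis j 1)) $ k $ j *\<^sub>R push \<phi> k (X v))"
proof -
  let ?DX = "frechet_derivative X (at v within W)"
  have DX: "(X has_derivative ?DX) (at v within W)" by (rule smooth_on_set_has_derivative[OF XD(4) v])
  note T = tangent_map_derivative[OF Emb_bdD(1)[OF \<phi>] XM[OF v]]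
  have "(Y has_derivative (\<lambda>h. tangent_map M \<phi> (X v) (?DX h))) (at v within W)"
    unfolding Y_def[abs_def] by (rule has_derivative_in_compose[OF DX has_derivative_subset[OF T XD(6)]])
  then have "(Y has_derivative (\<lambda>h. tangent_map M \<phi> (X v) (?DX h))) (at v)" by (simp add: at_within_open[OF v W])
  then have "frechet_derivative Y (at v) (axis j 1) = tangent_map M \<phi> (X v) (?DX (axis j 1))"
    by (simp add: frechet_derivative_at[symmetric])
  also have "\<dots> = tangent_map M \<phi> (X v) (\<Sum>k\<in>UNIV. (\<tau> (X v) $ k \<bullet> ?DX (axis j 1)) *\<^sub>R \<tau> (X v) $ k)"
    using orthonormal_frame_expansion[OF ori_frame[OF XM[OF v] \<tau>_ori[OF XM[OF v]]] chart_velocity_tangent[OF X v, of j]] by simp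
  finally show ?thesis
    by (simp add: linear_sum[OF has_derivative_linear[OF T]] linear_scale[OF has_derivative_linear[OF T]] push_def[OF \<phi> V_direction])
qed

lemma push_V_X:
  assumes v: "v \<in> W"
  shows "frechet_derivative (\<lambda>v. V (Y v)) (at v) (axis j 1) =
    (\<Sum>k\<in>UNIV. (\<chi> i j. \<tau> (X v) $ i \<bullet> frechet_derivative X (at v within W) (axis j 1)) $ k $ j *\<^sub>R push_V \<phi> V k (X v))"
proof -
  have DV: "(V has_derivative frechet_derivative V (at (Y v))) (at (Y v))"
    by (rule smooth_on_open_has_derivative[OF V_smooth]) simp
  have "((\<lambda>v. V (Y v)) has_derivative (\<lambda>h. frechet_derivative V (at (Y v)) (frechet_derivative Y (at v) h))) (at v)"
    by (rule has_derivative_compose[OF Y_derivative[OF v] DV])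
  then have "frechet_derivative (\<lambda>v. V (Y v)) (at v) (axis j 1) =
      frechet_derivative V (at (Y v)) (frechet_derivative Y (at v) (axis j 1))"
    by (simp add: frechet_derivative_at[symmetric])
  then show ?thesis
    unfolding push_X[OF v]
    by (simp add: linear_sum[OF has_derivative_linear[OF DV]] linear_scale[OF has_derivative_linear[OF DV]]
        push_V_def[OF \<phi> V_direction, of _ "X v", folded Y_def])
qed

text \<open>
  The straight perturbation and the reparametrized chart \<open>v \<mapsto> Y (v + \<omega> t cut v e)\<close> have the same
  velocity at time \<open>0\<close>, and so do their coordinate frames \<open>z1\<close> and \<open>z2\<close>, because second derivatives of
  \<open>Y\<close> commute. The volume element of the second curve is explicit: the density at the displaced
  point times the Jacobian determinant of the displacement.
\<close>
lemma jac_deriv_chart: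
  assumes v: "v \<in> W_Q"
  shows "wX v * jac_deriv \<phi> V (X v) = \<omega> * frechet_derivative (\<lambda>v. cut v * w v) (at v) e"
proof -
  have vW: "v \<in> W" using W_Q(1)[OF v] .
  define G where "G j y = frechet_derivative Y (at y) (axis j 1)" for j y
  define dcut where "dcut j = frechet_derivative cut (at v) (axis j 1)" for j
  define s where "s = \<omega> * cut v"
  define b where "b j = frechet_derivative (\<lambda>v. V (Y v)) (at v) (axis j 1)" for j
  define z1 where "z1 t j = G j v + t *\<^sub>R b j" for t j
  define z2 where "z2 t j = G j (v + (t * s) *\<^sub>R e) + (t * \<omega> * dcut j) *\<^sub>R G i (v + (t * s) *\<^sub>R e)" for t j
  have Gs: "smooth_on_open W (G j)" for j
    unfolding G_def[abs_def] by (rule smooth_on_open_frechet[OF Y_smooth])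
  have line: "((\<lambda>t. v + (t * s) *\<^sub>R e) has_derivative (\<lambda>t. (t * s) *\<^sub>R e)) (at 0)"
    by (auto intro!: derivative_eq_intros)
  have G_line: "((\<lambda>t. G j (v + (t * s) *\<^sub>R e)) has_vector_derivative s *\<^sub>R frechet_derivative (G j) (at v) e) (at 0)" for j
  proof -
    have D: "(G j has_derivative frechet_derivative (G j) (at v)) (at (v + (0 * s) *\<^sub>R e))"
      using smooth_on_open_has_derivative[OF Gs vW] by simp
    show ?thesis
      using has_derivative_compose[OF line D]
      by (simp add: has_vector_derivative_def linear_scale[OF has_derivative_linear[OF D]])
  qed
  have b_eq: "b j = s *\<^sub>R frechet_derivative (G j) (at v) e + (\<omega> * dcut j) *\<^sub>R G i v" for j
  proof -
    have Dcut: "(cut has_derivative frechet_derivative cut (at v)) (at v)"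
      by (rule smooth_on_open_has_derivative[OF cut_smooth vW])
    have DG: "(G i has_derivative frechet_derivative (G i) (at v)) (at v)"
      by (rule smooth_on_open_has_derivative[OF Gs vW])
    have "((\<lambda>v. (\<omega> * cut v) *\<^sub>R G i v) has_derivative
        (\<lambda>h. (\<omega> * cut v) *\<^sub>R frechet_derivative (G i) (at v) h + (\<omega> * frechet_derivative cut (at v) h) *\<^sub>R G i v)) (at v)"
      by (rule has_derivative_scaleR[OF has_derivative_mult_right[OF Dcut] DG])
    moreover have "frechet_derivative (\<lambda>v. V (Y v)) (at v) = frechet_derivative (\<lambda>v. (\<omega> * cut v) *\<^sub>R G i v) (at v)"
      by (rule frechet_derivative_cong_open[OF open_W_Q v]) (simp add: V_Y cut_def G_def)
    ultimately have "b j = s *\<^sub>R frechet_derivative (G i) (at v) (axis j 1) + (\<omega> * dcut j) *\<^sub>R G i v"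
      by (simp add: b_def s_def dcut_def frechet_derivative_at[symmetric])
    moreover have "frechet_derivative (G i) (at v) (axis j 1) = frechet_derivative (G j) (at v) e"
      unfolding G_def[abs_def] by (rule frechet_derivative_symmetric[OF W Y_smooth vW])
    ultimately show ?thesis by simp
  qed
  have z1d: "((\<lambda>t. z1 t j) has_vector_derivative b j) (at 0)" for j
    unfolding z1_def by (auto intro!: derivative_eq_intros)
  have z2d: "((\<lambda>t. z2 t j) has_vector_derivative b j) (at 0)" for j
  proof -
    have "((\<lambda>t. t * \<omega> * dcut j) has_real_derivative \<omega> * dcut j) (at 0)"
      by (auto intro!: derivative_eq_intros)
    from has_vector_derivative_add[OF G_line[of j] has_vector_derivative_scaleR[OF this G_line[of i]]]
    show ?thesis unfolding z2_def by (simp add: b_eq)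
  qed
  have eq0: "z1 0 = z2 0" by (simp add: z1_def z2_def fun_eq_iff)
  have w_gram: "w y = sqrt (gram (\<lambda>j. G j y))" if "y \<in> W" for y
    by (simp add: chart_density_def G_def at_within_open[OF that W])
  have "z2 0 = (\<lambda>j. G j v)" by (simp add: z2_def fun_eq_iff)
  then have "sqrt (gram (z2 0)) > 0" using w_gram[OF vW] w_pos[OF vW] by (simp only:)
  then have pos: "gram (z2 0) > 0" by simp
  have d1: "((\<lambda>t. sqrt (gram (z1 t))) has_real_derivative wX v * jac_deriv \<phi> V (X v)) (at 0)"
  proof -
    let ?A = "\<chi> i j. \<tau> (X v) $ i \<bullet> frechet_derivative X (at v within W) (axis j 1)"
    have "z1 t j = (\<Sum>k\<in>UNIV. ?A $ k $ j *\<^sub>R (push \<phi> k (X v) + t *\<^sub>R push_V \<phi> V k (X v)))" for t j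
      unfolding z1_def G_def b_def push_X[OF vW] push_V_X[OF vW]
      by (simp only: scaleR_sum_right sum.distrib[symmetric] scaleR_add_right scaleR_left_commute[of t])
    then have "sqrt (gram (z1 t)) = \<bar>det ?A\<bar> * sqrt (gram (\<lambda>k. push \<phi> k (X v) + t *\<^sub>R push_V \<phi> V k (X v)))" for t
      by (rule sqrt_gram_linear_combination)
    moreover have "\<bar>det ?A\<bar> = wX v"
      using chart_density_frame[OF X vW ori_frame[OF XM[OF vW] \<tau>_ori[OF XM[OF vW]]]] by simp
    ultimately have eq: "(\<lambda>t. sqrt (gram (z1 t))) = (\<lambda>t. wX v * sqrt (gram (\<lambda>k. push \<phi> k (X v) + t *\<^sub>R push_V \<phi> V k (X v))))"
      by auto
    show ?thesis unfolding eq by (rule DERIV_cmult[OF jac_has_derivative[OF \<phi> V_direction XM[OF vW]]])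
  qed
  have d2: "((\<lambda>t. sqrt (gram (z2 t))) has_real_derivative \<omega> * frechet_derivative (\<lambda>v. cut v * w v) (at v) e) (at 0)"
  proof -
    have Dw: "(w has_derivative frechet_derivative w (at v)) (at v)"
      by (rule smooth_on_open_has_derivative[OF w_smooth vW])
    have Dcut: "(cut has_derivative frechet_derivative cut (at v)) (at v)"
      by (rule smooth_on_open_has_derivative[OF cut_smooth vW])
    have fd: "frechet_derivative (\<lambda>v. cut v * w v) (at v) e = cut v * frechet_derivative w (at v) e + dcut i * w v"
      using has_derivative_mult[OF Dcut Dw] by (simp add: frechet_derivative_at[symmetric] dcut_def)
    have "((\<lambda>t. w (v + t *\<^sub>R (s *\<^sub>R e))) has_real_derivative frechet_derivative w (at v) (s *\<^sub>R e)) (at 0)"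
      by (rule has_real_derivative_along_line) (use Dw in simp)
    then have wl: "((\<lambda>t. w (v + (t * s) *\<^sub>R e)) has_real_derivative s * frechet_derivative w (at v) e) (at 0)"
      by (simp add: linear_scale[OF has_derivative_linear[OF Dw]])
    have prod: "((\<lambda>t. (1 + t * \<omega> * dcut i) * w (v + (t * s) *\<^sub>R e)) has_real_derivative
        \<omega> * frechet_derivative (\<lambda>v. cut v * w v) (at v) e) (at 0)"
    proof -
      have "((\<lambda>t. 1 + t * \<omega> * dcut i) has_real_derivative \<omega> * dcut i) (at 0)"
        by (auto intro!: derivative_eq_intros)
      from DERIV_mult[OF this wl] show ?thesis
        by (rule DERIV_cong) (simp only: fd s_def, simp add: algebra_simps)
    qed
    have "((\<lambda>t. v + (t * s) *\<^sub>R e) \<longlongrightarrow> v + (0 * s) *\<^sub>R e) (at (0::real))" by (intro tendsto_intros)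
    then have ev1: "eventually (\<lambda>t. v + (t * s) *\<^sub>R e \<in> W) (at (0::real))"
      using W vW by (intro topological_tendstoD) auto
    have "((\<lambda>t. 1 + t * \<omega> * dcut i) \<longlongrightarrow> 1 + 0 * \<omega> * dcut i) (at (0::real))" by (intro tendsto_intros)
    then have ev2: "eventually (\<lambda>t. 1 + t * \<omega> * dcut i > 0) (at (0::real))"
      by (intro order_tendstoD(1)[where y="1 + 0 * \<omega> * dcut i"]) auto
    have eqt: "(1 + t * \<omega> * dcut i) * w (v + (t * s) *\<^sub>R e) = sqrt (gram (z2 t))"
      if "v + (t * s) *\<^sub>R e \<in> W" "1 + t * \<omega> * dcut i > 0" for t
    proof -
      let ?B = "\<chi> k j. (if k = j then 1 else 0) + (if k = i then t * \<omega> * dcut j else 0)"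
      have "z2 t j = (\<Sum>k\<in>UNIV. ?B $ k $ j *\<^sub>R G k (v + (t * s) *\<^sub>R e))" for j
        by (simp add: z2_def scaleR_add_left sum.distrib if_distrib[of "\<lambda>x. x *\<^sub>R _"] cong: if_cong)
      then have "sqrt (gram (z2 t)) = \<bar>det ?B\<bar> * sqrt (gram (\<lambda>k. G k (v + (t * s) *\<^sub>R e)))"
        by (rule sqrt_gram_linear_combination)
      also have "det ?B = 1 + t * \<omega> * dcut i" by (rule det_identity_plus_row)
      finally show ?thesis using that by (simp add: w_gram)
    qed
    have ev: "eventually (\<lambda>t. (1 + t * \<omega> * dcut i) * w (v + (t * s) *\<^sub>R e) = sqrt (gram (z2 t))) (at 0)"
      using ev1 ev2 by eventually_elim (rule eqt)
    have "eqt0": "(1 + 0 * \<omega> * dcut i) * w (v + (0 * s) *\<^sub>R e) = sqrt (gram (z2 0))"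
      by (rule eqt) (use vW in simp_all)
    have "((\<lambda>t. ((1 + t * \<omega> * dcut i) * w (v + (t * s) *\<^sub>R e) - (1 + 0 * \<omega> * dcut i) * w (v + (0 * s) *\<^sub>R e)) / (t - 0)) \<longlongrightarrow>
       \<omega> * frechet_derivative (\<lambda>v. cut v * w v) (at v) e) (at 0)"
      using prod unfolding has_field_derivative_iff .
    then have "((\<lambda>t. (sqrt (gram (z2 t)) - sqrt (gram (z2 0))) / (t - 0)) \<longlongrightarrow>
       \<omega> * frechet_derivative (\<lambda>v. cut v * w v) (at v) e) (at 0)"
      by (rule Lim_transform_eventually) (use ev in eventually_elim, simp only: eqt0)
    then show ?thesis unfolding has_field_derivative_iff .
  qed
  show ?thesis by (rule gram_curve_derivative[OF z1d z2d eq0 pos d1 d2])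
qed

lemma f_deriv_chart:
  assumes v: "v \<in> W_Q"
  shows "f_deriv \<phi> V (X v) = \<omega> * cut v * frechet_derivative chart_f (at v) e"
proof -
  have vW: "v \<in> W" using W_Q(1)[OF v] .
  have lim: "((\<lambda>t. (f \<phi> (\<Theta> (t, \<phi> (X v))) - f \<phi> (\<phi> (X v))) / t) \<longlongrightarrow> f_deriv \<phi> V (X v)) (at_right 0)"
    by (rule flow_curve) (use XM[OF vW] in blast)
  have D: "(chart_f has_derivative frechet_derivative chart_f (at v)) (at v)"
    by (rule smooth_on_open_has_derivative[OF chart_f_smooth vW])
  have "((\<lambda>t. chart_f (v + t *\<^sub>R ((\<omega> * cut v) *\<^sub>R e))) has_real_derivative frechet_derivative chart_f (at v) ((\<omega> * cut v) *\<^sub>R e)) (at 0)"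
    by (rule has_real_derivative_along_line) (use D in simp)
  then have "((\<lambda>t. chart_f (v + t *\<^sub>R ((\<omega> * cut v) *\<^sub>R e))) has_real_derivative \<omega> * cut v * frechet_derivative chart_f (at v) e) (at 0 within {0<..})"
    using linear_scale[OF has_derivative_linear[OF D], of "\<omega> * cut v" e] by (auto intro: DERIV_subset)
  then have "((\<lambda>t. (chart_f (v + t *\<^sub>R ((\<omega> * cut v) *\<^sub>R e)) - chart_f v) / t) \<longlongrightarrow> \<omega> * cut v * frechet_derivative chart_f (at v) e) (at_right 0)"
    by (simp add: has_field_derivative_iff)
  moreover have "chart_f (v + t *\<^sub>R ((\<omega> * cut v) *\<^sub>R e)) = f \<phi> (\<Theta> (t, \<phi> (X v)))" for t
    using \<Theta>_Y[OF v, of t] by (simp add: chart_f_def Y_def cut_def mult_ac)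
  ultimately have "((\<lambda>t. (f \<phi> (\<Theta> (t, \<phi> (X v))) - f \<phi> (\<phi> (X v))) / t) \<longlongrightarrow> \<omega> * cut v * frechet_derivative chart_f (at v) e) (at_right 0)"
    by (simp add: chart_f_def Y_def)
  from tendsto_unique[OF _ lim this] show ?thesis by simp
qed

lemma variation_outside:
  assumes p: "p \<in> M" "\<phi> p \<notin> Q"
  shows "variation \<phi> V p = 0"
proof -
  have lim: "((\<lambda>t. (f \<phi> (\<Theta> (t, \<phi> p)) - f \<phi> (\<phi> p)) / t) \<longlongrightarrow> f_deriv \<phi> V p) (at_right 0)"
    by (rule flow_curve) (use p(1) in blast)
  have "\<Theta> (t, \<phi> p) = \<phi> p" for t using p(2) by (simp add: \<Theta>_def)
  then have "((\<lambda>t::real. 0) \<longlongrightarrow> f_deriv \<phi> V p) (at_right 0)" using lim by simp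
  then have f0: "f_deriv \<phi> V p = 0" by (simp add: tendsto_const_iff)
  have "frechet_derivative V (at (\<phi> p)) = frechet_derivative (\<lambda>x. 0) (at (\<phi> p))"
  proof (rule frechet_derivative_cong_open[of "- cball y0 r"])
    show "V x = 0" if "x \<in> - cball y0 r" for x using bump_zero[OF r(1), of x y0] that by (auto simp: V_def)
  qed (use p(2) r(2) in auto)
  then have "push_V \<phi> V k p = 0" for k by (simp add: push_V_def[OF \<phi> V_direction])
  then have "jac_deriv \<phi> V p = 0" by (simp add: jac_deriv_def[OF \<phi> V_direction])
  then show ?thesis by (simp add: variation_def[OF \<phi> V_direction] f0)
qed

end

section \<open>Integration by parts and strict descent\<close>

lemma integrable_compact_support:
  fixes F :: "'a::euclidean_space \<Rightarrow> real"
  assumes F: "continuous_on UNIV F" and K: "compact K" and zero: "\<And>x. x \<notin> K \<Longrightarrow> F x = 0"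
  shows "integrable lborel F"
proof -
  have "integrable lborel (\<lambda>x. indicator K x *\<^sub>R F x)"
    by (rule borel_integrable_compact[OF K continuous_on_subset[OF F]]) simp
  moreover have "(\<lambda>x. indicator K x *\<^sub>R F x) = F" using zero by (auto simp: indicator_def fun_eq_iff)
  ultimately show ?thesis by simp
qed

context chart_push
begin

definition supp :: "(real^'n) set" where "supp = {v \<in> W. Y v \<in> cball y0 r}"

lemma supp_subset: "supp \<subseteq> W_Q"
  using r(2) by (auto simp: supp_def W_Q_def)

lemma compact_supp: "compact supp"
proof -
  have "compact S" by (rule compact_continuous_image[OF smooth_on_set_continuous[OF Emb_bdD(1)[OF \<phi>]] compact])
  then have "compact (S \<inter> cball y0 r)" by (intro compact_Int_closed closed_cball)
  moreover have sub: "S \<inter> cball y0 r \<subseteq> Y ` W"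
  proof
    fix x assume x: "x \<in> S \<inter> cball y0 r"
    then have "\<pi> x \<in> W_Q \<and> Y (\<pi> x) = x" using S_Q r(2) by blast
    then show "x \<in> Y ` W" using W_Q(1) by (metis imageI)
  qed
  ultimately have "compact (inv_into W Y ` (S \<inter> cball y0 r))"
    by (intro compact_continuous_image continuous_on_subset[OF YD(8)])
  moreover have "inv_into W Y ` (S \<inter> cball y0 r) = supp"
  proof
    show "inv_into W Y ` (S \<inter> cball y0 r) \<subseteq> supp"
      using sub by (auto simp: supp_def inv_into_into f_inv_into_f subset_iff)
    show "supp \<subseteq> inv_into W Y ` (S \<inter> cball y0 r)"
    proof
      fix v assume v: "v \<in> supp"
      then have "v = inv_into W Y (Y v)" using YD(3) by (simp add: supp_def)
      moreover have "Y v \<in> S \<inter> cball y0 r" using v YD(6) by (auto simp: supp_def)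
      ultimately show "v \<in> inv_into W Y ` (S \<inter> cball y0 r)" by blast
    qed
  qed
  ultimately show ?thesis by simp
qed

lemma cut_zero: "v \<in> W_Q \<Longrightarrow> v \<notin> supp \<Longrightarrow> cut v = 0"
  using bump_zero[OF r(1), of "Y v" y0] W_Q(1) by (auto simp: supp_def cut_def)

text \<open>
  Its derivative along the coordinate line is the part of the first variation that integrates to zero.
\<close>
definition flux0 :: "real^'n \<Rightarrow> real" where
  "flux0 v = ((chart_f v)\<^sup>2 - (chart_td v)\<^sup>2) * (cut v * w v)"

text \<open>
  The part of the first variation that is left over after the derivative of \<open>flux0\<close> has been split off. Its sign
  is that of \<open>\<omega>\<close> times the slope of the defect.
\<close>
definition slope0 :: "real^'n \<Rightarrow> real" where
  "slope0 v = 2 * (cut v * w v * chart_td v) * (\<omega> * (frechet_derivative chart_td (at v) e - frechet_derivative chart_f (at v) e))"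

definition flux :: "real^'n \<Rightarrow> real" where "flux v = (if v \<in> W_Q then flux0 v else 0)"

definition slope :: "real^'n \<Rightarrow> real" where "slope v = (if v \<in> W_Q then slope0 v else 0)"

lemma W_Q_subset: "W_Q \<subseteq> W"
  using W_Q(1) by blast

lemma flux_smooth: "smooth_on_open UNIV flux"
  unfolding flux_def[abs_def]
proof (rule smooth_extend_zero[OF open_W_Q compact_imp_closed[OF compact_supp] supp_subset])
  have "smooth_on_open W flux0"
    unfolding flux0_def[abs_def] power2_eq_square
    by (intro smooth_mult[OF W] smooth_diff[OF W] chart_f_smooth chart_td_smooth cut_smooth w_smooth)
  then show "smooth_on_open W_Q flux0" by (rule smooth_on_open_subset[OF _ W_Q_subset])
  show "flux0 v = 0" if "v \<in> W_Q" "v \<notin> supp" for v using cut_zero[OF that] by (simp add: flux0_def)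
qed

lemma slope_smooth: "smooth_on_open UNIV slope"
  unfolding slope_def[abs_def]
proof (rule smooth_extend_zero[OF open_W_Q compact_imp_closed[OF compact_supp] supp_subset])
  have "smooth_on_open W slope0"
    unfolding slope0_def[abs_def]
    by (intro smooth_mult[OF W] smooth_diff[OF W] smooth_on_open_frechet chart_f_smooth chart_td_smooth cut_smooth w_smooth smooth_const)
  then show "smooth_on_open W_Q slope0" by (rule smooth_on_open_subset[OF _ W_Q_subset])
  show "slope0 v = 0" if "v \<in> W_Q" "v \<notin> supp" for v using cut_zero[OF that] by (simp add: slope0_def)
qed

lemma flux_zero: "v \<notin> supp \<Longrightarrow> flux v = 0"
  using cut_zero by (simp add: flux_def flux0_def)

lemma slope_zero: "v \<notin> supp \<Longrightarrow> slope v = 0"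
  using cut_zero by (simp add: slope_def slope0_def)

lemma flux_deriv_zero: "v \<notin> supp \<Longrightarrow> frechet_derivative flux (at v) e = 0"
proof -
  assume v: "v \<notin> supp"
  have "frechet_derivative flux (at v) = frechet_derivative (\<lambda>v. 0) (at v)"
    by (rule frechet_derivative_cong_open[of "- supp"])
      (use v compact_imp_closed[OF compact_supp] flux_zero in auto)
  then show ?thesis by simp
qed

lemma variation_chart:
  assumes v: "v \<in> W_Q"
  shows "wX v * variation \<phi> V (X v) = \<omega> * frechet_derivative flux (at v) e + slope v"
proof -
  have vW: "v \<in> W" using W_Q(1)[OF v] .
  let ?P = "\<lambda>v. cut v * w v"
  let ?chart_f' = "frechet_derivative chart_f (at v)" and ?chart_td' = "frechet_derivative chart_td (at v)" and ?P' = "frechet_derivative ?P (at v)"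
  have Dff: "(chart_f has_derivative ?chart_f') (at v)" by (rule smooth_on_open_has_derivative[OF chart_f_smooth vW])
  have Dhh: "(chart_td has_derivative ?chart_td') (at v)" by (rule smooth_on_open_has_derivative[OF chart_td_smooth vW])
  have DP: "(?P has_derivative ?P') (at v)"
    by (rule smooth_on_open_has_derivative[OF smooth_mult[OF W cut_smooth w_smooth] vW])
  have "((\<lambda>v. (chart_f v * chart_f v - chart_td v * chart_td v) * ?P v) has_derivative
      (\<lambda>h. (chart_f v * chart_f v - chart_td v * chart_td v) * ?P' h + ((chart_f v * ?chart_f' h + ?chart_f' h * chart_f v) - (chart_td v * ?chart_td' h + ?chart_td' h * chart_td v)) * ?P v)) (at v)"
    by (rule has_derivative_mult[OF has_derivative_diff[OF has_derivative_mult[OF Dff Dff] has_derivative_mult[OF Dhh Dhh]] DP])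
  then have "frechet_derivative flux0 (at v) e =
      ((chart_f v)\<^sup>2 - (chart_td v)\<^sup>2) * ?P' e + 2 * (chart_f v * ?chart_f' e - chart_td v * ?chart_td' e) * ?P v"
    by (simp add: flux0_def[abs_def] power2_eq_square frechet_derivative_at[symmetric] algebra_simps)
  moreover have "frechet_derivative flux (at v) = frechet_derivative flux0 (at v)"
    by (rule frechet_derivative_cong_open[OF open_W_Q v]) (simp add: flux_def)
  ultimately have flux': "frechet_derivative flux (at v) e =
      ((chart_f v)\<^sup>2 - (chart_td v)\<^sup>2) * ?P' e + 2 * (chart_f v * ?chart_f' e - chart_td v * ?chart_td' e) * ?P v" by simp
  have jw: "jac \<phi> (X v) * wX v = w v" using w_eq_jac[OF vW] by simp
  have gw: "g (X v) * wX v = chart_td v * w v" using w_pos[OF vW] by (simp add: chart_td_def)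
  have "wX v * variation \<phi> V (X v) = ((chart_f v)\<^sup>2 - (chart_td v)\<^sup>2) * (wX v * jac_deriv \<phi> V (X v))
      + 2 * (chart_f v * (jac \<phi> (X v) * wX v) - g (X v) * wX v) * f_deriv \<phi> V (X v)"
    using td_Y[OF vW] by (simp add: variation_def[OF \<phi> V_direction] chart_f_def Y_def algebra_simps)
  also have "\<dots> = ((chart_f v)\<^sup>2 - (chart_td v)\<^sup>2) * (\<omega> * ?P' e) + 2 * (chart_f v * w v - chart_td v * w v) * (\<omega> * cut v * ?chart_f' e)"
    unfolding jw gw jac_deriv_chart[OF v] f_deriv_chart[OF v] by (rule refl)
  also have "\<dots> = \<omega> * frechet_derivative flux (at v) e + slope v"
    unfolding flux' using v by (simp add: slope_def slope0_def algebra_simps)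
  finally show ?thesis .
qed

lemma integral_variation: "(\<integral>p. variation \<phi> V p \<partial>\<mu>) = (\<integral>v. slope v \<partial>lborel)"
proof -
  have XW: "p \<in> X ` W" if p: "p \<in> M" "\<phi> p \<in> Q" for p
  proof -
    have v: "\<pi> (\<phi> p) \<in> W_Q \<and> Y (\<pi> (\<phi> p)) = \<phi> p" using S_Q[of "\<phi> p"] p by blast
    then have "X (\<pi> (\<phi> p)) \<in> M" "\<phi> (X (\<pi> (\<phi> p))) = \<phi> p" using XM W_Q(1) by (auto simp: Y_def)
    then have "X (\<pi> (\<phi> p)) = p" using Emb_bdD(2)[OF \<phi>] p(1) by (meson inj_onD)
    then show ?thesis using v W_Q(1) by (metis imageI)
  qed
  have "(\<integral>p. variation \<phi> V p \<partial>\<mu>) = (\<integral>p\<in>X ` W. variation \<phi> V p \<partial>\<mu>)"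
    unfolding set_lebesgue_integral_def
    by (rule Bochner_Integration.integral_cong[OF refl])
      (use XW variation_outside in \<open>auto simp: space_\<mu> indicator_def\<close>)
  also have "\<dots> = (\<integral>v\<in>W. wX v * variation \<phi> V (X v) \<partial>lborel)"
    by (rule integral_surface_chart[OF borel_M has_frames surface X variation_measurable[OF \<phi> V_direction]])
  also have "\<dots> = (\<integral>v. \<omega> * frechet_derivative flux (at v) e + slope v \<partial>lborel)"
    unfolding set_lebesgue_integral_def
  proof (rule Bochner_Integration.integral_cong[OF refl])
    fix v
    show "indicator W v *\<^sub>R (wX v * variation \<phi> V (X v)) = \<omega> * frechet_derivative flux (at v) e + slope v"
    proof (cases "v \<in> W_Q")
      case True
      then show ?thesis using variation_chart[OF True] W_Q(1)[OF True] by simp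
    next
      case False
      then have "v \<notin> supp" using supp_subset by blast
      moreover have "indicator W v *\<^sub>R (wX v * variation \<phi> V (X v)) = 0"
      proof (cases "v \<in> W")
        case True
        then have "\<phi> (X v) \<notin> Q" using False by (simp add: W_Q_def Y_def)
        then show ?thesis using variation_outside[OF XM[OF True]] by simp
      qed simp
      ultimately show ?thesis using flux_deriv_zero slope_zero by simp
    qed
  qed
  also have "\<dots> = \<omega> * (\<integral>v. frechet_derivative flux (at v) e \<partial>lborel) + (\<integral>v. slope v \<partial>lborel)"
  proof -
    have "integrable lborel (\<lambda>v. frechet_derivative flux (at v) e)"
      by (rule integrable_compact_support[OF smooth_on_open_continuous[OF smooth_on_open_frechet[OF flux_smooth]] compact_supp flux_deriv_zero])
    moreover have "integrable lborel slope"
      by (rule integrable_compact_support[OF smooth_on_open_continuous[OF slope_smooth] compact_supp slope_zero])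
    ultimately show ?thesis by simp
  qed
  also have "(\<integral>v. frechet_derivative flux (at v) e \<partial>lborel) = 0"
    by (rule integral_directional_derivative_eq_0[OF smooth_on_open_has_derivative[OF flux_smooth UNIV_I]
          smooth_on_open_continuous[OF smooth_on_open_frechet[OF flux_smooth]] compact_supp flux_zero])
  finally show ?thesis by simp
qed

lemma chart_td_pos: "v \<in> W \<Longrightarrow> chart_td v > 0"
  using g_pos[OF XM] w_pos wX_pos by (simp add: chart_td_def)

lemma integral_variation_negative:
  assumes y0: "Y u0 = y0"
    and sign: "\<And>v. v \<in> ball u0 (\<rho> / 2) \<Longrightarrow> \<omega> * (frechet_derivative chart_td (at v) e - frechet_derivative chart_f (at v) e) < 0"
  shows "(\<integral>p. variation \<phi> V p \<partial>\<mu>) < 0"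
proof -
  have nonpos: "slope v \<le> 0" for v
  proof (cases "v \<in> W_Q")
    case True
    have "cut v * w v * chart_td v \<ge> 0"
      using bump_nonneg[of y0 r "Y v"] w_pos[OF W_Q(1)[OF True]] chart_td_pos[OF W_Q(1)[OF True]] by (simp add: cut_def)
    then have "2 * (cut v * w v * chart_td v) \<ge> 0" by simp
    then show ?thesis
      unfolding slope_def slope0_def using True sign[OF W_Q(4)[OF True]] by (simp add: mult_nonneg_nonpos less_imp_le)
  qed (simp add: slope_def)
  have u0W: "u0 \<in> W" using \<rho> by auto
  have u0: "u0 \<in> W_Q" using u0W y0 r by (auto simp: W_Q_def)
  have "cut u0 > 0" using bump_pos_iff[OF r(1), of y0 y0] r(1) by (simp add: cut_def y0)
  then have "cut u0 * w u0 * chart_td u0 > 0" using w_pos[OF u0W] chart_td_pos[OF u0W] by simp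
  then have Zu0: "slope u0 < 0"
    unfolding slope_def slope0_def using u0 sign[of u0] \<rho>(1) by (simp add: mult_pos_neg)
  have "isCont slope u0" using smooth_on_open_continuous[OF slope_smooth] by (simp add: continuous_on_eq_continuous_at)
  then obtain d where d: "d > 0" "\<And>v. dist v u0 < d \<Longrightarrow> dist (slope v) (slope u0) < - slope u0 / 2"
    unfolding continuous_at_eps_delta using Zu0 by (metis half_gt_zero neg_0_less_iff_less)
  have Zint: "integrable lborel slope"
    by (rule integrable_compact_support[OF smooth_on_open_continuous[OF slope_smooth] compact_supp slope_zero])
  have fin: "emeasure lborel (ball u0 d) < \<infinity>" by (rule emeasure_lborel_ball_finite)
  have "(\<integral>v. slope v \<partial>lborel) \<le> (\<integral>v. (slope u0 / 2) * indicator (ball u0 d) v \<partial>lborel)"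
  proof (rule integral_mono[OF Zint])
    show "integrable lborel (\<lambda>v. (slope u0 / 2) * indicator (ball u0 d) v)" using fin by simp
    fix v
    show "slope v \<le> (slope u0 / 2) * indicator (ball u0 d) v"
    proof (cases "v \<in> ball u0 d")
      case True
      then have "dist (slope v) (slope u0) < - slope u0 / 2" using d(2)[of v] by (simp add: dist_commute)
      then show ?thesis using True by (simp add: dist_real_def)
    qed (simp add: nonpos)
  qed
  also have "\<dots> = (slope u0 / 2) * measure lborel (ball u0 d)" by simp
  also have "\<dots> < 0" using Zu0 content_ball_pos[OF d(1), of u0] by (simp add: mult_neg_pos)
  finally show ?thesis by (simp add: integral_variation)
qed

end

section \<open>Vanishing of the defect\<close>

lemma parametrization_restrict:
  assumes X: "parametrization S \<Omega> X" and G: "open G" and \<Omega>G: "open (\<Omega> \<inter> G)"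
  shows "parametrization S (\<Omega> \<inter> G) X"
proof -
  note XD = parametrizationD[OF X]
  have inj: "inj_on X (\<Omega> \<inter> G)" by (rule inj_on_subset[OF XD(3)]) simp
  have "smooth_on_set (X ` (\<Omega> \<inter> G)) (inv_into (\<Omega> \<inter> G) X)"
  proof (rule smooth_on_set_cong)
    show "smooth_on_set (X ` (\<Omega> \<inter> G)) (inv_into \<Omega> X)" by (rule smooth_on_set_subset[OF XD(5)]) blast
    show "inv_into \<Omega> X x = inv_into (\<Omega> \<inter> G) X x" if x: "x \<in> X ` (\<Omega> \<inter> G)" for x
    proof -
      obtain v where "v \<in> \<Omega>" "v \<in> G" "x = X v" using x by blast
      then show ?thesis using inv_into_f_f[OF XD(3)] inv_into_f_f[OF inj] by simp
    qed
  qed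
  moreover have "smooth_on_set (\<Omega> \<inter> G) X" by (rule smooth_on_set_subset[OF XD(4)]) simp
  ultimately show ?thesis
    unfolding parametrization_def using \<Omega>G inj chart_image_openin[OF X G] by blast
qed

text \<open>
  Boundary charts are approached from the interior: a continuous function that is constant on the
  open half of a small half-ball is constant on the whole half-ball.
\<close>
lemma interior_chart_near:
  fixes S :: "'n::finite ambient set" and X :: "real^'n \<Rightarrow> 'n ambient"
  assumes X: "parametrization S \<Omega> X" and u: "u \<in> \<Omega>"
  obtains C where "open C" "convex C" "C \<noteq> {}" "parametrization S C X" "C \<subseteq> \<Omega>"
    "\<exists>T. openin (top_of_set S) T \<and> X u \<in> T \<and>
      (\<forall>F. continuous_on S F \<longrightarrow> (\<exists>c::real. \<forall>v\<in>C. F (X v) = c) \<longrightarrow> (\<forall>x\<in>T. F x = F (X u)))"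
proof -
  note XD = parametrizationD[OF X]
  obtain W where W: "open W" "\<Omega> = W \<or> (\<exists>i. \<Omega> = W \<inter> {u. 0 \<le> u $ i})"
    using XD(1) by (auto simp: chart_domain_def)
  obtain \<rho> where \<rho>: "\<rho> > 0" "ball u \<rho> \<subseteq> W" using W u open_contains_ball by blast
  obtain j where j: "\<Omega> = W \<or> \<Omega> = W \<inter> {u. 0 \<le> u $ j}" using W(2) by blast
  define H :: "(real^'n) set" where "H = (if \<Omega> = W then UNIV else {u. 0 < u $ j})"
  have H: "open H" "convex H"
  proof -
    have "{u :: real^'n. 0 < u $ j} = {u. 0 < axis j (1::real) \<bullet> u}" by (simp add: inner_axis')
    then show "convex H" using convex_halfspace_gt[of 0 "axis j (1::real)"] by (simp add: H_def)
    show "open H" by (auto simp: H_def intro!: open_Collect_less continuous_intros)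
  qed
  define G where "G = ball u \<rho> \<inter> H"
  have \<Omega>G: "\<Omega> \<inter> G = G" using \<rho>(2) j by (auto simp: G_def H_def split: if_splits)
  have G: "open G" "convex G" unfolding G_def using H by (auto intro: convex_Int)
  have near: "v + t *\<^sub>R axis j 1 \<in> G" if v: "v \<in> \<Omega>" "v \<in> ball u \<rho>" and t: "0 < t" "t < \<rho> - dist u v" for v t
  proof -
    have "dist u (v + t *\<^sub>R axis j 1) \<le> dist u v + dist v (v + t *\<^sub>R axis j 1)" by (rule dist_triangle)
    also have "dist v (v + t *\<^sub>R axis j 1) = t" using t by (simp add: dist_norm norm_axis_1)
    finally have "v + t *\<^sub>R axis j 1 \<in> ball u \<rho>" using t by simp
    moreover have "v + t *\<^sub>R axis j 1 \<in> H" using v(1) j t(1) by (auto simp: H_def)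
    ultimately show ?thesis by (simp add: G_def)
  qed
  show thesis
  proof (rule that[of G])
    show "open G" "convex G" by (rule G)+
    show "G \<noteq> {}" using near[of u "\<rho> / 2"] u \<rho>(1) by auto
    show "parametrization S G X" using parametrization_restrict[OF X G(1)] G(1) by (simp add: \<Omega>G)
    show "G \<subseteq> \<Omega>" using \<Omega>G by blast
    show "\<exists>T. openin (top_of_set S) T \<and> X u \<in> T \<and>
      (\<forall>F. continuous_on S F \<longrightarrow> (\<exists>c::real. \<forall>v\<in>G. F (X v) = c) \<longrightarrow> (\<forall>x\<in>T. F x = F (X u)))"
    proof (intro exI[of _ "X ` (\<Omega> \<inter> ball u \<rho>)"] conjI allI impI)
      show "openin (top_of_set S) (X ` (\<Omega> \<inter> ball u \<rho>))" by (rule chart_image_openin[OF X open_ball])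
      show "X u \<in> X ` (\<Omega> \<inter> ball u \<rho>)" using u \<rho>(1) by simp
      fix F :: "'n ambient \<Rightarrow> real"
      assume F: "continuous_on S F" and "\<exists>c. \<forall>v\<in>G. F (X v) = c"
      then obtain c where c: "\<And>v. v \<in> G \<Longrightarrow> F (X v) = c" by blast
      have FX: "continuous_on \<Omega> (\<lambda>v. F (X v))" by (rule continuous_on_compose2[OF F XD(7,6)])
      have const: "F (X v) = c" if v: "v \<in> \<Omega>" "v \<in> ball u \<rho>" for v
      proof -
        define d where "d = (\<rho> - dist u v) / 2"
        have d: "d > 0" using v(2) by (simp add: d_def)
        define s where "s n = v + (d / (real n + 1)) *\<^sub>R axis j 1" for n
        have pos: "0 < d / (real n + 1)" "d / (real n + 1) < \<rho> - dist u v" for n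
        proof -
          show "0 < d / (real n + 1)" using d by simp
          have "d / (real n + 1) \<le> d" using d by (simp add: pos_divide_le_eq distrib_left)
          moreover have "\<rho> - dist u v = 2 * d" by (simp add: d_def)
          ultimately show "d / (real n + 1) < \<rho> - dist u v" using d by linarith
        qed
        have sG: "s n \<in> G" for n unfolding s_def by (rule near[OF v pos])
        have "(\<lambda>n. d / (real n + 1)) \<longlonglongrightarrow> 0"
          by (rule LIMSEQ_Suc[OF lim_const_over_n, unfolded of_nat_Suc add.commute[of 1]])
        then have "s \<longlonglongrightarrow> v + 0 *\<^sub>R axis j 1" unfolding s_def by (intro tendsto_intros)
        then have "s \<longlonglongrightarrow> v" by simp
        then have "(\<lambda>n. F (X (s n))) \<longlonglongrightarrow> F (X v)"
          using sG \<Omega>G v(1) by (intro continuous_on_tendsto_compose[OF FX]) (auto intro!: always_eventually)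
        then have "(\<lambda>n. c) \<longlonglongrightarrow> F (X v)" by (simp add: c sG)
        then show ?thesis by (simp add: LIMSEQ_const_iff)
      qed
      show "\<forall>x\<in>X ` (\<Omega> \<inter> ball u \<rho>). F x = F (X u)"
        using const const[OF u] \<rho>(1) by auto
    qed
  qed
qed

context tracking_problem
begin

text \<open>
  Where a partial derivative of the defect is nonzero, it keeps its sign on a small ball. The locale
  data are chosen inside this ball, with \<open>\<omega>\<close> opposite to that sign.
\<close>
lemma defect_smooth_and_descent:
  assumes \<phi>: "\<phi> \<in> Emb_bd M" and W: "open W" and X: "parametrization M W X" and u0: "u0 \<in> W"
  defines "U \<equiv> \<lambda>v. td \<phi> (\<phi> (X v)) - f \<phi> (\<phi> (X v))"
  shows "smooth_on_open W U"
    and "frechet_derivative U (at u0) (axis i 1) \<noteq> 0 \<Longrightarrow>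
      \<exists>V\<in>directions M. (\<forall>x\<in>\<phi> ` M. V x \<in> tangent_space (\<phi> ` M) x) \<and>
        (\<exists>d<0. has_pre_shape_derivative M J \<phi> V d)"
proof -
  define YY where "YY v = \<phi> (X v)" for v
  have Yp: "parametrization (\<phi> ` M) W YY"
    unfolding YY_def[abs_def]
    by (rule parametrization_diffeo_image[OF X Emb_bdD(1)[OF \<phi>] smooth_inverse_embedding[OF hypersurface Emb_bd_Emb[OF \<phi>]]])
      (simp add: Emb_bdD(2)[OF \<phi>])
  note YD = parametrizationD[OF Yp]
  have ex: "\<exists>Q \<pi> \<rho> r. \<rho> \<le> \<rho>0 \<and> \<rho> > 0 \<and> ball u0 \<rho> \<subseteq> W \<and> open Q \<and> smooth_on_open Q \<pi> \<and> \<pi> ` Q \<subseteq> ball u0 (\<rho> / 2) \<and>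
     (\<forall>x. x \<in> \<phi> ` M \<longrightarrow> x \<in> Q \<longrightarrow> \<phi> (X (\<pi> x)) = x) \<and> r > 0 \<and> cball (YY u0) r \<subseteq> Q" if \<rho>0: "\<rho>0 > 0" for \<rho>0
  proof -
    obtain \<rho>1 where \<rho>1: "\<rho>1 > 0" "ball u0 \<rho>1 \<subseteq> W" using W u0 open_contains_ball by blast
    define \<rho> where "\<rho> = min \<rho>0 \<rho>1"
    have \<rho>: "\<rho> > 0" "\<rho> \<le> \<rho>0" "ball u0 \<rho> \<subseteq> W" using \<rho>0 \<rho>1 by (auto simp: \<rho>_def)
    have "YY u0 \<in> YY ` W" using u0 by blast
    then obtain P E where E: "open P" "YY u0 \<in> P" "smooth_on_open P E" "\<And>y. y \<in> YY ` W \<Longrightarrow> y \<in> P \<Longrightarrow> E y = inv_into W YY y"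
      using smooth_on_setE[OF YD(5)] by blast
    obtain O1 where O1: "open O1" "YY ` (W \<inter> ball u0 (\<rho> / 2)) = \<phi> ` M \<inter> O1"
      using chart_image_openin[OF Yp, of "ball u0 (\<rho> / 2)"] openin_open by (metis open_ball)
    define Q where "Q = (P \<inter> E -` ball u0 (\<rho> / 2)) \<inter> O1"
    have Q: "open Q"
      unfolding Q_def using continuous_open_preimage[OF smooth_on_open_continuous[OF E(3)] E(1) open_ball] O1(1) by blast
    have "E (YY u0) = u0" using E(2,4) u0 YD(3) by simp
    moreover have "YY u0 \<in> O1" using O1(2) u0 \<rho>(1) by auto
    ultimately have "YY u0 \<in> Q" using E(2) \<rho>(1) by (simp add: Q_def)
    then obtain r where r: "r > 0" "cball (YY u0) r \<subseteq> Q" using Q open_contains_cball by blast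
    have "\<phi> (X (E x)) = x" if x: "x \<in> \<phi> ` M" "x \<in> Q" for x
    proof -
      have xP: "x \<in> P" "x \<in> \<phi> ` M \<inter> O1" using x by (auto simp: Q_def)
      then obtain v where v: "v \<in> W" "x = YY v" using O1(2) by blast
      then have "E x = v" using E(4)[of x] xP(1) YD(3) by simp
      then show ?thesis using v(2) by (simp add: YY_def)
    qed
    moreover have "smooth_on_open Q E" by (rule smooth_on_open_subset[OF E(3)]) (auto simp: Q_def)
    moreover have "E ` Q \<subseteq> ball u0 (\<rho> / 2)" by (auto simp: Q_def)
    ultimately show ?thesis using \<rho> Q r by blast
  qed
  \<comment> \<open>smoothness does not depend on the size of the ball; it is needed before the ball can be chosen\<close>
  have basic: "smooth_on_open W U"
  proof -
    obtain Q \<pi> \<rho> r where q: "\<rho> \<le> 1" "\<rho> > 0" "ball u0 \<rho> \<subseteq> W" "open Q" "smooth_on_open Q \<pi>" "\<pi> ` Q \<subseteq> ball u0 (\<rho> / 2)"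
      "\<And>x. x \<in> \<phi> ` M \<Longrightarrow> x \<in> Q \<Longrightarrow> \<phi> (X (\<pi> x)) = x" "r > 0" "cball (YY u0) r \<subseteq> Q"
      using ex[OF zero_less_one] by blast
    interpret chart_push M ori \<tau> \<sigma> g f \<phi> X W Q \<pi> u0 \<rho> r "YY u0" i 1
      by unfold_locales (use \<phi> W X q in auto)
    have "smooth_on_open W (\<lambda>v. chart_td v - chart_f v)" by (rule smooth_diff[OF W chart_td_smooth chart_f_smooth])
    then show ?thesis
      by (rule smooth_on_open_cong[OF W])
        (simp add: U_def td_Y[unfolded Y_def] chart_f_def Y_def)
  qed
  then show "smooth_on_open W U" .
  assume nz: "frechet_derivative U (at u0) (axis i 1) \<noteq> 0"
  define a where "a = frechet_derivative U (at u0) (axis i 1)"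
  define \<omega> where "\<omega> = - sgn a"
  have \<omega>: "\<bar>\<omega>\<bar> = 1" "\<omega> * a < 0" using nz by (auto simp: \<omega>_def a_def sgn_if)
  have "continuous_on W (\<lambda>v. \<omega> * frechet_derivative U (at v) (axis i 1))"
    by (intro continuous_intros smooth_on_open_continuous smooth_on_open_frechet basic)
  then have "open (W \<inter> (\<lambda>v. \<omega> * frechet_derivative U (at v) (axis i 1)) -` {..<0})"
    by (rule continuous_open_preimage[OF _ W]) simp
  moreover have "u0 \<in> W \<inter> (\<lambda>v. \<omega> * frechet_derivative U (at v) (axis i 1)) -` {..<0}"
    using u0 \<omega>(2) by (simp add: a_def)
  ultimately obtain \<rho>0 where \<rho>0: "\<rho>0 > 0" "ball u0 \<rho>0 \<subseteq> W \<inter> (\<lambda>v. \<omega> * frechet_derivative U (at v) (axis i 1)) -` {..<0}"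
    using open_contains_ball by blast
  obtain Q \<pi> \<rho> r where q: "\<rho> \<le> \<rho>0" "\<rho> > 0" "ball u0 \<rho> \<subseteq> W" "open Q" "smooth_on_open Q \<pi>" "\<pi> ` Q \<subseteq> ball u0 (\<rho> / 2)"
    "\<And>x. x \<in> \<phi> ` M \<Longrightarrow> x \<in> Q \<Longrightarrow> \<phi> (X (\<pi> x)) = x" "r > 0" "cball (YY u0) r \<subseteq> Q"
    using ex[OF \<rho>0(1)] by blast
  interpret chart_push M ori \<tau> \<sigma> g f \<phi> X W Q \<pi> u0 \<rho> r "YY u0" i \<omega>
    by unfold_locales (use \<phi> W X q \<omega>(1) in auto)
  have Yeq: "Y v = YY v" for v
    by (simp add: Y_def YY_def)
  have neg: "(\<integral>p. variation \<phi> V p \<partial>\<mu>) < 0"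
  proof (rule integral_variation_negative)
    show "Y u0 = YY u0" by (rule Yeq)
    fix v assume v: "v \<in> ball u0 (\<rho> / 2)"
    have "v \<in> ball u0 \<rho>0" using v q(1,2) by auto
    then have vW: "v \<in> W" and sg: "\<omega> * frechet_derivative U (at v) (axis i 1) < 0" using \<rho>0(2) by auto
    have "frechet_derivative U (at v) = frechet_derivative (\<lambda>v. chart_td v - chart_f v) (at v)"
      by (rule frechet_derivative_cong_open[OF W vW])
        (simp add: U_def td_Y[unfolded Yeq YY_def] chart_f_def Yeq YY_def)
    moreover have "((\<lambda>v. chart_td v - chart_f v) has_derivative (\<lambda>h. frechet_derivative chart_td (at v) h - frechet_derivative chart_f (at v) h)) (at v)"
      by (rule has_derivative_diff[OF smooth_on_open_has_derivative[OF chart_td_smooth vW] smooth_on_open_has_derivative[OF chart_f_smooth vW]])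
    ultimately show "\<omega> * (frechet_derivative chart_td (at v) (axis i 1) - frechet_derivative chart_f (at v) (axis i 1)) < 0"
      using sg by (simp add: frechet_derivative_at[symmetric])
  qed
  have "has_pre_shape_derivative M J \<phi> V (1/2 * (\<integral>p. variation \<phi> V p \<partial>\<mu>))"
    by (rule pre_shape_derivative[OF \<phi> V_direction])
  moreover have "1/2 * (\<integral>p. variation \<phi> V p \<partial>\<mu>) < 0" using neg by simp
  ultimately show "\<exists>V\<in>directions M. (\<forall>x\<in>\<phi> ` M. V x \<in> tangent_space (\<phi> ` M) x) \<and>
        (\<exists>d<0. has_pre_shape_derivative M J \<phi> V d)"
    using V_direction V_tangent by blast
qed

lemma open_chart_positive_measure:
  assumes W: "open W" "W \<noteq> {}" and X: "parametrization M W X"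
  shows "emeasure \<mu> (X ` W) \<noteq> 0"
proof
  assume z: "emeasure \<mu> (X ` W) = 0"
  have "emeasure \<mu> (X ` W) = (\<integral>\<^sup>+u\<in>W. ennreal (chart_density W X u) \<partial>lborel)"
    using surface X W(1) by (simp add: is_surface_measure_def)
  then have int0: "(\<integral>\<^sup>+u\<in>W. ennreal (chart_density W X u) \<partial>lborel) = 0" using z by simp
  have meas: "(\<lambda>u. ennreal (chart_density W X u) * indicator W u) \<in> borel_measurable lborel"
  proof -
    note XD = parametrizationD[OF X]
    have "(\<lambda>u. indicator W u *\<^sub>R chart_density W X u) \<in> borel_measurable borel"
      by (rule borel_measurable_continuous_on_indicator[OF _ continuous_on_chart_density[OF XD(1,4)]]) (use W in simp)
    then have "(\<lambda>u. ennreal (indicator W u *\<^sub>R chart_density W X u)) \<in> borel_measurable lborel" by simp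
    moreover have "(\<lambda>u. ennreal (indicator W u *\<^sub>R chart_density W X u)) = (\<lambda>u. ennreal (chart_density W X u) * indicator W u)"
      by (auto simp: indicator_def fun_eq_iff)
    ultimately show ?thesis by simp
  qed
  have "AE u in lborel. ennreal (chart_density W X u) * indicator W u = 0"
    using int0 nn_integral_0_iff_AE[OF meas] by simp
  then have "AE u in lborel. u \<notin> W"
  proof eventually_elim
    case (elim u)
    show ?case
    proof
      assume "u \<in> W"
      then show False using elim chart_density_pos[OF has_frames X, of u] by simp
    qed
  qed
  then have "emeasure lborel W = 0" using W(1) by (simp add: AE_iff_measurable[OF _ refl])
  moreover obtain u d where "d > 0" "ball u d \<subseteq> W" using W open_contains_ball by (metis ex_in_conv)
  ultimately have "emeasure lborel (ball u d) = 0"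
    by (metis W(1) borel_open emeasure_mono le_zero_eq sets_lborel)
  then have "measure lborel (ball u d) = 0" by (simp add: measure_def)
  then show False using content_ball_pos[OF \<open>d > 0\<close>, of u] by simp
qed

text \<open>
  All partial derivatives of the defect vanish in interior charts, so it is locally constant on \<open>M\<close>,
  up to the boundary. By connectedness it is a constant \<open>c\<close>. Equality of the masses gives \<open>c\<close> times the
  area of \<open>\<phi> ` M\<close> equal to zero, and the area is positive.
\<close>
theorem no_descent_imp_equal:
  assumes \<phi>: "\<phi> \<in> Emb_bd M" and conn: "connected M"
    and no_descent: "\<And>V d. V \<in> directions M \<Longrightarrow> (\<And>x. x \<in> \<phi> ` M \<Longrightarrow> V x \<in> tangent_space (\<phi> ` M) x) \<Longrightarrow>
      has_pre_shape_derivative M J \<phi> V d \<Longrightarrow> d \<ge> 0"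
    and p: "p \<in> M"
  shows "td \<phi> (\<phi> p) = f \<phi> (\<phi> p)"
proof -
  define U where "U p = td \<phi> (\<phi> p) - f \<phi> (\<phi> p)" for p
  have U_cont: "continuous_on M U"
    unfolding U_def
    by (intro continuous_on_diff continuous_f_pullback \<phi>
        continuous_on_compose2[OF continuous_td[OF \<phi>] smooth_on_set_continuous[OF Emb_bdD(1)[OF \<phi>]]]) auto
  have const_chart: "\<exists>c. \<forall>v\<in>C. U (X v) = c" if C: "open C" "convex C" "parametrization M C X" for C and X :: "real^'n \<Rightarrow> 'n ambient"
  proof (rule has_derivative_zero_constant[OF C(2)])
    fix v assume v: "v \<in> C"
    have smooth: "smooth_on_open C (\<lambda>v. U (X v))"
      unfolding U_def by (rule defect_smooth_and_descent(1)[OF \<phi> C(1,3) v])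
    then have D: "((\<lambda>v. U (X v)) has_derivative frechet_derivative (\<lambda>v. U (X v)) (at v)) (at v)"
      by (rule smooth_on_open_has_derivative[OF _ v])
    have "frechet_derivative (\<lambda>v. U (X v)) (at v) (axis i 1) = 0" for i
    proof (rule ccontr)
      assume "frechet_derivative (\<lambda>v. U (X v)) (at v) (axis i 1) \<noteq> 0"
      then obtain V d where "V \<in> directions M" "\<forall>x\<in>\<phi> ` M. V x \<in> tangent_space (\<phi> ` M) x" "d < 0"
          "has_pre_shape_derivative M J \<phi> V d"
        using defect_smooth_and_descent(2)[OF \<phi> C(1,3) v, of i] unfolding U_def by blast
      then show False using no_descent[of V d] by auto
    qed
    then have "frechet_derivative (\<lambda>v. U (X v)) (at v) h = 0" for h
      using linear_axis_expansion[OF has_derivative_linear[OF D], of h] by simp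
    then have "frechet_derivative (\<lambda>v. U (X v)) (at v) = (\<lambda>h. 0)" by (rule ext)
    then show "((\<lambda>v. U (X v)) has_derivative (\<lambda>h. 0)) (at v within C)"
      using D has_derivative_at_withinI by metis
  qed
  have local: "\<exists>C X. open C \<and> C \<noteq> {} \<and> parametrization M C X \<and>
      (\<exists>T. openin (top_of_set M) T \<and> q \<in> T \<and> (\<forall>x\<in>T. U x = U q))" if q: "q \<in> M" for q
  proof -
    obtain \<Omega> and X :: "real^'n \<Rightarrow> 'n ambient" where X: "parametrization M \<Omega> X" "q \<in> X ` \<Omega>"
      using hypersurface q unfolding hypersurface_def by blast
    then obtain u where u: "u \<in> \<Omega>" "q = X u" by blast
    show ?thesis
    proof (rule interior_chart_near[OF X(1) u(1)])
      fix C assume C: "open C" "convex C" "C \<noteq> {}" "parametrization M C X"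
        "\<exists>T. openin (top_of_set M) T \<and> X u \<in> T \<and>
          (\<forall>F. continuous_on M F \<longrightarrow> (\<exists>c::real. \<forall>v\<in>C. F (X v) = c) \<longrightarrow> (\<forall>x\<in>T. F x = F (X u)))"
      then obtain T where "openin (top_of_set M) T" "X u \<in> T"
        "continuous_on M U \<longrightarrow> (\<exists>c::real. \<forall>v\<in>C. U (X v) = c) \<longrightarrow> (\<forall>x\<in>T. U x = U (X u))"
        by blast
      then show ?thesis using C(1,3,4) U_cont const_chart[OF C(1,2,4)] u(2) by blast
    qed
  qed
  have "U constant_on M"
    by (rule locally_constant_imp_constant[OF conn]) (use local in blast)
  then obtain c where c: "\<And>q. q \<in> M \<Longrightarrow> U q = c" unfolding constant_on_def by blast
  \<comment> \<open>the integral of the defect over the shape, computed on \<open>M\<close>\<close>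
  have jpos: "jac \<phi> q > 0" if "q \<in> M" for q by (rule jac_pos[OF \<phi> that])
  have ij: "integrable \<mu> (jac \<phi>)" by (rule integrable_continuous[OF continuous_jac[OF \<phi>]])
  have "c * (\<integral>q. jac \<phi> q \<partial>\<mu>) = (\<integral>q. c * jac \<phi> q \<partial>\<mu>)" by simp
  also have "\<dots> = (\<integral>q. g q - jac \<phi> q * f \<phi> (\<phi> q) \<partial>\<mu>)"
  proof (rule Bochner_Integration.integral_cong[OF refl])
    fix q assume "q \<in> space \<mu>"
    then have q: "q \<in> M" by (simp add: space_\<mu>)
    show "c * jac \<phi> q = g q - jac \<phi> q * f \<phi> (\<phi> q)"
      using c[OF q] jpos[OF q] by (simp add: U_def td_eq[OF \<phi> q] field_simps)
  qed
  also have "\<dots> = 0"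
    using mass_pullback[OF \<phi>] integrable_continuous[OF continuous_g]
      integrable_continuous[OF continuous_on_mult[OF continuous_jac[OF \<phi>] continuous_f_pullback[OF \<phi>]]] by simp
  finally have prod0: "c * (\<integral>q. jac \<phi> q \<partial>\<mu>) = 0" .
  have "(\<integral>q. jac \<phi> q \<partial>\<mu>) \<noteq> 0"
  proof
    assume z: "(\<integral>q. jac \<phi> q \<partial>\<mu>) = 0"
    have "AE q in \<mu>. 0 \<le> jac \<phi> q" by (rule AE_I2) (simp add: space_\<mu> jpos less_imp_le)
    then have "AE q in \<mu>. jac \<phi> q = 0" using z integral_nonneg_eq_0_iff_AE[OF ij] by simp
    moreover have "AE q in \<mu>. jac \<phi> q > 0" by (rule AE_I2) (simp add: space_\<mu> jpos)
    ultimately have "AE q in \<mu>. False" by eventually_elim simp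
    then have "emeasure \<mu> (space \<mu>) = 0" using AE_iff_measurable[of "space \<mu>" \<mu> "\<lambda>_. False"] by simp
    then have M0: "emeasure \<mu> M = 0" by (simp add: space_\<mu>)
    obtain C X where C: "open C" "C \<noteq> {}" "parametrization M C X" using local[OF p] by blast
    have "X ` C \<subseteq> M" by (rule parametrizationD(6)[OF C(3)])
    moreover have "M \<in> sets \<mu>" using sets.top[of \<mu>] by (simp add: space_\<mu>)
    ultimately have "emeasure \<mu> (X ` C) = 0" using emeasure_mono[of "X ` C" M \<mu>] M0 by simp
    then show False using open_chart_positive_measure[OF C] by simp
  qed
  then have "c = 0" using prod0 by simp
  then show ?thesis using c[OF p] by (simp add: U_def)
qed

lemma J_nonneg: "J \<psi> \<ge> 0"
  by (simp add: tracking_functional_def)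

lemma space_surface_image:
  assumes \<psi>: "\<psi> \<in> Emb_bd M"
  shows "space (surface_measure (\<psi> ` M)) = \<psi> ` M"
proof -
  have "surface_measure (\<psi> ` M) = distr (density \<mu> (\<lambda>p. ennreal (jac \<psi> p))) (restrict_space borel (\<psi> ` M)) \<psi>"
    by (rule surface_measure_image(1)[OF Emb_bd_Emb[OF \<psi>]]) (rule jac_pos[OF \<psi>])
  then show ?thesis by (simp add: space_restrict_space)
qed

context
  fixes \<phi>
  assumes \<phi>: "\<phi> \<in> Emb_bd M" and equal: "\<And>x. x \<in> \<phi> ` M \<Longrightarrow> td \<phi> x = f \<phi> x"
begin

lemma equal_imp_J_0: "J \<phi> = 0"
proof -
  have "(\<integral>x. (td \<phi> x - f \<phi> x)\<^sup>2 \<partial>surface_measure (\<phi> ` M)) = (\<integral>x. 0 \<partial>surface_measure (\<phi> ` M))"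
    by (rule Bochner_Integration.integral_cong[OF refl]) (simp add: space_surface_image[OF \<phi>] equal)
  then show ?thesis by (simp add: tracking_functional_def)
qed

lemma equal_imp_pre_shape_formula_0: "pre_shape_formula M g f \<tau> \<sigma> \<phi> V = 0"
proof -
  have "(\<integral>x. 1/2 * ((td \<phi> x)\<^sup>2 - (f \<phi> x)\<^sup>2) * tangential_divergence (\<phi> ` M) (\<sigma> \<phi> x) V x +
      (td \<phi> x - f \<phi> x) * material_derivative M f \<phi> V x \<partial>surface_measure (\<phi> ` M)) =
    (\<integral>x. 0 \<partial>surface_measure (\<phi> ` M))"
    by (rule Bochner_Integration.integral_cong[OF refl]) (simp add: space_surface_image[OF \<phi>] equal)
  then show ?thesis by (simp add: pre_shape_formula_def)
qed

lemma equal_imp_stationary: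
  assumes V: "V \<in> directions M"
  shows "has_pre_shape_derivative M J \<phi> V 0"
proof -
  have "(\<integral>p. variation \<phi> V p \<partial>\<mu>) = (\<integral>p. 0 \<partial>\<mu>)"
  proof (rule Bochner_Integration.integral_cong[OF refl])
    fix p assume "p \<in> space \<mu>"
    then have p: "p \<in> M" by (simp add: space_\<mu>)
    have e: "td \<phi> (\<phi> p) = f \<phi> (\<phi> p)" using equal p by blast
    then have "f \<phi> (\<phi> p) * jac \<phi> p = g p" using jac_pos[OF \<phi> p] by (simp add: td_eq[OF \<phi> p] field_simps)
    then show "variation \<phi> V p = 0" by (simp add: variation_def[OF \<phi> V] e)
  qed
  then show ?thesis using pre_shape_derivative[OF \<phi> V] by simp
qed

end

lemma minimizer_no_descent:
  assumes min: "global_minimizer M J \<phi>" and V: "V \<in> directions M" and d: "has_pre_shape_derivative M J \<phi> V d"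
  shows "d \<ge> 0"
proof (rule ccontr)
  have \<phi>: "\<phi> \<in> Emb_bd M" using min by (simp add: global_minimizer_def)
  assume "\<not> d \<ge> 0"
  then have "eventually (\<lambda>t. (J (perturb M \<phi> V t) - J \<phi>) / t < 0) (at_right 0)"
    using d unfolding has_pre_shape_derivative_def by (intro order_tendstoD(2)) auto
  then obtain b where b: "b > 0" "\<And>t. 0 < t \<Longrightarrow> t < b \<Longrightarrow> (J (perturb M \<phi> V t) - J \<phi>) / t < 0"
    unfolding eventually_at_right_field by blast
  obtain \<epsilon> where \<epsilon>: "\<epsilon> > 0" "\<And>t. t \<in> {0..\<epsilon>} \<Longrightarrow> perturb M \<phi> V t \<in> Emb_bd M"
    by (rule perturb_curve[OF \<phi> V]) blast
  define t where "t = min \<epsilon> b / 2"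
  have t: "0 < t" "t < b" "t \<in> {0..\<epsilon>}" using b(1) \<epsilon>(1) by (auto simp: t_def)
  have "J (perturb M \<phi> V t) < J \<phi>" using b(2)[OF t(1,2)] t(1) by (simp add: divide_less_0_iff)
  then show False using min \<epsilon>(2)[OF t(3)] unfolding global_minimizer_def by fastforce
qed

end

section \<open>The equivalence of the three conditions\<close>

theorem proposition3:
  fixes M :: "'n::finite ambient set"
    and ori :: "'n ambient \<Rightarrow> 'n frame set"
    and \<tau> :: "'n ambient \<Rightarrow> 'n frame"
    and \<sigma> :: "('n ambient \<Rightarrow> 'n ambient) \<Rightarrow> 'n ambient \<Rightarrow> 'n frame"
    and g :: "'n ambient \<Rightarrow> real"
    and f :: "('n ambient \<Rightarrow> 'n ambient) \<Rightarrow> 'n ambient \<Rightarrow> real"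
    and \<phi> \<nu> :: "'n ambient \<Rightarrow> 'n ambient"
  defines "J \<equiv> tracking_functional M g f \<tau> \<sigma>"
  assumes "hypersurface M" "compact M" "path_connected M" "orientation M ori"
    and "\<And>p. p \<in> M \<Longrightarrow> \<tau> p \<in> ori p"
    and "\<And>\<psi> x. \<psi> \<in> Emb_bd M \<Longrightarrow> x \<in> \<psi> ` M \<Longrightarrow> \<sigma> \<psi> x \<in> transported_orientation M ori \<psi> x"
    and "smooth_on_set M g" "\<And>p. p \<in> M \<Longrightarrow> g p > 0"
    and "\<And>\<psi>. \<psi> \<in> Emb_bd M \<Longrightarrow> smooth_on_set (\<psi> ` M) (f \<psi>)"
    and "\<And>\<psi> x. \<psi> \<in> Emb_bd M \<Longrightarrow> x \<in> \<psi> ` M \<Longrightarrow> f \<psi> x > 0"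
    and "shape_functionality M f"
    and "\<And>\<psi>. \<psi> \<in> Emb_bd M \<Longrightarrow>
           (LINT s|surface_measure (\<psi> ` M). f \<psi> s) = (LINT s|surface_measure M. g s)"
    and "materially_differentiable M f"
    and "\<phi> \<in> Emb_bd M"
    and "unit_normal_field (\<phi> ` M) \<nu>"
  shows "(fiber_stationary M J \<nu> \<phi> \<longleftrightarrow>
            global_minimizer M J \<phi> \<and> (\<forall>x\<in>\<phi> ` M. transported_density M g \<tau> \<sigma> \<phi> x = f \<phi> x)) \<and>
         (fiber_stationary M J \<nu> \<phi> \<longleftrightarrow>
            (\<forall>V\<in>directions M. has_pre_shape_derivative M J \<phi> V 0) \<and>
            (\<forall>V\<in>directions M. pre_shape_formula M g f \<tau> \<sigma> \<phi> (normal_part \<nu> V) = 0)) \<and>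
         (fiber_stationary M J \<nu> \<phi> \<longleftrightarrow> global_minimizer M J \<phi>)"
proof -
  interpret P: tracking_problem M ori \<tau> \<sigma> g f
    by unfold_locales (use assms in auto)
  note \<phi> = \<open>\<phi> \<in> Emb_bd M\<close>
  have conn: "connected M" using \<open>path_connected M\<close> by (rule path_connected_imp_connected)
  let ?E = "\<forall>x\<in>\<phi> ` M. transported_density M g \<tau> \<sigma> \<phi> x = f \<phi> x"
  have stationary_E: ?E if st: "fiber_stationary M J \<nu> \<phi>"
  proof clarify
    fix p assume p: "p \<in> M"
    show "transported_density M g \<tau> \<sigma> \<phi> (\<phi> p) = f \<phi> (\<phi> p)"
    proof (rule P.no_descent_imp_equal[OF \<phi> conn _ p])
      fix V d
      assume V: "V \<in> directions M" and tan: "\<And>x. x \<in> \<phi> ` M \<Longrightarrow> V x \<in> tangent_space (\<phi> ` M) x"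
        and d: "has_pre_shape_derivative M (tracking_functional M g f \<tau> \<sigma>) \<phi> V d"
      have "V x \<bullet> \<nu> x = 0" if x: "x \<in> manifold_interior (\<phi> ` M)" for x
      proof -
        have "x \<in> \<phi> ` M" using x by (simp add: manifold_interior_def)
        then have "\<nu> x \<bullet> V x = 0" using tan x \<open>unit_normal_field (\<phi> ` M) \<nu>\<close> unfolding unit_normal_field_def by blast
        then show ?thesis by (simp add: inner_commute)
      qed
      then have "has_pre_shape_derivative M J \<phi> V 0" using st V unfolding fiber_stationary_def by blast
      then have "d = 0"
        using d tendsto_unique[OF trivial_limit_at_right_real] unfolding has_pre_shape_derivative_def J_def by blast
      then show "0 \<le> d" by simp
    qed
  qed
  have minimizer_E: ?E if min: "global_minimizer M J \<phi>"
  proof clarify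
    fix p assume p: "p \<in> M"
    show "transported_density M g \<tau> \<sigma> \<phi> (\<phi> p) = f \<phi> (\<phi> p)"
      by (rule P.no_descent_imp_equal[OF \<phi> conn _ p]) (rule P.minimizer_no_descent[OF min[unfolded J_def]])
  qed
  have E_stationary: "has_pre_shape_derivative M J \<phi> V 0" if ?E "V \<in> directions M" for V
    unfolding J_def by (rule P.equal_imp_stationary[OF \<phi> _ that(2)]) (use that(1) in blast)
  have E_fiber: "fiber_stationary M J \<nu> \<phi>" if ?E
    using E_stationary[OF that] unfolding fiber_stationary_def by blast
  have E_formula: "pre_shape_formula M g f \<tau> \<sigma> \<phi> (normal_part \<nu> V) = 0" if ?E for V
    by (rule P.equal_imp_pre_shape_formula_0[OF \<phi>]) (use that in blast)
  have E_min: "global_minimizer M J \<phi>" if ?E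
  proof -
    have "J \<phi> = 0" unfolding J_def by (rule P.equal_imp_J_0[OF \<phi>]) (use that in blast)
    then show ?thesis using \<phi> P.J_nonneg by (simp add: global_minimizer_def J_def)
  qed
  have all_fiber: "fiber_stationary M J \<nu> \<phi>" if "\<forall>V\<in>directions M. has_pre_shape_derivative M J \<phi> V 0"
    using that unfolding fiber_stationary_def by blast
  show ?thesis
    using stationary_E minimizer_E E_stationary E_fiber E_formula E_min all_fiber by blast
qed

end
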